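(* Associate with each colour $c\in[C]$ an algebra $A_c$ of random $N\times N$ matrices (for $N$ arbitrarily large) with a second-order limit distribution, and assume that either the $A_c$ are independent, or the algebra generated by the $A_c$ has a second-order limit distribution. For each $c\in[C]$ let $O_c$ be an independent Haar-distributed orthogonal matrix, independent from any matrix in any of the $A_c$. Then the algebras $O_c^TA_cO_c:=\{O_c^TXO_c:X\in A_c\}$, $c\in[C]$, are asymptotically real second-order free.
   Context: $[C]=\{1,\ldots,C\}$. $\mathrm{Tr}$ is the usual trace, $\mathrm{tr}=\frac1N\mathrm{Tr}$. $k_r$ denotes the $r$th classical (joint) cumulant of random variables ($k_1$ is expectation, $k_2$ covariance). The matrices $O_1,\ldots,O_C$ are independent of each other and, jointly, of all matrices in the $A_c$. Algebras of random matrices are unital and closed under transpose, and the algebra generated by random matrices is the unital algebra generated by them and their transposes; matrices are given for arbitrarily large $N$, with $N$ suppressed in the notation. Probability spaces. A noncommutative probability space $(A,\phi_1)$ is a unital algebra $A$ with a linear functional $\phi_1$, $\phi_1(1_A)=1$. A second-order probability space $(A,\phi_1,\phi_2)$ has in addition a bilinear $\phi_2:A^2\to\mathbb{C}$, tracial in each argument, with $\phi_2(1_A,a)=\phi_2(a,1_A)=0$ for all $a\in A$. It is a real second-order probability space if equipped with an involution $a\mapsto a^t$ with $(ab)^t=b^ta^t$; subalgebras generated by elements are then required to be closed under $t$. Limit distributions. Random matrices $\{X_\lambda\}_{\lambda\in\Lambda}$ have a (first-order) limit distribution if there are $(A,\phi_1)$ and $\{x_\lambda\}_{\lambda\in\Lambda}\subseteq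 A$ such that for every noncommutative polynomial $p$, $\lim_{N\to\infty}\mathbb{E}(\mathrm{tr}(p(X_{\lambda_1},\ldots,X_{\lambda_m})))=\phi_1(p(x_{\lambda_1},\ldots,x_{\lambda_m}))$, while any higher cumulant $k_r$ ($r\ge2$) of such normalized traces tends to $0$. They have a second-order limit distribution if, in addition, there is $\phi_2$ making $(A,\phi_1,\phi_2)$ a second-order probability space such that for noncommutative polynomials $p_1,p_2,\ldots$, $\lim_{N\to\infty}k_2(\mathrm{Tr}(p_1(X)),\mathrm{Tr}(p_2(X)))=\phi_2(p_1(x),p_2(x))$ and for $r>2$, $\lim_{N\to\infty}k_r(\mathrm{Tr}(p_1(X)),\ldots,\mathrm{Tr}(p_r(X)))=0$. The limit distribution is real second-order if moreover $(A,\phi_1,\phi_2)$ is a real second-order probability space and the family contains the transpose of each of its members, the transpose $X_\lambda^T$ corresponding to $x_\lambda^t$. Freeness. $a\in A$ is centred if $\phi_1(a)=0$. For subalgebras $A_1,\ldots,A_C$ of $A$, elements $a_1,\ldots,a_n$ with $a_i\in A_{k_i}$ are alternating if $k_1\ne k_2\ne\cdots\ne k_n$, and cyclically alternating if in addition $k_n\ne k_1$. $A_1,\ldots,A_C$ are free if $\phi_1(a_1\cdots a_n)=0$ for all $a_1,\ldots,a_n$ centred and alternating. They are real second-order free if they are free and, for any centred and cyclically alternating $a_1,\ldots,a_p$ and centred and cyclically alternating $b_1,\ldots,b_q$: $\phi_2(a_1\cdots a_p,b_1\cdots b_q)=0$ if $p\ne q$, and if $p=q$ (subscripts modulo $p$)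 $$\phi_2(a_1\cdots a_p,b_1\cdots b_p)=\sum_{k=0}^{p-1}\prod_{i=1}^p\phi_1(a_ib_{k-i})+\sum_{k=0}^{p-1}\prod_{i=1}^p\phi_1(a_ib_{k+i}^t).$$ Subsets are (real second-order) free if the algebras they generate are. Sets of random matrices are asymptotically real second-order free if together they have a real second-order limit distribution and the corresponding sets of elements of the limit are real second-order free. *)

theory Defs
  imports
    "HOL-Probability.Probability"
    "HOL-Library.Poly_Mapping"
    "HOL-Library.Disjoint_Sets"
    "Jordan_Normal_Form.VS_Connect"
begin

section \<open>Second-order probability spaces\<close>

locale complex_algebra = ring A + Module.module "class_ring :: complex ring" A
  for A :: "(complex, 'a) module" (structure) +
  assumes smult_mult_left:
      "\<lbrakk>x \<in> carrier A; y \<in> carrier A\<rbrakk> \<Longrightarrow> (z \<odot> x) \<otimes> y = z \<odot> (x \<otimes> y)"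
    and smult_mult_right:
      "\<lbrakk>x \<in> carrier A; y \<in> carrier A\<rbrakk> \<Longrightarrow> x \<otimes> (z \<odot> y) = z \<odot> (x \<otimes> y)"

definition linear_functional :: "(complex, 'a) module \<Rightarrow> ('a \<Rightarrow> complex) \<Rightarrow> bool" where
  "linear_functional A f \<longleftrightarrow>
     (\<forall>x\<in>carrier A. \<forall>y\<in>carrier A. f (x \<oplus>\<^bsub>A\<^esub> y) = f x + f y) \<and>
     (\<forall>z. \<forall>x\<in>carrier A. f (z \<odot>\<^bsub>A\<^esub> x) = z * f x)"

definition tracial :: "(complex, 'a) module \<Rightarrow> ('a \<Rightarrow> complex) \<Rightarrow> bool" where
  "tracial A f \<longleftrightarrow> (\<forall>x\<in>carrier A. \<forall>y\<in>carrier A. f (x \<otimes>\<^bsub>A\<^esub> y) = f (y \<otimes>\<^bsub>A\<^esub> x))"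

locale nc_prob_space = complex_algebra A for A :: "(complex, 'a) module" (structure) +
  fixes \<phi>1 :: "'a \<Rightarrow> complex"
  assumes linear_phi1: "linear_functional A \<phi>1"
    and phi1_one: "\<phi>1 \<one> = 1"

locale second_order_prob_space = nc_prob_space A \<phi>1
  for A :: "(complex, 'a) module" (structure) and \<phi>1 +
  fixes \<phi>2 :: "'a \<Rightarrow> 'a \<Rightarrow> complex"
  assumes linear_phi2: "a \<in> carrier A \<Longrightarrow> linear_functional A (\<lambda>b. \<phi>2 a b)"
      "b \<in> carrier A \<Longrightarrow> linear_functional A (\<lambda>a. \<phi>2 a b)"
    and tracial_phi2: "a \<in> carrier A \<Longrightarrow> tracial A (\<lambda>b. \<phi>2 a b)"
      "b \<in> carrier A \<Longrightarrow> tracial A (\<lambda>a. \<phi>2 a b)"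
    and phi2_one: "a \<in> carrier A \<Longrightarrow> \<phi>2 \<one> a = 0"
      "a \<in> carrier A \<Longrightarrow> \<phi>2 a \<one> = 0"

locale real_second_order_prob_space = second_order_prob_space A \<phi>1 \<phi>2
  for A :: "(complex, 'a) module" (structure) and \<phi>1 \<phi>2 +
  fixes t :: "'a \<Rightarrow> 'a"
  assumes t_closed: "a \<in> carrier A \<Longrightarrow> t a \<in> carrier A"
    and t_add: "\<lbrakk>a \<in> carrier A; b \<in> carrier A\<rbrakk> \<Longrightarrow> t (a \<oplus> b) = t a \<oplus> t b"
    and t_smult: "a \<in> carrier A \<Longrightarrow> t (z \<odot> a) = z \<odot> t a"
    and t_mult: "\<lbrakk>a \<in> carrier A; b \<in> carrier A\<rbrakk> \<Longrightarrow> t (a \<otimes> b) = t b \<otimes> t a"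
    and t_invol: "a \<in> carrier A \<Longrightarrow> t (t a) = a"

inductive_set generated_t_algebra ::
    "(complex, 'a) module \<Rightarrow> ('a \<Rightarrow> 'a) \<Rightarrow> 'a set \<Rightarrow> 'a set"
  for A :: "(complex, 'a) module" and t :: "'a \<Rightarrow> 'a" and S :: "'a set" where
  base: "a \<in> S \<Longrightarrow> a \<in> generated_t_algebra A t S"
| one: "\<one>\<^bsub>A\<^esub> \<in> generated_t_algebra A t S"
| add: "a \<in> generated_t_algebra A t S \<Longrightarrow> b \<in> generated_t_algebra A t S
    \<Longrightarrow> a \<oplus>\<^bsub>A\<^esub> b \<in> generated_t_algebra A t S"
| smult: "a \<in> generated_t_algebra A t S \<Longrightarrow> z \<odot>\<^bsub>A\<^esub> a \<in> generated_t_algebra A t S"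
| mult: "a \<in> generated_t_algebra A t S \<Longrightarrow> b \<in> generated_t_algebra A t S
    \<Longrightarrow> a \<otimes>\<^bsub>A\<^esub> b \<in> generated_t_algebra A t S"
| t: "a \<in> generated_t_algebra A t S \<Longrightarrow> t a \<in> generated_t_algebra A t S"


section \<open>Real second-order freeness\<close>

definition list_prod :: "(complex, 'a) module \<Rightarrow> 'a list \<Rightarrow> 'a" where
  "list_prod A as = foldr (\<otimes>\<^bsub>A\<^esub>) as \<one>\<^bsub>A\<^esub>"

text \<open>A list of elements \<open>as\<close> is always accompanied by the list \<open>ks\<close> of the indices
  of the subalgebras it is taken from. A list of length one is alternating, but, because of the
  condition relating its last and first index, it is not cyclically alternating.\<close>

definition centred_in ::
    "('a \<Rightarrow> complex) \<Rightarrow> 'i set \<Rightarrow> ('i \<Rightarrow> 'a set) \<Rightarrow> 'i list \<Rightarrow> 'a list \<Rightarrow> bool" where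
  "centred_in \<phi>1 I B ks as \<longleftrightarrow> set ks \<subseteq> I \<and>
     list_all2 (\<lambda>k a. a \<in> B k \<and> \<phi>1 a = 0) ks as"

definition alternating :: "'i list \<Rightarrow> bool" where
  "alternating ks \<longleftrightarrow> ks \<noteq> [] \<and> distinct_adj ks"

definition cyclically_alternating :: "'i list \<Rightarrow> bool" where
  "cyclically_alternating ks \<longleftrightarrow> alternating ks \<and> last ks \<noteq> hd ks"

definition free_subalgebras ::
    "(complex, 'a) module \<Rightarrow> ('a \<Rightarrow> complex) \<Rightarrow> 'i set \<Rightarrow> ('i \<Rightarrow> 'a set) \<Rightarrow> bool" where
  "free_subalgebras A \<phi>1 I B \<longleftrightarrow>
     (\<forall>ks as. alternating ks \<longrightarrow> centred_in \<phi>1 I B ks as \<longrightarrow> \<phi>1 (list_prod A as) = 0)"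

text \<open>\<open>cyc as j\<close> is the entry with subscript \<open>j\<close> of \<open>as\<close>, where the entries of a list of
  length \<open>p\<close> have the subscripts 1, ..., \<open>p\<close>, taken modulo \<open>p\<close>.\<close>

definition cyc :: "'a list \<Rightarrow> int \<Rightarrow> 'a" where
  "cyc as j = as ! nat ((j - 1) mod int (length as))"

definition real_second_order_free_subalgebras ::
    "(complex, 'a) module \<Rightarrow> ('a \<Rightarrow> complex) \<Rightarrow> ('a \<Rightarrow> 'a \<Rightarrow> complex) \<Rightarrow> ('a \<Rightarrow> 'a)
      \<Rightarrow> 'i set \<Rightarrow> ('i \<Rightarrow> 'a set) \<Rightarrow> bool" where
  "real_second_order_free_subalgebras A \<phi>1 \<phi>2 t I B \<longleftrightarrow>
     free_subalgebras A \<phi>1 I B \<and>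
     (\<forall>ks as ls bs.
        cyclically_alternating ks \<longrightarrow> centred_in \<phi>1 I B ks as \<longrightarrow>
        cyclically_alternating ls \<longrightarrow> centred_in \<phi>1 I B ls bs \<longrightarrow>
        (length as \<noteq> length bs \<longrightarrow> \<phi>2 (list_prod A as) (list_prod A bs) = 0) \<and>
        (length as = length bs \<longrightarrow>
           (let p = int (length as) in
            \<phi>2 (list_prod A as) (list_prod A bs) =
              (\<Sum>k\<in>{0..p-1}. \<Prod>i\<in>{1..p}. \<phi>1 (cyc as i \<otimes>\<^bsub>A\<^esub> cyc bs (k - i))) +
              (\<Sum>k\<in>{0..p-1}. \<Prod>i\<in>{1..p}. \<phi>1 (cyc as i \<otimes>\<^bsub>A\<^esub> t (cyc bs (k + i)))))))"

definition real_second_order_free ::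
    "(complex, 'a) module \<Rightarrow> ('a \<Rightarrow> complex) \<Rightarrow> ('a \<Rightarrow> 'a \<Rightarrow> complex) \<Rightarrow> ('a \<Rightarrow> 'a)
      \<Rightarrow> 'i set \<Rightarrow> ('i \<Rightarrow> 'a set) \<Rightarrow> bool" where
  "real_second_order_free A \<phi>1 \<phi>2 t I S \<longleftrightarrow>
     real_second_order_free_subalgebras A \<phi>1 \<phi>2 t I (\<lambda>k. generated_t_algebra A t (S k))"


section \<open>Random matrices\<close>

text \<open>The dimension \<open>N\<close> ranges over an infinite set \<open>Ns\<close>; the random \<open>N \<times> N\<close> matrices live on
  the probability space \<open>M N\<close>. A random matrix is the whole sequence over \<open>N\<close>. That the values
  are square matrices is required for all arguments, including those outside \<open>Ns\<close> and
  \<open>space (M N)\<close>, so that the pointwise operations satisfy the usual identities as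
  identities of functions. The entries have finite moments of all orders, so
  that all cumulants of traces are defined.\<close>

type_synonym 'w matrix_seq = "nat \<Rightarrow> 'w \<Rightarrow> complex mat"

definition random_matrix :: "nat set \<Rightarrow> (nat \<Rightarrow> 'w measure) \<Rightarrow> 'w matrix_seq \<Rightarrow> bool" where
  "random_matrix Ns M X \<longleftrightarrow>
     (\<forall>N \<omega>. X N \<omega> \<in> carrier_mat N N) \<and>
     (\<forall>N\<in>Ns. \<forall>i<N. \<forall>j<N.
        (\<lambda>\<omega>. X N \<omega> $$ (i, j)) \<in> borel_measurable (M N) \<and>
        (\<forall>m::nat. integrable (M N) (\<lambda>\<omega>. norm (X N \<omega> $$ (i, j)) ^ m)))"

definition seq_one :: "'w matrix_seq" where
  "seq_one = (\<lambda>N \<omega>. 1\<^sub>m N)"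
definition seq_add :: "'w matrix_seq \<Rightarrow> 'w matrix_seq \<Rightarrow> 'w matrix_seq" where
  "seq_add X Y = (\<lambda>N \<omega>. X N \<omega> + Y N \<omega>)"
definition seq_smult :: "complex \<Rightarrow> 'w matrix_seq \<Rightarrow> 'w matrix_seq" where
  "seq_smult z X = (\<lambda>N \<omega>. z \<cdot>\<^sub>m X N \<omega>)"
definition seq_mult :: "'w matrix_seq \<Rightarrow> 'w matrix_seq \<Rightarrow> 'w matrix_seq" where
  "seq_mult X Y = (\<lambda>N \<omega>. X N \<omega> * Y N \<omega>)"
definition seq_transpose :: "'w matrix_seq \<Rightarrow> 'w matrix_seq" where
  "seq_transpose X = (\<lambda>N \<omega>. transpose_mat (X N \<omega>))"

definition random_matrix_algebra ::
    "nat set \<Rightarrow> (nat \<Rightarrow> 'w measure) \<Rightarrow> 'w matrix_seq set \<Rightarrow> bool" where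
  "random_matrix_algebra Ns M S \<longleftrightarrow>
     (\<forall>X\<in>S. random_matrix Ns M X) \<and> seq_one \<in> S \<and>
     (\<forall>X\<in>S. \<forall>Y\<in>S. seq_add X Y \<in> S \<and> seq_mult X Y \<in> S) \<and>
     (\<forall>X\<in>S. seq_transpose X \<in> S \<and> (\<forall>z. seq_smult z X \<in> S))"

inductive_set generated_matrix_algebra :: "'w matrix_seq set \<Rightarrow> 'w matrix_seq set"
  for S :: "'w matrix_seq set" where
  base: "X \<in> S \<Longrightarrow> X \<in> generated_matrix_algebra S"
| one: "seq_one \<in> generated_matrix_algebra S"
| add: "X \<in> generated_matrix_algebra S \<Longrightarrow> Y \<in> generated_matrix_algebra S
    \<Longrightarrow> seq_add X Y \<in> generated_matrix_algebra S"
| smult: "X \<in> generated_matrix_algebra S \<Longrightarrow> seq_smult z X \<in> generated_matrix_algebra S"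
| mult: "X \<in> generated_matrix_algebra S \<Longrightarrow> Y \<in> generated_matrix_algebra S
    \<Longrightarrow> seq_mult X Y \<in> generated_matrix_algebra S"
| transpose: "X \<in> generated_matrix_algebra S \<Longrightarrow> seq_transpose X \<in> generated_matrix_algebra S"

text \<open>The \<open>\<sigma>\<close>-algebra generated by the entries of the \<open>N \<times> N\<close> members of \<open>S\<close>.\<close>

definition matrix_sigma :: "'w measure \<Rightarrow> nat \<Rightarrow> 'w matrix_seq set \<Rightarrow> 'w set set" where
  "matrix_sigma P N S = sigma_sets (space P)
     {(\<lambda>\<omega>. X N \<omega> $$ (i, j)) -` E \<inter> space P | X i j E. X \<in> S \<and> i < N \<and> j < N \<and> E \<in> sets borel}"

definition orthogonal_group_mat :: "nat \<Rightarrow> real mat set" where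
  "orthogonal_group_mat N = {Q \<in> carrier_mat N N. transpose_mat Q * Q = 1\<^sub>m N}"

definition matrix_law ::
    "'w measure \<Rightarrow> nat \<Rightarrow> ('w \<Rightarrow> real mat) \<Rightarrow> (nat \<times> nat \<Rightarrow> real) measure" where
  "matrix_law P N Y = distr P (Pi\<^sub>M ({..<N} \<times> {..<N}) (\<lambda>_. borel))
     (\<lambda>\<omega>. \<lambda>ij\<in>{..<N} \<times> {..<N}. Y \<omega> $$ ij)"

definition haar_orthogonal :: "'w measure \<Rightarrow> nat \<Rightarrow> ('w \<Rightarrow> real mat) \<Rightarrow> bool" where
  "haar_orthogonal P N Y \<longleftrightarrow>
     (\<forall>i<N. \<forall>j<N. (\<lambda>\<omega>. Y \<omega> $$ (i, j)) \<in> borel_measurable P) \<and>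
     (\<forall>\<omega>\<in>space P. Y \<omega> \<in> orthogonal_group_mat N) \<and>
     (\<forall>Q\<in>orthogonal_group_mat N. matrix_law P N (\<lambda>\<omega>. Q * Y \<omega>) = matrix_law P N Y)"

definition complexify :: "(nat \<Rightarrow> 'w \<Rightarrow> real mat) \<Rightarrow> 'w matrix_seq" where
  "complexify Y = (\<lambda>N \<omega>. map_mat complex_of_real (Y N \<omega>))"

definition conjugate_by :: "(nat \<Rightarrow> 'w \<Rightarrow> real mat) \<Rightarrow> 'w matrix_seq \<Rightarrow> 'w matrix_seq" where
  "conjugate_by Y X =
     seq_mult (seq_mult (seq_transpose (complexify Y)) X) (complexify Y)"


section \<open>Limit distributions\<close>

text \<open>The moment-cumulant formula solved for the joint cumulant of the listed variables.\<close>

definition joint_cumulant :: "'w measure \<Rightarrow> ('w \<Rightarrow> complex) list \<Rightarrow> complex" where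
  "joint_cumulant P Ys =
     (\<Sum>\<pi> | partition_on {..<length Ys} \<pi>.
        (- 1) ^ (card \<pi> - 1) * fact (card \<pi> - 1) *
        (\<Prod>V\<in>\<pi>. \<integral>\<omega>. (\<Prod>i\<in>V. (Ys ! i) \<omega>) \<partial>P))"

text \<open>Noncommutative polynomials are finitely supported functions on words.\<close>

type_synonym 'l nc_poly = "'l list \<Rightarrow>\<^sub>0 complex"

definition nc_polys :: "'l set \<Rightarrow> 'l nc_poly set" where
  "nc_polys L = {p. \<forall>w\<in>Poly_Mapping.keys p. set w \<subseteq> L}"

definition nc_eval :: "(complex, 'a) module \<Rightarrow> ('l \<Rightarrow> 'a) \<Rightarrow> 'l nc_poly \<Rightarrow> 'a" where
  "nc_eval A x p =
     (\<Oplus>\<^bsub>A\<^esub>w\<in>Poly_Mapping.keys p. Poly_Mapping.lookup p w \<odot>\<^bsub>A\<^esub> list_prod A (map x w))"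

definition mat_trace :: "complex mat \<Rightarrow> complex" where
  "mat_trace B = (\<Sum>i<dim_row B. B $$ (i, i))"

definition poly_Tr :: "('l \<Rightarrow> 'w matrix_seq) \<Rightarrow> nat \<Rightarrow> 'l nc_poly \<Rightarrow> 'w \<Rightarrow> complex" where
  "poly_Tr X N p \<omega> =
     mat_trace (nc_eval (module_mat TYPE(complex) N N) (\<lambda>l. X l N \<omega>) p)"

definition poly_tr :: "('l \<Rightarrow> 'w matrix_seq) \<Rightarrow> nat \<Rightarrow> 'l nc_poly \<Rightarrow> 'w \<Rightarrow> complex" where
  "poly_tr X N p \<omega> = poly_Tr X N p \<omega> / of_nat N"

definition dims_to_infinity :: "nat set \<Rightarrow> nat filter" where
  "dims_to_infinity Ns = inf sequentially (principal Ns)"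

definition limit_distribution ::
    "nat set \<Rightarrow> (nat \<Rightarrow> 'w measure) \<Rightarrow> 'l set \<Rightarrow> ('l \<Rightarrow> 'w matrix_seq)
      \<Rightarrow> (complex, 'a) module \<Rightarrow> ('a \<Rightarrow> complex) \<Rightarrow> ('l \<Rightarrow> 'a) \<Rightarrow> bool" where
  "limit_distribution Ns M L X A \<phi>1 x \<longleftrightarrow>
     (\<forall>l\<in>L. random_matrix Ns M (X l)) \<and>
     nc_prob_space A \<phi>1 \<and> (\<forall>l\<in>L. x l \<in> carrier A) \<and>
     (\<forall>p\<in>nc_polys L.
        ((\<lambda>N. \<integral>\<omega>. poly_tr X N p \<omega> \<partial>M N) \<longlongrightarrow> \<phi>1 (nc_eval A x p)) (dims_to_infinity Ns)) \<and>
     (\<forall>ps. set ps \<subseteq> nc_polys L \<longrightarrow> length ps \<ge> 2 \<longrightarrow>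
        ((\<lambda>N. joint_cumulant (M N) (map (poly_tr X N) ps)) \<longlongrightarrow> 0) (dims_to_infinity Ns))"

definition second_order_limit_distribution ::
    "nat set \<Rightarrow> (nat \<Rightarrow> 'w measure) \<Rightarrow> 'l set \<Rightarrow> ('l \<Rightarrow> 'w matrix_seq)
      \<Rightarrow> (complex, 'a) module \<Rightarrow> ('a \<Rightarrow> complex) \<Rightarrow> ('a \<Rightarrow> 'a \<Rightarrow> complex) \<Rightarrow> ('l \<Rightarrow> 'a) \<Rightarrow> bool" where
  "second_order_limit_distribution Ns M L X A \<phi>1 \<phi>2 x \<longleftrightarrow>
     limit_distribution Ns M L X A \<phi>1 x \<and>
     second_order_prob_space A \<phi>1 \<phi>2 \<and>
     (\<forall>p\<in>nc_polys L. \<forall>q\<in>nc_polys L.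
        ((\<lambda>N. joint_cumulant (M N) [poly_Tr X N p, poly_Tr X N q])
           \<longlongrightarrow> \<phi>2 (nc_eval A x p) (nc_eval A x q)) (dims_to_infinity Ns)) \<and>
     (\<forall>ps. set ps \<subseteq> nc_polys L \<longrightarrow> length ps > 2 \<longrightarrow>
        ((\<lambda>N. joint_cumulant (M N) (map (poly_Tr X N) ps)) \<longlongrightarrow> 0) (dims_to_infinity Ns))"

definition real_second_order_limit_distribution ::
    "nat set \<Rightarrow> (nat \<Rightarrow> 'w measure) \<Rightarrow> 'l set \<Rightarrow> ('l \<Rightarrow> 'w matrix_seq)
      \<Rightarrow> (complex, 'a) module \<Rightarrow> ('a \<Rightarrow> complex) \<Rightarrow> ('a \<Rightarrow> 'a \<Rightarrow> complex) \<Rightarrow> ('a \<Rightarrow> 'a)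
      \<Rightarrow> ('l \<Rightarrow> 'a) \<Rightarrow> bool" where
  "real_second_order_limit_distribution Ns M L X A \<phi>1 \<phi>2 t x \<longleftrightarrow>
     second_order_limit_distribution Ns M L X A \<phi>1 \<phi>2 x \<and>
     real_second_order_prob_space A \<phi>1 \<phi>2 t \<and>
     (\<forall>l\<in>L. \<exists>l'\<in>L. X l' = seq_transpose (X l) \<and> x l' = t (x l))"

text \<open>A set of random matrices is regarded as a family indexed by itself. HOL cannot quantify
  existentially over the carrier type of the limit space, so this type is an explicit
  parameter. As limits are only evaluated on polynomials in the family, nothing is lost by taking
  it to be the type of noncommutative polynomials in the members of the family.\<close>

definition has_second_order_limit_distribution ::
    "'a itself \<Rightarrow> nat set \<Rightarrow> (nat \<Rightarrow> 'w measure) \<Rightarrow> 'w matrix_seq set \<Rightarrow> bool" where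
  "has_second_order_limit_distribution (ty :: 'a itself) Ns M S \<longleftrightarrow>
     (\<exists>(A :: (complex, 'a) module) \<phi>1 \<phi>2 x.
        second_order_limit_distribution Ns M S (\<lambda>X. X) A \<phi>1 \<phi>2 x)"

definition asymptotically_real_second_order_free ::
    "'a itself \<Rightarrow> nat set \<Rightarrow> (nat \<Rightarrow> 'w measure) \<Rightarrow> 'i set \<Rightarrow> ('i \<Rightarrow> 'w matrix_seq set) \<Rightarrow> bool" where
  "asymptotically_real_second_order_free (ty :: 'a itself) Ns M I S \<longleftrightarrow>
     (\<exists>(A :: (complex, 'a) module) \<phi>1 \<phi>2 t x.
        real_second_order_limit_distribution Ns M (\<Union>c\<in>I. S c) (\<lambda>X. X) A \<phi>1 \<phi>2 t x \<and>
        real_second_order_free A \<phi>1 \<phi>2 t I (\<lambda>c. x ` S c))"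

end

theory Submission
  imports Defs "HOL-Library.Function_Algebras"
begin

text \<open>A letter of colour \<open>c\<close> is a matrix \<open>O\<^sub>c\<^sup>T X O\<^sub>c\<close> with \<open>X\<close> traceless. Invariance of the law of
  \<open>O\<^sub>c\<close> under rotations in a coordinate plane, differentiated at the angle 0 and summed over all
  planes, gives a loop equation: \<open>N - 1\<close> times the expectation of a product of traces of words is a
  sum over the other occurrences of the colour of a chosen letter, in its own trace and in the other
  ones, of expectations in which the words are cut and rejoined there, with or without a
  transposition. Merging neighbours of equal colour turns the new words into cyclically alternating
  ones. By induction on the number of letters, the expectations of products of traces of cyclically
  alternating words converge, and in the limit two such words only interact if all their letters can be
  contracted, that is, if they have the same length and one is read along a rotation of the
  other or of its transpose. So these traces satisfy Wick's formula in the limit: their higher cumulants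
  vanish and their covariance is the one of real second-order freeness. Being bounded in
  expectation, they vanish after division by \<open>N\<close>, which is freeness. Traces of arbitrary words are
  reduced to these by centring and merging; their fluctuations also contain
  those of the traces of the given matrices, which are independent of the \<open>O\<^sub>c\<close>.\<close>

section \<open>Joint cumulants\<close>

text \<open>The hypotheses control traces only: no norm bounds are at hand, so all estimates must
  come from limits of expectations. The loop equation is not a recursion, since it couples
  configurations with the same number of letters. But only finitely many of these occur, and the
  coupling carries the factor \<open>1/N\<close>; so the sum of the absolute values of their
  expectations is bounded all at once, and only then does each of them converge. Scalars live on two
  scales. Centring a matrix subtracts its normalized trace, which is random, so contractions have
  random coefficients; these are constants up to fluctuations of order \<open>1/N\<close>. Next to a
  trace of a nonempty word they may be replaced by their limits, but next to \<open>tr []\<close>,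
  which is \<open>N\<close>, the fluctuation survives and carries the covariances of the given
  algebras into the limit. The limit space is the algebra generated by the conjugated matrices
  itself, with the limits of means and covariances of traces as its functionals.\<close>

definition cumulant_of :: "('i set \<Rightarrow> complex) \<Rightarrow> 'i set \<Rightarrow> complex" where
  "cumulant_of m V = (\<Sum>\<pi> | partition_on V \<pi>. (- 1) ^ (card \<pi> - 1) * fact (card \<pi> - 1) * (\<Prod>B\<in>\<pi>. m B))"

lemma cumulant_of_cong:
  assumes "\<And>B. B \<subseteq> V \<Longrightarrow> B \<noteq> {} \<Longrightarrow> m B = m' B"
  shows "cumulant_of m V = cumulant_of m' V"
proof -
  have "(\<Prod>B\<in>\<pi>. m B) = (\<Prod>B\<in>\<pi>. m' B)" if "partition_on V \<pi>" for \<pi>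
    using that assms by (intro prod.cong refl) (metis Union_upper partition_onD1 partition_onD3)
  then show ?thesis by (simp add: cumulant_of_def)
qed

text \<open>Grouping the pairs of a block containing \<open>i\<close> and a partition of it by the partition of the
  whole set that they form with the complement: a partition into \<open>s \<ge> 2\<close> blocks occurs once with the
  coefficient of \<open>s\<close> blocks and \<open>s - 1\<close> times with that of \<open>s - 1\<close> blocks, which cancel.\<close>

lemma moment_cumulant_rec:
  fixes m :: "'i set \<Rightarrow> complex"
  assumes fin: "finite S" and i: "i \<in> S" and m0: "m {} = 1"
  shows "m S = (\<Sum>V | V \<subseteq> S \<and> i \<in> V. cumulant_of m V * m (S - V))"
proof -
  define c :: "nat \<Rightarrow> complex" where "c n = (- 1) ^ (n - 1) * fact (n - 1)" for n
  define \<P> where "\<P> = {\<pi>. partition_on S \<pi>}"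
  have fP: "finite \<P>" unfolding \<P>_def by (rule finitely_many_partition_on[OF fin])
  have fpi: "finite \<pi>" if "\<pi> \<in> \<P>" for \<pi> using that fin finite_elements \<P>_def by blast
  let ?Vs = "{V. V \<subset> S \<and> i \<in> V}"
  have fV: "finite ?Vs" using fin by (auto intro: finite_subset[of _ "Pow S"])
  have split: "{V. V \<subseteq> S \<and> i \<in> V} = insert S ?Vs" using i by auto
  have "(\<Sum>V | V \<subseteq> S \<and> i \<in> V. cumulant_of m V * m (S - V))
      = cumulant_of m S + (\<Sum>V\<in>?Vs. cumulant_of m V * m (S - V))"
    unfolding split using fV m0 by (subst sum.insert) auto
  also have "(\<Sum>V\<in>?Vs. cumulant_of m V * m (S - V)) =
      (\<Sum>(V,\<pi>)\<in>(SIGMA V:?Vs. {\<pi>. partition_on V \<pi>}). c (card \<pi>) * (\<Prod>B\<in>\<pi>. m B) * m (S - V))"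
    using fV fin by (subst sum.Sigma[symmetric])
      (auto simp: cumulant_of_def c_def sum_distrib_right intro!: finitely_many_partition_on
        intro: finite_subset)
  also have "\<dots> = (\<Sum>(\<sigma>,B)\<in>(SIGMA \<sigma>:\<P>. {B\<in>\<sigma>. i \<notin> B}). c (card \<sigma> - 1) * (\<Prod>B\<in>\<sigma>. m B))"
  proof (rule sum.reindex_bij_witness[where
        j = "\<lambda>(V,\<pi>). (insert (S - V) \<pi>, S - V)" and i = "\<lambda>(\<sigma>,B). (S - B, \<sigma> - {B})"], goal_cases)
    case (1 a)
    then obtain V \<pi> where a: "a = (V,\<pi>)" "V \<subset> S" "i \<in> V" "partition_on V \<pi>" by auto
    have "S - V \<notin> \<pi>" using a(2,4) by (auto simp: partition_on_def)
    then show ?case using a by auto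
  next
    case (2 a)
    then obtain V \<pi> where a: "a = (V,\<pi>)" "V \<subset> S" "i \<in> V" "partition_on V \<pi>" by auto
    have e: "S - (S - V) = V" using a by auto
    have "disjnt (S - V) (\<Union>\<pi>)" using a(4) by (auto simp: partition_on_def disjnt_def)
    moreover have "partition_on (S - (S - V)) \<pi>" using a e by simp
    ultimately have "partition_on S (insert (S - V) \<pi>)"
      using a by (subst partition_on_insert) auto
    then show ?case using a by (auto simp: \<P>_def)
  next
    case (3 b)
    then obtain \<sigma> B where b: "b = (\<sigma>,B)" "partition_on S \<sigma>" "B \<in> \<sigma>" "i \<notin> B" by (auto simp: \<P>_def)
    then have "S - (S - B) = B" by (auto simp: partition_on_def)
    then show ?case using b by auto
  next
    case (4 b)
    then obtain \<sigma> B where b: "b = (\<sigma>,B)" "partition_on S \<sigma>" "B \<in> \<sigma>" "i \<notin> B" by (auto simp: \<P>_def)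
    have "disjnt B (\<Union>(\<sigma> - {B}))" using b
      by (auto simp: partition_on_def disjoint_def disjnt_def)
    then have "partition_on (S - B) (\<sigma> - {B})" "B \<subseteq> S" "B \<noteq> {}"
      using b partition_on_insert[of B "\<sigma> - {B}" S] by (auto simp: insert_absorb)
    then show ?case using b i by auto
  next
    case (5 a)
    then obtain V \<pi> where a: "a = (V,\<pi>)" "V \<subset> S" "i \<in> V" "partition_on V \<pi>" by auto
    have n: "S - V \<notin> \<pi>" using a(2,4) by (auto simp: partition_on_def)
    have f: "finite \<pi>" using a fin finite_elements finite_subset by (metis psubset_imp_subset)
    show ?case using a n f by (simp add: mult_ac)
  qed
  also have "\<dots> = (\<Sum>\<sigma>\<in>\<P>. of_nat (card \<sigma> - 1) * c (card \<sigma> - 1) * (\<Prod>B\<in>\<sigma>. m B))"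
  proof (subst sum.Sigma[symmetric], goal_cases)
    case 3
    have "card {B\<in>\<sigma>. i \<notin> B} = card \<sigma> - 1" if s: "\<sigma> \<in> \<P>" for \<sigma>
    proof -
      obtain B where B: "B \<in> \<sigma>" "i \<in> B" using s i by (auto simp: \<P>_def partition_on_def)
      then have "{B\<in>\<sigma>. i \<notin> B} = \<sigma> - {B}" using s by (auto simp: \<P>_def partition_on_def disjoint_def)
      then show ?thesis using B by simp
    qed
    then show ?case by (intro sum.cong) (simp_all add: mult_ac)
  qed (use fP fpi in auto)
  also have "cumulant_of m S + \<dots> =
      (\<Sum>\<sigma>\<in>\<P>. (c (card \<sigma>) + of_nat (card \<sigma> - 1) * c (card \<sigma> - 1)) * (\<Prod>B\<in>\<sigma>. m B))"
    by (simp add: cumulant_of_def \<P>_def c_def sum.distrib distrib_right)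
  also have "\<dots> = (\<Sum>\<sigma>\<in>\<P>. if \<sigma> = {S} then m S else 0)"
  proof (rule sum.cong)
    fix \<sigma> assume s: "\<sigma> \<in> \<P>"
    have ne: "\<sigma> \<noteq> {}" using s i by (auto simp: \<P>_def partition_on_def)
    show "(c (card \<sigma>) + of_nat (card \<sigma> - 1) * c (card \<sigma> - 1)) * (\<Prod>B\<in>\<sigma>. m B)
        = (if \<sigma> = {S} then m S else 0)"
    proof (cases "card \<sigma> = 1")
      case True
      then obtain B where "\<sigma> = {B}" by (meson card_1_singletonE)
      then have "\<sigma> = {S}" using s by (auto simp: \<P>_def partition_on_def)
      then show ?thesis by (simp add: c_def)
    next
      case False
      have "card \<sigma> \<noteq> 0" using ne fpi[OF s] by simp
      with False obtain n where n: "card \<sigma> = Suc (Suc n)" by (metis One_nat_def nat.exhaust)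
      then have "\<sigma> \<noteq> {S}" by auto
      then show ?thesis using n by (simp add: c_def algebra_simps)
    qed
  qed simp
  also have "\<dots> = m S" using fP i partition_on_space[of S] by (subst sum.delta) (auto simp: \<P>_def)
  finally show ?thesis by simp
qed

lemma cumulant_of_singleton [simp]: "cumulant_of m {i} = m {i}"
proof -
  have "\<pi> = {{i}}" if p: "partition_on {i} \<pi>" for \<pi>
  proof -
    have "B = {i}" if B: "B \<in> \<pi>" for B
    proof -
      have "B \<subseteq> {i}" "B \<noteq> {}" using B p by (auto simp: partition_on_def)
      then show ?thesis by (metis subset_singletonD)
    qed
    moreover have "\<pi> \<noteq> {}" using p by (auto simp: partition_on_def)
    ultimately show ?thesis by blast
  qed
  then have "partition_on {i} \<pi> \<longleftrightarrow> \<pi> = {{i}}" for \<pi>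
    using partition_on_space[of "{i}"] by (metis insert_not_empty)
  then show ?thesis by (simp add: cumulant_of_def)
qed

lemma moment_cumulant_rec':
  assumes fin: "finite S" and i: "i \<in> S" and m0: "m {} = 1" and ne: "S \<noteq> {i}"
  shows "m S = cumulant_of m S + m {i} * m (S - {i}) +
           (\<Sum>V | V \<subset> S \<and> i \<in> V \<and> V \<noteq> {i}. cumulant_of m V * m (S - V))"
proof -
  have e: "{V. V \<subseteq> S \<and> i \<in> V} = insert S (insert {i} {V. V \<subset> S \<and> i \<in> V \<and> V \<noteq> {i}})"
    using i by auto
  have "finite {V. V \<subset> S \<and> i \<in> V \<and> V \<noteq> {i}}" using fin by (auto intro: finite_subset[of _ "Pow S"])
  then show ?thesis
    using ne m0 by (subst moment_cumulant_rec[where m=m, OF fin i m0], unfold e) (auto simp: algebra_simps)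
qed

text \<open>Variable \<open>i\<close> acts as the constant \<open>a\<close>: by induction the blocks
  strictly between \<open>{i}\<close> and \<open>S\<close> contribute nothing, and the block
  \<open>{i}\<close> alone already gives \<open>m S\<close>, so nothing is left for \<open>S\<close>
  itself.\<close>

lemma cumulant_of_const:
  assumes fin: "finite S" and i: "i \<in> S" and ne: "S \<noteq> {i}" and m0: "m {} = 1"
    and const: "\<And>B. B \<subseteq> S \<Longrightarrow> i \<in> B \<Longrightarrow> m B = a * m (B - {i})"
  shows "cumulant_of m S = 0"
  using fin i ne const
proof (induction S rule: finite_psubset_induct)
  case (psubset S)
  have "cumulant_of m V = 0" if "V \<subset> S" "i \<in> V" "V \<noteq> {i}" for V
    using psubset.IH[of V] psubset.prems that by (meson psubset_imp_subset subset_trans)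
  moreover have "m {i} = a" using psubset.prems(3)[of "{i}"] psubset.prems(1) m0 by simp
  moreover have "m S = a * m (S - {i})" using psubset.prems by simp
  ultimately show ?case
    using moment_cumulant_rec'[where m=m, OF psubset.hyps(1) psubset.prems(1) m0 psubset.prems(2)] by simp
qed

text \<open>Vanishing of mixed cumulants. Multiplying the expansion of
  \<open>m (S \<inter> A)\<close> by \<open>m (S - A)\<close> gives an expansion of
  \<open>m S\<close> over the blocks inside \<open>A\<close>. By induction the expansion of
  \<open>m S\<close> itself has the same terms and, in addition, only the block
  \<open>S\<close>.\<close>

lemma cumulant_of_indep:
  assumes fin: "finite S" and i: "i \<in> S \<inter> A" and j: "j \<in> S - A" and m0: "m {} = 1"
    and indep: "\<And>B. B \<subseteq> S \<Longrightarrow> m B = m (B \<inter> A) * m (B - A)"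
  shows "cumulant_of m S = 0"
  using fin i j indep
proof (induction S arbitrary: j rule: finite_psubset_induct)
  case (psubset S)
  let ?X = "{V. V \<subseteq> S \<and> i \<in> V}" and ?Y = "{V. V \<subseteq> S \<inter> A \<and> i \<in> V}"
  have fX: "finite ?X" using psubset.hyps by (auto intro: finite_subset[of _ "Pow S"])
  have z: "cumulant_of m V = 0" if V: "V \<subset> S" "i \<in> V" "\<not> V \<subseteq> A" for V
  proof -
    obtain j' where j': "j' \<in> V - A" using V by auto
    show ?thesis using psubset.IH[OF V(1) _ j'] V psubset.prems by blast
  qed
  have SY: "S \<notin> ?Y" using psubset.prems by auto
  have "m (S \<inter> A) = (\<Sum>V\<in>?Y. cumulant_of m V * m (S \<inter> A - V))"
    using psubset.hyps psubset.prems(1) m0 by (intro moment_cumulant_rec) auto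
  then have "m (S \<inter> A) * m (S - A) = (\<Sum>V\<in>?Y. cumulant_of m V * (m (S \<inter> A - V) * m (S - A)))"
    by (simp add: sum_distrib_right mult.assoc)
  also have "\<dots> = (\<Sum>V\<in>?Y. cumulant_of m V * m (S - V))"
  proof (intro sum.cong refl)
    fix V assume V: "V \<in> ?Y"
    have "(S - V) \<inter> A = S \<inter> A - V" "(S - V) - A = S - A" using V by auto
    then show "cumulant_of m V * (m (S \<inter> A - V) * m (S - A)) = cumulant_of m V * m (S - V)"
      using psubset.prems(3)[of "S - V"] by simp
  qed
  finally have "m S = (\<Sum>V\<in>?Y. cumulant_of m V * m (S - V))" using psubset.prems(3)[of S] by (simp only: subset_refl)
  moreover have "m S = (\<Sum>V\<in>?X. cumulant_of m V * m (S - V))"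
    using psubset.hyps psubset.prems(1) m0 by (intro moment_cumulant_rec) auto
  moreover have "(\<Sum>V\<in>?X. cumulant_of m V * m (S - V))
      = (\<Sum>V\<in>insert S ?Y. cumulant_of m V * m (S - V))"
  proof (rule sum.mono_neutral_right[OF fX])
    show "insert S ?Y \<subseteq> ?X" using psubset.prems by auto
    show "\<forall>V\<in>?X - insert S ?Y. cumulant_of m V * m (S - V) = 0"
      using z by (auto simp: psubset_eq)
  qed
  moreover have "\<dots> = cumulant_of m S + (\<Sum>V\<in>?Y. cumulant_of m V * m (S - V))"
    using SY m0 psubset.hyps by (subst sum.insert) (auto intro: finite_subset[of _ "Pow S"])
  ultimately show ?case by simp
qed

text \<open>The Wick expansion is required along the single index \<open>i\<close>; the other
  variables may have any joint law. In the recursion on the block of \<open>i\<close>, the pairs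
  reproduce the sum over \<open>j\<close>, and larger proper blocks vanish by induction.\<close>

lemma cumulant_of_wick:
  assumes fin: "finite S" and i: "i \<in> S" and m0: "m {} = 1"
    and wick: "\<And>B. B \<subseteq> S \<Longrightarrow> i \<in> B \<Longrightarrow>
      m B = m {i} * m (B - {i}) + (\<Sum>j\<in>B - {i}. c j * m (B - {i, j}))"
  shows "card S \<ge> 3 \<Longrightarrow> cumulant_of m S = 0" and "j \<noteq> i \<Longrightarrow> S = {i, j} \<Longrightarrow> cumulant_of m S = c j"
proof -
  have pair: "cumulant_of m {i, j} = c j" if "j \<noteq> i" "{i, j} \<subseteq> S" for j
  proof -
    have e: "{V. V \<subset> {i, j} \<and> i \<in> V \<and> V \<noteq> {i}} = {}" by auto
    have "(\<Sum>V | V \<subset> {i, j} \<and> i \<in> V \<and> V \<noteq> {i}. cumulant_of m V * m ({i, j} - V)) = 0"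
      by (simp only: e sum.empty)
    moreover have "{i, j} - {i} = {j}" using that by auto
    ultimately show ?thesis
      using moment_cumulant_rec'[of "{i,j}" i m] wick[of "{i,j}"] that m0 by simp
  qed
  show "j \<noteq> i \<Longrightarrow> S = {i, j} \<Longrightarrow> cumulant_of m S = c j" using pair by simp
  show "card S \<ge> 3 \<Longrightarrow> cumulant_of m S = 0" using fin i wick pair
  proof (induction S rule: finite_psubset_induct)
    case (psubset S)
    \<comment> \<open>The pairs containing \<open>i\<close>; they are proper blocks because
      \<open>S\<close> has at least three elements.\<close>
    let ?P = "(\<lambda>j. {i, j}) ` (S - {i})"
    have sub: "?P \<subseteq> {V. V \<subset> S \<and> i \<in> V \<and> V \<noteq> {i}}"
    proof
      fix V assume "V \<in> ?P"
      then obtain j where j: "V = {i,j}" "j \<in> S" "j \<noteq> i" by auto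
      have "card {i, j} \<noteq> card S" using psubset.prems(1) j by simp
      then show "V \<in> {V. V \<subset> S \<and> i \<in> V \<and> V \<noteq> {i}}" using j psubset.prems(2) by auto
    qed
    have "(\<Sum>V | V \<subset> S \<and> i \<in> V \<and> V \<noteq> {i}. cumulant_of m V * m (S - V))
        = (\<Sum>V\<in>?P. cumulant_of m V * m (S - V))"
    proof (rule sum.mono_neutral_right[OF _ sub])
      show "finite {V. V \<subset> S \<and> i \<in> V \<and> V \<noteq> {i}}"
        using psubset.hyps by (auto intro: finite_subset[of _ "Pow S"])
      show "\<forall>V\<in>{V. V \<subset> S \<and> i \<in> V \<and> V \<noteq> {i}} - ?P. cumulant_of m V * m (S - V) = 0"
      proof
        fix V assume V: "V \<in> {V. V \<subset> S \<and> i \<in> V \<and> V \<noteq> {i}} - ?P"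
        then have VS: "V \<subset> S" "i \<in> V" "V \<noteq> {i}" "V \<notin> ?P" by auto
        then have fV: "finite V" using psubset.hyps finite_subset by auto
        obtain x where x: "x \<in> V" "x \<noteq> i" using VS by blast
        have "V \<noteq> {i, x}" using VS x by auto
        then obtain y where y: "y \<in> V" "y \<noteq> i" "y \<noteq> x" using VS(2) x by blast
        have "card {i, x, y} \<le> card V" using VS(2) x y fV by (intro card_mono) auto
        then have "card V \<ge> 3" using x y by auto
        then have "cumulant_of m V = 0"
          using psubset.IH[OF VS(1)] psubset.prems VS by (meson psubset_imp_subset subset_trans)
        then show "cumulant_of m V * m (S - V) = 0" by simp
      qed
    qed
    also have "\<dots> = (\<Sum>j\<in>S - {i}. cumulant_of m {i, j} * m (S - {i, j}))"
      by (subst sum.reindex) (auto simp: inj_on_def doubleton_eq_iff)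
    also have "\<dots> = (\<Sum>j\<in>S - {i}. c j * m (S - {i, j}))"
      by (intro sum.cong refl) (use psubset.prems(2,4) in auto)
    finally have "m S = cumulant_of m S + m {i} * m (S - {i}) + (\<Sum>j\<in>S - {i}. c j * m (S - {i, j}))"
      using moment_cumulant_rec'[where m=m, OF psubset.hyps psubset.prems(2) m0] psubset.prems(1) by force
    then show ?case using psubset.prems(3)[of S] psubset.prems(2) by simp
  qed
qed

text \<open>Exactly one block of each partition contains \<open>i\<close>, so each product of
  moments is linear in that slot.\<close>

lemma cumulant_of_linear:
  assumes fin: "finite S" and i: "i \<in> S"
    and inn: "\<And>B. B \<subseteq> S \<Longrightarrow> i \<in> B \<Longrightarrow> m B = a * m1 B + b * m2 B"
    and out: "\<And>B. B \<subseteq> S \<Longrightarrow> i \<notin> B \<Longrightarrow> m1 B = m B \<and> m2 B = m B"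
  shows "cumulant_of m S = a * cumulant_of m1 S + b * cumulant_of m2 S"
proof -
  have *: "(\<Prod>B\<in>\<pi>. m B) = a * (\<Prod>B\<in>\<pi>. m1 B) + b * (\<Prod>B\<in>\<pi>. m2 B)" if p: "partition_on S \<pi>" for \<pi>
  proof -
    obtain A where A: "A \<in> \<pi>" "i \<in> A" using p i by (auto simp: partition_on_def)
    have f: "finite \<pi>" using finite_elements[OF fin p] .
    have o: "m1 B = m B \<and> m2 B = m B" if "B \<in> \<pi> - {A}" for B
      using that A p by (intro out) (auto simp: partition_on_def disjoint_def)
    have "A \<subseteq> S" using A p by (auto simp: partition_on_def)
    then show ?thesis using A f o by (simp add: prod.remove[OF f A(1)] inn algebra_simps)
  qed
  have "cumulant_of m S = (\<Sum>\<pi> | partition_on S \<pi>.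
      (- 1) ^ (card \<pi> - 1) * fact (card \<pi> - 1) * (a * (\<Prod>B\<in>\<pi>. m1 B) + b * (\<Prod>B\<in>\<pi>. m2 B)))"
    unfolding cumulant_of_def by (intro sum.cong refl) (simp only: mem_Collect_eq *)
  then show ?thesis
    by (simp add: cumulant_of_def sum_distrib_left sum.distrib distrib_left mult.left_commute mult.assoc)
qed

lemma tendsto_cumulant_of:
  fixes m :: "'n \<Rightarrow> 'i set \<Rightarrow> complex"
  assumes "\<And>B. B \<subseteq> S \<Longrightarrow> ((\<lambda>N. m N B) \<longlongrightarrow> l B) F"
  shows "((\<lambda>N. cumulant_of (m N) S) \<longlongrightarrow> cumulant_of l S) F"
  unfolding cumulant_of_def
  by (intro tendsto_intros assms) (auto simp: partition_on_def)

text \<open>Cumulants are treated as functions of a set function of moments. The same calculus then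
  serves limits of moments, for which there are no underlying random variables.\<close>

lemma joint_cumulant_eq:
  "joint_cumulant P Ys = cumulant_of (\<lambda>B. \<integral>\<omega>. (\<Prod>i\<in>B. (Ys ! i) \<omega>) \<partial>P) {..<length Ys}"
  unfolding joint_cumulant_def cumulant_of_def by simp

lemmas pointwise = plus_fun_apply times_fun_apply zero_fun_apply one_fun_apply minus_apply uminus_apply

declare pointwise [simp del]

section \<open>Finite sums of elements of a set\<close>

text \<open>Closed under sums only. Scalars are part of the generators, because their range differs
  between the applications: constants, \<open>R0\<close>, \<open>R\<close>, functions of an
  angle.\<close>

inductive_set sumset :: "'r::comm_monoid_add set \<Rightarrow> 'r set" for S where
  zero: "0 \<in> sumset S"
| plus: "x \<in> S \<Longrightarrow> y \<in> sumset S \<Longrightarrow> x + y \<in> sumset S"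

lemma sumset_base: "x \<in> S \<Longrightarrow> x \<in> sumset S"
  using sumset.plus[OF _ sumset.zero] by fastforce

lemma sumset_add: "x \<in> sumset S \<Longrightarrow> y \<in> sumset S \<Longrightarrow> x + y \<in> sumset S"
  by (induction x rule: sumset.induct) (auto simp: add.assoc intro: sumset.intros)

lemma sumset_sum: "(\<And>i. i \<in> I \<Longrightarrow> f i \<in> sumset S) \<Longrightarrow> sum f I \<in> sumset S"
  by (induction I rule: infinite_finite_induct) (auto intro: sumset_add sumset.zero)

lemma sumset_mono: "x \<in> sumset S \<Longrightarrow> S \<subseteq> T \<Longrightarrow> x \<in> sumset T"
  by (induction rule: sumset.induct) (auto intro: sumset.intros)

lemma sumset_mult:
  fixes x y :: "'r::comm_ring_1"
  assumes "x \<in> sumset S" "y \<in> sumset T" and "\<And>a b. a \<in> S \<Longrightarrow> b \<in> T \<Longrightarrow> a * b \<in> sumset U"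
  shows "x * y \<in> sumset U"
proof -
  have *: "a * y \<in> sumset U" if "a \<in> S" for a
    using assms(2) by induction (auto simp: distrib_left intro: sumset_add[OF assms(3)[OF that]] sumset.zero)
  show ?thesis using assms(1)
    by induction (auto simp: distrib_right intro: sumset_add * sumset.zero)
qed

lemma sumset_closed:
  assumes "x \<in> sumset S" "S \<subseteq> T" "0 \<in> T" "\<And>a b. a \<in> T \<Longrightarrow> b \<in> T \<Longrightarrow> a + b \<in> T"
  shows "x \<in> T"
  using assms by (induction rule: sumset.induct) auto

section \<open>Random variables with finite moments of all orders\<close>

text \<open>Finiteness of all absolute moments is stable under sums and products, so every
  expectation in a loop equation exists without a separate integrability argument.\<close>

definition all_moments :: "'w measure \<Rightarrow> ('w \<Rightarrow> complex) set" where
  "all_moments P = {f \<in> borel_measurable P. \<forall>m::nat. integrable P (\<lambda>\<omega>. norm (f \<omega>) ^ m)}"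

lemma all_moments_measurable: "f \<in> all_moments P \<Longrightarrow> f \<in> borel_measurable P"
  by (simp add: all_moments_def)

lemma all_moments_integrable: "f \<in> all_moments P \<Longrightarrow> integrable P f"
  unfolding all_moments_def by (auto dest!: spec[of _ 1] simp: integrable_norm_iff)

lemma all_moments_bounded:
  assumes "finite_measure P" "f \<in> borel_measurable P" "\<And>\<omega>. \<omega> \<in> space P \<Longrightarrow> norm (f \<omega>) \<le> B"
  shows "f \<in> all_moments P"
proof -
  have "integrable P (\<lambda>\<omega>. norm (f \<omega>) ^ m)" for m :: nat
    by (rule finite_measure.integrable_const_bound[OF assms(1), where B = "B ^ m"])
      (use assms(2) in \<open>auto intro!: AE_I2 power_mono assms(3)\<close>)
  then show ?thesis using assms by (simp add: all_moments_def)
qed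

lemma all_moments_const: "finite_measure P \<Longrightarrow> (\<lambda>\<omega>. c) \<in> all_moments P"
  by (rule all_moments_bounded[where B = "norm c"]) auto

lemma all_moments_add:
  assumes f: "f \<in> all_moments P" and g: "g \<in> all_moments P"
  shows "(\<lambda>\<omega>. f \<omega> + g \<omega>) \<in> all_moments P"
proof -
  note [measurable] = all_moments_measurable[OF f] all_moments_measurable[OF g]
  have "integrable P (\<lambda>\<omega>. norm (f \<omega> + g \<omega>) ^ m)" for m :: nat
  proof (rule Bochner_Integration.integrable_bound)
    show "integrable P (\<lambda>\<omega>. 2 ^ m * (norm (f \<omega>) ^ m + norm (g \<omega>) ^ m))"
      using f g by (auto simp: all_moments_def)
    have "norm (f \<omega> + g \<omega>) ^ m \<le> 2 ^ m * (norm (f \<omega>) ^ m + norm (g \<omega>) ^ m)" for \<omega>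
    proof -
      have "norm (f \<omega> + g \<omega>) ^ m \<le> (2 * max (norm (f \<omega>)) (norm (g \<omega>))) ^ m"
        by (rule power_mono) (use norm_triangle_ineq[of "f \<omega>" "g \<omega>"] in auto)
      also have "\<dots> \<le> 2 ^ m * (norm (f \<omega>) ^ m + norm (g \<omega>) ^ m)"
        by (auto simp: power_mult_distrib max_def)
      finally show ?thesis .
    qed
    then show "AE \<omega> in P. norm (norm (f \<omega> + g \<omega>) ^ m) \<le> norm (2 ^ m * (norm (f \<omega>) ^ m + norm (g \<omega>) ^ m))"
      by (intro AE_I2) simp
  qed measurable
  then show ?thesis by (simp add: all_moments_def)
qed

lemma all_moments_mult:
  assumes f: "f \<in> all_moments P" and g: "g \<in> all_moments P"
  shows "(\<lambda>\<omega>. f \<omega> * g \<omega>) \<in> all_moments P"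
proof -
  note [measurable] = all_moments_measurable[OF f] all_moments_measurable[OF g]
  have "integrable P (\<lambda>\<omega>. norm (f \<omega> * g \<omega>) ^ m)" for m :: nat
  proof (rule Bochner_Integration.integrable_bound)
    show "integrable P (\<lambda>\<omega>. norm (f \<omega>) ^ (2 * m) + norm (g \<omega>) ^ (2 * m))"
      using f g by (auto simp: all_moments_def)
    have "norm (f \<omega> * g \<omega>) ^ m \<le> norm (f \<omega>) ^ (2 * m) + norm (g \<omega>) ^ (2 * m)" for \<omega>
    proof -
      have "2 * (x * y) \<le> x\<^sup>2 + y\<^sup>2" for x y :: real
        using zero_le_power2[of "x - y"] by (simp add: power2_diff)
      from this[of "norm (f \<omega>) ^ m" "norm (g \<omega>) ^ m"]
      have "2 * norm (f \<omega> * g \<omega>) ^ m \<le> norm (f \<omega>) ^ (2 * m) + norm (g \<omega>) ^ (2 * m)"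
        by (simp add: norm_mult power_mult_distrib power_mult[symmetric] mult.commute)
      moreover have "0 \<le> norm (f \<omega> * g \<omega>) ^ m" by simp
      ultimately show ?thesis by linarith
    qed
    then show "AE \<omega> in P. norm (norm (f \<omega> * g \<omega>) ^ m) \<le> norm (norm (f \<omega>) ^ (2 * m) + norm (g \<omega>) ^ (2 * m))"
      by (intro AE_I2) simp
  qed measurable
  then show ?thesis by (simp add: all_moments_def)
qed

lemma all_moments_uminus: "f \<in> all_moments P \<Longrightarrow> (\<lambda>\<omega>. - f \<omega>) \<in> all_moments P"
  by (simp add: all_moments_def)

lemma all_moments_sum:
  "finite_measure P \<Longrightarrow> (\<And>i. i \<in> I \<Longrightarrow> f i \<in> all_moments P) \<Longrightarrow> (\<lambda>\<omega>. \<Sum>i\<in>I. f i \<omega>) \<in> all_moments P"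
  by (induction I rule: infinite_finite_induct) (auto intro: all_moments_add all_moments_const)

type_synonym 'w scalar_seq = "nat \<Rightarrow> 'w \<Rightarrow> complex"

definition moment_seqs :: "nat set \<Rightarrow> (nat \<Rightarrow> 'w measure) \<Rightarrow> 'w scalar_seq set" where
  "moment_seqs Ns M = {f. \<forall>N\<in>Ns. f N \<in> all_moments (M N)}"

definition expect :: "(nat \<Rightarrow> 'w measure) \<Rightarrow> nat \<Rightarrow> 'w scalar_seq \<Rightarrow> complex" where
  "expect M N f = (\<integral>\<omega>. f N \<omega> \<partial>M N)"

definition cseq :: "(nat \<Rightarrow> complex) \<Rightarrow> 'w scalar_seq" where
  "cseq d = (\<lambda>N \<omega>. d N)"

lemma cseq_apply [simp]: "cseq d N \<omega> = d N" by (simp add: cseq_def)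

lemma cseq_simps: "cseq d + cseq e = cseq (\<lambda>N. d N + e N)" "cseq d * cseq e = cseq (\<lambda>N. d N * e N)"
  "- cseq d = cseq (\<lambda>N. - d N)" "cseq (\<lambda>_. 1) = 1" "cseq (\<lambda>_. 0) = 0"
  by (auto simp: fun_eq_iff pointwise)

lemma expect_add:
  assumes "f \<in> moment_seqs Ns M" "g \<in> moment_seqs Ns M" "N \<in> Ns"
  shows "expect M N (f + g) = expect M N f + expect M N g"
  using assms unfolding expect_def moment_seqs_def
  by (simp add: plus_fun_def Bochner_Integration.integral_add[OF all_moments_integrable all_moments_integrable])

lemma expect_uminus: "expect M N (- f) = - expect M N f"
  unfolding expect_def by (simp add: fun_Compl_def)

lemma expect_diff:
  assumes "f \<in> moment_seqs Ns M" "g \<in> moment_seqs Ns M" "N \<in> Ns"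
  shows "expect M N (f - g) = expect M N f - expect M N g"
  using assms unfolding expect_def moment_seqs_def
  by (simp add: fun_diff_def Bochner_Integration.integral_diff[OF all_moments_integrable all_moments_integrable])

lemma expect_cseq: "expect M N (cseq d * f) = d N * expect M N f"
  unfolding expect_def by (simp add: times_fun_def)

lemma expect_0 [simp]: "expect M N 0 = 0"
  unfolding expect_def by (simp add: zero_fun_def)

section \<open>Loop equations\<close>

text \<open>The word of the transposed matrix, for \<open>fl\<close> the transposition of
  letters.\<close>

definition mrev :: "('l \<Rightarrow> 'l) \<Rightarrow> 'l list \<Rightarrow> 'l list" where
  "mrev fl w = rev (map fl w)"

text \<open>The trace of \<open>l # y\<close> is cut behind and in front of each letter of the
  colour of \<open>l\<close>; the two parts become two traces, or are rejoined with the second one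
  transposed. The cuts at \<open>l\<close> itself are already evaluated: the one behind it leaves
  \<open>- tr (l # mrev fl y)\<close>, because \<open>tr [l]\<close> is zero, and the one in front
  of it gives the factor \<open>N - 1\<close> on the left of \<open>loop\<close>.\<close>

definition loop_self :: "('l \<Rightarrow> 'i) \<Rightarrow> ('l \<Rightarrow> 'l) \<Rightarrow> ('l list \<Rightarrow> 'r::comm_ring_1) \<Rightarrow> 'l \<Rightarrow> 'l list \<Rightarrow> 'r" where
  "loop_self clr fl tr l y = - tr (l # mrev fl y) + (\<Sum>i | i < length y \<and> clr (y ! i) = clr l.
      tr (l # take (Suc i) y) * tr (drop (Suc i) y) - tr (l # take i y) * tr (drop i y)
      - tr (l # take (Suc i) y @ mrev fl (drop (Suc i) y)) + tr (l # take i y @ mrev fl (drop i y)))"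

text \<open>The trace of \<open>w\<close> is opened behind and in front of each letter of the colour
  of \<open>hd z\<close> and inserted after \<open>z\<close> in either direction. The opposite signs
  of the two cuts come from a commutator, those of the two directions from the skew-symmetry of the
  generator of a rotation.\<close>

definition loop_cross :: "('l \<Rightarrow> 'i) \<Rightarrow> ('l \<Rightarrow> 'l) \<Rightarrow> ('l list \<Rightarrow> 'r::comm_ring_1) \<Rightarrow> 'l list \<Rightarrow> 'l list \<Rightarrow> 'r" where
  "loop_cross clr fl tr z w = (\<Sum>i | i < length w \<and> clr (w ! i) = clr (hd z).
      tr (z @ drop (Suc i) w @ take (Suc i) w) - tr (z @ drop i w @ take i w)
      - tr (z @ mrev fl (drop (Suc i) w @ take (Suc i) w)) + tr (z @ mrev fl (drop i w @ take i w)))"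

definition remove_nth :: "nat \<Rightarrow> 'a list \<Rightarrow> 'a list" where
  "remove_nth j ws = take j ws @ drop (Suc j) ws"

definition traces :: "('l list \<Rightarrow> 'r::comm_ring_1) \<Rightarrow> 'l list list \<Rightarrow> 'r" where
  "traces tr ws = (\<Prod>w\<leftarrow>ws. tr w)"

text \<open>Excludes the empty word, whose trace has order \<open>N\<close>, and one-letter words,
  whose ends coincide and whose trace vanishes.\<close>

definition cyc_alt :: "'l set \<Rightarrow> ('l \<Rightarrow> 'i) \<Rightarrow> 'l list \<Rightarrow> bool" where
  "cyc_alt L clr w \<longleftrightarrow> set w \<subseteq> L \<and> w \<noteq> [] \<and> distinct_adj (map clr w) \<and> clr (hd w) \<noteq> clr (last w)"

definition lin_alt :: "'l set \<Rightarrow> ('l \<Rightarrow> 'i) \<Rightarrow> 'l list \<Rightarrow> bool" where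
  "lin_alt L clr w \<longleftrightarrow> set w \<subseteq> L \<and> distinct_adj (map clr w)"

text \<open>The letters are traceless matrices \<open>O\<^sub>c\<^sup>T X O\<^sub>c\<close> of colour \<open>c\<close>, \<open>tr\<close> is the
  unnormalized trace of a word, \<open>fl\<close> the transposition, \<open>mrg\<close> the traceless part of the product of
  two letters of the same colour and \<open>pr\<close> the normalized trace of that product.\<close>

locale loop_system =
  fixes Ns :: "nat set" and M :: "nat \<Rightarrow> 'w measure" and R0 R :: "'w scalar_seq set"
    and L :: "'l set" and clr :: "'l \<Rightarrow> 'i" and fl :: "'l \<Rightarrow> 'l" and mrg :: "'l \<Rightarrow> 'l \<Rightarrow> 'l"
    and pr :: "'l \<Rightarrow> 'l \<Rightarrow> 'w scalar_seq" and tr :: "'l list \<Rightarrow> 'w scalar_seq"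
  assumes infinite_Ns: "infinite Ns"
    and prob_M: "N \<in> Ns \<Longrightarrow> prob_space (M N)"
    and R0_R: "R0 \<subseteq> R" and R_moments: "R \<subseteq> moment_seqs Ns M"
    and R0_add: "f \<in> R0 \<Longrightarrow> g \<in> R0 \<Longrightarrow> f + g \<in> R0"
    and R0_mult: "f \<in> R0 \<Longrightarrow> g \<in> R0 \<Longrightarrow> f * g \<in> R0"
    and R0_cseq: "(d \<longlongrightarrow> c) (dims_to_infinity Ns) \<Longrightarrow> cseq d \<in> R0"
    and R_add: "f \<in> R \<Longrightarrow> g \<in> R \<Longrightarrow> f + g \<in> R"
    and R_mult: "f \<in> R \<Longrightarrow> g \<in> R \<Longrightarrow> f * g \<in> R"
    and R_conv: "f \<in> R \<Longrightarrow> \<exists>c. ((\<lambda>N. expect M N f) \<longlongrightarrow> c) (dims_to_infinity Ns)"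
    and fl_L: "l \<in> L \<Longrightarrow> fl l \<in> L" and fl_fl: "l \<in> L \<Longrightarrow> fl (fl l) = l" and clr_fl: "clr (fl l) = clr l"
    and mrg_L: "l \<in> L \<Longrightarrow> l' \<in> L \<Longrightarrow> clr l = clr l' \<Longrightarrow> mrg l l' \<in> L" and clr_mrg: "clr (mrg l l') = clr l"
    and pr_R0: "l \<in> L \<Longrightarrow> l' \<in> L \<Longrightarrow> clr l = clr l' \<Longrightarrow> pr l l' \<in> R0"
    and tr_moments: "set w \<subseteq> L \<Longrightarrow> tr w \<in> moment_seqs Ns M"
    and tr_Nil: "tr [] = cseq of_nat"
    and tr_single: "l \<in> L \<Longrightarrow> tr [l] = 0"
    and tr_rot: "set u \<subseteq> L \<Longrightarrow> set v \<subseteq> L \<Longrightarrow> tr (u @ v) = tr (v @ u)"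
    and tr_mrg: "set u \<subseteq> L \<Longrightarrow> l \<in> L \<Longrightarrow> l' \<in> L \<Longrightarrow> set v \<subseteq> L \<Longrightarrow> clr l = clr l' \<Longrightarrow>
        tr (u @ [l, l'] @ v) = tr (u @ [mrg l l'] @ v) + pr l l' * tr (u @ v)"
    and loop: "N \<in> Ns \<Longrightarrow> a \<in> R \<Longrightarrow> cyc_alt L clr (l # y) \<Longrightarrow> list_all (cyc_alt L clr) ws \<Longrightarrow>
        (of_nat N - 1) * expect M N (a * tr (l # y) * traces tr ws) =
          expect M N (a * traces tr ws * loop_self clr fl tr l y) +
          expect M N (a * (\<Sum>j<length ws. traces tr (remove_nth j ws) * loop_cross clr fl tr (l # y) (ws ! j)))"
begin

abbreviation E :: "nat \<Rightarrow> 'w scalar_seq \<Rightarrow> complex" where "E \<equiv> expect M"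
abbreviation F :: "nat filter" where "F \<equiv> dims_to_infinity Ns"
abbreviation T :: "'l list list \<Rightarrow> 'w scalar_seq" where "T \<equiv> traces tr"
abbreviation calt :: "'l list \<Rightarrow> bool" where "calt \<equiv> cyc_alt L clr"
abbreviation lalt :: "'l list \<Rightarrow> bool" where "lalt \<equiv> lin_alt L clr"
abbreviation V :: "'w scalar_seq set" where "V \<equiv> moment_seqs Ns M"
abbreviation tot :: "'l list list \<Rightarrow> nat" where "tot ws \<equiv> (\<Sum>w\<leftarrow>ws. length w)"

lemma F_eventually: "eventually P F \<longleftrightarrow> (\<exists>n0. \<forall>N\<ge>n0. N \<in> Ns \<longrightarrow> P N)"
  by (simp add: dims_to_infinity_def eventually_inf_principal eventually_sequentially)

lemma F_neq_bot: "F \<noteq> bot"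
  using infinite_Ns by (auto simp: trivial_limit_def F_eventually infinite_nat_iff_unbounded_le)

lemma eventually_Ns: "eventually (\<lambda>N. N \<in> Ns) F"
  by (simp add: F_eventually)

lemma F_le: "F \<le> sequentially"
  by (simp add: dims_to_infinity_def)

lemma fin_M: "N \<in> Ns \<Longrightarrow> finite_measure (M N)"
  using prob_M prob_space.finite_measure by blast

lemma V_add: "f \<in> V \<Longrightarrow> g \<in> V \<Longrightarrow> f + g \<in> V"
  by (auto simp: moment_seqs_def plus_fun_def intro: all_moments_add)

lemma V_mult: "f \<in> V \<Longrightarrow> g \<in> V \<Longrightarrow> f * g \<in> V"
  by (auto simp: moment_seqs_def times_fun_def intro: all_moments_mult)

lemma V_cseq: "cseq d \<in> V"
  by (auto simp: moment_seqs_def cseq_def intro: all_moments_const fin_M)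

lemma V_uminus: "f \<in> V \<Longrightarrow> - f \<in> V"
  by (auto simp: moment_seqs_def fun_Compl_def intro: all_moments_uminus)

lemma V_diff: "f \<in> V \<Longrightarrow> g \<in> V \<Longrightarrow> f - g \<in> V"
  using V_add[OF _ V_uminus] by fastforce

lemma V_0: "0 \<in> V" and V_1: "1 \<in> V"
  using V_cseq[of "\<lambda>_. 0"] V_cseq[of "\<lambda>_. 1"] by (simp_all only: cseq_simps)

lemma V_sum: "(\<And>i. i \<in> I \<Longrightarrow> f i \<in> V) \<Longrightarrow> sum f I \<in> V"
  by (induction I rule: infinite_finite_induct) (auto intro: V_add V_0)

lemma R_const: "cseq (\<lambda>_. c) \<in> R" and R0_const: "cseq (\<lambda>_. c) \<in> R0"
  using R0_cseq[OF tendsto_const] R0_R by auto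

lemma R_1: "1 \<in> R" and R0_1: "1 \<in> R0" and R_0: "0 \<in> R" and R0_0: "0 \<in> R0"
  using R_const[of 1] R0_const[of 1] R_const[of 0] R0_const[of 0] by (simp_all only: cseq_simps)

lemma R_V: "a \<in> R \<Longrightarrow> a \<in> V" using R_moments by auto

lemma R_uminus: "f \<in> R \<Longrightarrow> - f \<in> R" and R0_uminus: "f \<in> R0 \<Longrightarrow> - f \<in> R0"
proof -
  have e: "- f = cseq (\<lambda>_. - 1) * f" by (auto simp: fun_eq_iff pointwise)
  show "f \<in> R \<Longrightarrow> - f \<in> R" "f \<in> R0 \<Longrightarrow> - f \<in> R0"
    unfolding e by (auto intro: R_mult R0_mult R_const R0_const)
qed

lemma R0_sum: "(\<And>i. i \<in> I \<Longrightarrow> f i \<in> R0) \<Longrightarrow> sum f I \<in> R0"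
  by (induction I rule: infinite_finite_induct) (auto intro: R0_add R0_0)

lemma T_simps [simp]: "T [] = 1" "T (w # ws) = tr w * T ws" "T (ws @ ws') = T ws * T ws'"
  by (simp_all add: traces_def)

lemma T_V: "list_all (\<lambda>w. set w \<subseteq> L) ws \<Longrightarrow> T ws \<in> V"
  by (induction ws) (auto intro: V_mult V_1 tr_moments)

lemma calt_L: "calt w \<Longrightarrow> set w \<subseteq> L" by (simp add: cyc_alt_def)

lemma T_calt_V: "list_all calt ws \<Longrightarrow> T ws \<in> V"
  by (rule T_V) (auto simp: list_all_iff dest: calt_L)

text \<open>What a single word reduces to: one trace at a time, with normalized traces as
  coefficients and without \<open>tr []\<close>, hence without any summand of order
  \<open>N\<close>. \<open>VV\<close> is the corresponding span for expectations, with products of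
  traces and coefficients in \<open>R\<close>. The index bounds the number of letters, which is the
  induction parameter.\<close>

definition V1 :: "nat \<Rightarrow> 'w scalar_seq set" where
  "V1 k = sumset {b * tr w | b w. b \<in> R0 \<and> calt w \<and> length w \<le> k}"

definition VV :: "nat \<Rightarrow> 'w scalar_seq set" where
  "VV k = sumset {b * T ws | b ws. b \<in> R \<and> list_all calt ws \<and> tot ws \<le> k}"

lemma V1_mono: "f \<in> V1 j \<Longrightarrow> j \<le> k \<Longrightarrow> f \<in> V1 k"
  unfolding V1_def by (erule sumset_mono) (auto intro: order.trans)

lemma VV_mono: "f \<in> VV j \<Longrightarrow> j \<le> k \<Longrightarrow> f \<in> VV k"
  unfolding VV_def by (erule sumset_mono) (auto intro: order.trans)

lemma V1_add: "f \<in> V1 k \<Longrightarrow> g \<in> V1 k \<Longrightarrow> f + g \<in> V1 k"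
  unfolding V1_def by (rule sumset_add)

lemma V1_scale: "b \<in> R0 \<Longrightarrow> f \<in> V1 k \<Longrightarrow> b * f \<in> V1 k"
  unfolding V1_def
proof (rule sumset_mult[of _ "{b}"], rule sumset_base, simp, assumption, safe)
  fix b' w assume "b \<in> R0" "b' \<in> R0" "calt w" "length w \<le> k"
  then show "b * (b' * tr w) \<in> sumset {b * tr w | b w. b \<in> R0 \<and> calt w \<and> length w \<le> k}"
    by (intro sumset_base) (metis (mono_tags, lifting) R0_mult mem_Collect_eq mult.assoc)
qed

lemma V1_0: "0 \<in> V1 k"
  by (simp add: V1_def sumset.zero)

lemma V1_base: "calt w \<Longrightarrow> length w \<le> k \<Longrightarrow> tr w \<in> V1 k"
  unfolding V1_def using R0_1 by (intro sumset_base) force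

lemma V1_VV: "f \<in> V1 k \<Longrightarrow> f \<in> VV k"
  unfolding V1_def VV_def
proof (erule sumset_mono, safe)
  fix b w assume "b \<in> R0" "calt w" "length w \<le> k"
  then have "b * tr w = b * T [w] \<and> b \<in> R \<and> list_all calt [w] \<and> tot [w] \<le> k" using R0_R by auto
  then show "\<exists>b' ws. b * tr w = b' * T ws \<and> b' \<in> R \<and> list_all calt ws \<and> tot ws \<le> k" by blast
qed

lemma VV_add: "f \<in> VV k \<Longrightarrow> g \<in> VV k \<Longrightarrow> f + g \<in> VV k"
  unfolding VV_def by (rule sumset_add)

lemma VV_sum: "(\<And>i. i \<in> I \<Longrightarrow> f i \<in> VV k) \<Longrightarrow> sum f I \<in> VV k"
  unfolding VV_def by (rule sumset_sum)

lemma VV_mult: "f \<in> VV j \<Longrightarrow> g \<in> VV k \<Longrightarrow> f * g \<in> VV (j + k)"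
  unfolding VV_def
proof (erule sumset_mult, assumption, safe)
  fix b ws b' ws' assume *: "b \<in> R" "b' \<in> R" "list_all calt ws" "list_all calt ws'" "tot ws \<le> j" "tot ws' \<le> k"
  have "b * T ws * (b' * T ws') = (b * b') * T (ws @ ws')" by (simp add: mult_ac)
  moreover have "b * b' \<in> R" "list_all calt (ws @ ws')" "tot (ws @ ws') \<le> j + k" using * R_mult by auto
  ultimately show "b * T ws * (b' * T ws') \<in> sumset {b * T ws | b ws. b \<in> R \<and> list_all calt ws \<and> tot ws \<le> j + k}"
    by (intro sumset_base) blast
qed

lemma VV_T: "list_all calt ws \<Longrightarrow> tot ws \<le> k \<Longrightarrow> T ws \<in> VV k"
  unfolding VV_def using R_1 by (intro sumset_base) force

lemma VV_R: "a \<in> R \<Longrightarrow> a \<in> VV k"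
  unfolding VV_def by (rule sumset_base, clarsimp) (rule exI[of _ a], rule exI[of _ "[]"], simp)

lemma VV_scale: "a \<in> R \<Longrightarrow> f \<in> VV k \<Longrightarrow> a * f \<in> VV k"
  using VV_mult[OF VV_R[of a 0]] by simp

lemma VV_V: "f \<in> VV k \<Longrightarrow> f \<in> V"
  unfolding VV_def by (erule sumset_closed) (auto intro: V_mult T_calt_V R_V V_0 V_add)

subsection \<open>Reduction of words\<close>

text \<open>The value zero for different colours is the one that freeness gives in the
  limit.\<close>

definition prc :: "'l \<Rightarrow> 'l \<Rightarrow> 'w scalar_seq" where
  "prc l l' = (if clr l = clr l' then pr l l' else 0)"

text \<open>The nested contraction of all letters of \<open>rev v @ u\<close>, from the middle
  outwards: there the head of \<open>v\<close> stands directly to the left of the head of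
  \<open>u\<close>, hence the order \<open>prc y x\<close>.\<close>

fun contr :: "'l list \<Rightarrow> 'l list \<Rightarrow> 'w scalar_seq" where
  "contr [] [] = 1"
| "contr (x # u) (y # v) = prc y x * contr u v"
| "contr _ _ = 0"

lemma prc_R0: "l \<in> L \<Longrightarrow> l' \<in> L \<Longrightarrow> prc l l' \<in> R0"
  by (auto simp: prc_def pr_R0 R0_0)

lemma contr_R0: "set u \<subseteq> L \<Longrightarrow> set v \<subseteq> L \<Longrightarrow> contr u v \<in> R0"
  by (induction u v rule: contr.induct) (auto intro!: R0_mult prc_R0 simp: R0_1 R0_0)

lemma lalt_Cons: "lalt (l # w) \<longleftrightarrow> l \<in> L \<and> lalt w \<and> (w = [] \<or> clr l \<noteq> clr (hd w))"
  by (cases w) (auto simp: lin_alt_def)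

lemma lalt_append: "lalt (u @ v) \<longleftrightarrow> lalt u \<and> lalt v \<and> (u = [] \<or> v = [] \<or> clr (last u) \<noteq> clr (hd v))"
  by (auto simp: lin_alt_def distinct_adj_append_iff last_map hd_map)

lemma lalt_Nil [simp]: "lalt []" by (simp add: lin_alt_def)

lemma lalt_L: "lalt w \<Longrightarrow> set w \<subseteq> L" by (simp add: lin_alt_def)

lemma lalt_rev [simp]: "lalt (rev w) \<longleftrightarrow> lalt w"
  by (simp add: lin_alt_def rev_map[symmetric])

lemma lalt_map_fl: "lalt w \<Longrightarrow> lalt (map fl w)"
  by (auto simp: lin_alt_def fl_L o_def clr_fl)

lemma calt_iff: "calt w \<longleftrightarrow> lalt w \<and> w \<noteq> [] \<and> clr (hd w) \<noteq> clr (last w)"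
  by (auto simp: cyc_alt_def lin_alt_def)

lemma tr_mrg': "l \<in> L \<Longrightarrow> l' \<in> L \<Longrightarrow> set v \<subseteq> L \<Longrightarrow> clr l = clr l' \<Longrightarrow>
    tr (l # v @ [l']) = tr (mrg l' l # v) + pr l' l * tr v"
  using tr_mrg[of "[]" l' l v] tr_rot[of "l # v" "[l']"] by auto

text \<open>Cyclicity brings the last letter in front of the first one. If their colours agree,
  merging them loses a letter and gives a cyclically alternating word, while contracting them leaves
  a shorter alternating word for the induction. The lost letter is what later puts such terms within
  reach of the induction on the number of letters.\<close>

lemma tr_lalt:
  assumes "lalt w" "w \<noteq> []"
  shows "tr w \<in> V1 (length w)" and "clr (hd w) = clr (last w) \<Longrightarrow> tr w \<in> V1 (length w - 1)"
proof -
  have "tr w \<in> V1 (length w) \<and> (clr (hd w) = clr (last w) \<longrightarrow> tr w \<in> V1 (length w - 1))"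
    using assms
  proof (induction w rule: length_induct)
    case (1 w)
    show ?case
    proof (cases "clr (hd w) = clr (last w)")
      case False
      then show ?thesis using 1 by (auto simp: calt_iff intro: V1_base)
    next
      case True
      obtain l v where w: "w = l # v" using 1 by (cases w) auto
      show ?thesis
      proof (cases v rule: rev_exhaust)
        case Nil
        then have "tr w = 0" using w 1 tr_single by (auto simp: lalt_Cons)
        then show ?thesis by (metis V1_0)
      next
        case (snoc m l')
        note w = w[unfolded snoc]
        have c: "clr l = clr l'" using True w by simp
        have m: "m \<noteq> []" using 1 c w by (auto simp: lalt_Cons)
        have L: "l \<in> L" "l' \<in> L" "set m \<subseteq> L" "lalt m" using 1 w by (auto simp: lalt_Cons lalt_append lalt_L)
        have "calt (mrg l' l # m)"
          using L m c 1(2) w by (auto simp: calt_iff lalt_Cons lalt_append mrg_L clr_mrg)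
        then have a: "tr (mrg l' l # m) \<in> V1 (length w - 1)" by (rule V1_base) (simp add: w)
        have "tr m \<in> V1 (length m)" using 1(1) L m w by auto
        then have "pr l' l * tr m \<in> V1 (length w - 1)"
          by (intro V1_scale) (auto simp: L c pr_R0 w intro: V1_mono)
        then have "tr w \<in> V1 (length w - 1)"
          using a tr_mrg'[of l l' m] L c by (auto simp: w intro: V1_add)
        then show ?thesis using V1_mono[of _ "length w - 1" "length w"] by auto
      qed
    qed
  qed
  then show "tr w \<in> V1 (length w)" and "clr (hd w) = clr (last w) \<Longrightarrow> tr w \<in> V1 (length w - 1)"
    by auto
qed

text \<open>The coefficient of \<open>tr []\<close>, which is of order \<open>N\<close>, comes from contracting all letters.\<close>

lemma tr_two_lalt:
  assumes "lalt u" "lalt v"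
  shows "tr (rev v @ u) - contr u v * tr [] \<in> V1 (length u + length v)"
    and "u \<noteq> [] \<Longrightarrow> v \<noteq> [] \<Longrightarrow> clr (hd u) = clr (hd v) \<Longrightarrow>
      tr (rev v @ u) - contr u v * tr [] \<in> V1 (length u + length v - 1)"
proof -
  let ?P = "\<lambda>u v. tr (rev v @ u) - contr u v * tr [] \<in> V1 (length u + length v) \<and>
    (u \<noteq> [] \<and> v \<noteq> [] \<and> clr (hd u) = clr (hd v) \<longrightarrow>
      tr (rev v @ u) - contr u v * tr [] \<in> V1 (length u + length v - 1))"
  have "?P u v" using assms
  proof (induction u v rule: contr.induct)
    case (2 x u y v)
    have L: "x \<in> L" "y \<in> L" "set u \<subseteq> L" "set v \<subseteq> L" "lalt u" "lalt v"
      using 2 by (auto simp: lalt_Cons lalt_L)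
    have IH: "tr (rev v @ u) - contr u v * tr [] \<in> V1 (length u + length v)"
      using 2(1)[OF L(5,6)] by (rule conjunct1)
    show ?case
    proof (cases "clr x = clr y")
      case False
      have "lalt (rev (y # v))" using 2(3) by (simp only: lalt_rev)
      then have "lalt (rev (y # v) @ x # u)" using 2(2) False
        by (simp only: lalt_append[of "rev (y # v)" "x # u"]) (simp add: last_rev)
      then show ?thesis using tr_lalt(1)[of "rev (y # v) @ x # u"] False by (simp add: prc_def add_ac)
    next
      case True
      have "lalt (rev v @ mrg y x # u)" using 2 L True
        by (auto simp: lalt_append lalt_Cons mrg_L clr_mrg last_rev)
      then have a: "tr (rev v @ mrg y x # u) \<in> V1 (length u + length v + 1)"
        using tr_lalt(1)[of "rev v @ mrg y x # u"] by (simp add: add_ac)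
      have b: "pr y x * (tr (rev v @ u) - contr u v * tr []) \<in> V1 (length u + length v + 1)"
        using L True pr_R0 by (intro V1_scale V1_mono[OF IH]) auto
      have "tr (rev (y # v) @ x # u) - contr (x # u) (y # v) * tr [] =
          tr (rev v @ mrg y x # u) + pr y x * (tr (rev v @ u) - contr u v * tr [])"
        using tr_mrg[of "rev v" y x u] L True by (simp add: prc_def algebra_simps)
      then have c: "tr (rev (y # v) @ x # u) - contr (x # u) (y # v) * tr [] \<in> V1 (length u + length v + 1)"
        using V1_add[OF a b] by simp
      show ?thesis using c V1_mono[OF c, of "length (x # u) + length (y # v)"] by simp
    qed
  next
    case 1
    show ?case by (simp add: V1_def sumset.zero)
  next
    case ("3_1" x u)
    then show ?case using tr_lalt(1)[of "x # u"] by simp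
  next
    case ("3_2" y v)
    then show ?case using tr_lalt(1)[of "rev (y # v)"] lalt_rev[of "y # v"] by simp
  qed
  then show "tr (rev v @ u) - contr u v * tr [] \<in> V1 (length u + length v)"
    and "u \<noteq> [] \<Longrightarrow> v \<noteq> [] \<Longrightarrow> clr (hd u) = clr (hd v) \<Longrightarrow>
      tr (rev v @ u) - contr u v * tr [] \<in> V1 (length u + length v - 1)" by auto
qed

text \<open>Merging adjacent letters of equal colour shortens the word, and so does contracting
  them. The coefficient \<open>b\<close> collects what remains when the word has been reduced to
  \<open>tr []\<close>; it is random, as the contractions are.\<close>

lemma tr_word:
  assumes "set w \<subseteq> L"
  shows "\<exists>b\<in>R0. tr w - b * tr [] \<in> V1 (length w)"
  using assms
proof (induction w rule: length_induct)
  case (1 w)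
  show ?case
  proof (cases "lalt w")
    case True
    show ?thesis
    proof (cases "w = []")
      case True
      have "tr w - 1 * tr [] = 0" using True by simp
      then show ?thesis using R0_1 V1_0[of "length w"] by metis
    next
      case False
      then show ?thesis using tr_lalt(1)[OF True] R0_0 by (intro bexI[of _ 0]) auto
    qed
  next
    case False
    then have "\<not> distinct_adj (map clr w)" using 1 by (simp add: lin_alt_def)
    then obtain i where i: "Suc i < length w" "clr (w ! i) = clr (w ! Suc i)"
      unfolding distinct_adj_conv_nth by auto
    define u v where "u = take i w" and "v = drop (Suc (Suc i)) w"
    have w: "w = u @ [w ! i, w ! Suc i] @ v"
      unfolding u_def v_def using i by (simp add: Cons_nth_drop_Suc)
    define l l' where "l = w ! i" and "l' = w ! Suc i"
    note w = w[folded l_def l'_def]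
    have c: "clr l = clr l'" using i by (simp add: l_def l'_def)
    have L: "set u \<subseteq> L" "set v \<subseteq> L" "l \<in> L" "l' \<in> L" using 1(2) arg_cong[OF w, of set] by auto
    have len: "length w = length u + length v + 2" using arg_cong[OF w, of length] by simp
    obtain b1 where b1: "b1 \<in> R0" "tr (u @ [mrg l l'] @ v) - b1 * tr [] \<in> V1 (length w)"
      using 1(1)[rule_format, of "u @ [mrg l l'] @ v"] L c len mrg_L V1_mono[of _ "length u + length v + 1" "length w"]
      by auto
    obtain b2 where b2: "b2 \<in> R0" "tr (u @ v) - b2 * tr [] \<in> V1 (length w)"
      using 1(1)[rule_format, of "u @ v"] L len V1_mono[of _ "length u + length v" "length w"] by auto
    have "tr w - (b1 + pr l l' * b2) * tr [] =
        (tr (u @ [mrg l l'] @ v) - b1 * tr []) + pr l l' * (tr (u @ v) - b2 * tr [])"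
      using arg_cong[OF w, of tr] tr_mrg[of u l l' v] L c by (simp add: algebra_simps)
    also have "\<dots> \<in> V1 (length w)" using b1 b2 L c pr_R0 by (intro V1_add V1_scale) auto
    finally show ?thesis using b1 b2 L c pr_R0
      by (intro bexI[of _ "b1 + pr l l' * b2"]) (auto intro!: R0_add R0_mult)
  qed
qed

end

context loop_system
begin

subsection \<open>Convergence of expectations of products of traces\<close>

text \<open>The coefficient of \<open>N\<close> in \<open>loop_self\<close>. It stems from
  \<open>tr (l # take i y @ mrev fl (drop i y))\<close>, the only kind of term there that can be
  contracted down to \<open>tr []\<close> in full. Its limit turns out to be the limiting mean of
  \<open>tr (l # y)\<close>.\<close>

definition mean :: "'l \<Rightarrow> 'l list \<Rightarrow> 'w scalar_seq" where
  "mean l y = (\<Sum>i<length y. contr (l # take i y) (map fl (drop i y)))"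

text \<open>The coefficient of \<open>N\<close> in \<open>loop_cross\<close>: every letter of
  \<open>z\<close> is contracted with a letter of \<open>w\<close>, running through \<open>w\<close>
  in the opposite direction in the first summand, and in the same direction with transposed letters
  in the second. These become the two sums in the covariance formula of real second-order
  freeness.\<close>

definition spokes :: "'l list \<Rightarrow> 'l list \<Rightarrow> 'w scalar_seq" where
  "spokes z w = (\<Sum>i<length w. contr z (rev (drop (Suc i) w @ take (Suc i) w)) + contr z (map fl (drop i w @ take i w)))"

text \<open>The part of order \<open>N\<close> of the right side of the loop equation, divided by
  \<open>N\<close>. The word \<open>l # y\<close> occurs in none of its traces any more.\<close>

definition lead :: "'l \<Rightarrow> 'l list \<Rightarrow> 'l list list \<Rightarrow> 'w scalar_seq" where
  "lead l y ws = mean l y * T ws + (\<Sum>j<length ws. spokes (l # y) (ws ! j) * T (remove_nth j ws))"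

lemma map_fl_L: "set w \<subseteq> L \<Longrightarrow> set (map fl w) \<subseteq> L"
  using fl_L by auto

lemma set_take_drop_L: "set w \<subseteq> L \<Longrightarrow> set (take i w) \<subseteq> L \<and> set (drop i w) \<subseteq> L"
  by (meson order.trans set_drop_subset set_take_subset)

lemma mean_R0: "l \<in> L \<Longrightarrow> set y \<subseteq> L \<Longrightarrow> mean l y \<in> R0"
  unfolding mean_def
  by (intro R0_sum contr_R0 map_fl_L) (auto simp: set_take_drop_L dest: in_set_takeD)

lemma spokes_R0: "set z \<subseteq> L \<Longrightarrow> set w \<subseteq> L \<Longrightarrow> spokes z w \<in> R0"
  unfolding spokes_def
  by (intro R0_sum R0_add contr_R0 map_fl_L) (auto dest: in_set_takeD in_set_dropD)

lemma remove_nth_all: "list_all P ws \<Longrightarrow> list_all P (remove_nth j ws)"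
  by (auto simp: remove_nth_def list_all_iff dest: in_set_takeD in_set_dropD)

lemma remove_nth_tot: "j < length ws \<Longrightarrow> tot (remove_nth j ws) + length (ws ! j) = tot ws"
  unfolding remove_nth_def
  by (subst (3) id_take_nth_drop[of j ws]) auto

text \<open>All cuts are made at some letter \<open>m\<close> of a cyclically alternating word.
  Which of the new words alternate depends on the colours that meet at \<open>m\<close> and at the
  ends; they are listed here once for all kinds of cuts.\<close>

lemma calt_split:
  assumes "calt w" "i < length w"
  shows "\<exists>p m q. (w = p @ m # q) \<and>
    (take i w = p) \<and>
    (drop i w = m # q) \<and>
    (take (Suc i) w = p @ [m]) \<and>
    (drop (Suc i) w = q) \<and>
    (w ! i = m) \<and>
    (lalt p) \<and>
    (lalt q) \<and>
    (m \<in> L) \<and>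
    (p \<noteq> [] \<longrightarrow> clr (last p) \<noteq> clr m) \<and>
    (q \<noteq> [] \<longrightarrow> clr m \<noteq> clr (hd q)) \<and>
    (p = [] \<longrightarrow> q \<noteq> [] \<and> clr m \<noteq> clr (last q)) \<and>
    (q = [] \<longrightarrow> p \<noteq> [] \<and> clr (hd p) \<noteq> clr m) \<and>
    (p \<noteq> [] \<and> q \<noteq> [] \<longrightarrow> clr (hd p) \<noteq> clr (last q))"
proof -
  define p m q where "p = take i w" "m = w ! i" "q = drop (Suc i) w"
  have w: "w = p @ m # q" unfolding p_m_q_def by (rule id_take_nth_drop[OF assms(2)])
  have l: "length p = i" using assms by (simp add: p_m_q_def)
  have *: "lalt p" "lalt q" "m \<in> L"
    "p \<noteq> [] \<longrightarrow> clr (last p) \<noteq> clr m" "q \<noteq> [] \<longrightarrow> clr m \<noteq> clr (hd q)"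
    using assms(1) unfolding calt_iff w by (auto simp: lalt_append lalt_Cons)
  have **: "p = [] \<longrightarrow> q \<noteq> [] \<and> clr m \<noteq> clr (last q)"
    "q = [] \<longrightarrow> p \<noteq> [] \<and> clr (hd p) \<noteq> clr m" "p \<noteq> [] \<and> q \<noteq> [] \<longrightarrow> clr (hd p) \<noteq> clr (last q)"
    using assms(1) unfolding calt_iff w by (auto simp: hd_append split: if_splits)
  have "take i w = p" "drop i w = m # q" "take (Suc i) w = p @ [m]" "drop (Suc i) w = q" "w ! i = m"
    using l by (simp_all add: w nth_append)
  then show ?thesis using w * ** by blast
qed

lemma calt_rotate:
  assumes "calt w" shows "calt (drop i w @ take i w)"
proof (cases "i < length w")
  case True
  obtain p m q where pq: "w = p @ m # q" "take i w = p" "drop i w = m # q" "take (Suc i) w = p @ [m]" "drop (Suc i) w = q" "w ! i = m" "lalt p" "lalt q" "m \<in> L" "p \<noteq> [] \<longrightarrow> clr (last p) \<noteq> clr m" "q \<noteq> [] \<longrightarrow> clr m \<noteq> clr (hd q)" "p = [] \<longrightarrow> q \<noteq> [] \<and> clr m \<noteq> clr (last q)" "q = [] \<longrightarrow> p \<noteq> [] \<and> clr (hd p) \<noteq> clr m" "p \<noteq> [] \<and> q \<noteq> [] \<longrightarrow> clr (hd p) \<noteq> clr (last q)"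
    using calt_split[OF assms True] by blast
  show ?thesis unfolding pq(2,3)
    by (cases "p = []"; cases "q = []") (use pq in \<open>auto simp: calt_iff lalt_append lalt_Cons\<close>)
qed (use assms in simp)

lemma mrev_simps: "mrev fl [] = []" "mrev fl (l # w) = mrev fl w @ [fl l]" "mrev fl (u @ v) = mrev fl v @ mrev fl u"
  "length (mrev fl w) = length w" "mrev fl w = [] \<longleftrightarrow> w = []"
  by (simp_all add: mrev_def)

lemma mrev_lalt: "lalt w \<Longrightarrow> lalt (mrev fl w)"
  by (simp add: mrev_def lalt_map_fl)

lemma mrev_hd_last: "w \<noteq> [] \<Longrightarrow> clr (hd (mrev fl w)) = clr (last w)" "w \<noteq> [] \<Longrightarrow> clr (last (mrev fl w)) = clr (hd w)"
  by (simp_all add: mrev_def hd_rev last_rev last_map hd_map clr_fl)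

lemma mrev_calt: "calt w \<Longrightarrow> calt (mrev fl w)"
  by (auto simp: calt_iff mrev_lalt mrev_hd_last mrev_simps)

lemma calt_append:
  assumes "calt z" "calt w" "clr (last z) \<noteq> clr (hd w)" "clr (last w) \<noteq> clr (hd z)"
  shows "calt (z @ w)"
  using assms by (auto simp: calt_iff lalt_append)

lemma mrev_L: "set w \<subseteq> L \<Longrightarrow> set (mrev fl w) \<subseteq> L"
  using map_fl_L by (simp add: mrev_def)

lemma loop_self_V:
  assumes "l \<in> L" "set y \<subseteq> L"
  shows "loop_self clr fl tr l y \<in> V"
proof -
  note td = set_take_drop_L[OF assms(2)]
  show ?thesis unfolding loop_self_def
    by (intro V_mult V_add V_diff V_uminus V_sum tr_moments)
      (simp_all add: assms td mrev_L)
qed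

lemma loop_cross_V:
  assumes "set z \<subseteq> L" "set w \<subseteq> L"
  shows "loop_cross clr fl tr z w \<in> V"
proof -
  note td = set_take_drop_L[OF assms(2)]
  show ?thesis unfolding loop_cross_def
    by (intro V_mult V_add V_diff V_uminus V_sum tr_moments)
      (simp_all add: assms td mrev_L)
qed

lemma rev_lalt_tr:
  assumes u: "lalt u" "lalt v" "u \<noteq> []" "v \<noteq> []" "clr (hd u) = clr (hd v)"
  shows "tr (u @ rev v) - contr u v * tr [] \<in> V1 (length u + length v - 1)"
  using tr_two_lalt(2)[OF assms] tr_rot[of u "rev v"] lalt_L[OF u(1)] lalt_L[OF u(2)] by simp

end

text \<open>The induction step: \<open>n\<close> is the total number of letters. The words of the configurations in
  \<open>confs\<close> are made of all letters of a given configuration and their transposes; the loop equation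
  couples them with coefficients of order \<open>1/N\<close>, up to terms with fewer letters.\<close>

locale loop_step = loop_system Ns M R0 R L clr fl mrg pr tr
  for Ns and M :: "nat \<Rightarrow> 'w measure" and R0 R and L :: "'l set" and clr :: "'l \<Rightarrow> 'i" and fl mrg pr tr +
  fixes n :: nat and a :: "'w scalar_seq" and Al :: "'l set"
  assumes IH: "\<And>m f. m < n \<Longrightarrow> f \<in> VV m \<Longrightarrow> \<exists>c. ((\<lambda>N. E N f) \<longlongrightarrow> c) F"
    and a: "a \<in> R" and fin_Al: "finite Al" and fl_Al: "fl ` Al \<subseteq> Al" and n_pos: "n > 0"
begin

section \<open>Configurations with a fixed number of letters and the error class\<close>

definition confs :: "'l list list set" where
  "confs = {ws. list_all calt ws \<and> list_all (\<lambda>w. set w \<subseteq> Al) ws \<and> tot ws = n}"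

definition total :: "nat \<Rightarrow> real" where
  "total N = (\<Sum>ws\<in>confs. norm (E N (a * T ws)))"

text \<open>Two kinds of terms are errors: words with all \<open>n\<close> letters, whose
  expectation is one of the summands of \<open>total\<close>, and words with fewer letters, whose
  expectations converge by \<open>IH\<close>. That \<open>total\<close> is bounded is not known at
  this stage, so the bound is affine in it.\<close>

definition err :: "'w scalar_seq set" where
  "err = {f \<in> V. \<exists>K\<ge>0. eventually (\<lambda>N. norm (E N f) \<le> K * total N + K) F}"

lemma fin_confs: "finite confs"
proof (rule finite_subset)
  let ?W = "{w. set w \<subseteq> Al \<and> length w \<le> n}"
  have len: "length ws \<le> tot ws" if "list_all calt ws" for ws
    using that
  proof (induction ws)
    case (Cons w ws)
    then have "w \<noteq> []" by (auto simp: calt_iff)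
    then show ?case using Cons by (cases w) auto
  qed simp
  have "length w \<le> tot ws" if "w \<in> set ws" for w and ws :: "'l list list"
    using that by (simp add: member_le_sum_list)
  then show "confs \<subseteq> {ws. set ws \<subseteq> ?W \<and> length ws \<le> n}"
    using len by (auto simp: confs_def list_all_iff)
  show "finite {ws. set ws \<subseteq> ?W \<and> length ws \<le> n}"
    by (intro finite_lists_length_le fin_Al)
qed

lemma total_nonneg: "total N \<ge> 0"
  by (simp add: total_def sum_nonneg)

lemma err_add: assumes "f \<in> err" "g \<in> err" shows "f + g \<in> err"
proof -
  obtain K1 where K1: "f \<in> V" "K1 \<ge> 0" "eventually (\<lambda>N. norm (E N f) \<le> K1 * total N + K1) F"
    using assms(1) by (auto simp: err_def)
  obtain K2 where K2: "g \<in> V" "K2 \<ge> 0" "eventually (\<lambda>N. norm (E N g) \<le> K2 * total N + K2) F"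
    using assms(2) by (auto simp: err_def)
  have "eventually (\<lambda>N. norm (E N (f + g)) \<le> (K1 + K2) * total N + (K1 + K2)) F"
    using K1(3) K2(3) eventually_Ns
  proof eventually_elim
    case (elim N)
    have "norm (E N (f + g)) \<le> norm (E N f) + norm (E N g)"
      using expect_add[OF K1(1) K2(1) elim(3)] norm_triangle_ineq by metis
    then show ?case using elim by (simp add: algebra_simps)
  qed
  then show ?thesis using K1 K2 V_add unfolding err_def by (auto intro!: exI[of _ "K1 + K2"])
qed

lemma err_uminus: "f \<in> err \<Longrightarrow> - f \<in> err"
  by (auto simp: err_def expect_uminus V_uminus)

lemma err_diff: "f \<in> err \<Longrightarrow> g \<in> err \<Longrightarrow> f - g \<in> err"
  using err_add[OF _ err_uminus] by fastforce

lemma err_0: "0 \<in> err"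
  using total_nonneg by (auto simp: err_def V_0 intro!: exI[of _ 0])

lemma err_sum: "(\<And>i. i \<in> I \<Longrightarrow> f i \<in> err) \<Longrightarrow> sum f I \<in> err"
  by (induction I rule: infinite_finite_induct) (auto intro: err_add err_0)

lemma err_conf:
  assumes "ws \<in> confs" shows "a * T ws \<in> err"
proof -
  have "norm (E N (a * T ws)) \<le> 1 * total N + 1" for N
    using member_le_sum[OF assms, of "\<lambda>ws. norm (E N (a * T ws))"] fin_confs by (simp add: total_def)
  moreover have "a * T ws \<in> V" using assms a by (auto simp: confs_def intro: V_mult R_V T_calt_V)
  ultimately show ?thesis unfolding err_def by (auto intro!: exI[of _ 1])
qed

lemma conv_bounded:
  fixes u :: "nat \<Rightarrow> complex"
  assumes "(u \<longlongrightarrow> c) F"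
  shows "eventually (\<lambda>N. norm (u N) \<le> norm c + 1) F"
proof -
  have "((\<lambda>N. norm (u N)) \<longlongrightarrow> norm c) F" using assms by (rule tendsto_norm)
  then have "eventually (\<lambda>N. norm (u N) < norm c + 1) F" by (rule order_tendstoD) simp
  then show ?thesis by eventually_elim simp
qed

lemma err_VV:
  assumes "f \<in> VV m" "m < n" shows "f \<in> err"
proof -
  obtain c where "((\<lambda>N. E N f) \<longlongrightarrow> c) F" using IH assms by blast
  from conv_bounded[OF this] have "eventually (\<lambda>N. norm (E N f) \<le> (norm c + 1) * total N + (norm c + 1)) F"
  proof eventually_elim
    case (elim N)
    have "0 \<le> (norm c + 1) * total N" using total_nonneg by simp
    then show ?case using elim by linarith
  qed
  then show ?thesis using VV_V[OF assms(1)] unfolding err_def by (auto intro!: exI[of _ "norm c + 1"])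
qed

lemma err_V1:
  assumes "f \<in> V1 j" "list_all calt ws" "j + tot ws < n"
  shows "a * (f * T ws) \<in> err"
  using VV_scale[OF a VV_mult[OF V1_VV[OF assms(1)] VV_T[OF assms(2) order.refl]]] assms(3)
  by (rule err_VV)

lemma confs_tail:
  assumes "z # ws \<in> confs"
  shows "calt z" "list_all calt ws" "length z + tot ws = n" "set z \<subseteq> Al" "list_all (\<lambda>w. set w \<subseteq> Al) ws"
  using assms by (auto simp: confs_def)

lemma mrev_Al: "set w \<subseteq> Al \<Longrightarrow> set (mrev fl w) \<subseteq> Al"
  using fl_Al by (auto simp: mrev_def)

text \<open>At a letter \<open>m\<close> of the colour of \<open>l\<close>, with
  \<open>y = p @ m # q\<close>, cutting behind \<open>m\<close> leaves a word that begins and ends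
  with this colour and so loses a letter; cutting in front of \<open>m\<close> gives two cyclically
  alternating words. With the second part transposed the roles are exchanged: cutting behind
  \<open>m\<close> gives a configuration, and cutting in front of \<open>m\<close> gives the
  contraction of order \<open>N\<close> plus terms with fewer letters.\<close>

lemma err_self:
  assumes x: "(l # y) # ws \<in> confs"
  shows "a * T ws * loop_self clr fl tr l y - cseq of_nat * (a * mean l y * T ws) \<in> err"
proof -
  note z = confs_tail[OF x]
  have L: "l \<in> L" "lalt y" "y \<noteq> []" "clr l \<noteq> clr (hd y)" "clr l \<noteq> clr (last y)" "set y \<subseteq> Al" "l \<in> Al"
    using z(1,4) by (cases "y = []"; auto simp: calt_iff lalt_Cons)+
  have n: "n = Suc (length y + tot ws)" using z(3) by simp
  let ?t = "\<lambda>i. tr (l # take (Suc i) y) * tr (drop (Suc i) y) - tr (l # take i y) * tr (drop i y)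
      - tr (l # take (Suc i) y @ mrev fl (drop (Suc i) y)) + tr (l # take i y @ mrev fl (drop i y))"
  let ?c = "\<lambda>i. contr (l # take i y) (map fl (drop i y))"
  let ?I = "{i. i < length y \<and> clr (y ! i) = clr l}"
  have same: "a * T ws * tr w \<in> err" if "calt w" "set w \<subseteq> Al" "length w = Suc (length y)" for w
  proof -
    have "w # ws \<in> confs" unfolding confs_def using that z n by simp
    from err_conf[OF this] show ?thesis by (simp add: mult_ac)
  qed
  \<comment> \<open>A cut at a letter of another colour contributes nothing, since the innermost
    pair of the contraction, \<open>l\<close> and the transpose of \<open>y ! i\<close>, has
    different colours.\<close>
  have "mean l y = (\<Sum>i\<in>?I. ?c i)"
    unfolding mean_def
  proof (rule sum.mono_neutral_right)
    show "\<forall>i\<in>{..<length y} - ?I. ?c i = 0"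
      by (auto simp: Cons_nth_drop_Suc[symmetric] prc_def clr_fl)
  qed auto
  then have "a * T ws * loop_self clr fl tr l y - cseq of_nat * (a * mean l y * T ws) =
      - (a * T ws * tr (l # mrev fl y)) + (\<Sum>i\<in>?I. a * T ws * ?t i - cseq of_nat * (a * ?c i * T ws))"
    by (simp add: loop_self_def sum_distrib_left sum_distrib_right sum_subtractf algebra_simps)
  also have "\<dots> \<in> err"
  proof (intro err_add err_uminus err_sum same)
    show "calt (l # mrev fl y)" using L by (auto simp: calt_iff lalt_Cons mrev_lalt mrev_hd_last mrev_simps)
    show "set (l # mrev fl y) \<subseteq> Al" using L mrev_Al by auto
    show "length (l # mrev fl y) = Suc (length y)" by (simp add: mrev_simps)
  next
    fix i assume i: "i \<in> ?I"
    have "Suc i < length (l # y)" using i by simp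
    then obtain p' m q where pq': "(l # y) = p' @ m # q" "take (Suc i) (l # y) = p'" "drop (Suc i) (l # y) = m # q" "take (Suc (Suc i)) (l # y) = p' @ [m]" "drop (Suc (Suc i)) (l # y) = q" "(l # y) ! (Suc i) = m" "lalt p'" "lalt q" "m \<in> L" "p' \<noteq> [] \<longrightarrow> clr (last p') \<noteq> clr m" "q \<noteq> [] \<longrightarrow> clr m \<noteq> clr (hd q)" "p' = [] \<longrightarrow> q \<noteq> [] \<and> clr m \<noteq> clr (last q)" "q = [] \<longrightarrow> p' \<noteq> [] \<and> clr (hd p') \<noteq> clr m" "p' \<noteq> [] \<and> q \<noteq> [] \<longrightarrow> clr (hd p') \<noteq> clr (last q)"
      using calt_split[OF z(1)] by blast
    define p where "p = take i y"
    have p': "p' = l # p" using pq'(2) by (simp add: p_def)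
    have pq: "y = p @ m # q" "take i y = p" "drop i y = m # q"
      "take (Suc i) y = p @ [m]" "drop (Suc i) y = q" "y ! i = m" "lalt (l # p)" "lalt q" "m \<in> L"
      "clr (last (l # p)) \<noteq> clr m" "q \<noteq> [] \<Longrightarrow> clr m \<noteq> clr (hd q)" "q = [] \<Longrightarrow> clr l \<noteq> clr m" "q \<noteq> [] \<Longrightarrow> clr l \<noteq> clr (last q)"
      using pq' unfolding p' by simp_all
    have ml: "clr m = clr l" using i pq by simp
    have q: "q \<noteq> []" and p: "p \<noteq> []" using pq ml by auto
    have pl: "lalt p" "clr l \<noteq> clr (hd p)" "clr (last p) \<noteq> clr m" using pq p by (auto simp: lalt_Cons)
    have Al: "set p \<subseteq> Al" "set q \<subseteq> Al" "m \<in> Al" "l \<in> Al" using L pq(1) by auto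
    have len: "length y = length p + length q + 1" using pq(1) by simp
    have 1: "a * T ws * (tr (l # p @ [m]) * tr q) \<in> err"
    proof -
      have "lalt (l # p @ [m])" using pq pl p by (auto simp: lalt_Cons lalt_append)
      from tr_lalt(2)[OF this] have "tr (l # p @ [m]) \<in> V1 (length p + 1)" using ml by simp
      moreover have "tr q \<in> V1 (length q)" by (rule tr_lalt(1)[OF pq(8) q])
      ultimately have "tr (l # p @ [m]) * tr q \<in> VV (length p + 1 + length q)" by (intro VV_mult V1_VV)
      from VV_scale[OF a VV_mult[OF this VV_T[OF z(2) order.refl]]]
      have "a * (tr (l # p @ [m]) * tr q * T ws) \<in> err" by (rule err_VV) (simp add: n len)
      then show ?thesis by (simp add: mult_ac)
    qed
    have 2: "a * T ws * (tr (l # p) * tr (m # q)) \<in> err"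
    proof -
      have "calt (l # p)" "calt (m # q)" using pq pl p q ml by (auto simp: calt_iff lalt_Cons)
      then have "(l # p) # (m # q) # ws \<in> confs" unfolding confs_def using z n len Al by simp
      from err_conf[OF this] show ?thesis by (simp add: mult_ac)
    qed
    have 3: "a * T ws * tr (l # (p @ [m]) @ mrev fl q) \<in> err"
    proof (rule same)
      show "calt (l # (p @ [m]) @ mrev fl q)" using pq pl p q ml
        by (auto simp: calt_iff lalt_Cons lalt_append mrev_lalt mrev_hd_last mrev_simps)
    qed (use Al mrev_Al len in \<open>auto simp: mrev_simps\<close>)
    have 4: "a * T ws * (tr (l # p @ mrev fl (m # q)) - contr (l # p) (map fl (m # q)) * tr []) \<in> err"
    proof -
      have lq: "lalt (m # q)" using pq(8,9,11) by (auto simp: lalt_Cons)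
      have "tr ((l # p) @ rev (map fl (m # q))) - contr (l # p) (map fl (m # q)) * tr []
          \<in> V1 (length (l # p) + length (map fl (m # q)) - 1)"
        by (rule rev_lalt_tr) (use pq lq ml in \<open>auto simp: lalt_map_fl[OF lq, simplified] clr_fl\<close>)
      from err_V1[OF this z(2)] show ?thesis by (simp add: mrev_def n len mult_ac)
    qed
    have "a * T ws * ?t i - cseq of_nat * (a * ?c i * T ws) =
        a * T ws * (tr (l # p @ [m]) * tr q) - a * T ws * (tr (l # p) * tr (m # q))
        - a * T ws * tr (l # (p @ [m]) @ mrev fl q)
        + a * T ws * (tr (l # p @ mrev fl (m # q)) - contr (l # p) (map fl (m # q)) * tr [])"
      unfolding pq(2-5) tr_Nil by (simp add: algebra_simps)
    also have "\<dots> \<in> err" by (intro err_add err_diff 1 2 3 4)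
    finally show "a * T ws * ?t i - cseq of_nat * (a * ?c i * T ws) \<in> err" .
  qed
  finally show ?thesis .
qed

text \<open>At a letter of the colour of \<open>hd z\<close>, the rotation of \<open>w\<close> that
  ends with this letter meets its own colour when it is followed by \<open>hd z\<close>, so it is
  contracted or loses a letter. The rotation that begins with this letter fits between the ends of
  \<open>z\<close>, and the result is a configuration. Transposition exchanges the two
  cases.\<close>

lemma err_cross:
  assumes x: "z # ws \<in> confs" and j: "j < length ws"
  shows "a * (T (remove_nth j ws) * loop_cross clr fl tr z (ws ! j))
    - cseq of_nat * (a * (spokes z (ws ! j) * T (remove_nth j ws))) \<in> err"
proof -
  note z = confs_tail[OF x]
  define w vs where "w = ws ! j" "vs = remove_nth j ws"
  have w: "calt w" "set w \<subseteq> Al" using z j by (auto simp: list_all_iff w_vs_def)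
  have vs: "list_all calt vs" "list_all (\<lambda>w. set w \<subseteq> Al) vs" "length z + length w + tot vs = n"
    using z remove_nth_tot[OF j] by (auto simp: remove_nth_all w_vs_def)
  let ?r = "\<lambda>i. drop i w @ take i w"
  let ?t = "\<lambda>i. tr (z @ ?r (Suc i)) - tr (z @ ?r i) - tr (z @ mrev fl (?r (Suc i))) + tr (z @ mrev fl (?r i))"
  let ?c = "\<lambda>i. contr z (rev (?r (Suc i))) + contr z (map fl (?r i))"
  let ?I = "{i. i < length w \<and> clr (w ! i) = clr (hd z)}"
  have zn: "z \<noteq> []" and wn: "w \<noteq> []" using z(1) w(1) by (auto simp: calt_iff)
  have r: "calt (?r i)" for i by (rule calt_rotate[OF w(1)])
  have rA: "set (?r i) \<subseteq> Al" for i using w(2) by (auto dest: in_set_takeD in_set_dropD)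
  have rn: "?r i \<noteq> []" for i using wn by (metis append_is_Nil_conv append_take_drop_id)
  have last_r: "last (?r (Suc i)) = w ! i" if "i < length w" for i
    using that by (simp add: take_Suc_conv_app_nth)
  have hd_r: "hd (?r i) = w ! i" if "i < length w" for i
    using that by (simp add: hd_append hd_drop_conv_nth)
  have same: "a * (T vs * tr (z @ u)) \<in> err"
    if "calt u" "set u \<subseteq> Al" "length u = length w" "clr (last z) \<noteq> clr (hd u)" "clr (last u) \<noteq> clr (hd z)" for u
  proof -
    have "(z @ u) # vs \<in> confs" unfolding confs_def using that z vs calt_append[OF z(1) that(1,4,5)] by simp
    from err_conf[OF this] show ?thesis by (simp add: mult_ac)
  qed
  have low: "a * (T vs * (tr (z @ u) - contr z (rev u) * tr [])) \<in> err"
    if "calt u" "length u = length w" "clr (last u) = clr (hd z)" for u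
  proof -
    have 1: "tr (z @ rev (rev u)) - contr z (rev u) * tr [] \<in> V1 (length z + length (rev u) - 1)"
      by (rule rev_lalt_tr) (use that z(1) in \<open>auto simp: calt_iff hd_rev\<close>)
    have "length z + length (rev u) - 1 + tot vs < n" using vs(3) that zn by (cases z) auto
    from err_V1[OF 1 vs(1) this] show ?thesis by (simp add: mult_ac)
  qed
  have spk: "spokes z w = (\<Sum>i\<in>?I. ?c i)"
    unfolding spokes_def
  proof (rule sum.mono_neutral_right)
    show "\<forall>i\<in>{..<length w} - ?I. ?c i = 0"
    proof
      fix i assume i: "i \<in> {..<length w} - ?I"
      obtain l y where ly: "z = l # y" using zn by (cases z) auto
      obtain m1 u1 where m1: "rev (?r (Suc i)) = m1 # u1" using rn by (metis neq_Nil_conv rev_is_Nil_conv)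
      obtain m2 u2 where m2: "map fl (?r i) = m2 # u2" using rn by (metis neq_Nil_conv map_is_Nil_conv)
      have "m1 = hd (rev (?r (Suc i)))" unfolding m1 by simp
      then have c1: "m1 = w ! i" using last_r i by (simp only: hd_rev) auto
      have "m2 = hd (map fl (?r i))" unfolding m2 by simp
      then have c2: "m2 = fl (w ! i)" using i by (simp add: Cons_nth_drop_Suc[symmetric])
      show "?c i = 0" unfolding m1 m2 unfolding ly using i ly c1 c2 by (simp add: prc_def clr_fl)
    qed
  qed auto
  have "a * (T vs * loop_cross clr fl tr z w) - cseq of_nat * (a * (spokes z w * T vs)) =
      (\<Sum>i\<in>?I. a * (T vs * ?t i) - cseq of_nat * (a * (?c i * T vs)))"
    by (simp only: spk loop_cross_def sum_distrib_left sum_distrib_right sum_subtractf[symmetric])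
  also have "\<dots> \<in> err"
  proof (rule err_sum)
    fix i assume i: "i \<in> ?I"
    then have il: "i < length w" and ic: "clr (w ! i) = clr (hd z)" by auto
    have zc: "clr (hd z) \<noteq> clr (last z)" using z(1) by (simp add: calt_iff)
    have lr: "clr (last (?r i)) \<noteq> clr (hd z)" "clr (hd (?r (Suc i))) \<noteq> clr (hd z)"
      using r[of i] r[of "Suc i"] hd_r[OF il] last_r[OF il] ic by (auto simp: calt_iff simp del: hd_append last_append)
    have 1: "a * (T vs * (tr (z @ ?r (Suc i)) - contr z (rev (?r (Suc i))) * tr [])) \<in> err"
      by (rule low[OF r]) (use last_r[OF il] ic il in \<open>auto simp del: last_append\<close>)
    have 2: "a * (T vs * tr (z @ ?r i)) \<in> err"
      by (rule same[OF r rA]) (use lr hd_r[OF il] ic zc il in \<open>auto simp del: last_append hd_append\<close>)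
    have 3: "a * (T vs * tr (z @ mrev fl (?r (Suc i)))) \<in> err"
      by (rule same[OF mrev_calt[OF r] mrev_Al[OF rA]])
        (use lr last_r[OF il] ic zc il rn[of "Suc i"] in \<open>auto simp: mrev_hd_last mrev_simps(4) simp del: last_append hd_append append_is_Nil_conv\<close>)
    have "a * (T vs * (tr (z @ mrev fl (?r i)) - contr z (rev (mrev fl (?r i))) * tr [])) \<in> err"
      by (rule low[OF mrev_calt[OF r]])
        (use hd_r[OF il] ic il rn[of i] in \<open>auto simp: mrev_hd_last mrev_simps(4) simp del: hd_append append_is_Nil_conv\<close>)
    then have 4: "a * (T vs * (tr (z @ mrev fl (?r i)) - contr z (map fl (?r i)) * tr [])) \<in> err"
      by (simp only: mrev_def rev_rev_ident)
    have "a * (T vs * ?t i) - cseq of_nat * (a * (?c i * T vs)) =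
        a * (T vs * (tr (z @ ?r (Suc i)) - contr z (rev (?r (Suc i))) * tr []))
        - a * (T vs * tr (z @ ?r i)) - a * (T vs * tr (z @ mrev fl (?r (Suc i))))
        + a * (T vs * (tr (z @ mrev fl (?r i)) - contr z (map fl (?r i)) * tr []))"
      unfolding tr_Nil by (simp only: algebra_simps)
    also have "\<dots> \<in> err" by (intro err_add err_diff 1 2 3 4)
    finally show "a * (T vs * ?t i) - cseq of_nat * (a * (?c i * T vs)) \<in> err" .
  qed
  finally show ?thesis unfolding w_vs_def .
qed

text \<open>The letters of the chosen word are gone from every trace in \<open>lead\<close>, so the
  induction hypothesis covers it.\<close>

lemma lead_VV:
  assumes x: "(l # y) # ws \<in> confs"
  shows "lead l y ws \<in> VV (n - 1)"
proof -
  note z = confs_tail[OF x]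
  have L: "l \<in> L" "set y \<subseteq> L" using calt_L[OF z(1)] by auto
  have "mean l y * T ws \<in> VV (n - 1)"
    using mean_R0[OF L] R0_R z(2,3) by (intro VV_scale VV_T) auto
  moreover have "spokes (l # y) (ws ! j) * T (remove_nth j ws) \<in> VV (n - 1)" if j: "j < length ws" for j
  proof -
    have "set (ws ! j) \<subseteq> L" using z(2) j calt_L by (auto simp: list_all_iff)
    then have "spokes (l # y) (ws ! j) \<in> R" using spokes_R0[of "l # y"] L R0_R by auto
    then show ?thesis using remove_nth_all[OF z(2)] remove_nth_tot[OF j] z(3) by (intro VV_scale VV_T) auto
  qed
  ultimately show ?thesis unfolding lead_def by (intro VV_add VV_sum) auto
qed

text \<open>The loop equation up to errors: its right side differs from \<open>N\<close> times
  \<open>lead\<close> by an element of \<open>err\<close>.\<close>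

lemma err_loop:
  assumes x: "(l # y) # ws \<in> confs"
  shows "\<exists>K\<ge>0. eventually (\<lambda>N. norm ((of_nat N - 1) * E N (a * T ((l # y) # ws)) - of_nat N * E N (a * lead l y ws))
    \<le> K * total N + K) F"
proof -
  note z = confs_tail[OF x]
  define A where "A = a * T ws * loop_self clr fl tr l y"
  define A' where "A' = a * mean l y * T ws"
  define B where "B = a * (\<Sum>j<length ws. T (remove_nth j ws) * loop_cross clr fl tr (l # y) (ws ! j))"
  define B' where "B' = a * (\<Sum>j<length ws. spokes (l # y) (ws ! j) * T (remove_nth j ws))"
  have "B - cseq of_nat * B' = (\<Sum>j<length ws. a * (T (remove_nth j ws) * loop_cross clr fl tr (l # y) (ws ! j))
    - cseq of_nat * (a * (spokes (l # y) (ws ! j) * T (remove_nth j ws))))"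
    by (simp add: B_def B'_def sum_distrib_left sum_subtractf)
  also have "\<dots> \<in> err" by (intro err_sum err_cross[OF x]) auto
  finally have eB: "B - cseq of_nat * B' \<in> err" .
  have eA: "A - cseq of_nat * A' \<in> err" unfolding A_def A'_def by (rule err_self[OF x])
  have "a * lead l y ws \<in> V" using VV_V[OF lead_VV[OF x]] R_V[OF a] by (intro V_mult)
  moreover have ld: "a * lead l y ws = A' + B'"
    by (simp add: lead_def A'_def B'_def algebra_simps)
  ultimately have V1: "cseq of_nat * (A' + B') \<in> V" by (intro V_mult V_cseq) simp
  have eAB: "(A - cseq of_nat * A') + (B - cseq of_nat * B') \<in> err" using eA eB by (rule err_add)
  have loop_V: "A \<in> V" "B \<in> V"
  proof -
    have L: "l \<in> L" "set y \<subseteq> L" using calt_L[OF z(1)] by auto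
    show "A \<in> V" unfolding A_def
      by (intro V_mult R_V[OF a] T_calt_V[OF z(2)] loop_self_V L)
    have "set (ws ! j) \<subseteq> L" if "j < length ws" for j using z(2) that calt_L by (auto simp: list_all_iff)
    then show "B \<in> V" unfolding B_def
      by (intro V_mult V_sum R_V[OF a] T_calt_V[OF remove_nth_all[OF z(2)]] loop_cross_V) (use L in auto)
  qed
  obtain K where K: "K \<ge> 0"
    "eventually (\<lambda>N. norm (E N ((A - cseq of_nat * A') + (B - cseq of_nat * B'))) \<le> K * total N + K) F"
    using eAB by (auto simp: err_def)
  have "eventually (\<lambda>N. norm ((of_nat N - 1) * E N (a * T ((l # y) # ws)) - of_nat N * E N (a * lead l y ws))
      \<le> K * total N + K) F"
    using K(2) eventually_Ns
  proof eventually_elim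
    case (elim N)
    have "(of_nat N - 1) * E N (a * T ((l # y) # ws)) = E N A + E N B"
      using loop[OF elim(2) a z(1,2)] by (simp add: A_def B_def mult.assoc)
    also have "\<dots> = E N (A + B)" using expect_add[OF loop_V elim(2)] by simp
    finally have "(of_nat N - 1) * E N (a * T ((l # y) # ws)) - of_nat N * E N (a * lead l y ws)
        = E N (A + B) - E N (cseq of_nat * (A' + B'))"
      by (simp add: ld expect_cseq)
    also have "\<dots> = E N ((A + B) - cseq of_nat * (A' + B'))"
      by (rule expect_diff[symmetric]) (use loop_V V1 V_add elim in auto)
    also have "(A + B) - cseq of_nat * (A' + B') = (A - cseq of_nat * A') + (B - cseq of_nat * B')"
      by (simp add: algebra_simps)
    finally show ?case using elim(1) by simp
  qed
  then show ?thesis using K by blast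
qed

lemma confs_Cons:
  assumes "x \<in> confs" obtains l y ws where "x = (l # y) # ws"
proof -
  obtain z ws where "x = z # ws" using assms n_pos by (cases x) (auto simp: confs_def)
  moreover have "z \<noteq> []" using assms calculation by (auto simp: confs_def calt_iff)
  ultimately show thesis using that by (cases z) auto
qed

lemma lead_conv:
  assumes "(l # y) # ws \<in> confs" shows "\<exists>c. ((\<lambda>N. E N (a * lead l y ws)) \<longlongrightarrow> c) F"
  using IH[of "n - 1"] VV_scale[OF a lead_VV[OF assms]] n_pos by simp

text \<open>For each configuration the loop equation bounds \<open>N\<close> times its expectation
  by a multiple of \<open>total N + N\<close>. Summing over the finitely many configurations gives
  \<open>N * total N \<le> S * total N + S * N\<close>, and for \<open>N \<ge> 2 * S\<close> the
  first term on the right is absorbed into half of the left side.\<close>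

lemma total_bounded: "\<exists>K. eventually (\<lambda>N. total N \<le> K) F"
proof -
  have "\<exists>K\<ge>0. eventually (\<lambda>N. real N * norm (E N (a * T x)) \<le> K * total N + K * real N) F" if x: "x \<in> confs" for x
  proof -
    obtain l y ws where ly: "x = (l # y) # ws" using confs_Cons x by blast
    note x' = x[unfolded ly]
    obtain K where K: "K \<ge> 0" "eventually (\<lambda>N. norm ((of_nat N - 1) * E N (a * T x) - of_nat N * E N (a * lead l y ws))
      \<le> K * total N + K) F" using err_loop[OF x'] unfolding ly by blast
    obtain c where c: "((\<lambda>N. E N (a * lead l y ws)) \<longlongrightarrow> c) F" using lead_conv[OF x'] by blast
    \<comment> \<open>\<open>K\<close> bounds the error, one further \<open>total N\<close> pays for
      replacing \<open>N - 1\<close> by \<open>N\<close>, and \<open>norm c + 1\<close> bounds the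
      expectation of \<open>lead\<close>. One generous constant serves both terms.\<close>
    have "eventually (\<lambda>N. real N * norm (E N (a * T x)) \<le> (K + 2 + norm c) * total N + (K + 2 + norm c) * real N) F"
      using K(2) conv_bounded[OF c] filter_leD[OF F_le eventually_ge_at_top[of 1]]
    proof eventually_elim
      case (elim N)
      have v: "norm (E N (a * T x)) \<le> total N"
        using member_le_sum[OF x, of "\<lambda>ws. norm (E N (a * T ws))"] fin_confs by (simp add: total_def)
      define p q where "p = (of_nat N - 1) * E N (a * T x) - of_nat N * E N (a * lead l y ws)"
        and "q = of_nat N * E N (a * lead l y ws)"
      have "of_nat N * E N (a * T x) = p + E N (a * T x) + q" by (simp add: p_def q_def algebra_simps)
      then have "norm (of_nat N * E N (a * T x)) = norm (p + E N (a * T x) + q)" by (rule arg_cong)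
      then have "norm (of_nat N * E N (a * T x)) \<le> norm p + norm (E N (a * T x)) + norm q"
        using norm_triangle_ineq[of "p + E N (a * T x)" q] norm_triangle_ineq[of p "E N (a * T x)"] by linarith
      moreover have "norm (of_nat N * E N (a * T x)) = real N * norm (E N (a * T x))" by (simp add: norm_mult)
      moreover have "norm q \<le> real N * (norm c + 1)"
        using mult_left_mono[OF elim(2), of "real N"] by (simp add: q_def norm_mult)
      ultimately have "real N * norm (E N (a * T x)) \<le> K * total N + K + total N + (real N * norm c + real N)"
        unfolding distrib_left mult_1_right using elim(1)[folded p_def] v by linarith
      moreover have "K \<le> K * real N" using K(1) elim(3) by (simp add: mult_le_cancel_left1)
      moreover have "0 \<le> norm c * total N" "0 \<le> total N" using total_nonneg[of N] by auto
      ultimately have "real N * norm (E N (a * T x)) \<le>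
          K * total N + 2 * total N + norm c * total N + K * real N + 2 * real N + real N * norm c"
        using of_nat_0_le_iff[of N, where ?'a = real] by linarith
      then show ?case by (simp add: algebra_simps)
    qed
    then show ?thesis using K(1) by (intro exI[of _ "K + 2 + norm c"]) auto
  qed
  then have "\<forall>x\<in>confs. \<exists>K. K \<ge> 0 \<and>
      eventually (\<lambda>N. real N * norm (E N (a * T x)) \<le> K * total N + K * real N) F" by blast
  from bchoice[OF this] obtain K where K: "\<forall>x\<in>confs. K x \<ge> 0 \<and>
      eventually (\<lambda>N. real N * norm (E N (a * T x)) \<le> K x * total N + K x * real N) F" by blast
  define S where "S = (\<Sum>x\<in>confs. K x)"
  have S: "S \<ge> 0" using K by (simp add: S_def sum_nonneg)
  have ev: "eventually (\<lambda>N. \<forall>x\<in>confs. real N * norm (E N (a * T x)) \<le> K x * total N + K x * real N) F"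
    using K fin_confs by (intro eventually_ball_finite) auto
  have "eventually (\<lambda>N. total N \<le> 2 * S) F"
    using ev filter_leD[OF F_le eventually_ge_at_top[of "nat \<lceil>2 * S\<rceil> + 1"]]
  proof eventually_elim
    case (elim N)
    have "real N * total N = (\<Sum>x\<in>confs. real N * norm (E N (a * T x)))"
      by (simp add: total_def sum_distrib_left)
    also have "\<dots> \<le> (\<Sum>x\<in>confs. K x * total N + K x * real N)" using elim by (intro sum_mono) auto
    also have "\<dots> = S * total N + S * real N" by (simp add: S_def sum.distrib sum_distrib_right)
    finally have 1: "real N * total N \<le> S * total N + S * real N" .
    have N: "real N \<ge> 2 * S" "real N > 0" using elim(2) by linarith+
    have "2 * S * total N \<le> real N * total N" by (rule mult_right_mono[OF N(1) total_nonneg])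
    then have "real N * total N \<le> real N * (2 * S)" using 1 by (simp add: mult_ac)
    then show ?case using N(2) by simp
  qed
  then show ?thesis by blast
qed

text \<open>Once \<open>total\<close> is bounded, the difference is of order \<open>1/N\<close>. The
  summand \<open>S\<close> in the constant again accounts for \<open>N\<close> in place of
  \<open>N - 1\<close>.\<close>

lemma conf_lead:
  assumes x: "(l # y) # ws \<in> confs"
  shows "((\<lambda>N. E N (a * T ((l # y) # ws)) - E N (a * lead l y ws)) \<longlongrightarrow> 0) F"
proof -
  obtain K where K: "K \<ge> 0"
    "eventually (\<lambda>N. norm ((of_nat N - 1) * E N (a * T ((l # y) # ws)) - of_nat N * E N (a * lead l y ws)) \<le> K * total N + K) F"
    using err_loop[OF x] by blast
  obtain S where S: "eventually (\<lambda>N. total N \<le> S) F" using total_bounded by blast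
  have "((\<lambda>N::nat. (K * S + K + S) / real N) \<longlongrightarrow> 0) F"
    by (rule tendsto_mono[OF F_le]) (rule lim_const_over_n)
  then show ?thesis
  proof (rule Lim_null_comparison[rotated])
    show "eventually (\<lambda>N. norm (E N (a * T ((l # y) # ws)) - E N (a * lead l y ws)) \<le> (K * S + K + S) / real N) F"
      using K(2) S filter_leD[OF F_le eventually_ge_at_top[of 1]]
    proof eventually_elim
      case (elim N)
      let ?v = "E N (a * T ((l # y) # ws))" and ?w = "E N (a * lead l y ws)"
      have v: "norm ?v \<le> total N"
        using member_le_sum[OF x, of "\<lambda>ws. norm (E N (a * T ws))"] fin_confs by (simp add: total_def)
      have "real N * norm (?v - ?w) = norm (of_nat N * (?v - ?w))" by (simp add: norm_mult)
      also have "of_nat N * (?v - ?w) = ((of_nat N - 1) * ?v - of_nat N * ?w) + ?v" by (simp add: algebra_simps)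
      also have "norm \<dots> \<le> (K * total N + K) + total N"
        using norm_triangle_ineq[of "(of_nat N - 1) * ?v - of_nat N * ?w" ?v] elim v by linarith
      also have "\<dots> \<le> K * S + K + S" using elim(2) mult_left_mono[OF elim(2) K(1)] by linarith
      finally show ?case using elim(3) by (simp add: pos_le_divide_eq mult.commute)
    qed
  qed
qed

end

section \<open>Conclusion of the induction on the number of letters\<close>

context loop_system
begin

text \<open>The letters of \<open>ws\<close> together with their transposes form a finite alphabet
  closed under \<open>fl\<close>, because \<open>fl\<close> is an involution on
  \<open>L\<close>.\<close>

lemma loop_step_interp:
  assumes "list_all calt ws" "tot ws > 0" "b \<in> R"
    and "\<And>m f. m < tot ws \<Longrightarrow> f \<in> VV m \<Longrightarrow> \<exists>c. ((\<lambda>N. E N f) \<longlongrightarrow> c) F"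
  defines "Al \<equiv> \<Union>(set ` set ws) \<union> fl ` \<Union>(set ` set ws)"
  shows "loop_step Ns M R0 R L clr fl mrg pr tr (tot ws) b Al"
    and "ws \<in> loop_step.confs L clr (tot ws) Al"
proof -
  have L: "\<Union>(set ` set ws) \<subseteq> L" using assms(1) calt_L by (auto simp: list_all_iff)
  have ff: "\<And>w x. w \<in> set ws \<Longrightarrow> x \<in> set w \<Longrightarrow> fl (fl x) = x" using L fl_fl by blast
  show *: "loop_step Ns M R0 R L clr fl mrg pr tr (tot ws) b Al"
  proof (intro loop_step.intro loop_system_axioms loop_step_axioms.intro)
    show "fl ` Al \<subseteq> Al" by (auto simp: Al_def ff)
  qed (use assms in \<open>auto simp: Al_def\<close>)
  show "ws \<in> loop_step.confs L clr (tot ws) Al"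
    using assms(1) unfolding loop_step.confs_def[OF *] by (auto simp: list_all_iff Al_def)
qed

text \<open>Without letters the expectation is that of an element of \<open>R\<close>, which
  converges by assumption. Otherwise a product of traces has the same limit as \<open>lead\<close>,
  which has fewer letters.\<close>

theorem VV_conv:
  assumes "f \<in> VV n" shows "\<exists>c. ((\<lambda>N. E N f) \<longlongrightarrow> c) F"
  using assms
proof (induction n arbitrary: f rule: less_induct)
  case (less n)
  have *: "\<exists>c. ((\<lambda>N. E N (b * T ws)) \<longlongrightarrow> c) F" if b: "b \<in> R" "list_all calt ws" "tot ws \<le> n" for b ws
  proof (cases "tot ws = 0")
    case True
    then have "ws = []" using b(2) by (cases ws) (auto simp: calt_iff)
    then show ?thesis using R_conv[OF b(1)] by simp
  next
    case False
    have IH: "\<exists>c. ((\<lambda>N. E N f) \<longlongrightarrow> c) F" if "m < tot ws" "f \<in> VV m" for m f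
      using less.IH[of m f] that b by simp
    have pos: "tot ws > 0" using False by (simp only: neq0_conv)
    interpret S: loop_step Ns M R0 R L clr fl mrg pr tr "tot ws" b "\<Union>(set ` set ws) \<union> fl ` \<Union>(set ` set ws)"
      by (rule loop_step_interp(1)[OF b(2) pos b(1) IH])
    have ws: "ws \<in> S.confs" by (rule loop_step_interp(2)[OF b(2) pos b(1) IH])
    obtain l y vs where x: "ws = (l # y) # vs" using S.confs_Cons[OF ws] by blast
    have "ws = (l # y) # vs \<longrightarrow> (\<exists>c. ((\<lambda>N. E N (b * T ws)) \<longlongrightarrow> c) F)"
    proof
      assume "ws = (l # y) # vs"
      then have ws': "(l # y) # vs \<in> S.confs" using ws by simp
      obtain c where c: "((\<lambda>N. E N (b * lead l y vs)) \<longlongrightarrow> c) F" using S.lead_conv[OF ws'] by blast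
      have "((\<lambda>N. (E N (b * T ((l # y) # vs)) - E N (b * lead l y vs)) + E N (b * lead l y vs)) \<longlongrightarrow> 0 + c) F"
        by (intro tendsto_add S.conf_lead[OF ws'] c)
      then show "\<exists>c. ((\<lambda>N. E N (b * T ws)) \<longlongrightarrow> c) F" using x by auto
    qed
    then show ?thesis using x by blast
  qed
  let ?C = "{f \<in> V. \<exists>c. ((\<lambda>N. E N f) \<longlongrightarrow> c) F}"
  have "f \<in> ?C" using less.prems unfolding VV_def
  proof (rule sumset_closed)
    show "{b * T ws |b ws. b \<in> R \<and> list_all calt ws \<and> tot ws \<le> n} \<subseteq> ?C"
      using * by (auto intro: V_mult R_V T_calt_V)
    show "0 \<in> ?C" by (auto simp: V_0)
    fix f g assume f: "f \<in> ?C" and g: "g \<in> ?C"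
    then obtain c d where cd: "((\<lambda>N. E N f) \<longlongrightarrow> c) F" "((\<lambda>N. E N g) \<longlongrightarrow> d) F" by auto
    have "((\<lambda>N. E N (f + g)) \<longlongrightarrow> c + d) F"
      by (rule Lim_transform_eventually[OF tendsto_add[OF cd]])
        (use eventually_Ns in eventually_elim, use f g expect_add in \<open>metis (no_types, lifting) mem_Collect_eq\<close>)
    then show "f + g \<in> ?C" using f g V_add by auto
  qed
  then show ?case by simp
qed

text \<open>\<open>VV_conv\<close> supplies the induction hypothesis of \<open>loop_step\<close> for
  every number of letters, so its conclusion now holds unconditionally.\<close>

theorem loop_limit:
  assumes "calt (l # y)" "list_all calt ws" "b \<in> R"
  shows "((\<lambda>N. E N (b * T ((l # y) # ws)) - E N (b * lead l y ws)) \<longlongrightarrow> 0) F"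
proof -
  let ?x = "(l # y) # ws"
  have x: "list_all calt ?x" "tot ?x > 0" using assms by simp_all
  interpret S: loop_step Ns M R0 R L clr fl mrg pr tr "tot ?x" b "\<Union>(set ` set ?x) \<union> fl ` \<Union>(set ` set ?x)"
    by (rule loop_step_interp(1)[OF x assms(3) VV_conv])
  have "?x \<in> S.confs" by (rule loop_step_interp(2)[OF x assms(3) VV_conv])
  then show ?thesis by (rule S.conf_lead)
qed

end

section \<open>Haar-distributed orthogonal matrices\<close>

lemma sum_pointwise: "(\<Sum>i\<in>I. f i) x = (\<Sum>i\<in>I. f i x)" for f :: "'i \<Rightarrow> 'a \<Rightarrow> 'b::comm_monoid_add"
  by (induction I rule: infinite_finite_induct) (simp_all add: pointwise)

lemma mat_trace_carrier: "A \<in> carrier_mat N N \<Longrightarrow> mat_trace A = (\<Sum>i<N. A $$ (i, i))"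
  by (simp add: mat_trace_def)

lemma mat_trace_add: "A \<in> carrier_mat N N \<Longrightarrow> B \<in> carrier_mat N N \<Longrightarrow> mat_trace (A + B) = mat_trace A + mat_trace B"
  by (simp add: mat_trace_def sum.distrib)

lemma mat_trace_minus: "A \<in> carrier_mat N N \<Longrightarrow> B \<in> carrier_mat N N \<Longrightarrow> mat_trace (A - B) = mat_trace A - mat_trace B"
  by (simp add: mat_trace_def sum_subtractf)

lemma mat_trace_smult: "mat_trace (c \<cdot>\<^sub>m A) = c * mat_trace A" if "A \<in> carrier_mat N N"
  using that by (simp add: mat_trace_def sum_distrib_left)

lemma mat_mult_entry:
  "A \<in> carrier_mat N N \<Longrightarrow> B \<in> carrier_mat N N \<Longrightarrow> i < N \<Longrightarrow> j < N \<Longrightarrow> (A * B) $$ (i, j) = (\<Sum>k<N. A $$ (i, k) * B $$ (k, j))"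
  by (auto simp: scalar_prod_def atLeast0LessThan intro!: sum.cong)

lemma mat_trace_mult: "A \<in> carrier_mat N N \<Longrightarrow> B \<in> carrier_mat N N \<Longrightarrow>
    mat_trace (A * B) = (\<Sum>i<N. \<Sum>k<N. A $$ (i, k) * B $$ (k, i))"
  by (subst mat_trace_carrier[of _ N]) (auto simp: mat_mult_entry simp del: index_mult_mat)

lemma mat_trace_comm: "A \<in> carrier_mat N N \<Longrightarrow> B \<in> carrier_mat N N \<Longrightarrow> mat_trace (A * B) = mat_trace (B * A)"
  by (simp only: mat_trace_mult) (subst sum.swap, simp add: mult.commute)

lemma mat_trace_transpose: "A \<in> carrier_mat N N \<Longrightarrow> mat_trace (transpose_mat A) = mat_trace A"
  by (simp add: mat_trace_def)

lemma mat_trace_one: "mat_trace (1\<^sub>m N) = of_nat N"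
  by (simp add: mat_trace_def)

text \<open>The generator of the rotations in the plane of the coordinates \<open>a\<close> and
  \<open>b\<close>. It is zero for \<open>a = b\<close>, so sums may run over all ordered
  pairs.\<close>

definition skew :: "nat \<Rightarrow> nat \<Rightarrow> nat \<Rightarrow> complex mat" where
  "skew N a b = mat N N (\<lambda>(i, j). (if i = a \<and> j = b then 1 else 0) - (if i = b \<and> j = a then 1 else 0))"

lemma skew_carrier [simp]: "skew N a b \<in> carrier_mat N N" by (simp add: skew_def)

lemma skew_entry:
  assumes P: "P \<in> carrier_mat N N" and Q: "Q \<in> carrier_mat N N" and "a < N" "b < N" "i < N" "j < N"
  shows "(P * skew N a b * Q) $$ (i, j) = P $$ (i, a) * Q $$ (b, j) - P $$ (i, b) * Q $$ (a, j)"
proof -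
  have e: "(P * skew N a b) $$ (i, k) = (if k = b then P $$ (i, a) else 0) - (if k = a then P $$ (i, b) else 0)" if "k < N" for k
  proof -
    have "(P * skew N a b) $$ (i, k) = (\<Sum>l<N. (if l = a then (if k = b then P $$ (i, l) else 0) else 0)
        - (if l = b then (if k = a then P $$ (i, l) else 0) else 0))"
      using assms that by (subst mat_mult_entry) (auto simp: skew_def intro!: sum.cong)
    then show ?thesis using assms by (simp add: sum_subtractf sum.delta)
  qed
  have "(P * skew N a b * Q) $$ (i, j) = (\<Sum>k<N. (if k = b then P $$ (i, a) * Q $$ (k, j) else 0)
      - (if k = a then P $$ (i, b) * Q $$ (k, j) else 0))"
    using assms by (subst mat_mult_entry[of _ N]) (auto simp: e algebra_simps simp del: index_mult_mat intro!: sum.cong)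
  then show ?thesis using assms by (simp add: sum_subtractf sum.delta)
qed

text \<open>One half of the generator yields \<open>P $$ (a, a) * Q $$ (b, b)\<close>, which splits
  a trace into two; the other half yields \<open>P $$ (a, b) * Q $$ (a, b)\<close>, a single trace
  with a transposed factor. This is where the transposes originate, and with them the second sum in
  real second-order freeness.\<close>

lemma sum_skew_diag:
  assumes P: "P \<in> carrier_mat N N" and Q: "Q \<in> carrier_mat N N"
  shows "(\<Sum>a<N. \<Sum>b<N. (P * skew N a b * Q) $$ (a, b)) = mat_trace P * mat_trace Q - mat_trace (P * transpose_mat Q)"
proof -
  have "(\<Sum>a<N. \<Sum>b<N. (P * skew N a b * Q) $$ (a, b)) =
      (\<Sum>a<N. \<Sum>b<N. P $$ (a, a) * Q $$ (b, b) - P $$ (a, b) * Q $$ (a, b))"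
    by (intro sum.cong refl skew_entry assms) auto
  also have "\<dots> = mat_trace P * mat_trace Q - mat_trace (P * transpose_mat Q)"
    using Q by (subst mat_trace_mult[OF P]) (auto simp: mat_trace_carrier[OF P] mat_trace_carrier[OF Q] sum_subtractf sum_product)
  finally show ?thesis .
qed

text \<open>The counterpart for a derivative that falls on another trace: its indices are tied to
  the open indices of \<open>Z\<close>, which joins two traces into one, directly or with a
  transposition.\<close>

lemma sum_skew_trace:
  assumes P: "P \<in> carrier_mat N N" and Q: "Q \<in> carrier_mat N N" and Z: "Z \<in> carrier_mat N N"
  shows "(\<Sum>a<N. \<Sum>b<N. Z $$ (a, b) * mat_trace (P * skew N a b * Q)) =
    mat_trace (Z * (Q * P)) - mat_trace (Z * transpose_mat (Q * P))"
proof -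
  have QP: "Q * P \<in> carrier_mat N N" using P Q by simp
  have "mat_trace (P * skew N a b * Q) = (Q * P) $$ (b, a) - (Q * P) $$ (a, b)" if "a < N" "b < N" for a b
  proof -
    have "P * skew N a b * Q \<in> carrier_mat N N" using P Q by (metis mult_carrier_mat skew_carrier)
    then have "mat_trace (P * skew N a b * Q) = (\<Sum>i<N. P $$ (i, a) * Q $$ (b, i) - P $$ (i, b) * Q $$ (a, i))"
      using that by (subst mat_trace_carrier) (auto intro!: sum.cong skew_entry P Q simp del: index_mult_mat)
    then show ?thesis using P Q that
      by (simp add: mat_mult_entry sum_subtractf mult.commute del: index_mult_mat)
  qed
  then have "(\<Sum>a<N. \<Sum>b<N. Z $$ (a, b) * mat_trace (P * skew N a b * Q)) =
      (\<Sum>a<N. \<Sum>b<N. Z $$ (a, b) * ((Q * P) $$ (b, a) - (Q * P) $$ (a, b)))"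
    by (intro sum.cong) auto
  also have "\<dots> = mat_trace (Z * (Q * P)) - mat_trace (Z * transpose_mat (Q * P))"
    using mat_trace_mult[OF Z QP] mat_trace_mult[OF Z, of "transpose_mat (Q * P)"] QP
    by (simp add: right_diff_distrib sum_subtractf index_transpose_mat(1)[of _ "Q * P"] del: index_mult_mat)
  finally show ?thesis .
qed

text \<open>The identity for \<open>a = b\<close>, in accordance with the vanishing of
  \<open>skew N a a\<close>. The signs are chosen such that the derivative at 0 is
  \<open>skew N a b\<close>.\<close>

definition rot :: "nat \<Rightarrow> nat \<Rightarrow> nat \<Rightarrow> real \<Rightarrow> real mat" where
  "rot N a b \<theta> = (if a = b then 1\<^sub>m N else mat N N (\<lambda>(i, j).
     if j = a then (if i = a then cos \<theta> else if i = b then - sin \<theta> else 0)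
     else if j = b then (if i = a then sin \<theta> else if i = b then cos \<theta> else 0)
     else if i = j then 1 else 0))"

lemma rot_carrier [simp]: "rot N a b \<theta> \<in> carrier_mat N N" by (simp add: rot_def)

lemma rot_0: "rot N a b 0 = 1\<^sub>m N"
  by (auto simp: rot_def intro!: eq_matI)

lemma rot_orthogonal:
  assumes "a < N" "b < N" shows "rot N a b \<theta> \<in> orthogonal_group_mat N"
proof (cases "a = b")
  case False
  let ?R = "rot N a b \<theta>"
  have two: "(\<Sum>k<N. (if k = a then x else if k = b then y else 0) * g k) = x * g a + y * g b" for x y :: real and g
  proof -
    have "(\<Sum>k<N. (if k = a then x else if k = b then y else 0) * g k) =
        (\<Sum>k<N. (if k = a then x * g k else 0) + (if k = b then y * g k else 0))"
      using False by (intro sum.cong) auto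
    then show ?thesis using assms by (simp add: sum.distrib sum.delta)
  qed
  have e: "?R $$ (i, j) = (if j = a then (if i = a then cos \<theta> else if i = b then - sin \<theta> else 0)
     else if j = b then (if i = a then sin \<theta> else if i = b then cos \<theta> else 0)
     else if i = j then 1 else 0)" if "i < N" "j < N" for i j
    using that False by (simp add: rot_def)
  have sc: "cos \<theta> * cos \<theta> + sin \<theta> * sin \<theta> = 1" "sin \<theta> * sin \<theta> + cos \<theta> * cos \<theta> = 1"
    using sin_cos_squared_add2[of \<theta>] sin_cos_squared_add[of \<theta>] by (simp_all add: power2_eq_square)
  have "transpose_mat ?R * ?R = 1\<^sub>m N"
  proof (rule eq_matI)
    fix i j assume ij: "i < dim_row (1\<^sub>m N)" "j < dim_col (1\<^sub>m N)"
    then have ij: "i < N" "j < N" by auto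
    have "(transpose_mat ?R * ?R) $$ (i, j) = (\<Sum>k<N. ?R $$ (k, i) * ?R $$ (k, j))"
      using ij by (subst mat_mult_entry[of _ N]) (auto simp: rot_def)
    also have "\<dots> = (1\<^sub>m N) $$ (i, j)"
    proof (cases "i = a \<or> i = b")
      case True
      then have "(\<Sum>k<N. ?R $$ (k, i) * ?R $$ (k, j)) = (\<Sum>k<N. (if k = a then ?R $$ (a, i) else if k = b then ?R $$ (b, i) else 0) * ?R $$ (k, j))"
        using ij assms by (intro sum.cong) (auto simp: e)
      also have "\<dots> = ?R $$ (a, i) * ?R $$ (a, j) + ?R $$ (b, i) * ?R $$ (b, j)" by (rule two)
      also have "\<dots> = (if i = j then 1 else 0)"
        unfolding e[OF assms(1) ij(1)] e[OF assms(1) ij(2)] e[OF assms(2) ij(1)] e[OF assms(2) ij(2)]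
        using True False sc by (cases "i = a"; cases "j = a"; cases "j = b") (simp_all add: mult.commute)
      also have "\<dots> = (1\<^sub>m N) $$ (i, j)" using ij by simp
      finally show ?thesis .
    next
      case nab: False
      then have "(\<Sum>k<N. ?R $$ (k, i) * ?R $$ (k, j)) = (\<Sum>k<N. if k = i then ?R $$ (k, j) else 0)"
        using ij by (intro sum.cong) (auto simp: e)
      also have "\<dots> = ?R $$ (i, j)" using ij by simp
      also have "\<dots> = (if i = j then 1 else 0)" unfolding e[OF ij] using nab by (cases "j = a"; cases "j = b") simp_all
      also have "\<dots> = (1\<^sub>m N) $$ (i, j)" using ij by simp
      finally show ?thesis .
    qed
    finally show "(transpose_mat ?R * ?R) $$ (i, j) = (1\<^sub>m N) $$ (i, j)" .
  qed (auto simp: rot_def)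
  then show ?thesis by (simp add: orthogonal_group_mat_def)
qed (simp add: rot_def orthogonal_group_mat_def)

lemma rot_deriv:
  assumes "a < N" "b < N" "i < N" "j < N"
  shows "((\<lambda>\<theta>. complex_of_real (rot N a b \<theta> $$ (i, j))) has_vector_derivative skew N a b $$ (i, j)) (at 0)"
proof -
  have 1: "((\<lambda>\<theta>. complex_of_real (cos \<theta>)) has_vector_derivative 0) (at 0)"
    by (auto intro!: derivative_eq_intros)
  have 2: "((\<lambda>\<theta>. complex_of_real (sin \<theta>)) has_vector_derivative 1) (at 0)"
    by (auto intro!: derivative_eq_intros)
  have 3: "((\<lambda>\<theta>. - complex_of_real (sin \<theta>)) has_vector_derivative - 1) (at 0)"
    by (auto intro!: derivative_eq_intros)
  show ?thesis
  proof (cases "a = b")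
    case True
    then show ?thesis using assms by (simp add: rot_def skew_def)
  next
    case False
    then show ?thesis using assms 1 2 3
      by (cases "j = a"; cases "i = a"; cases "j = b"; cases "i = b") (simp_all add: rot_def skew_def)
  qed
qed

section \<open>Entrywise derivatives of matrix-valued functions at the angle 0\<close>

definition mat_deriv :: "nat \<Rightarrow> (real \<Rightarrow> complex mat) \<Rightarrow> complex mat \<Rightarrow> bool" where
  "mat_deriv N F F' \<longleftrightarrow> (\<forall>\<theta>. F \<theta> \<in> carrier_mat N N) \<and> F' \<in> carrier_mat N N \<and>
     (\<forall>i<N. \<forall>j<N. ((\<lambda>\<theta>. F \<theta> $$ (i, j)) has_vector_derivative F' $$ (i, j)) (at 0))"

lemma mat_deriv_const: "A \<in> carrier_mat N N \<Longrightarrow> mat_deriv N (\<lambda>_. A) (0\<^sub>m N N)"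
  by (auto simp: mat_deriv_def)

lemma mat_deriv_transpose: "mat_deriv N F F' \<Longrightarrow> mat_deriv N (\<lambda>\<theta>. transpose_mat (F \<theta>)) (transpose_mat F')"
  unfolding mat_deriv_def
proof (intro conjI allI impI; elim conjE)
  fix i j assume *: "\<forall>\<theta>. F \<theta> \<in> carrier_mat N N" "F' \<in> carrier_mat N N" "i < N" "j < N"
    "\<forall>i<N. \<forall>j<N. ((\<lambda>\<theta>. F \<theta> $$ (i, j)) has_vector_derivative F' $$ (i, j)) (at 0)"
  have "transpose_mat (F \<theta>) $$ (i, j) = F \<theta> $$ (j, i)" "transpose_mat F' $$ (i, j) = F' $$ (j, i)" for \<theta>
    using *(2-4) *(1)[rule_format, of \<theta>] by auto
  then show "((\<lambda>\<theta>. transpose_mat (F \<theta>) $$ (i, j)) has_vector_derivative transpose_mat F' $$ (i, j)) (at 0)"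
    using * by simp
qed auto

lemma mat_deriv_mult:
  assumes "mat_deriv N F F'" "mat_deriv N G G'"
  shows "mat_deriv N (\<lambda>\<theta>. F \<theta> * G \<theta>) (F' * G 0 + F 0 * G')"
  unfolding mat_deriv_def
proof (intro conjI allI impI)
  have c: "F \<theta> \<in> carrier_mat N N" "G \<theta> \<in> carrier_mat N N" "F' \<in> carrier_mat N N" "G' \<in> carrier_mat N N" for \<theta>
    using assms by (auto simp: mat_deriv_def)
  show "F \<theta> * G \<theta> \<in> carrier_mat N N" "F' * G 0 + F 0 * G' \<in> carrier_mat N N" for \<theta>
    by (intro add_carrier_mat mult_carrier_mat[of _ N N] c)+
  fix i j assume ij: "i < N" "j < N"
  have "((\<lambda>\<theta>. \<Sum>k<N. F \<theta> $$ (i, k) * G \<theta> $$ (k, j)) has_vector_derivative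
      (\<Sum>k<N. F 0 $$ (i, k) * G' $$ (k, j) + F' $$ (i, k) * G 0 $$ (k, j))) (at 0)"
    using assms ij by (intro has_vector_derivative_sum has_vector_derivative_mult) (auto simp: mat_deriv_def)
  moreover have "(F' * G 0 + F 0 * G') $$ (i, j) = (\<Sum>k<N. F 0 $$ (i, k) * G' $$ (k, j) + F' $$ (i, k) * G 0 $$ (k, j))"
  proof -
    have "F 0 * G' \<in> carrier_mat N N" by (intro mult_carrier_mat[of _ N N] c)
    then have "(F' * G 0 + F 0 * G') $$ (i, j) = (F' * G 0) $$ (i, j) + (F 0 * G') $$ (i, j)"
      using ij by (intro index_add_mat(1)) auto
    then show ?thesis using c ij by (simp add: mat_mult_entry[of _ N] sum.distrib del: index_mult_mat(1))
  qed
  ultimately show "((\<lambda>\<theta>. (F \<theta> * G \<theta>) $$ (i, j)) has_vector_derivative (F' * G 0 + F 0 * G') $$ (i, j)) (at 0)"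
    using c ij by (simp add: mat_mult_entry[of _ N] del: index_mult_mat(1))
qed

lemma mat_deriv_trace:
  assumes "mat_deriv N F F'" shows "((\<lambda>\<theta>. mat_trace (F \<theta>)) has_vector_derivative mat_trace F') (at 0)"
proof -
  have c: "F \<theta> \<in> carrier_mat N N" "F' \<in> carrier_mat N N" for \<theta> using assms by (auto simp: mat_deriv_def)
  show ?thesis unfolding mat_trace_carrier[OF c(1)] mat_trace_carrier[OF c(2)]
    using assms by (intro has_vector_derivative_sum) (auto simp: mat_deriv_def)
qed

text \<open>One Haar matrix \<open>Y\<close> in one dimension. \<open>H\<close> carries everything
  independent of \<open>Y\<close>, which later includes the Haar matrices of the other colours, and
  \<open>GY\<close> carries \<open>Y\<close> itself; independence enters as the factorization of
  expectations. Orthogonality is asked for at every point, so that identities between words hold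
  pointwise.\<close>

locale haar_step = prob_space P for P :: "'w measure" +
  fixes N :: nat and Y :: "'w \<Rightarrow> real mat" and H GY :: "'w measure"
  assumes haar: "haar_orthogonal P N Y" and Y_orth: "Y \<omega> \<in> orthogonal_group_mat N"
    and space_H: "space H = space P" and sets_H: "sets H \<subseteq> sets P"
    and Y_GY: "i < N \<Longrightarrow> j < N \<Longrightarrow> (\<lambda>\<omega>. complex_of_real (Y \<omega> $$ (i, j))) \<in> borel_measurable GY"
    and indep: "g \<in> borel_measurable H \<Longrightarrow> h \<in> borel_measurable GY \<Longrightarrow> integrable P g \<Longrightarrow> integrable P h \<Longrightarrow>
      (\<integral>\<omega>. g \<omega> * h \<omega> \<partial>P) = (\<integral>\<omega>. g \<omega> \<partial>P) * (\<integral>\<omega>. h \<omega> \<partial>P :: complex)"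
begin

lemma Y_carrier [simp]: "Y \<omega> \<in> carrier_mat N N" and YtY: "transpose_mat (Y \<omega>) * Y \<omega> = 1\<^sub>m N"
  using Y_orth[of \<omega>] by (auto simp: orthogonal_group_mat_def)

lemma Y_le_1:
  assumes "i < N" "j < N" shows "\<bar>Y \<omega> $$ (i, j)\<bar> \<le> 1"
proof -
  have "(transpose_mat (Y \<omega>) * Y \<omega>) $$ (j, j) = (\<Sum>k<N. Y \<omega> $$ (k, j) * Y \<omega> $$ (k, j))"
    using assms carrier_matD[OF Y_carrier[of \<omega>]] by (subst mat_mult_entry[of _ N]) auto
  then have "(\<Sum>k<N. (Y \<omega> $$ (k, j))\<^sup>2) = 1" using assms by (simp add: YtY power2_eq_square)
  moreover have "(Y \<omega> $$ (i, j))\<^sup>2 \<le> (\<Sum>k<N. (Y \<omega> $$ (k, j))\<^sup>2)"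
    using assms by (intro member_le_sum) auto
  ultimately show ?thesis by (simp add: abs_square_le_1)
qed

lemma Y_measurable [measurable]: "i < N \<Longrightarrow> j < N \<Longrightarrow> (\<lambda>\<omega>. Y \<omega> $$ (i, j)) \<in> borel_measurable P"
  using haar by (simp add: haar_orthogonal_def)

definition Yc :: "nat \<Rightarrow> nat \<Rightarrow> 'w \<Rightarrow> complex" where "Yc i j \<omega> = complex_of_real (Y \<omega> $$ (i, j))"

lemma Yc_moments: "i < N \<Longrightarrow> j < N \<Longrightarrow> Yc i j \<in> all_moments P"
  by (rule all_moments_bounded[where B = 1]) (auto simp: Yc_def[abs_def] Y_le_1)

definition mom :: "nat \<Rightarrow> (nat \<Rightarrow> nat) \<Rightarrow> (nat \<Rightarrow> nat) \<Rightarrow> complex" where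
  "mom d i j = (\<integral>\<omega>. (\<Prod>l<d. Yc (i l) (j l) \<omega>) \<partial>P)"

lemma prod_moments: "(\<And>l. l \<in> A \<Longrightarrow> f l \<in> all_moments P) \<Longrightarrow> (\<lambda>\<omega>. \<Prod>l\<in>A. f l \<omega>) \<in> all_moments P"
  by (induction A rule: infinite_finite_induct) (auto intro: all_moments_mult all_moments_const)

lemma integral_law:
  assumes Z: "\<And>i j. i < N \<Longrightarrow> j < N \<Longrightarrow> (\<lambda>\<omega>. Z \<omega> $$ (i, j)) \<in> borel_measurable P"
    and ij: "\<And>l. l < d \<Longrightarrow> i l < N \<and> j l < N"
  shows "(\<integral>x. (\<Prod>l<d. complex_of_real (x (i l, j l))) \<partial>matrix_law P N Z) = (\<integral>\<omega>. (\<Prod>l<d. complex_of_real (Z \<omega> $$ (i l, j l))) \<partial>P)"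
proof -
  let ?I = "{..<N} \<times> {..<N}"
  have "(\<lambda>\<omega>. \<lambda>ij\<in>?I. Z \<omega> $$ ij) \<in> measurable P (Pi\<^sub>M ?I (\<lambda>_. borel))"
    by (intro measurable_restrict) (use Z in auto)
  moreover have "(\<lambda>x. \<Prod>l<d. complex_of_real (x (i l, j l))) \<in> borel_measurable (Pi\<^sub>M ?I (\<lambda>_. borel))"
    using ij by (intro borel_measurable_prod measurable_compose[OF measurable_component_singleton]) auto
  ultimately show ?thesis unfolding matrix_law_def
    by (subst integral_distr) (use ij in \<open>auto intro!: Bochner_Integration.integral_cong prod.cong\<close>)
qed

lemma left_invariant:
  assumes R: "R \<in> orthogonal_group_mat N" and ij: "\<And>l. l < d \<Longrightarrow> i l < N \<and> j l < N"
  shows "(\<integral>\<omega>. (\<Prod>l<d. complex_of_real ((R * Y \<omega>) $$ (i l, j l))) \<partial>P) = mom d i j"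
proof -
  have Rc: "R \<in> carrier_mat N N" using R by (simp add: orthogonal_group_mat_def)
  have "(\<lambda>\<omega>. (R * Y \<omega>) $$ (i, j)) \<in> borel_measurable P" if "i < N" "j < N" for i j
    using that by (simp add: mat_mult_entry[OF Rc Y_carrier] del: index_mult_mat)
  note 1 = integral_law[where Z = "\<lambda>\<omega>. R * Y \<omega>" and d = d and i = i and j = j, OF this ij]
  note 2 = integral_law[where Z = Y and d = d and i = i and j = j, OF Y_measurable ij]
  have "matrix_law P N (\<lambda>\<omega>. R * Y \<omega>) = matrix_law P N Y" using haar R by (simp add: haar_orthogonal_def)
  then show ?thesis using 1 2 unfolding mom_def Yc_def by simp
qed

lemma expand_moment:
  assumes ij: "\<And>l. l < d \<Longrightarrow> i l < N"
  shows "(\<integral>\<omega>. (\<Prod>l<d. \<Sum>k<N. c l k * Yc k (i l) \<omega>) \<partial>P) = (\<Sum>g\<in>PiE {..<d} (\<lambda>_. {..<N}). (\<Prod>l<d. c l (g l)) * mom d g i)"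
    and "(\<integral>\<omega>. (\<Prod>l<d. \<Sum>k<N. c l k * Yc (i l) k \<omega>) \<partial>P) = (\<Sum>g\<in>PiE {..<d} (\<lambda>_. {..<N}). (\<Prod>l<d. c l (g l)) * mom d i g)"
proof -
  have "integrable P (\<lambda>\<omega>. (\<Prod>l<d. c l (g l)) * (\<Prod>l<d. Yc (g l) (i l) \<omega>))"
    "integrable P (\<lambda>\<omega>. (\<Prod>l<d. c l (g l)) * (\<Prod>l<d. Yc (i l) (g l) \<omega>))"
    if "g \<in> PiE {..<d} (\<lambda>_. {..<N})" for g
    using that ij by (auto intro!: all_moments_integrable all_moments_mult all_moments_const prod_moments Yc_moments)
  then show "(\<integral>\<omega>. (\<Prod>l<d. \<Sum>k<N. c l k * Yc k (i l) \<omega>) \<partial>P) = (\<Sum>g\<in>PiE {..<d} (\<lambda>_. {..<N}). (\<Prod>l<d. c l (g l)) * mom d g i)"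
    "(\<integral>\<omega>. (\<Prod>l<d. \<Sum>k<N. c l k * Yc (i l) k \<omega>) \<partial>P) = (\<Sum>g\<in>PiE {..<d} (\<lambda>_. {..<N}). (\<Prod>l<d. c l (g l)) * mom d i g)"
    unfolding mom_def by (simp_all add: prod_sum_PiE prod.distrib)
qed

text \<open>Left invariance under an independent copy expresses the moments of \<open>Y\<close> by a sum that is
  symmetric under transposition; hence right invariance.\<close>

lemma mom_transpose:
  assumes ij: "\<And>l. l < d \<Longrightarrow> i l < N \<and> j l < N" shows "mom d i j = mom d j i"
proof -
  have key: "mom d i j = (\<Sum>g\<in>PiE {..<d} (\<lambda>_. {..<N}). mom d g i * mom d g j)"
    if ij: "\<And>l. l < d \<Longrightarrow> i l < N \<and> j l < N" for i j
  proof -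
    \<comment> \<open>With \<open>\<omega>\<close> frozen, \<open>transpose_mat (Y \<omega>)\<close>
      is a fixed orthogonal matrix and left invariance applies to it. Integrating over
      \<open>\<omega>\<close> afterwards is what makes it an independent copy, without a product
      space.\<close>
    have "mom d i j = (\<Sum>g\<in>PiE {..<d} (\<lambda>_. {..<N}). (\<Prod>l<d. Yc (g l) (i l) \<omega>) * mom d g j)" for \<omega>
    proof -
      have "transpose_mat (Y \<omega>) \<in> orthogonal_group_mat N"
        using mat_mult_left_right_inverse[OF _ Y_carrier YtY] by (auto simp: orthogonal_group_mat_def)
      from left_invariant[OF this ij]
      have "mom d i j = (\<integral>\<omega>'. (\<Prod>l<d. complex_of_real ((transpose_mat (Y \<omega>) * Y \<omega>') $$ (i l, j l))) \<partial>P)" by simp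
      also have "\<dots> = (\<integral>\<omega>'. (\<Prod>l<d. \<Sum>k<N. Yc k (i l) \<omega> * Yc k (j l) \<omega>') \<partial>P)"
        using ij carrier_matD[OF Y_carrier[of \<omega>]]
        by (intro Bochner_Integration.integral_cong refl prod.cong) (subst mat_mult_entry[of _ N], auto simp: Yc_def)
      finally show ?thesis using expand_moment(1)[of d j "\<lambda>l k. Yc k (i l) \<omega>"] ij by simp
    qed
    then have "(\<integral>\<omega>. mom d i j \<partial>P) = (\<integral>\<omega>. (\<Sum>g\<in>PiE {..<d} (\<lambda>_. {..<N}). (\<Prod>l<d. Yc (g l) (i l) \<omega>) * mom d g j) \<partial>P)"
      by (intro Bochner_Integration.integral_cong refl)
    also have "\<dots> = (\<Sum>g\<in>PiE {..<d} (\<lambda>_. {..<N}). mom d g i * mom d g j)"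
      using ij by (subst Bochner_Integration.integral_sum)
        (auto simp: mom_def intro!: all_moments_integrable all_moments_mult all_moments_const prod_moments Yc_moments)
    finally show ?thesis by (simp add: prob_space)
  qed
  show ?thesis using key[of i j] key[of j i] ij by (simp add: mult.commute)
qed

text \<open>Transposing the moments turns multiplication by \<open>R\<close> from the right into
  multiplication by its transpose from the left. Invariance from the right is what the conjugation
  \<open>transpose_mat Y * X * Y\<close> calls for, while \<open>haar_orthogonal\<close> provides
  invariance from the left.\<close>

lemma right_invariant:
  assumes R: "R \<in> orthogonal_group_mat N" and ij: "\<And>l. l < d \<Longrightarrow> i l < N \<and> j l < N"
  shows "(\<integral>\<omega>. (\<Prod>l<d. complex_of_real ((Y \<omega> * R) $$ (i l, j l))) \<partial>P) = mom d i j"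
proof -
  have Rc: "R \<in> carrier_mat N N" using R by (simp add: orthogonal_group_mat_def)
  have Rt: "transpose_mat R \<in> orthogonal_group_mat N"
    using R mat_mult_left_right_inverse[of "transpose_mat R" N R] by (auto simp: orthogonal_group_mat_def)
  let ?G = "PiE {..<d} (\<lambda>_. {..<N})"
  have "(\<integral>\<omega>. (\<Prod>l<d. complex_of_real ((Y \<omega> * R) $$ (i l, j l))) \<partial>P) =
      (\<integral>\<omega>. (\<Prod>l<d. \<Sum>k<N. complex_of_real (R $$ (k, j l)) * Yc (i l) k \<omega>) \<partial>P)"
    using ij Rc by (intro Bochner_Integration.integral_cong refl prod.cong)
      (subst mat_mult_entry[of _ N], auto simp: Yc_def mult.commute)
  also have "\<dots> = (\<Sum>g\<in>?G. (\<Prod>l<d. complex_of_real (R $$ (g l, j l))) * mom d i g)"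
    using ij by (intro expand_moment) auto
  also have "\<dots> = (\<Sum>g\<in>?G. (\<Prod>l<d. complex_of_real (R $$ (g l, j l))) * mom d g i)"
    using ij by (intro sum.cong refl arg_cong2[where f = "(*)"] mom_transpose) auto
  also have "\<dots> = (\<integral>\<omega>. (\<Prod>l<d. \<Sum>k<N. complex_of_real (R $$ (k, j l)) * Yc k (i l) \<omega>) \<partial>P)"
    using ij by (intro expand_moment[symmetric]) auto
  also have "\<dots> = (\<integral>\<omega>. (\<Prod>l<d. complex_of_real ((transpose_mat R * Y \<omega>) $$ (j l, i l))) \<partial>P)"
    using ij Rc by (intro Bochner_Integration.integral_cong refl prod.cong)
      (subst mat_mult_entry[of _ N], auto simp: Yc_def)
  also have "\<dots> = mom d j i" using ij by (intro left_invariant Rt) auto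
  also have "\<dots> = mom d i j" using ij by (intro mom_transpose) auto
  finally show ?thesis .
qed

section \<open>Polynomials in the entries of a Haar matrix and their derivatives along
  rotations\<close>

definition H_moments :: "('w \<Rightarrow> complex) set" where
  "H_moments = {g \<in> all_moments P. g \<in> borel_measurable H}"

lemma H_moments_mult: "f \<in> H_moments \<Longrightarrow> g \<in> H_moments \<Longrightarrow> (\<lambda>\<omega>. f \<omega> * g \<omega>) \<in> H_moments"
  by (auto simp: H_moments_def intro: all_moments_mult)

lemma H_moments_const: "(\<lambda>\<omega>. c) \<in> H_moments"
  by (auto simp: H_moments_def intro: all_moments_const)

text \<open>Monomials in the entries of \<open>U\<close>. The matrix is an argument separate from
  the sample point, so that it can be rotated while the coefficients stay fixed.\<close>

definition poly_gen :: "(real mat \<Rightarrow> 'w \<Rightarrow> complex) set" where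
  "poly_gen = {\<lambda>U \<omega>. g \<omega> * (\<Prod>ij\<leftarrow>js. complex_of_real (U $$ ij)) | g js.
     g \<in> H_moments \<and> set js \<subseteq> {..<N} \<times> {..<N}}"

definition is_poly :: "(real mat \<Rightarrow> 'w \<Rightarrow> complex) \<Rightarrow> bool" where
  "is_poly f \<longleftrightarrow> (\<exists>p\<in>sumset poly_gen. \<forall>U\<in>carrier_mat N N. \<forall>\<omega>. f U \<omega> = p U \<omega>)"

lemma is_poly_cong: "is_poly f \<Longrightarrow> (\<And>U \<omega>. U \<in> carrier_mat N N \<Longrightarrow> f U \<omega> = g U \<omega>) \<Longrightarrow> is_poly g"
  by (auto simp: is_poly_def)

lemma is_poly_const: "g \<in> H_moments \<Longrightarrow> is_poly (\<lambda>U. g)"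
  unfolding is_poly_def poly_gen_def
  by (rule bexI[of _ "\<lambda>U. g"], simp, rule sumset_base, clarsimp) (rule exI[of _ g], rule exI[of _ "[]"], simp)

lemma is_poly_entry: "i < N \<Longrightarrow> j < N \<Longrightarrow> is_poly (\<lambda>U \<omega>. complex_of_real (U $$ (i, j)))"
  unfolding is_poly_def poly_gen_def
  by (rule bexI[of _ "\<lambda>U \<omega>. complex_of_real (U $$ (i, j))"], simp, rule sumset_base, clarsimp)
    (rule exI[of _ "\<lambda>_. 1"], rule exI[of _ "[(i, j)]"], simp add: H_moments_const)

lemma is_poly_add:
  assumes "is_poly f" "is_poly g" shows "is_poly (\<lambda>U \<omega>. f U \<omega> + g U \<omega>)"
proof -
  obtain p q where "p \<in> sumset poly_gen" "q \<in> sumset poly_gen" "\<forall>U\<in>carrier_mat N N. \<forall>\<omega>. f U \<omega> = p U \<omega>" "\<forall>U\<in>carrier_mat N N. \<forall>\<omega>. g U \<omega> = q U \<omega>"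
    using assms by (auto simp: is_poly_def)
  then show ?thesis unfolding is_poly_def by (intro bexI[of _ "p + q"] sumset_add) (auto simp: pointwise)
qed

lemma is_poly_mult:
  assumes "is_poly f" "is_poly g" shows "is_poly (\<lambda>U \<omega>. f U \<omega> * g U \<omega>)"
proof -
  obtain p q where pq: "p \<in> sumset poly_gen" "q \<in> sumset poly_gen" "\<forall>U\<in>carrier_mat N N. \<forall>\<omega>. f U \<omega> = p U \<omega>" "\<forall>U\<in>carrier_mat N N. \<forall>\<omega>. g U \<omega> = q U \<omega>"
    using assms by (auto simp: is_poly_def)
  have "p * q \<in> sumset poly_gen" using pq(1,2)
  proof (rule sumset_mult)
    fix a b assume "a \<in> poly_gen" "b \<in> poly_gen"
    then obtain g js h ks where *: "a = (\<lambda>U \<omega>. g \<omega> * (\<Prod>ij\<leftarrow>js. complex_of_real (U $$ ij)))"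
      "b = (\<lambda>U \<omega>. h \<omega> * (\<Prod>ij\<leftarrow>ks. complex_of_real (U $$ ij)))"
      "g \<in> H_moments" "h \<in> H_moments" "set js \<subseteq> {..<N} \<times> {..<N}" "set ks \<subseteq> {..<N} \<times> {..<N}"
      by (auto simp: poly_gen_def)
    have "a * b = (\<lambda>U \<omega>. (g \<omega> * h \<omega>) * (\<Prod>ij\<leftarrow>js @ ks. complex_of_real (U $$ ij)))"
      by (simp add: * fun_eq_iff pointwise mult_ac)
    moreover have "(\<lambda>\<omega>. g \<omega> * h \<omega>) \<in> H_moments" "set (js @ ks) \<subseteq> {..<N} \<times> {..<N}" using * H_moments_mult by auto
    ultimately show "a * b \<in> sumset poly_gen" unfolding poly_gen_def
      by (intro sumset_base CollectI exI[of _ "\<lambda>\<omega>. g \<omega> * h \<omega>"] exI[of _ "js @ ks"] conjI)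
  qed
  then show ?thesis using pq unfolding is_poly_def by (intro bexI[of _ "p * q"]) (auto simp: pointwise)
qed

lemma is_poly_sum: "(\<And>i. i \<in> I \<Longrightarrow> is_poly (f i)) \<Longrightarrow> is_poly (\<lambda>U \<omega>. \<Sum>i\<in>I. f i U \<omega>)"
  by (induction I rule: infinite_finite_induct) (auto intro: is_poly_add is_poly_const H_moments_const)

lemma is_poly_prod_list: "(\<And>w. w \<in> set ws \<Longrightarrow> is_poly (f w)) \<Longrightarrow> is_poly (\<lambda>U \<omega>. \<Prod>w\<leftarrow>ws. f w U \<omega>)"
  by (induction ws) (auto intro: is_poly_mult is_poly_const H_moments_const)

text \<open>Functions of the angle times random variables. For finite sums of these, differentiation
  under the integral is mere linearity and no domination argument arises.\<close>

definition diff_gen :: "(real \<Rightarrow> 'w \<Rightarrow> complex) set" where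
  "diff_gen = {\<lambda>\<theta> \<omega>. p \<theta> * g \<omega> | p g. (\<exists>p'. (p has_vector_derivative p') (at 0)) \<and> g \<in> all_moments P}"

lemma diff_gen_mult: "F \<in> sumset diff_gen \<Longrightarrow> G \<in> sumset diff_gen \<Longrightarrow> F * G \<in> sumset diff_gen"
proof (erule sumset_mult, assumption)
  fix a b assume "a \<in> diff_gen" "b \<in> diff_gen"
  then obtain p g p' q h q' where *: "a = (\<lambda>\<theta> \<omega>. p \<theta> * g \<omega>)" "b = (\<lambda>\<theta> \<omega>. q \<theta> * h \<omega>)"
    "(p has_vector_derivative p') (at 0)" "(q has_vector_derivative q') (at 0)" "g \<in> all_moments P" "h \<in> all_moments P"
    by (auto simp: diff_gen_def)
  have "a * b = (\<lambda>\<theta> \<omega>. (p \<theta> * q \<theta>) * (g \<omega> * h \<omega>))" by (simp add: * fun_eq_iff pointwise mult_ac)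
  then show "a * b \<in> sumset diff_gen"
    using has_vector_derivative_mult[OF *(3,4)] all_moments_mult[OF *(5,6)]
    unfolding diff_gen_def
    by (intro sumset_base CollectI exI[of _ "\<lambda>\<theta>. p \<theta> * q \<theta>"] exI[of _ "\<lambda>\<omega>. g \<omega> * h \<omega>"] conjI) auto
qed

lemma diff_gen_deriv:
  assumes "F \<in> sumset diff_gen"
  shows "\<exists>F'. F' \<in> all_moments P \<and> (\<forall>\<omega>. ((\<lambda>\<theta>. F \<theta> \<omega>) has_vector_derivative F' \<omega>) (at 0)) \<and>
    (\<forall>\<theta>. F \<theta> \<in> all_moments P) \<and> ((\<lambda>\<theta>. \<integral>\<omega>. F \<theta> \<omega> \<partial>P) has_vector_derivative (\<integral>\<omega>. F' \<omega> \<partial>P)) (at 0)"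
  using assms
proof induction
  case zero
  then show ?case by (intro exI[of _ "\<lambda>_. 0"]) (auto simp: pointwise zero_fun_def all_moments_const)
next
  case (plus x y)
  obtain p g p' where x: "x = (\<lambda>\<theta> \<omega>. p \<theta> * g \<omega>)" "(p has_vector_derivative p') (at 0)" "g \<in> all_moments P"
    using plus(1) by (auto simp: diff_gen_def)
  obtain F' where F': "F' \<in> all_moments P" "\<And>\<omega>. ((\<lambda>\<theta>. y \<theta> \<omega>) has_vector_derivative F' \<omega>) (at 0)"
    "\<And>\<theta>. y \<theta> \<in> all_moments P" "((\<lambda>\<theta>. \<integral>\<omega>. y \<theta> \<omega> \<partial>P) has_vector_derivative (\<integral>\<omega>. F' \<omega> \<partial>P)) (at 0)"
    using plus(3) by auto
  have x1: "(\<lambda>\<omega>. p' * g \<omega>) \<in> all_moments P" "\<And>\<theta>. x \<theta> \<in> all_moments P"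
    unfolding x(1) by (intro all_moments_mult all_moments_const x(3) finite_measure_axioms)+
  have x2: "((\<lambda>\<theta>. x \<theta> \<omega>) has_vector_derivative p' * g \<omega>) (at 0)" for \<omega>
    unfolding x(1) by (rule has_vector_derivative_mult_left[OF x(2)])
  have "(\<integral>\<omega>. x \<theta> \<omega> + y \<theta> \<omega> \<partial>P) = p \<theta> * (\<integral>\<omega>. g \<omega> \<partial>P) + (\<integral>\<omega>. y \<theta> \<omega> \<partial>P)" for \<theta>
    using x1(2)[THEN all_moments_integrable] F'(3)[THEN all_moments_integrable] by (simp add: x(1))
  moreover have "(\<integral>\<omega>. p' * g \<omega> + F' \<omega> \<partial>P) = p' * (\<integral>\<omega>. g \<omega> \<partial>P) + (\<integral>\<omega>. F' \<omega> \<partial>P)"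
    using x1(1)[THEN all_moments_integrable] F'(1)[THEN all_moments_integrable] by simp
  moreover have "((\<lambda>\<theta>. p \<theta> * (\<integral>\<omega>. g \<omega> \<partial>P) + (\<integral>\<omega>. y \<theta> \<omega> \<partial>P)) has_vector_derivative
      p' * (\<integral>\<omega>. g \<omega> \<partial>P) + (\<integral>\<omega>. F' \<omega> \<partial>P)) (at 0)"
    by (intro has_vector_derivative_add has_vector_derivative_mult_left x(2) F'(4))
  ultimately show ?case
    using x1 x2 F' by (intro exI[of _ "\<lambda>\<omega>. p' * g \<omega> + F' \<omega>"])
      (auto simp: pointwise plus_fun_def intro!: all_moments_add has_vector_derivative_add)
qed

text \<open>An entry of \<open>Y * rot\<close> is a finite sum of entries of \<open>Y\<close> with
  coefficients depending on the angle, and \<open>diff_gen_mult\<close> passes to monomials.\<close>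

lemma diff_gen_rot:
  assumes p: "p \<in> sumset poly_gen" and ab: "a < N" "b < N"
  shows "(\<lambda>\<theta> \<omega>. p (Y \<omega> * rot N a b \<theta>) \<omega>) \<in> sumset diff_gen"
  using p
proof induction
  case zero
  then show ?case using sumset.zero[of diff_gen] by (simp add: pointwise zero_fun_def)
next
  case (plus x y)
  have entry: "(\<lambda>\<theta> \<omega>. complex_of_real ((Y \<omega> * rot N a b \<theta>) $$ (i, j))) \<in> sumset diff_gen" if "i < N" "j < N" for i j
  proof -
    have "(\<lambda>\<theta> \<omega>. complex_of_real ((Y \<omega> * rot N a b \<theta>) $$ (i, j))) =
        (\<Sum>k<N. (\<lambda>\<theta> \<omega>. complex_of_real (rot N a b \<theta> $$ (k, j)) * Yc i k \<omega>))"
      using that by (simp add: fun_eq_iff sum_pointwise mat_mult_entry[of _ N] Yc_def mult.commute del: index_mult_mat)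
    also have "\<dots> \<in> sumset diff_gen"
    proof (intro sumset_sum sumset_base)
      fix k assume "k \<in> {..<N}"
      then show "(\<lambda>\<theta> \<omega>. complex_of_real (rot N a b \<theta> $$ (k, j)) * Yc i k \<omega>) \<in> diff_gen"
        using that rot_deriv[OF ab, of k j] Yc_moments[of i k] unfolding diff_gen_def
        by (intro CollectI exI[of _ "\<lambda>\<theta>. complex_of_real (rot N a b \<theta> $$ (k, j))"] exI[of _ "Yc i k"] conjI) auto
    qed
    finally show ?thesis .
  qed
  obtain g js where x: "x = (\<lambda>U \<omega>. g \<omega> * (\<Prod>ij\<leftarrow>js. complex_of_real (U $$ ij)))" "g \<in> H_moments" "set js \<subseteq> {..<N} \<times> {..<N}"
    using plus(1) by (auto simp: poly_gen_def)
  have "(\<lambda>\<theta> \<omega>. g \<omega> * (\<Prod>ij\<leftarrow>js. complex_of_real ((Y \<omega> * rot N a b \<theta>) $$ ij))) \<in> sumset diff_gen"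
    using x(3)
  proof (induction js)
    case Nil
    have "(\<lambda>\<theta> \<omega>. 1 * g \<omega>) \<in> diff_gen" using x(2) unfolding diff_gen_def H_moments_def
      by (intro CollectI exI[of _ "\<lambda>_. 1"] exI[of _ g] exI[of _ 0] conjI) auto
    then show ?case by (auto intro: sumset_base)
  next
    case (Cons ij js)
    obtain i j where ij: "ij = (i, j)" "i < N" "j < N" using Cons(2) by auto
    have "(\<lambda>\<theta> \<omega>. complex_of_real ((Y \<omega> * rot N a b \<theta>) $$ (i, j))) *
      (\<lambda>\<theta> \<omega>. g \<omega> * (\<Prod>ij\<leftarrow>js. complex_of_real ((Y \<omega> * rot N a b \<theta>) $$ ij))) \<in> sumset diff_gen"
      by (rule diff_gen_mult[OF entry[OF ij(2,3)] Cons.IH]) (use Cons(2) in auto)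
    then show ?case by (simp add: times_fun_def ij(1) mult_ac del: index_mult_mat)
  qed
  from sumset_add[OF this plus(3)] show ?case by (simp add: x(1) pointwise plus_fun_def del: index_mult_mat)
qed

text \<open>Each term is a coefficient independent of \<open>Y\<close> times a monomial in the
  entries: the expectation of the coefficient factors out, and right invariance applies to the
  moment that remains.\<close>

lemma poly_invariant:
  assumes p: "p \<in> sumset poly_gen" and ab: "a < N" "b < N"
  shows "(\<integral>\<omega>. p (Y \<omega> * rot N a b \<theta>) \<omega> \<partial>P) = (\<integral>\<omega>. p (Y \<omega>) \<omega> \<partial>P)"
  using p
proof induction
  case zero
  then show ?case by (simp add: pointwise)
next
  case (plus x y)
  obtain g js where x: "x = (\<lambda>U \<omega>. g \<omega> * (\<Prod>ij\<leftarrow>js. complex_of_real (U $$ ij)))" "g \<in> H_moments" "set js \<subseteq> {..<N} \<times> {..<N}"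
    using plus(1) by (auto simp: poly_gen_def)
  define d i j where "d = length js" and "i l = fst (js ! l)" and "j l = snd (js ! l)" for l
  have ij: "i l < N \<and> j l < N" if "l < d" for l
  proof -
    have "js ! l \<in> {..<N} \<times> {..<N}" using x(3) that nth_mem[of l js] by (auto simp: d_def simp del: nth_mem)
    then show ?thesis by (cases "js ! l") (simp add: i_def j_def)
  qed
  have pl: "(\<Prod>ij\<leftarrow>js. f ij) = (\<Prod>l<d. f (i l, j l))" for f :: "nat \<times> nat \<Rightarrow> complex"
    by (simp add: prod.list_conv_set_nth d_def i_def j_def case_prod_beta atLeast0LessThan)
  have *: "(\<integral>\<omega>. x (Y \<omega> * R) \<omega> \<partial>P) = (\<integral>\<omega>. g \<omega> \<partial>P) * mom d i j" if R: "R \<in> orthogonal_group_mat N" for R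
  proof -
    have Rc: "R \<in> carrier_mat N N" using R by (simp add: orthogonal_group_mat_def)
    have e: "complex_of_real ((Y \<omega> * R) $$ (i l, j l)) = (\<Sum>k<N. Yc (i l) k \<omega> * complex_of_real (R $$ (k, j l)))" if "l < d" for l \<omega>
      using ij[OF that] Rc by (simp add: mat_mult_entry[of _ N] Yc_def del: index_mult_mat)
    have m: "(\<lambda>\<omega>. \<Prod>l<d. complex_of_real ((Y \<omega> * R) $$ (i l, j l))) \<in> all_moments P"
      using ij by (intro prod_moments) (auto simp: e intro!: all_moments_sum all_moments_mult Yc_moments all_moments_const finite_measure_axioms simp del: index_mult_mat)
    have G: "(\<lambda>\<omega>. \<Prod>l<d. complex_of_real ((Y \<omega> * R) $$ (i l, j l))) \<in> borel_measurable GY"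
      using ij Y_GY by (intro borel_measurable_prod) (auto simp: e Yc_def simp del: index_mult_mat)
    show ?thesis unfolding x(1) pl
      using x(2) right_invariant[OF R ij] indep[OF _ G _ all_moments_integrable[OF m]]
      by (simp add: H_moments_def all_moments_integrable del: index_mult_mat)
  qed
  have Id: "1\<^sub>m N \<in> orthogonal_group_mat N" by (simp add: orthogonal_group_mat_def)
  have dg: "(\<lambda>\<theta> \<omega>. p (Y \<omega> * rot N a b \<theta>) \<omega>) \<in> sumset diff_gen" if "p \<in> sumset poly_gen" for p
    by (rule diff_gen_rot[OF that ab])
  have int: "integrable P (\<lambda>\<omega>. p (Y \<omega> * rot N a b \<theta>) \<omega>)" if "p \<in> sumset poly_gen" for p \<theta>
    using diff_gen_deriv[OF dg[OF that]] by (auto intro: all_moments_integrable)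
  have int0: "integrable P (\<lambda>\<omega>. p (Y \<omega>) \<omega>)" if "p \<in> sumset poly_gen" for p
    using int[OF that, of 0] by (simp add: rot_0 right_mult_one_mat[OF Y_carrier])
  have xs: "x \<in> sumset poly_gen" using plus(1) by (rule sumset_base)
  have "(\<integral>\<omega>. x (Y \<omega> * rot N a b \<theta>) \<omega> \<partial>P) = (\<integral>\<omega>. x (Y \<omega>) \<omega> \<partial>P)"
    using *[OF rot_orthogonal[OF ab]] *[OF Id] by (simp add: right_mult_one_mat[OF Y_carrier])
  then show ?case using plus(3) int[OF xs] int[OF plus(2)] int0[OF xs] int0[OF plus(2)]
    by (simp add: pointwise)
qed

text \<open>By invariance the expectation is constant in the angle; its derivative is the
  expectation of the derivative and therefore zero.\<close>

lemma poly_deriv: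
  assumes f: "is_poly f" and ab: "a < N" "b < N"
    and D: "\<And>\<omega>. ((\<lambda>\<theta>. f (Y \<omega> * rot N a b \<theta>) \<omega>) has_vector_derivative D \<omega>) (at 0)"
  shows "D \<in> all_moments P" "(\<integral>\<omega>. D \<omega> \<partial>P) = 0"
proof -
  obtain p where p: "p \<in> sumset poly_gen" "\<forall>U\<in>carrier_mat N N. \<forall>\<omega>. f U \<omega> = p U \<omega>"
    using f by (auto simp: is_poly_def)
  have fp: "f (Y \<omega> * rot N a b \<theta>) \<omega> = p (Y \<omega> * rot N a b \<theta>) \<omega>" for \<theta> \<omega>
    using p(2) mult_carrier_mat[OF Y_carrier rot_carrier] by blast
  obtain F' where F': "F' \<in> all_moments P" "\<And>\<omega>. ((\<lambda>\<theta>. p (Y \<omega> * rot N a b \<theta>) \<omega>) has_vector_derivative F' \<omega>) (at 0)"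
    "((\<lambda>\<theta>. \<integral>\<omega>. p (Y \<omega> * rot N a b \<theta>) \<omega> \<partial>P) has_vector_derivative (\<integral>\<omega>. F' \<omega> \<partial>P)) (at 0)"
    using diff_gen_deriv[OF diff_gen_rot[OF p(1) ab]] by blast
  have "D \<omega> = F' \<omega>" for \<omega>
    using vector_derivative_unique_at[OF D[of \<omega>, unfolded fp] F'(2)[of \<omega>]] .
  then have DF: "D = F'" by auto
  have "((\<lambda>\<theta>::real. \<integral>\<omega>. p (Y \<omega>) \<omega> \<partial>P) has_vector_derivative (\<integral>\<omega>. F' \<omega> \<partial>P)) (at 0)"
    using F'(3) by (simp only: poly_invariant[OF p(1) ab])
  then have "(\<integral>\<omega>. F' \<omega> \<partial>P) = 0" using vector_derivative_unique_at has_vector_derivative_const by blast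
  then show "D \<in> all_moments P" "(\<integral>\<omega>. D \<omega> \<partial>P) = 0" using F'(1) by (simp_all add: DF)
qed

subsection \<open>The loop equation in fixed dimension\<close>

text \<open>The flag marks the letters conjugated by the matrix under consideration. The others are
  coefficients, built from what is independent of that matrix.\<close>

definition letter :: "real mat \<Rightarrow> 'w \<Rightarrow> bool \<times> ('w \<Rightarrow> complex mat) \<Rightarrow> complex mat" where
  "letter U \<omega> l = (if fst l then transpose_mat (map_mat complex_of_real U) * snd l \<omega> * map_mat complex_of_real U else snd l \<omega>)"

definition word :: "real mat \<Rightarrow> 'w \<Rightarrow> (bool \<times> ('w \<Rightarrow> complex mat)) list \<Rightarrow> complex mat" where
  "word U \<omega> w = foldr (\<lambda>l A. letter U \<omega> l * A) w (1\<^sub>m N)"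

definition good :: "bool \<times> ('w \<Rightarrow> complex mat) \<Rightarrow> bool" where
  "good l \<longleftrightarrow> (\<forall>\<omega>. snd l \<omega> \<in> carrier_mat N N) \<and> (\<forall>i<N. \<forall>j<N. (\<lambda>\<omega>. snd l \<omega> $$ (i, j)) \<in> H_moments)"

definition flip :: "bool \<times> ('w \<Rightarrow> complex mat) \<Rightarrow> bool \<times> ('w \<Rightarrow> complex mat)" where
  "flip l = (fst l, \<lambda>\<omega>. transpose_mat (snd l \<omega>))"

lemma letter_carrier: "good l \<Longrightarrow> U \<in> carrier_mat N N \<Longrightarrow> letter U \<omega> l \<in> carrier_mat N N"
  unfolding letter_def good_def by (auto intro!: mult_carrier_mat[of _ N N])

lemma word_simps: "word U \<omega> [] = 1\<^sub>m N" "word U \<omega> (l # w) = letter U \<omega> l * word U \<omega> w"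
  by (simp_all add: word_def)

lemma word_carrier: "list_all good w \<Longrightarrow> U \<in> carrier_mat N N \<Longrightarrow> word U \<omega> w \<in> carrier_mat N N"
  by (induction w) (auto simp: word_simps intro!: mult_carrier_mat[of _ N N] letter_carrier)

lemma word_append:
  assumes "list_all good u" "list_all good v" "U \<in> carrier_mat N N"
  shows "word U \<omega> (u @ v) = word U \<omega> u * word U \<omega> v"
  using assms(1)
proof (induction u)
  case Nil
  then show ?case using left_mult_one_mat[OF word_carrier[OF assms(2,3)]] by (simp add: word_simps)
next
  case (Cons l u)
  then show ?case using letter_carrier[of l U] word_carrier[of u U] word_carrier[of v U] assms
    by (simp add: word_simps assoc_mult_mat[of _ N N _ N _ N])
qed

lemma good_flip: "good l \<Longrightarrow> good (flip l)"
proof -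
  assume l: "good l"
  then have c: "snd l \<omega> \<in> carrier_mat N N" for \<omega> by (simp add: good_def)
  have "(\<lambda>\<omega>. transpose_mat (snd l \<omega>) $$ (i, j)) = (\<lambda>\<omega>. snd l \<omega> $$ (j, i))" if "i < N" "j < N" for i j
    using that carrier_matD[OF c] by (intro ext) simp
  then show ?thesis using l by (auto simp: good_def flip_def)
qed

lemma letter_flip: "good l \<Longrightarrow> U \<in> carrier_mat N N \<Longrightarrow> letter U \<omega> (flip l) = transpose_mat (letter U \<omega> l)"
proof -
  assume l: "good l" and U: "U \<in> carrier_mat N N"
  let ?U = "map_mat complex_of_real U"
  have c: "?U \<in> carrier_mat N N" "snd l \<omega> \<in> carrier_mat N N" "transpose_mat ?U \<in> carrier_mat N N"
    using l U by (auto simp: good_def)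
  have "transpose_mat (transpose_mat ?U * snd l \<omega> * ?U) = transpose_mat ?U * transpose_mat (transpose_mat ?U * snd l \<omega>)"
    by (rule transpose_mult[of _ N N _ N]) (use c in auto)
  also have "transpose_mat (transpose_mat ?U * snd l \<omega>) = transpose_mat (snd l \<omega>) * ?U"
    by (subst transpose_mult[of _ N N _ N]) (use c in auto)
  also have "transpose_mat ?U * (transpose_mat (snd l \<omega>) * ?U) = transpose_mat ?U * transpose_mat (snd l \<omega>) * ?U"
    by (rule assoc_mult_mat[symmetric, of _ N N _ N _ N]) (use c in auto)
  finally show ?thesis by (simp add: letter_def flip_def)
qed

lemma word_mrev:
  assumes "list_all good w" "U \<in> carrier_mat N N"
  shows "word U \<omega> (mrev flip w) = transpose_mat (word U \<omega> w)"
  using assms(1)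
proof (induction w)
  case (Cons l w)
  have c: "letter U \<omega> l \<in> carrier_mat N N" "word U \<omega> w \<in> carrier_mat N N" "word U \<omega> (mrev flip w) \<in> carrier_mat N N"
    using Cons assms letter_carrier word_carrier by auto
  have "list_all good (mrev flip w)" using Cons by (auto simp: mrev_def list_all_iff good_flip)
  then have "word U \<omega> (mrev flip (l # w)) = word U \<omega> (mrev flip w) * word U \<omega> [flip l]"
    using Cons assms by (simp add: mrev_def word_append good_flip)
  also have "word U \<omega> [flip l] = transpose_mat (letter U \<omega> l)"
    using Cons c assms by (simp add: word_simps letter_flip right_mult_one_mat[of _ N])
  finally show ?case using Cons c by (simp add: word_simps transpose_mult[of _ N N _ N])
qed (simp add: mrev_def word_simps)

lemma is_poly_matmult:
  assumes "\<And>U \<omega>. U \<in> carrier_mat N N \<Longrightarrow> A U \<omega> \<in> carrier_mat N N \<and> B U \<omega> \<in> carrier_mat N N"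
    and "\<And>i j. i < N \<Longrightarrow> j < N \<Longrightarrow> is_poly (\<lambda>U \<omega>. A U \<omega> $$ (i, j))" "\<And>i j. i < N \<Longrightarrow> j < N \<Longrightarrow> is_poly (\<lambda>U \<omega>. B U \<omega> $$ (i, j))"
    and "i < N" "j < N"
  shows "is_poly (\<lambda>U \<omega>. (A U \<omega> * B U \<omega>) $$ (i, j))"
proof (rule is_poly_cong)
  show "is_poly (\<lambda>U \<omega>. \<Sum>k<N. A U \<omega> $$ (i, k) * B U \<omega> $$ (k, j))"
    using assms(2-5) by (intro is_poly_sum is_poly_mult) auto
  show "(\<Sum>k<N. A U \<omega> $$ (i, k) * B U \<omega> $$ (k, j)) = (A U \<omega> * B U \<omega>) $$ (i, j)" if "U \<in> carrier_mat N N" for U \<omega>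
    using assms(1)[OF that] assms(4,5) by (subst mat_mult_entry[of _ N]) auto
qed

lemma is_poly_letter:
  assumes "good l" "i < N" "j < N" shows "is_poly (\<lambda>U \<omega>. letter U \<omega> l $$ (i, j))"
proof (cases "fst l")
  case False
  then show ?thesis using assms by (simp add: letter_def good_def is_poly_const)
next
  case True
  have X: "snd l \<omega> \<in> carrier_mat N N" "i < N \<Longrightarrow> j < N \<Longrightarrow> is_poly (\<lambda>U \<omega>. snd l \<omega> $$ (i, j))" for \<omega> i j
    using assms by (auto simp: good_def intro: is_poly_const)
  have U: "is_poly (\<lambda>U \<omega>. map_mat complex_of_real U $$ (i, j))" "is_poly (\<lambda>U \<omega>. transpose_mat (map_mat complex_of_real U) $$ (i, j))"
    if "i < N" "j < N" for i j
    by (rule is_poly_cong[OF is_poly_entry[OF that]], use that in simp)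
      (rule is_poly_cong[OF is_poly_entry[OF that(2,1)]], use that in simp)
  have "is_poly (\<lambda>U \<omega>. (transpose_mat (map_mat complex_of_real U) * snd l \<omega>) $$ (i, j))" if "i < N" "j < N" for i j
    by (rule is_poly_matmult) (use X U that in auto)
  then have "is_poly (\<lambda>U \<omega>. (transpose_mat (map_mat complex_of_real U) * snd l \<omega> * map_mat complex_of_real U) $$ (i, j))"
    by (intro is_poly_matmult) (use X U assms in \<open>auto intro!: mult_carrier_mat[of _ N N]\<close>)
  then show ?thesis using True by (simp add: letter_def)
qed

lemma is_poly_word: "list_all good w \<Longrightarrow> i < N \<Longrightarrow> j < N \<Longrightarrow> is_poly (\<lambda>U \<omega>. word U \<omega> w $$ (i, j))"
proof (induction w arbitrary: i j)
  case Nil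
  then show ?case by (simp add: word_simps is_poly_const H_moments_const)
next
  case (Cons l w)
  then show ?case unfolding word_simps
    by (intro is_poly_matmult) (auto intro: letter_carrier word_carrier is_poly_letter)
qed

lemma is_poly_trace:
  assumes "list_all good w" shows "is_poly (\<lambda>U \<omega>. mat_trace (word U \<omega> w))"
proof (rule is_poly_cong)
  show "is_poly (\<lambda>U \<omega>. \<Sum>i<N. word U \<omega> w $$ (i, i))" by (intro is_poly_sum is_poly_word assms) auto
  show "(\<Sum>i<N. word U \<omega> w $$ (i, i)) = mat_trace (word U \<omega> w)" if "U \<in> carrier_mat N N" for U \<omega>
    using mat_trace_carrier[OF word_carrier[OF assms that]] by simp
qed

text \<open>The derivative of \<open>transpose_mat R * L * R\<close> at the identity; it is a
  commutator because the generator is skew-symmetric. Unmarked letters do not move.\<close>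

definition dletter :: "nat \<Rightarrow> nat \<Rightarrow> 'w \<Rightarrow> bool \<times> ('w \<Rightarrow> complex mat) \<Rightarrow> complex mat" where
  "dletter a b \<omega> l = (if fst l then letter (Y \<omega>) \<omega> l * skew N a b - skew N a b * letter (Y \<omega>) \<omega> l else 0\<^sub>m N N)"

fun dword :: "nat \<Rightarrow> nat \<Rightarrow> 'w \<Rightarrow> (bool \<times> ('w \<Rightarrow> complex mat)) list \<Rightarrow> complex mat" where
  "dword a b \<omega> [] = 0\<^sub>m N N"
| "dword a b \<omega> (l # w) = dletter a b \<omega> l * word (Y \<omega>) \<omega> w + letter (Y \<omega>) \<omega> l * dword a b \<omega> w"

lemma dletter_carrier: "good l \<Longrightarrow> dletter a b \<omega> l \<in> carrier_mat N N"
  by (auto simp: dletter_def intro!: minus_carrier_mat mult_carrier_mat[of _ N N] letter_carrier)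

lemma dword_carrier: "list_all good w \<Longrightarrow> dword a b \<omega> w \<in> carrier_mat N N"
  by (induction w) (auto intro!: add_carrier_mat mult_carrier_mat[of _ N N] letter_carrier dletter_carrier word_carrier)

lemma skew_transpose: "transpose_mat (skew N a b) = - skew N a b"
proof (rule eq_matI)
  fix i j assume "i < dim_row (- skew N a b)" "j < dim_col (- skew N a b)"
  then have ij: "i < N" "j < N" by (simp_all add: skew_def)
  show "transpose_mat (skew N a b) $$ (i, j) = (- skew N a b) $$ (i, j)"
  proof -
    have "transpose_mat (skew N a b) $$ (i, j) = skew N a b $$ (j, i)"
      by (rule index_transpose_mat(1)) (use ij carrier_matD[OF skew_carrier] in auto)
    also have "\<dots> = - (skew N a b $$ (i, j))" using ij by (simp add: skew_def conj_commute)
    also have "\<dots> = (- skew N a b) $$ (i, j)"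
      by (rule index_uminus_mat(1)[symmetric]) (use ij carrier_matD[OF skew_carrier] in auto)
    finally show ?thesis .
  qed
qed (simp_all add: skew_def)

lemma Y_rot_0 [simp]: "Y \<omega> * rot N a b 0 = Y \<omega>"
  by (simp add: rot_0 right_mult_one_mat[OF Y_carrier])

lemma letter_deriv:
  assumes l: "good l" and ab: "a < N" "b < N"
  shows "mat_deriv N (\<lambda>\<theta>. letter (Y \<omega> * rot N a b \<theta>) \<omega> l) (dletter a b \<omega> l)"
proof (cases "fst l")
  case False
  then show ?thesis using l by (auto simp: letter_def dletter_def good_def intro: mat_deriv_const)
next
  case True
  define R where "R \<theta> = map_mat complex_of_real (rot N a b \<theta>)" for \<theta>
  define S where "S = skew N a b"
  have R: "mat_deriv N R S"
    unfolding mat_deriv_def R_def S_def using rot_deriv[OF ab] carrier_matD[OF rot_carrier] by auto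
  have Rc: "R \<theta> \<in> carrier_mat N N" and Sc: "S \<in> carrier_mat N N" for \<theta> by (simp_all add: R_def S_def)
  have R0: "R 0 = 1\<^sub>m N" by (auto simp: R_def rot_0 intro!: eq_matI)
  define L where "L = letter (Y \<omega>) \<omega> l"
  have Lc: "L \<in> carrier_mat N N" unfolding L_def using l by (intro letter_carrier) auto
  have e: "letter (Y \<omega> * rot N a b \<theta>) \<omega> l = transpose_mat (R \<theta>) * L * R \<theta>" for \<theta>
  proof -
    define U where "U = map_mat complex_of_real (Y \<omega>)"
    define X where "X = snd l \<omega>"
    have c: "U \<in> carrier_mat N N" "X \<in> carrier_mat N N" "transpose_mat U \<in> carrier_mat N N" "transpose_mat (R \<theta>) \<in> carrier_mat N N"
      using l Rc[of \<theta>] by (auto simp: U_def X_def good_def)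
    have m: "map_mat complex_of_real (Y \<omega> * rot N a b \<theta>) = U * R \<theta>"
      unfolding U_def R_def by (rule of_real_hom.mat_hom_mult[OF Y_carrier rot_carrier])
    have "transpose_mat (U * R \<theta>) * X * (U * R \<theta>) = transpose_mat (R \<theta>) * transpose_mat U * X * (U * R \<theta>)"
      using c Rc[of \<theta>] by (simp add: transpose_mult[of _ N N _ N])
    also have "\<dots> = transpose_mat (R \<theta>) * (transpose_mat U * X * U) * R \<theta>"
      using c Rc[of \<theta>] mult_carrier_mat[of _ N N _ N] by (simp add: assoc_mult_mat[of _ N N _ N _ N])
    finally show ?thesis using True by (simp add: letter_def m L_def U_def X_def)
  qed
  have "mat_deriv N (\<lambda>\<theta>. transpose_mat (R \<theta>) * L * R \<theta>)
      ((transpose_mat S * L + transpose_mat (R 0) * 0\<^sub>m N N) * R 0 + transpose_mat (R 0) * L * S)"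
    by (intro mat_deriv_mult mat_deriv_transpose R mat_deriv_const Lc)
  moreover have "(transpose_mat S * L + transpose_mat (R 0) * 0\<^sub>m N N) * R 0 + transpose_mat (R 0) * L * S = L * S - S * L"
  proof -
    have SL: "S * L \<in> carrier_mat N N" "L * S \<in> carrier_mat N N" using Sc Lc by auto
    have "transpose_mat S * L = - (S * L)" using Sc Lc unfolding S_def skew_transpose
      by (subst uminus_mult_left_mat) (use carrier_matD(2)[OF skew_carrier] in auto)
    then have "(transpose_mat S * L + transpose_mat (R 0) * 0\<^sub>m N N) * R 0 + transpose_mat (R 0) * L * S = - (S * L) + L * S"
      using SL Lc Sc by (simp add: R0 right_mult_one_mat[of _ N N] left_mult_one_mat[of _ N N])
    also have "\<dots> = L * S - S * L"
    proof -
      have "- A + B = B - A" if "A \<in> carrier_mat N N" "B \<in> carrier_mat N N" for A B :: "complex mat"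
        using that by (intro eq_matI) auto
      from this[OF SL] show ?thesis .
    qed
    finally show ?thesis .
  qed
  ultimately show ?thesis using True by (simp add: e dletter_def L_def S_def)
qed

lemma word_deriv:
  assumes "list_all good w" and ab: "a < N" "b < N"
  shows "mat_deriv N (\<lambda>\<theta>. word (Y \<omega> * rot N a b \<theta>) \<omega> w) (dword a b \<omega> w)"
  using assms(1)
proof (induction w)
  case Nil
  then show ?case by (simp add: word_simps mat_deriv_const)
next
  case (Cons l w)
  then show ?case using mat_deriv_mult[OF letter_deriv[OF _ ab, of l \<omega>] Cons.IH] by (simp add: word_simps)
qed

definition tr_word :: "'w \<Rightarrow> (bool \<times> ('w \<Rightarrow> complex mat)) list \<Rightarrow> complex" where
  "tr_word \<omega> w = mat_trace (word (Y \<omega>) \<omega> w)"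

lemma zero_minus: "0\<^sub>m N N - 0\<^sub>m N N = (0\<^sub>m N N :: complex mat)"
  by (intro eq_matI) auto

text \<open>\<open>\<Sum>\<^sub>a\<^sub>b\<close> of a linear functional of the derivative of a word in the direction of the rotation
  in the \<open>(a, b)\<close>-plane: only the letters that contain \<open>U\<close> contribute.\<close>

lemma sum_dword:
  fixes \<omega> :: 'w
  assumes w: "list_all good w"
    and add: "\<And>a b A B. a < N \<Longrightarrow> b < N \<Longrightarrow> A \<in> carrier_mat N N \<Longrightarrow> B \<in> carrier_mat N N \<Longrightarrow> f a b (A + B) = f a b A + (f a b B :: complex)"
    and minus: "\<And>a b A B. a < N \<Longrightarrow> b < N \<Longrightarrow> A \<in> carrier_mat N N \<Longrightarrow> B \<in> carrier_mat N N \<Longrightarrow> f a b (A - B) = f a b A - f a b B"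
    and S: "\<And>P Q. P \<in> carrier_mat N N \<Longrightarrow> Q \<in> carrier_mat N N \<Longrightarrow> (\<Sum>a<N. \<Sum>b<N. f a b (P * skew N a b * Q)) = s P Q"
    and p: "list_all good p"
  defines "W \<equiv> word (Y \<omega>) \<omega>"
  shows "(\<Sum>a<N. \<Sum>b<N. f a b (W p * dword a b \<omega> w)) =
    (\<Sum>i | i < length w \<and> fst (w ! i). s (W (p @ take (Suc i) w)) (W (drop (Suc i) w)) - s (W (p @ take i w)) (W (drop i w)))"
  using w p
proof (induction w arbitrary: p)
  case Nil
  have "f a b (0\<^sub>m N N) = 0" if "a < N" "b < N" for a b
    using minus[OF that, of "0\<^sub>m N N" "0\<^sub>m N N"] zero_minus by simp
  moreover have "W p * 0\<^sub>m N N = 0\<^sub>m N N" using word_carrier[OF Nil(2) Y_carrier] by (simp add: W_def right_mult_zero_mat)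
  ultimately show ?case by simp
next
  case (Cons l w)
  have g: "good l" "list_all good w" using Cons by auto
  have c: "W p \<in> carrier_mat N N" "W w \<in> carrier_mat N N" "letter (Y \<omega>) \<omega> l \<in> carrier_mat N N" "dword a b \<omega> w \<in> carrier_mat N N"
    "dletter a b \<omega> l \<in> carrier_mat N N" for a b
    using word_carrier letter_carrier dletter_carrier dword_carrier Cons g by (auto simp: W_def)
  let ?l = "letter (Y \<omega>) \<omega> l"
  have pl: "W (p @ [l]) = W p * ?l" using Cons g c
    by (simp add: W_def word_append word_simps right_mult_one_mat[of _ N N])
  have "f a b (W p * dword a b \<omega> (l # w)) = f a b (W p * dletter a b \<omega> l * W w) + f a b (W (p @ [l]) * dword a b \<omega> w)"
    if "a < N" "b < N" for a b
  proof -
    have "W p * dword a b \<omega> (l # w) = W p * (dletter a b \<omega> l * W w) + W p * (?l * dword a b \<omega> w)"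
      unfolding W_def[symmetric] dword.simps using c by (intro mult_add_distrib_mat[of _ N N]) (auto intro!: mult_carrier_mat[of _ N N])
    also have "\<dots> = W p * dletter a b \<omega> l * W w + W (p @ [l]) * dword a b \<omega> w"
      unfolding pl using c by (simp add: assoc_mult_mat[of _ N N _ N _ N])
    finally show ?thesis using c that pl word_carrier[of "p @ [l]" "Y \<omega>"] Cons
      by (simp add: add mult_carrier_mat[of _ N N])
  qed
  then have "(\<Sum>a<N. \<Sum>b<N. f a b (W p * dword a b \<omega> (l # w))) =
      (\<Sum>a<N. \<Sum>b<N. f a b (W p * dletter a b \<omega> l * W w)) + (\<Sum>a<N. \<Sum>b<N. f a b (W (p @ [l]) * dword a b \<omega> w))"
    by (simp add: sum.distrib)
  \<comment> \<open>The commutator contributes the cut behind \<open>l\<close> minus the cut in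
    front of \<open>l\<close>.\<close>
  also have "(\<Sum>a<N. \<Sum>b<N. f a b (W p * dletter a b \<omega> l * W w)) = (if fst l then s (W (p @ [l])) (W w) - s (W p) (W (l # w)) else 0)"
  proof (cases "fst l")
    case False
    have "f a b (0\<^sub>m N N) = 0" if "a < N" "b < N" for a b
    proof -
      have "0\<^sub>m N N - 0\<^sub>m N N = (0\<^sub>m N N :: complex mat)" by (intro eq_matI) auto
      then show ?thesis using minus[OF that, of "0\<^sub>m N N" "0\<^sub>m N N"] zero_minus by simp
    qed
    then show ?thesis using False c by (simp add: dletter_def)
  next
    case True
    have "f a b (W p * dletter a b \<omega> l * W w) = f a b (W (p @ [l]) * skew N a b * W w) - f a b (W p * skew N a b * W (l # w))"
      if "a < N" "b < N" for a b
    proof -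
      have "W p * dletter a b \<omega> l = W p * (?l * skew N a b) - W p * (skew N a b * ?l)"
      proof -
        have "?l * skew N a b \<in> carrier_mat N N" "skew N a b * ?l \<in> carrier_mat N N"
          by (intro mult_carrier_mat[of _ N N] c skew_carrier)+
        from mult_minus_distrib_mat[OF c(1) this] show ?thesis using True by (simp add: dletter_def)
      qed
      then have "W p * dletter a b \<omega> l * W w = W p * (?l * skew N a b) * W w - W p * (skew N a b * ?l) * W w"
        using c by (simp add: minus_mult_distrib_mat[of _ N N] mult_carrier_mat[of _ N N])
      also have "\<dots> = W (p @ [l]) * skew N a b * W w - W p * skew N a b * W (l # w)"
      proof -
        have "W p * (?l * skew N a b) = W p * ?l * skew N a b"
          by (rule assoc_mult_mat[symmetric, of _ N N _ N _ N]) (use c in auto)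
        moreover have "W p * (skew N a b * ?l) = W p * skew N a b * ?l"
          by (rule assoc_mult_mat[symmetric, of _ N N _ N _ N]) (use c in auto)
        moreover have "W p * skew N a b * ?l * W w = W p * skew N a b * (?l * W w)"
          by (rule assoc_mult_mat[of _ N N _ N _ N]) (use c in \<open>auto intro!: mult_carrier_mat[of _ N N]\<close>)
        ultimately show ?thesis unfolding pl by (simp add: W_def word_simps)
      qed
      finally show ?thesis using c that pl word_carrier[of "l # w" "Y \<omega>"] g
        by (simp add: minus mult_carrier_mat[of _ N N] W_def)
    qed
    then have "(\<Sum>a<N. \<Sum>b<N. f a b (W p * dletter a b \<omega> l * W w)) =
        (\<Sum>a<N. \<Sum>b<N. f a b (W (p @ [l]) * skew N a b * W w)) - (\<Sum>a<N. \<Sum>b<N. f a b (W p * skew N a b * W (l # w)))"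
      by (simp add: sum_subtractf)
    then show ?thesis using True S c pl word_carrier[of "l # w" "Y \<omega>"] word_carrier[of "p @ [l]" "Y \<omega>"] g Cons
      by (simp add: W_def)
  qed
  also have "(\<Sum>a<N. \<Sum>b<N. f a b (W (p @ [l]) * dword a b \<omega> w)) =
      (\<Sum>i | i < length w \<and> fst (w ! i). s (W ((p @ [l]) @ take (Suc i) w)) (W (drop (Suc i) w)) - s (W ((p @ [l]) @ take i w)) (W (drop i w)))"
    by (rule Cons.IH) (use Cons in auto)
  also have "\<dots> = (\<Sum>i | i < length (l # w) \<and> fst ((l # w) ! i) \<and> i \<noteq> 0.
      s (W (p @ take (Suc i) (l # w))) (W (drop (Suc i) (l # w))) - s (W (p @ take i (l # w))) (W (drop i (l # w))))"
    by (rule sum.reindex_bij_witness[of _ "\<lambda>i. i - 1" Suc]) (auto simp: gr0_conv_Suc)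
  also have "(if fst l then s (W (p @ [l])) (W w) - s (W p) (W (l # w)) else 0) + \<dots> =
      (\<Sum>i | i < length (l # w) \<and> fst ((l # w) ! i).
      s (W (p @ take (Suc i) (l # w))) (W (drop (Suc i) (l # w))) - s (W (p @ take i (l # w))) (W (drop i (l # w))))"
  proof (cases "fst l")
    case True
    have "{i. i < length (l # w) \<and> fst ((l # w) ! i)} = insert 0 {i. i < length (l # w) \<and> fst ((l # w) ! i) \<and> i \<noteq> 0}"
      using True by auto
    then show ?thesis using True by simp
  next
    case False
    have "{i. i < length (l # w) \<and> fst ((l # w) ! i)} = {i. i < length (l # w) \<and> fst ((l # w) ! i) \<and> i \<noteq> 0}"
      using False by (auto simp: nth_Cons split: nat.splits)
    then show ?thesis using False by simp
  qed
  finally show ?case .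
qed

text \<open>The sum runs over all marked letters of \<open>z\<close>, the first one included. The
  two cuts at the first letter are separated from the rest in \<open>self_sum_Cons\<close>.\<close>

definition self_sum :: "'w \<Rightarrow> (bool \<times> ('w \<Rightarrow> complex mat)) list \<Rightarrow> complex" where
  "self_sum \<omega> z = (\<Sum>i | i < length z \<and> fst (z ! i).
     tr_word \<omega> (take (Suc i) z) * tr_word \<omega> (drop (Suc i) z) - tr_word \<omega> (take (Suc i) z @ mrev flip (drop (Suc i) z))
     - (tr_word \<omega> (take i z) * tr_word \<omega> (drop i z) - tr_word \<omega> (take i z @ mrev flip (drop i z))))"

definition cross_sum :: "'w \<Rightarrow> (bool \<times> ('w \<Rightarrow> complex mat)) list \<Rightarrow> (bool \<times> ('w \<Rightarrow> complex mat)) list \<Rightarrow> complex" where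
  "cross_sum \<omega> z w = (\<Sum>i | i < length w \<and> fst (w ! i).
     tr_word \<omega> (z @ drop (Suc i) w @ take (Suc i) w) - tr_word \<omega> (z @ mrev flip (drop (Suc i) w @ take (Suc i) w))
     - (tr_word \<omega> (z @ drop i w @ take i w) - tr_word \<omega> (z @ mrev flip (drop i w @ take i w))))"

lemma good_parts: "list_all good w \<Longrightarrow> list_all good (take i w)" "list_all good w \<Longrightarrow> list_all good (drop i w)"
  "list_all good w \<Longrightarrow> list_all good (mrev flip w)"
  by (auto simp: list_all_iff mrev_def good_flip dest: in_set_takeD in_set_dropD)

lemma sum_dword_self:
  assumes z: "list_all good z"
  shows "(\<Sum>a<N. \<Sum>b<N. dword a b \<omega> z $$ (a, b)) = self_sum \<omega> z"
proof -
  let ?W = "word (Y \<omega>) \<omega>"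
  have "(\<Sum>a<N. \<Sum>b<N. (?W [] * dword a b \<omega> z) $$ (a, b)) =
    (\<Sum>i | i < length z \<and> fst (z ! i).
      (mat_trace (?W ([] @ take (Suc i) z)) * mat_trace (?W (drop (Suc i) z)) - mat_trace (?W ([] @ take (Suc i) z) * transpose_mat (?W (drop (Suc i) z))))
      - (mat_trace (?W ([] @ take i z)) * mat_trace (?W (drop i z)) - mat_trace (?W ([] @ take i z) * transpose_mat (?W (drop i z)))))"
    by (rule sum_dword[OF z, where s = "\<lambda>P Q. mat_trace P * mat_trace Q - mat_trace (P * transpose_mat Q)"])
      (auto simp: sum_skew_diag simp del: index_mult_mat)
  also have "\<dots> = self_sum \<omega> z"
    unfolding self_sum_def tr_word_def
    by (intro sum.cong refl) (simp add: word_append word_mrev good_parts z)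
  also have "(\<Sum>a<N. \<Sum>b<N. (?W [] * dword a b \<omega> z) $$ (a, b)) = (\<Sum>a<N. \<Sum>b<N. dword a b \<omega> z $$ (a, b))"
    using left_mult_one_mat[OF dword_carrier[OF z]] by (simp add: word_simps)
  finally show ?thesis .
qed

lemma sum_dword_cross:
  assumes z: "list_all good z" and w: "list_all good w"
  shows "(\<Sum>a<N. \<Sum>b<N. word (Y \<omega>) \<omega> z $$ (a, b) * mat_trace (dword a b \<omega> w)) = cross_sum \<omega> z w"
proof -
  let ?W = "word (Y \<omega>) \<omega>"
  have Z: "?W z \<in> carrier_mat N N" by (rule word_carrier[OF z Y_carrier])
  have "(\<Sum>a<N. \<Sum>b<N. ?W z $$ (a, b) * mat_trace (?W [] * dword a b \<omega> w)) =
    (\<Sum>i | i < length w \<and> fst (w ! i).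
      (mat_trace (?W z * (?W (drop (Suc i) w) * ?W ([] @ take (Suc i) w))) - mat_trace (?W z * transpose_mat (?W (drop (Suc i) w) * ?W ([] @ take (Suc i) w))))
      - (mat_trace (?W z * (?W (drop i w) * ?W ([] @ take i w))) - mat_trace (?W z * transpose_mat (?W (drop i w) * ?W ([] @ take i w)))))"
    by (rule sum_dword[OF w, where s = "\<lambda>P Q. mat_trace (?W z * (Q * P)) - mat_trace (?W z * transpose_mat (Q * P))"])
      (simp_all add: sum_skew_trace Z mat_trace_add[of _ N] mat_trace_minus[of _ N] distrib_left right_diff_distrib)
  also have "\<dots> = cross_sum \<omega> z w"
    unfolding cross_sum_def tr_word_def
  proof (intro sum.cong refl)
    fix i assume "i \<in> {i. i < length w \<and> fst (w ! i)}"
    have e: "?W (z @ drop j w @ take j w) = ?W z * (?W (drop j w) * ?W (take j w))"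
      "?W (z @ mrev flip (drop j w @ take j w)) = ?W z * transpose_mat (?W (drop j w) * ?W (take j w))" for j
      using z w by (simp_all add: word_append good_parts word_mrev[symmetric] flip: word_append)
    show "mat_trace (?W z * (?W (drop (Suc i) w) * ?W ([] @ take (Suc i) w))) - mat_trace (?W z * transpose_mat (?W (drop (Suc i) w) * ?W ([] @ take (Suc i) w)))
      - (mat_trace (?W z * (?W (drop i w) * ?W ([] @ take i w))) - mat_trace (?W z * transpose_mat (?W (drop i w) * ?W ([] @ take i w))))
      = mat_trace (?W (z @ drop (Suc i) w @ take (Suc i) w)) - mat_trace (?W (z @ mrev flip (drop (Suc i) w @ take (Suc i) w)))
      - (mat_trace (?W (z @ drop i w @ take i w)) - mat_trace (?W (z @ mrev flip (drop i w @ take i w))))"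
      by (simp only: e append_Nil)
  qed
  also have "(\<Sum>a<N. \<Sum>b<N. ?W z $$ (a, b) * mat_trace (?W [] * dword a b \<omega> w)) =
      (\<Sum>a<N. \<Sum>b<N. ?W z $$ (a, b) * mat_trace (dword a b \<omega> w))"
    using left_mult_one_mat[OF dword_carrier[OF w]] by (simp add: word_simps)
  finally show ?thesis .
qed

fun dtraces :: "nat \<Rightarrow> nat \<Rightarrow> 'w \<Rightarrow> (bool \<times> ('w \<Rightarrow> complex mat)) list list \<Rightarrow> complex" where
  "dtraces a b \<omega> [] = 0"
| "dtraces a b \<omega> (w # ws) = tr_word \<omega> w * dtraces a b \<omega> ws + mat_trace (dword a b \<omega> w) * traces (tr_word \<omega>) ws"

lemma dtraces_eq: "dtraces a b \<omega> ws = (\<Sum>j<length ws. traces (tr_word \<omega>) (remove_nth j ws) * mat_trace (dword a b \<omega> (ws ! j)))"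
proof (induction ws)
  case (Cons w ws)
  show ?case unfolding dtraces.simps Cons length_Cons
    by (subst sum.lessThan_Suc_shift) (simp add: remove_nth_def traces_def sum_distrib_left mult_ac)
qed simp

lemma traces_deriv:
  assumes "list_all (list_all good) ws" and ab: "a < N" "b < N"
  shows "((\<lambda>\<theta>. traces (\<lambda>w. mat_trace (word (Y \<omega> * rot N a b \<theta>) \<omega> w)) ws) has_vector_derivative dtraces a b \<omega> ws) (at 0)"
  using assms(1)
proof (induction ws)
  case (Cons w ws)
  then have "list_all good w" by simp
  from has_vector_derivative_mult[OF mat_deriv_trace[OF word_deriv[OF this ab, of \<omega>]] Cons.IH] Cons(2)
  show ?case by (simp add: traces_def tr_word_def)
qed (simp add: traces_def)

text \<open>For each plane the observable is the entry of the word \<open>z\<close> with the indices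
  of that plane, times the coefficient and the traces of \<open>ws\<close>. Its derivative has mean
  zero, and summing over \<open>a\<close> and \<open>b\<close> closes the open indices of
  \<open>z\<close> to traces.\<close>

theorem loop_equation:
  assumes z: "list_all good z" and ws: "list_all (list_all good) ws" and g: "g \<in> H_moments"
  shows "(\<integral>\<omega>. g \<omega> * (traces (tr_word \<omega>) ws * self_sum \<omega> z +
      (\<Sum>j<length ws. traces (tr_word \<omega>) (remove_nth j ws) * cross_sum \<omega> z (ws ! j))) \<partial>P) = 0"
proof -
  define D where "D a b \<omega> = g \<omega> * (word (Y \<omega>) \<omega> z $$ (a, b) * dtraces a b \<omega> ws + dword a b \<omega> z $$ (a, b) * traces (tr_word \<omega>) ws)" for a b \<omega>
  have D: "D a b \<in> all_moments P \<and> (\<integral>\<omega>. D a b \<omega> \<partial>P) = 0" if ab: "a < N" "b < N" for a b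
  proof -
    let ?f = "\<lambda>U \<omega>. g \<omega> * (word U \<omega> z $$ (a, b) * traces (\<lambda>w. mat_trace (word U \<omega> w)) ws)"
    have f: "is_poly ?f" unfolding traces_def
      by (intro is_poly_mult is_poly_prod_list is_poly_word is_poly_trace is_poly_const g z ab) (use ws in \<open>auto simp: list_all_iff\<close>)
    have "((\<lambda>\<theta>. word (Y \<omega> * rot N a b \<theta>) \<omega> z $$ (a, b)) has_vector_derivative dword a b \<omega> z $$ (a, b)) (at 0)" for \<omega>
      using word_deriv[OF z ab, of \<omega>] ab by (auto simp: mat_deriv_def)
    from has_vector_derivative_mult[OF this traces_deriv[OF ws ab]]
    have "((\<lambda>\<theta>. ?f (Y \<omega> * rot N a b \<theta>) \<omega>) has_vector_derivative D a b \<omega>) (at 0)" for \<omega>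
      unfolding D_def by (intro has_vector_derivative_mult_right) (simp add: tr_word_def[abs_def])
    from poly_deriv[OF f ab this] show ?thesis by auto
  qed
  have "(\<Sum>a<N. \<Sum>b<N. D a b \<omega>) = g \<omega> * (traces (tr_word \<omega>) ws * self_sum \<omega> z +
      (\<Sum>j<length ws. traces (tr_word \<omega>) (remove_nth j ws) * cross_sum \<omega> z (ws ! j)))" for \<omega>
  proof -
    let ?T = "\<lambda>j. traces (tr_word \<omega>) (remove_nth j ws)"
    have "(\<Sum>a<N. \<Sum>b<N. word (Y \<omega>) \<omega> z $$ (a, b) * dtraces a b \<omega> ws) =
        (\<Sum>a<N. \<Sum>b<N. \<Sum>j<length ws. ?T j * (word (Y \<omega>) \<omega> z $$ (a, b) * mat_trace (dword a b \<omega> (ws ! j))))"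
      by (simp add: dtraces_eq sum_distrib_left mult_ac)
    also have "\<dots> = (\<Sum>j<length ws. \<Sum>a<N. \<Sum>b<N. ?T j * (word (Y \<omega>) \<omega> z $$ (a, b) * mat_trace (dword a b \<omega> (ws ! j))))"
      by (subst sum.swap[of _ "{..<length ws}"], subst sum.swap[of _ "{..<length ws}"]) (rule refl)
    also have "\<dots> = (\<Sum>j<length ws. ?T j * cross_sum \<omega> z (ws ! j))"
      by (intro sum.cong refl, subst sum_dword_cross[OF z, symmetric])
        (use ws in \<open>auto simp: list_all_iff sum_distrib_left\<close>)
    finally have 1: "(\<Sum>a<N. \<Sum>b<N. word (Y \<omega>) \<omega> z $$ (a, b) * dtraces a b \<omega> ws) = (\<Sum>j<length ws. ?T j * cross_sum \<omega> z (ws ! j))" .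
    have 2: "(\<Sum>a<N. \<Sum>b<N. dword a b \<omega> z $$ (a, b) * traces (tr_word \<omega>) ws) = traces (tr_word \<omega>) ws * self_sum \<omega> z"
      by (subst sum_dword_self[OF z, symmetric]) (simp add: sum_distrib_left mult.commute)
    show ?thesis unfolding D_def
      by (simp only: sum_distrib_left[symmetric] sum.distrib 1 2 add.commute)
  qed
  then have "(\<integral>\<omega>. g \<omega> * (traces (tr_word \<omega>) ws * self_sum \<omega> z +
      (\<Sum>j<length ws. traces (tr_word \<omega>) (remove_nth j ws) * cross_sum \<omega> z (ws ! j))) \<partial>P)
    = (\<integral>\<omega>. (\<Sum>a<N. \<Sum>b<N. D a b \<omega>) \<partial>P)" by simp
  also have "\<dots> = (\<Sum>a<N. \<integral>\<omega>. (\<Sum>b<N. D a b \<omega>) \<partial>P)"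
    using D by (intro Bochner_Integration.integral_sum Bochner_Integration.integrable_sum all_moments_integrable) auto
  also have "\<dots> = (\<Sum>a<N. \<Sum>b<N. \<integral>\<omega>. D a b \<omega> \<partial>P)"
    using D by (intro sum.cong refl Bochner_Integration.integral_sum all_moments_integrable) auto
  also have "\<dots> = 0" using D by simp
  finally show ?thesis .
qed

end

section \<open>Gaussian limits\<close>

declare cseq_apply [simp del]

lemma cumulant_of_pair:
  assumes "i \<noteq> j" "m {} = 1" shows "cumulant_of m {i, j} = m {i, j} - m {i} * m {j}"
proof -
  have e: "{V. V \<subset> {i, j} \<and> i \<in> V \<and> V \<noteq> {i}} = {}" by auto
  have "(\<Sum>V | V \<subset> {i, j} \<and> i \<in> V \<and> V \<noteq> {i}. cumulant_of m V * m ({i, j} - V)) = 0"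
    by (simp only: e sum.empty)
  moreover have "{i, j} - {i} = {j}" using assms by auto
  ultimately show ?thesis using moment_cumulant_rec'[of "{i, j}" i m] assms by simp
qed

lemma cumulant_of_zero:
  assumes "finite S" "i \<in> S" "\<And>B. B \<subseteq> S \<Longrightarrow> i \<in> B \<Longrightarrow> m B = 0"
  shows "cumulant_of m S = 0"
  using cumulant_of_linear[of S i m 0 m 0 m] assms by simp

context prob_space
begin

lemma prod_all_moments: "(\<And>l. l \<in> A \<Longrightarrow> f l \<in> all_moments M) \<Longrightarrow> (\<lambda>\<omega>. \<Prod>l\<in>A. f l \<omega>) \<in> all_moments M"
  by (induction A rule: infinite_finite_induct) (auto intro: all_moments_mult all_moments_const finite_measure_axioms)

text \<open>Linearity in this slot splits off \<open>D\<close> times the cumulant with the constant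
  variable 1, which vanishes in the presence of another variable. The condition \<open>len\<close>
  excludes the mean, which does change.\<close>

lemma joint_cumulant_shift_one:
  assumes "set pre \<subseteq> all_moments M" "set post \<subseteq> all_moments M" "Y \<in> all_moments M"
    and len: "length pre + length post \<ge> 1"
  shows "joint_cumulant M (pre @ (\<lambda>\<omega>. D + Y \<omega>) # post) = joint_cumulant M (pre @ Y # post)"
proof -
  let ?i = "length pre" and ?S = "{..<Suc (length pre + length post)}"
  define Z where "Z X = pre @ X # post" for X :: "'a \<Rightarrow> complex"
  define m where "m X B = (\<integral>\<omega>. (\<Prod>i\<in>B. (Z X ! i) \<omega>) \<partial>M)" for X B
  have mom: "Z X ! i \<in> all_moments M" if "i \<in> ?S" "X \<in> all_moments M" for X i
    using that assms by (auto simp: Z_def nth_append nth_Cons' dest!: nth_mem)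
  have Zi: "Z X ! ?i = X" and Zn: "i \<noteq> ?i \<Longrightarrow> Z X ! i = Z X' ! i" for X X' i
    by (auto simp: Z_def nth_append nth_Cons')
  have one: "(\<lambda>_. 1) \<in> all_moments M" by (rule all_moments_const) (rule finite_measure_axioms)
  have prod: "(\<Prod>i\<in>B. (Z X ! i) \<omega>) = X \<omega> * (\<Prod>i\<in>B - {?i}. (Z Y ! i) \<omega>)" if "B \<subseteq> ?S" "?i \<in> B" for X B \<omega>
  proof -
    have "finite B" using that finite_subset by blast
    then have "(\<Prod>i\<in>B. (Z X ! i) \<omega>) = X \<omega> * (\<Prod>i\<in>B - {?i}. (Z X ! i) \<omega>)"
      using that Zi by (subst prod.remove[of B ?i]) auto
    also have "(\<Prod>i\<in>B - {?i}. (Z X ! i) \<omega>) = (\<Prod>i\<in>B - {?i}. (Z Y ! i) \<omega>)"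
      using Zn[of _ X Y] by (intro prod.cong) auto
    finally show ?thesis .
  qed
  have out: "m X B = m X' B" if "?i \<notin> B" for X X' B
  proof -
    have "(\<Prod>i\<in>B. (Z X ! i) \<omega>) = (\<Prod>i\<in>B. (Z X' ! i) \<omega>)" for \<omega>
      by (intro prod.cong refl, subst Zn[of _ X X']) (use that in auto)
    then show ?thesis by (simp add: m_def)
  qed
  have rest: "(\<lambda>\<omega>. \<Prod>i\<in>B - {?i}. (Z Y ! i) \<omega>) \<in> all_moments M" if "B \<subseteq> ?S" for B
    using that assms(3) by (intro prod_all_moments mom) auto
  have "cumulant_of (m (\<lambda>\<omega>. D + Y \<omega>)) ?S = D * cumulant_of (m (\<lambda>_. 1)) ?S + 1 * cumulant_of (m Y) ?S"
  proof (rule cumulant_of_linear[of _ ?i])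
    fix B assume B: "B \<subseteq> ?S" "?i \<in> B"
    have "(\<integral>\<omega>. (D + Y \<omega>) * (\<Prod>i\<in>B - {?i}. (Z Y ! i) \<omega>) \<partial>M) =
        D * (\<integral>\<omega>. (\<Prod>i\<in>B - {?i}. (Z Y ! i) \<omega>) \<partial>M) + (\<integral>\<omega>. Y \<omega> * (\<Prod>i\<in>B - {?i}. (Z Y ! i) \<omega>) \<partial>M)"
      using rest[OF B(1)] all_moments_mult[OF assms(3) rest[OF B(1)]] by (simp add: distrib_right all_moments_integrable)
    then show "m (\<lambda>\<omega>. D + Y \<omega>) B = D * m (\<lambda>_. 1) B + 1 * m Y B"
      unfolding m_def prod[OF B] by simp
  qed (use out in auto)
  also have "cumulant_of (m (\<lambda>_. 1)) ?S = 0"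
  proof (rule cumulant_of_const[of _ ?i, where a = 1])
    show "?S \<noteq> {?i}"
    proof
      assume "?S = {?i}"
      then have "card ?S = card {?i}" by (rule arg_cong)
      then show False using len by simp
    qed
    show "m (\<lambda>_. 1) {} = 1" by (simp add: m_def prob_space)
    fix B assume B: "B \<subseteq> ?S" "?i \<in> B"
    show "m (\<lambda>_. 1) B = 1 * m (\<lambda>_. 1) (B - {?i})"
      using out[of "B - {?i}" "\<lambda>_. 1" Y] unfolding m_def prod[OF B] by simp
  qed auto
  finally show ?thesis by (simp add: joint_cumulant_eq m_def Z_def)
qed

text \<open>The slots are shifted one after the other; \<open>pre\<close> holds those already done.
  It is used to remove constants that diverge with the dimension before a limit is taken.\<close>

lemma joint_cumulant_shift:
  assumes "list_all2 (\<lambda>X Y. Y \<in> all_moments M \<and> (\<exists>D. \<forall>\<omega>. X \<omega> = D + Y \<omega>)) Xs Ys"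
    and "set pre \<subseteq> all_moments M" "length pre + length Ys \<ge> 2"
  shows "joint_cumulant M (pre @ Xs) = joint_cumulant M (pre @ Ys)"
  using assms
proof (induction Xs Ys arbitrary: pre rule: list_all2_induct)
  case (Cons X Xs Y Ys)
  obtain D where D: "X = (\<lambda>\<omega>. D + Y \<omega>)" "Y \<in> all_moments M" using Cons(1) by auto
  have "set Xs \<subseteq> all_moments M"
  proof
    fix X' assume "X' \<in> set Xs"
    then obtain Y' where "Y' \<in> all_moments M" "\<exists>D. \<forall>\<omega>. X' \<omega> = D + Y' \<omega>"
      using Cons(2) by (auto simp: list_all2_conv_all_nth in_set_conv_nth)
    then obtain D' where "X' = (\<lambda>\<omega>. D' + Y' \<omega>)" "Y' \<in> all_moments M" by auto
    then show "X' \<in> all_moments M" using all_moments_add[OF all_moments_const[OF finite_measure_axioms]] by auto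
  qed
  moreover have "length Xs = length Ys" using Cons(2) by (rule list_all2_lengthD)
  ultimately have "joint_cumulant M (pre @ X # Xs) = joint_cumulant M (pre @ Y # Xs)"
    unfolding D(1) using Cons.prems D(2) by (intro joint_cumulant_shift_one) auto
  also have "\<dots> = joint_cumulant M ((pre @ [Y]) @ Ys)"
    using Cons.IH[of "pre @ [Y]"] Cons.prems D(2) by simp
  finally show ?case by simp
qed simp

lemma joint_cumulant_pair:
  "joint_cumulant M [X, Y] = (\<integral>\<omega>. X \<omega> * Y \<omega> \<partial>M) - (\<integral>\<omega>. X \<omega> \<partial>M) * (\<integral>\<omega>. Y \<omega> \<partial>M)"
proof -
  have "{..<length [X, Y]} = {0, 1::nat}" by auto
  then show ?thesis unfolding joint_cumulant_eq
    by (simp only:) (subst cumulant_of_pair, auto simp: prob_space)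
qed

end

text \<open>\<open>Taus\<close>: centred unnormalized traces of matrices independent of the Haar matrices; \<open>Trs\<close>:
  their normalized traces. The latter generate the coefficient algebra of the letters.\<close>

locale gauss_system = loop_system Ns M R0 R L clr fl mrg pr tr
  for Ns and M :: "nat \<Rightarrow> 'w measure" and R0 R and L :: "'l set" and clr :: "'l \<Rightarrow> 'i" and fl mrg pr tr +
  fixes Taus Trs :: "'w scalar_seq set"
  assumes Taus_R: "Taus \<subseteq> R"
    and R0_gen: "f \<in> R0 \<Longrightarrow> f \<in> sumset {cseq d * prod_list ss | d ss. (\<exists>c. (d \<longlongrightarrow> c) (dims_to_infinity Ns)) \<and> set ss \<subseteq> Trs}"
    and Trs: "s \<in> Trs \<Longrightarrow> \<exists>d c t. (d \<longlongrightarrow> c) (dims_to_infinity Ns) \<and> t \<in> Taus \<and> s = cseq d + cseq (\<lambda>N. 1 / of_nat N) * t"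
    and Taus_cumulant: "set ss \<subseteq> Taus \<Longrightarrow> length ss \<ge> 3 \<Longrightarrow>
      ((\<lambda>N. joint_cumulant (M N) (map (\<lambda>s. s N) ss)) \<longlongrightarrow> 0) (dims_to_infinity Ns)"
begin

text \<open>A ring, all of whose members have a limiting expectation by \<open>VV_conv\<close>. The
  functional \<open>lam\<close> is linear on it; it turns out to be multiplicative as soon as one
  factor lies in \<open>R0\<close>.\<close>

definition G :: "'w scalar_seq set" where "G = (\<Union>n. VV n)"

definition lam :: "'w scalar_seq \<Rightarrow> complex" where "lam f = Lim F (\<lambda>N. E N f)"

lemma lam_lim: "f \<in> G \<Longrightarrow> ((\<lambda>N. E N f) \<longlongrightarrow> lam f) F"
  using VV_conv unfolding G_def lam_def by (auto dest!: VV_conv simp: tendsto_Lim[OF F_neq_bot])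

lemma lam_eqI: "((\<lambda>N. E N f) \<longlongrightarrow> c) F \<Longrightarrow> lam f = c"
  unfolding lam_def by (rule tendsto_Lim[OF F_neq_bot])

lemma G_V: "f \<in> G \<Longrightarrow> f \<in> V" by (auto simp: G_def dest: VV_V)

lemma G_add: "f \<in> G \<Longrightarrow> g \<in> G \<Longrightarrow> f + g \<in> G"
proof -
  assume "f \<in> G" "g \<in> G"
  then obtain m n where "f \<in> VV m" "g \<in> VV n" by (auto simp: G_def)
  then have "f + g \<in> VV (max m n)" by (intro VV_add) (auto intro: VV_mono)
  then show ?thesis by (auto simp: G_def)
qed

lemma G_mult: "f \<in> G \<Longrightarrow> g \<in> G \<Longrightarrow> f * g \<in> G"
  unfolding G_def using VV_mult by blast

lemma R_G: "f \<in> R \<Longrightarrow> f \<in> G" using VV_R by (auto simp: G_def)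
lemma R0_G: "f \<in> R0 \<Longrightarrow> f \<in> G" using R0_R R_G by auto
lemma cseq_G: "(d \<longlongrightarrow> c) F \<Longrightarrow> cseq d \<in> G" by (rule R0_G[OF R0_cseq])
lemma const_G: "cseq (\<lambda>_. c) \<in> G" by (rule cseq_G[OF tendsto_const])
lemma one_G: "1 \<in> G" and zero_G: "0 \<in> G" using R_G R_1 R_0 by auto
lemma T_G: "list_all calt ws \<Longrightarrow> T ws \<in> G" unfolding G_def using VV_T by blast
lemma tr_G: "calt w \<Longrightarrow> tr w \<in> G" using T_G[of "[w]"] by simp
lemma V1_G: "f \<in> V1 k \<Longrightarrow> f \<in> G" using V1_VV by (auto simp: G_def)

lemma G_uminus: "f \<in> G \<Longrightarrow> - f \<in> G"
proof -
  assume "f \<in> G"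
  then have "cseq (\<lambda>_. - 1) * f \<in> G" by (intro G_mult const_G)
  moreover have "cseq (\<lambda>_. - 1) * f = - f" by (auto simp: fun_eq_iff pointwise cseq_apply)
  ultimately show ?thesis by simp
qed

lemma G_prod: "(\<And>i. i \<in> I \<Longrightarrow> f i \<in> G) \<Longrightarrow> prod f I \<in> G"
  by (induction I rule: infinite_finite_induct) (auto intro: G_mult one_G)

lemma G_sum: "(\<And>i. i \<in> I \<Longrightarrow> f i \<in> G) \<Longrightarrow> sum f I \<in> G"
  by (induction I rule: infinite_finite_induct) (auto intro: G_add zero_G)

lemma lam_add: "f \<in> G \<Longrightarrow> g \<in> G \<Longrightarrow> lam (f + g) = lam f + lam g"
proof -
  assume f: "f \<in> G" and g: "g \<in> G"
  have "((\<lambda>N. E N (f + g)) \<longlongrightarrow> lam f + lam g) F"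
    by (rule Lim_transform_eventually[OF tendsto_add[OF lam_lim[OF f] lam_lim[OF g]]])
      (rule eventually_mono[OF eventually_Ns], simp add: expect_add[OF G_V[OF f] G_V[OF g]])
  then show ?thesis by (rule lam_eqI)
qed

lemma lam_cseq: "(d \<longlongrightarrow> c) F \<Longrightarrow> f \<in> G \<Longrightarrow> lam (cseq d * f) = c * lam f"
  by (rule lam_eqI) (simp add: expect_cseq tendsto_mult lam_lim)

lemma lam_const: "f \<in> G \<Longrightarrow> lam (cseq (\<lambda>_. c) * f) = c * lam f"
  by (rule lam_cseq[OF tendsto_const])

lemma lam_1: "lam 1 = 1"
proof (rule lam_eqI)
  have "eventually (\<lambda>N. 1 = E N 1) F"
    using eventually_Ns
  proof eventually_elim
    case (elim N)
    interpret prob_space "M N" by (rule prob_M[OF elim])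
    show ?case by (simp add: expect_def one_fun_def prob_space)
  qed
  then show "((\<lambda>N. E N 1) \<longlongrightarrow> 1) F" by (rule Lim_transform_eventually[OF tendsto_const])
qed

lemma lam_uminus: "f \<in> G \<Longrightarrow> lam (- f) = - lam f"
proof -
  assume f: "f \<in> G"
  have "cseq (\<lambda>_. - 1) * f = - f" by (auto simp: fun_eq_iff pointwise cseq_apply)
  then show ?thesis using lam_const[OF f, of "- 1"] by simp
qed

lemma lam_diff: "f \<in> G \<Longrightarrow> g \<in> G \<Longrightarrow> lam (f - g) = lam f - lam g"
  using lam_add[OF _ G_uminus] lam_uminus by (metis diff_conv_add_uminus)

lemma lam_sum: "(\<And>i. i \<in> I \<Longrightarrow> f i \<in> G) \<Longrightarrow> lam (sum f I) = (\<Sum>i\<in>I. lam (f i))"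
proof -
  have l0: "lam 0 = 0" using lam_add[OF zero_G zero_G] by simp
  have "(\<forall>i\<in>I. f i \<in> G) \<longrightarrow> sum f I \<in> G \<and> lam (sum f I) = (\<Sum>i\<in>I. lam (f i))"
    by (induction I rule: infinite_finite_induct) (auto simp: l0 zero_G lam_add intro: G_add)
  then show "(\<And>i. i \<in> I \<Longrightarrow> f i \<in> G) \<Longrightarrow> lam (sum f I) = (\<Sum>i\<in>I. lam (f i))" by blast
qed

text \<open>The ideal of negligible sequences. That the expectation alone tends to zero would not
  suffice to drop a term inside a joint moment.\<close>

definition neg :: "'w scalar_seq set" where "neg = {f \<in> G. \<forall>g\<in>G. lam (f * g) = 0}"

lemma neg_G: "f \<in> neg \<Longrightarrow> f \<in> G" by (simp add: neg_def)
lemma neg_lam: "f \<in> neg \<Longrightarrow> lam f = 0" using one_G by (auto simp: neg_def dest: bspec[of _ _ 1])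
lemma neg_mult: "f \<in> neg \<Longrightarrow> g \<in> G \<Longrightarrow> f * g \<in> neg" by (auto simp: neg_def mult.assoc G_mult)
lemma neg_add: "f \<in> neg \<Longrightarrow> g \<in> neg \<Longrightarrow> f + g \<in> neg"
  by (auto simp: neg_def distrib_right lam_add G_mult G_add)
lemma neg_0: "0 \<in> neg" using lam_add[OF zero_G zero_G] by (auto simp: neg_def zero_G)

lemma neg_null: "(d \<longlongrightarrow> 0) F \<Longrightarrow> f \<in> G \<Longrightarrow> cseq d * f \<in> neg"
  by (auto simp: neg_def mult.assoc lam_cseq G_mult intro!: G_mult intro: cseq_G)

lemma nv_lim: "((\<lambda>N. 1 / of_nat N :: complex) \<longlongrightarrow> 0) F"
  by (rule tendsto_mono[OF F_le]) (rule lim_const_over_n)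

lemma nv_neg: "f \<in> G \<Longrightarrow> cseq (\<lambda>N. 1 / of_nat N) * f \<in> neg"
  by (rule neg_null[OF nv_lim])

lemma neg_cseq_diff: "(d \<longlongrightarrow> c) F \<Longrightarrow> f \<in> G \<Longrightarrow> cseq d * f - cseq (\<lambda>_. c) * f \<in> neg"
proof -
  assume d: "(d \<longlongrightarrow> c) F" and f: "f \<in> G"
  have "cseq d * f - cseq (\<lambda>_. c) * f = cseq (\<lambda>N. d N - c) * f"
    by (auto simp: fun_eq_iff pointwise cseq_apply algebra_simps)
  moreover have "((\<lambda>N. d N - c) \<longlongrightarrow> 0) F" using tendsto_diff[OF d tendsto_const[of c]] by simp
  ultimately show ?thesis using neg_null f by simp
qed

text \<open>The variables that are jointly Gaussian in the limit, with the constant 1 and the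
  negligible sequences adjoined. \<open>lin\<close> is their complex span; products are left out,
  since these may have nonvanishing higher cumulants.\<close>

definition gens :: "'w scalar_seq set" where "gens = Taus \<union> {tr w | w. calt w} \<union> {1} \<union> neg"

definition lin :: "'w scalar_seq set" where "lin = sumset {cseq (\<lambda>_. c) * s | c s. s \<in> gens}"

lemma gens_G: "s \<in> gens \<Longrightarrow> s \<in> G"
  using Taus_R by (auto simp: gens_def intro: R_G tr_G one_G neg_G)

lemma lin_G: "f \<in> lin \<Longrightarrow> f \<in> G"
  unfolding lin_def by (erule sumset_closed) (auto intro: G_mult const_G gens_G zero_G G_add)

lemma lin_base: "s \<in> gens \<Longrightarrow> s \<in> lin"
proof -
  assume "s \<in> gens"
  moreover have "s = cseq (\<lambda>_. 1) * s" by (simp add: cseq_simps)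
  ultimately show ?thesis unfolding lin_def by (intro sumset_base CollectI exI conjI)
qed

lemma lin_add: "f \<in> lin \<Longrightarrow> g \<in> lin \<Longrightarrow> f + g \<in> lin" unfolding lin_def by (rule sumset_add)

lemma lin_neg: "f \<in> neg \<Longrightarrow> f \<in> lin" by (rule lin_base) (simp add: gens_def)

lemma lin_scale: "f \<in> lin \<Longrightarrow> cseq (\<lambda>_. c) * f \<in> lin"
  unfolding lin_def
proof (rule sumset_mult[of _ "{cseq (\<lambda>_. c)}"], rule sumset_base, simp, assumption, safe)
  fix c' s assume "s \<in> gens"
  moreover have "cseq (\<lambda>_. c) * (cseq (\<lambda>_. c') * s) = cseq (\<lambda>_. c * c') * s"
    by (auto simp: fun_eq_iff pointwise cseq_apply)
  ultimately show "cseq (\<lambda>_. c) * (cseq (\<lambda>_. c') * s) \<in> sumset {cseq (\<lambda>_. c) * s | c s. s \<in> gens}"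
    by (intro sumset_base CollectI exI conjI)
qed

lemma lin_cseq: "(d \<longlongrightarrow> c) F \<Longrightarrow> f \<in> lin \<Longrightarrow> cseq d * f \<in> lin"
proof -
  assume d: "(d \<longlongrightarrow> c) F" and f: "f \<in> lin"
  have "cseq (\<lambda>_. c) * f + (cseq d * f - cseq (\<lambda>_. c) * f) \<in> lin"
    by (intro lin_add lin_scale f lin_neg neg_cseq_diff d lin_G)
  then show ?thesis by simp
qed

text \<open>Concentration of normalized traces: each is deterministic up to \<open>1/N\<close> times
  a centred trace, and in products the quadratic terms carry a second factor \<open>1/N\<close> and
  are negligible. The part of first order stays in \<open>lin\<close>, ready to be multiplied by
  \<open>N\<close>.\<close>

lemma R0_form:
  assumes "f \<in> R0"
  shows "\<exists>d c u. (d \<longlongrightarrow> c) F \<and> u \<in> lin \<and> f = cseq d + cseq (\<lambda>N. 1 / of_nat N) * u"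
proof -
  let ?nv = "cseq (\<lambda>N. 1 / of_nat N) :: 'w scalar_seq"
  let ?S = "{f. \<exists>d c u. (d \<longlongrightarrow> c) F \<and> u \<in> lin \<and> f = cseq d + ?nv * u}"
  have cS: "cseq d \<in> ?S" if "(d \<longlongrightarrow> c) F" for d c
    by (intro CollectI exI[of _ d] exI[of _ c] exI[of _ 0] conjI) (use that lin_neg[OF neg_0] in auto)
  have mult: "f * g \<in> ?S" if fg: "f \<in> ?S" "g \<in> ?S" for f g
  proof -
    obtain d c u d' c' u' where *: "(d \<longlongrightarrow> c) F" "u \<in> lin" "f = cseq d + ?nv * u"
      "(d' \<longlongrightarrow> c') F" "u' \<in> lin" "g = cseq d' + ?nv * u'" using fg by auto
    have "f * g = cseq (\<lambda>N. d N * d' N) + ?nv * (cseq d * u' + cseq d' * u + ?nv * (u * u'))"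
      by (simp add: * fun_eq_iff pointwise cseq_apply algebra_simps)
    moreover have "cseq d * u' + cseq d' * u + ?nv * (u * u') \<in> lin"
      by (intro lin_add lin_cseq[OF *(1) *(5)] lin_cseq[OF *(4) *(2)] lin_neg[OF nv_neg[OF G_mult[OF lin_G[OF *(2)] lin_G[OF *(5)]]]])
    moreover have "((\<lambda>N. d N * d' N) \<longlongrightarrow> c * c') F" using * by (intro tendsto_mult)
    ultimately show ?thesis by blast
  qed
  have "prod_list ss \<in> ?S" if "set ss \<subseteq> Trs" for ss
    using that
  proof (induction ss)
    case Nil
    then show ?case using cS[OF tendsto_const[of 1]] by (simp add: cseq_simps)
  next
    case (Cons s ss)
    obtain d c t where "(d \<longlongrightarrow> c) F" "t \<in> Taus" "s = cseq d + ?nv * t" using Trs[of s] Cons by auto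
    moreover have "t \<in> lin" using calculation by (intro lin_base) (simp add: gens_def)
    ultimately have "s \<in> ?S" by blast
    then show ?case using mult Cons by simp
  qed
  then have "{cseq d * prod_list ss | d ss. (\<exists>c. (d \<longlongrightarrow> c) F) \<and> set ss \<subseteq> Trs} \<subseteq> ?S"
    by (intro subsetI, elim CollectE exE conjE, hypsubst) (rule mult[OF cS])
  with R0_gen[OF assms] have "f \<in> ?S"
  proof (rule sumset_closed)
    show "0 \<in> ?S" using cS[OF tendsto_const[of 0]] by (simp add: cseq_simps)
    fix f g assume "f \<in> ?S" "g \<in> ?S"
    then obtain d c u d' c' u' where *: "(d \<longlongrightarrow> c) F" "u \<in> lin" "f = cseq d + ?nv * u"
      "(d' \<longlongrightarrow> c') F" "u' \<in> lin" "g = cseq d' + ?nv * u'" by auto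
    have "f + g = cseq (\<lambda>N. d N + d' N) + ?nv * (u + u')"
      by (simp add: * fun_eq_iff pointwise cseq_apply algebra_simps)
    moreover have "((\<lambda>N. d N + d' N) \<longlongrightarrow> c + c') F" "u + u' \<in> lin"
      by (intro tendsto_add lin_add *)+
    ultimately show "f + g \<in> ?S" by blast
  qed
  then show ?thesis by simp
qed

lemma R0_form_lam:
  assumes "(d \<longlongrightarrow> c) F" "u \<in> G" "f = cseq d + cseq (\<lambda>N. 1 / of_nat N) * u" "g \<in> G"
  shows "lam (f * g) = c * lam g"
proof -
  have "f * g = cseq d * g + cseq (\<lambda>N. 1 / of_nat N) * (u * g)" by (simp add: assms algebra_simps)
  then show ?thesis using assms lam_add[of "cseq d * g" "cseq (\<lambda>N. 1 / of_nat N) * (u * g)"]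
      lam_cseq[OF assms(1,4)] lam_cseq[OF nv_lim, of "u * g"]
    by (simp add: G_mult cseq_G[OF assms(1)] cseq_G[OF nv_lim])
qed

text \<open>In the limit the elements of \<open>R0\<close> act as constants, since their
  fluctuations carry a factor \<open>1/N\<close>.\<close>

lemma lam_R0_mult:
  assumes "f \<in> R0" "g \<in> G" shows "lam (f * g) = lam f * lam g"
proof -
  obtain d c u where *: "(d \<longlongrightarrow> c) F" "u \<in> lin" "f = cseq d + cseq (\<lambda>N. 1 / of_nat N) * u"
    using R0_form[OF assms(1)] by blast
  show ?thesis using R0_form_lam[OF *(1) lin_G[OF *(2)] *(3) assms(2)] R0_form_lam[OF *(1) lin_G[OF *(2)] *(3) one_G] lam_1
    by simp
qed

lemma R0_form':
  assumes "f \<in> R0"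
  shows "\<exists>d u. (d \<longlongrightarrow> lam f) F \<and> u \<in> lin \<and> f = cseq d + cseq (\<lambda>N. 1 / of_nat N) * u"
proof -
  obtain d c u where *: "(d \<longlongrightarrow> c) F" "u \<in> lin" "f = cseq d + cseq (\<lambda>N. 1 / of_nat N) * u"
    using R0_form[OF assms] by blast
  have "lam f = c" using R0_form_lam[OF *(1) lin_G[OF *(2)] *(3) one_G] lam_1 by simp
  then show ?thesis using * by blast
qed

lemma R0_null_neg: "f \<in> R0 \<Longrightarrow> lam f = 0 \<Longrightarrow> g \<in> G \<Longrightarrow> f * g \<in> neg"
  by (auto simp: neg_def mult.assoc lam_R0_mult G_mult R0_G)

text \<open>Replacing the coefficient of a trace by its limit costs a negligible error.\<close>

lemma V1_lin: "f \<in> V1 k \<Longrightarrow> f \<in> lin"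
  unfolding V1_def
proof (erule sumset_closed)
  show "{b * tr w |b w. b \<in> R0 \<and> calt w \<and> length w \<le> k} \<subseteq> lin"
  proof safe
    fix b w assume b: "b \<in> R0" and w: "calt w"
    have "(b - cseq (\<lambda>_. lam b)) * tr w \<in> neg"
    proof (rule R0_null_neg[OF _ _ tr_G[OF w]])
      show "b - cseq (\<lambda>_. lam b) \<in> R0" using R0_add[OF b R0_uminus[OF R0_const[of "lam b"]]] by simp
      show "lam (b - cseq (\<lambda>_. lam b)) = 0"
        using lam_diff[OF R0_G[OF b] const_G[of "lam b"]] lam_const[OF one_G, of "lam b"] lam_1 by simp
    qed
    then have "cseq (\<lambda>_. lam b) * tr w + (b - cseq (\<lambda>_. lam b)) * tr w \<in> lin"
      using w by (intro lin_add lin_scale lin_base lin_neg) (auto simp: gens_def)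
    then show "b * tr w \<in> lin" by (simp add: algebra_simps)
  qed
qed (auto intro: lin_add lin_neg[OF neg_0])

subsection \<open>Cumulants\<close>

text \<open>The limiting cumulant, formed from the limiting moments.\<close>

definition kappa :: "'w scalar_seq list \<Rightarrow> complex" where
  "kappa us = cumulant_of (\<lambda>B. lam (\<Prod>i\<in>B. us ! i)) {..<length us}"

lemma prod_apply: "(\<Prod>i\<in>B. f i) N \<omega> = (\<Prod>i\<in>B. f i N \<omega>)" for f :: "'j \<Rightarrow> 'w scalar_seq"
  by (induction B rule: infinite_finite_induct) (simp_all add: pointwise)

lemma kappa_lim:
  assumes "set us \<subseteq> G"
  shows "((\<lambda>N. joint_cumulant (M N) (map (\<lambda>u. u N) us)) \<longlongrightarrow> kappa us) F"
proof -
  have *: "joint_cumulant (M N) (map (\<lambda>u. u N) us) = cumulant_of (\<lambda>B. E N (\<Prod>i\<in>B. us ! i)) {..<length us}" for N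
    unfolding joint_cumulant_eq length_map
    by (rule cumulant_of_cong) (auto simp: expect_def prod_apply intro!: Bochner_Integration.integral_cong prod.cong)
  have "us ! i \<in> G" if "i < length us" for i using assms that by auto
  then have "((\<lambda>N. E N (\<Prod>i\<in>B. us ! i)) \<longlongrightarrow> lam (\<Prod>i\<in>B. us ! i)) F" if "B \<subseteq> {..<length us}" for B
    using that by (intro lam_lim G_prod) auto
  then show ?thesis unfolding kappa_def *
    by (rule tendsto_cumulant_of[where m = "\<lambda>N B. E N (\<Prod>i\<in>B. us ! i)"])
qed

lemma prod_update:
  assumes "B \<subseteq> {..<length us}" "n \<in> B"
  shows "(\<Prod>i\<in>B. us[n := f] ! i) = f * (\<Prod>i\<in>B - {n}. us ! i)"
proof -
  have "finite B" "n < length us" using assms finite_subset by auto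
  then have "(\<Prod>i\<in>B. us[n := f] ! i) = f * (\<Prod>i\<in>B - {n}. us[n := f] ! i)"
    using assms by (subst prod.remove[of B n]) auto
  also have "(\<Prod>i\<in>B - {n}. us[n := f] ! i) = (\<Prod>i\<in>B - {n}. us ! i)"
    by (intro prod.cong) auto
  finally show ?thesis .
qed

lemma kappa_linear:
  assumes us: "set us \<subseteq> G" and n: "n < length us" and fg: "f \<in> G" "g \<in> G"
  shows "kappa (us[n := cseq (\<lambda>_. c) * f + g]) = c * kappa (us[n := f]) + 1 * kappa (us[n := g])"
  unfolding kappa_def length_list_update
proof (rule cumulant_of_linear[of _ n])
  fix B assume B: "B \<subseteq> {..<length us}" "n \<in> B"
  have "us ! i \<in> G" if "i < length us" for i using us that by auto
  then have P: "(\<Prod>i\<in>B - {n}. us ! i) \<in> G" using B by (intro G_prod) auto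
  have "lam ((cseq (\<lambda>_. c) * f + g) * (\<Prod>i\<in>B - {n}. us ! i)) =
      c * lam (f * (\<Prod>i\<in>B - {n}. us ! i)) + lam (g * (\<Prod>i\<in>B - {n}. us ! i))"
    using lam_add[of "cseq (\<lambda>_. c) * (f * (\<Prod>i\<in>B - {n}. us ! i))" "g * (\<Prod>i\<in>B - {n}. us ! i)"] lam_const[of "f * (\<Prod>i\<in>B - {n}. us ! i)"]
    by (simp add: fg P G_mult const_G distrib_right mult.assoc)
  then show "lam (\<Prod>i\<in>B. us[n := cseq (\<lambda>_. c) * f + g] ! i) =
      c * lam (\<Prod>i\<in>B. us[n := f] ! i) + 1 * lam (\<Prod>i\<in>B. us[n := g] ! i)"
    unfolding prod_update[OF B] by simp
next
  fix B assume "n \<notin> B"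
  then have "(\<Prod>i\<in>B. us[n := h] ! i) = (\<Prod>i\<in>B. us[n := h'] ! i)" for h h'
    by (intro prod.cong refl) (metis nth_list_update_neq)
  then show "lam (\<Prod>i\<in>B. us[n := f] ! i) = lam (\<Prod>i\<in>B. us[n := cseq (\<lambda>_. c) * f + g] ! i) \<and>
      lam (\<Prod>i\<in>B. us[n := g] ! i) = lam (\<Prod>i\<in>B. us[n := cseq (\<lambda>_. c) * f + g] ! i)" by metis
qed (use n in auto)

lemma prod_split_index:
  assumes "B \<subseteq> {..<length us}" "n \<in> B"
  shows "(\<Prod>i\<in>B. us ! i) = us ! n * (\<Prod>i\<in>B - {n}. us ! i)"
  using prod_update[OF assms, of "us ! n"] by simp

lemma kappa_neg: "set us \<subseteq> G \<Longrightarrow> n < length us \<Longrightarrow> us ! n \<in> neg \<Longrightarrow> kappa us = 0"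
  unfolding kappa_def
proof (rule cumulant_of_zero[of _ n])
  fix B assume us: "set us \<subseteq> G" "us ! n \<in> neg" and B: "B \<subseteq> {..<length us}" "n \<in> B"
  have "us ! i \<in> G" if "i < length us" for i using us that by auto
  then have "us ! n * (\<Prod>i\<in>B - {n}. us ! i) \<in> neg" using B us by (intro neg_mult G_prod) auto
  then show "lam (\<Prod>i\<in>B. us ! i) = 0" unfolding prod_split_index[OF B] by (rule neg_lam)
qed auto

lemma kappa_one:
  assumes "n < length us" "us ! n = 1" "length us \<ge> 2" shows "kappa us = 0"
  unfolding kappa_def
proof (rule cumulant_of_const[of _ n, where a = 1])
  show "{..<length us} \<noteq> {n}"
  proof
    assume "{..<length us} = {n}"
    then have "card {..<length us} = card {n}" by (rule arg_cong)
    then show False using assms by simp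
  qed
  fix B assume "B \<subseteq> {..<length us}" "n \<in> B"
  then show "lam (\<Prod>i\<in>B. us ! i) = 1 * lam (\<Prod>i\<in>B - {n}. us ! i)" using assms by (simp add: prod_split_index)
qed (use assms in \<open>auto simp: lam_1\<close>)

text \<open>The coefficients in \<open>R0\<close> factor out of \<open>lam\<close>, so that the loop
  equation becomes a Wick expansion with constant coefficients along the word
  \<open>z\<close>.\<close>

lemma lam_loop:
  assumes z: "calt z" and ws: "list_all calt ws" and a: "a \<in> R"
  shows "lam (a * tr z * T ws) = lam (tr z) * lam (a * T ws) +
    (\<Sum>j<length ws. lam (spokes z (ws ! j)) * lam (a * T (remove_nth j ws)))"
proof -
  obtain l y where zl: "z = l # y" using z by (cases z) (auto simp: calt_iff)
  have L: "l \<in> L" "set y \<subseteq> L" using calt_L[OF z] zl by auto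
  have mR: "mean l y \<in> R0" by (rule mean_R0[OF L])
  have *: "lam (b * tr z * T vs) = lam (mean l y) * lam (b * T vs) +
      (\<Sum>j<length vs. lam (spokes z (vs ! j)) * lam (b * T (remove_nth j vs)))"
    if vs: "list_all calt vs" and b: "b \<in> R" for b vs
  proof -
    have sR: "spokes z (vs ! j) \<in> R0" if "j < length vs" for j
      using vs that calt_L zl L by (intro spokes_R0) (auto simp: list_all_iff)
    have bT: "b * T vs \<in> G" "b * T (remove_nth j vs) \<in> G" for j
      using b vs by (auto intro: G_mult R_G T_G remove_nth_all)
    have sG: "spokes z (vs ! j) * (b * T (remove_nth j vs)) \<in> G" if "j < length vs" for j
      by (rule G_mult[OF R0_G[OF sR[OF that]] bT(2)])
    have e: "b * lead l y vs = mean l y * (b * T vs) + (\<Sum>j<length vs. spokes z (vs ! j) * (b * T (remove_nth j vs)))"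
      by (simp add: lead_def zl distrib_left sum_distrib_left mult_ac)
    have lG: "(\<Sum>j<length vs. spokes z (vs ! j) * (b * T (remove_nth j vs))) \<in> G"
      by (rule G_sum) (use sG in auto)
    have bl: "b * lead l y vs \<in> G" unfolding e by (rule G_add[OF G_mult[OF R0_G[OF mR] bT(1)] lG])
    have tG: "b * tr z * T vs \<in> G" using b vs z by (intro G_mult R_G T_G tr_G)
    have "((\<lambda>N. E N (b * tr z * T vs) - E N (b * lead l y vs)) \<longlongrightarrow> lam (b * tr z * T vs) - lam (b * lead l y vs)) F"
      by (intro tendsto_diff lam_lim tG bl)
    moreover have "((\<lambda>N. E N (b * tr z * T vs) - E N (b * lead l y vs)) \<longlongrightarrow> 0) F"
      using loop_limit[of l y vs b] z vs b by (simp add: zl mult.assoc)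
    ultimately have "lam (b * tr z * T vs) = lam (b * lead l y vs)"
      using tendsto_unique[OF F_neq_bot] by fastforce
    also have "\<dots> = lam (mean l y * (b * T vs)) + (\<Sum>j<length vs. lam (spokes z (vs ! j) * (b * T (remove_nth j vs))))"
      unfolding e lam_add[OF G_mult[OF R0_G[OF mR] bT(1)] lG]
      by (subst lam_sum) (use sG in auto)
    also have "\<dots> = lam (mean l y) * lam (b * T vs) + (\<Sum>j<length vs. lam (spokes z (vs ! j)) * lam (b * T (remove_nth j vs)))"
      using lam_R0_mult[OF mR bT(1)] lam_R0_mult[OF sR bT(2)] by simp
    finally show ?thesis .
  qed
  \<comment> \<open>With no other traces and coefficient 1, the equation itself identifies the
    coefficient of the first term as the limiting mean.\<close>
  have "lam (tr z) = lam (mean l y)" using *[of "[]" 1] R_1 lam_1 by simp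
  then show ?thesis using *[OF ws a] by simp
qed

lemma remove_nth_map: "remove_nth k (map f js) = map f (remove_nth k js)"
  by (simp add: remove_nth_def take_map drop_map)

lemma remove_nth_distinct:
  assumes "distinct js" "k < length js"
  shows "distinct (remove_nth k js)" "set (remove_nth k js) = set js - {js ! k}"
proof -
  have js: "js = take k js @ js ! k # drop (Suc k) js" by (rule id_take_nth_drop[OF assms(2)])
  have "distinct (take k js @ js ! k # drop (Suc k) js)" using assms js by simp
  then show "distinct (remove_nth k js)" by (simp add: remove_nth_def)
  have "set js = set (take k js @ js ! k # drop (Suc k) js)" using js by simp
  then show "set (remove_nth k js) = set js - {js ! k}"
    using \<open>distinct (take k js @ js ! k # drop (Suc k) js)\<close> by (auto simp: remove_nth_def)
qed

text \<open>The loop equation expands along the trace of a word, hence the condition on position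
  \<open>n\<close>. The traces of the given matrices among the other entries are moved into the
  coefficient \<open>a\<close>; in the expansion along \<open>z\<close> they are not paired with it,
  so their Wick coefficient \<open>c\<close> is zero.\<close>

lemma kappa_wick:
  assumes us: "set us \<subseteq> Taus \<union> {tr w | w. calt w}" and n: "n < length us" "us ! n = tr z" "calt z"
    and len: "length us \<ge> 3"
  shows "kappa us = 0"
proof -
  have "\<forall>j. \<exists>w. j < length us \<and> us ! j \<notin> Taus \<longrightarrow> us ! j = tr w \<and> calt w"
    using us nth_mem by blast
  then obtain w where w: "\<And>j. j < length us \<Longrightarrow> us ! j \<notin> Taus \<Longrightarrow> us ! j = tr (w j) \<and> calt (w j)" by metis
  define c where "c j = (if us ! j \<in> Taus then 0 else lam (spokes z (w j)))" for j
  let ?m = "\<lambda>B. lam (\<Prod>i\<in>B. us ! i)"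
  show ?thesis unfolding kappa_def
  proof (rule cumulant_of_wick(1)[of _ n ?m c])
    fix B assume B: "B \<subseteq> {..<length us}" "n \<in> B"
    define Bt Ba where "Bt = {j \<in> B - {n}. us ! j \<notin> Taus}" and "Ba = {j \<in> B - {n}. us ! j \<in> Taus}"
    have fB: "finite B" using B(1) by (rule finite_subset) simp
    then have fin: "finite B" "finite Bt" "finite Ba" unfolding Bt_def Ba_def by auto
    define a where "a = (\<Prod>i\<in>Ba. us ! i)"
    have aR: "a \<in> R"
    proof -
      have "(\<forall>i\<in>Ba. us ! i \<in> R) \<longrightarrow> a \<in> R" unfolding a_def using fin(3)
        by (induction rule: finite_induct) (auto intro: R_1 R_mult)
      then show ?thesis using Taus_R by (auto simp: Ba_def)
    qed
    \<comment> \<open>\<open>traces\<close> takes lists while cumulants are indexed by sets;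
      \<open>js\<close> enumerates the positions that hold words.\<close>
    define js where "js = sorted_list_of_set Bt"
    have js: "distinct js" "set js = Bt" using fin by (auto simp: js_def)
    have wj: "us ! j = tr (w j)" "calt (w j)" if "j \<in> Bt" for j using w that B by (auto simp: Bt_def)
    have T: "T (map w ks) = (\<Prod>j\<in>set ks. us ! j)" if "distinct ks" "set ks \<subseteq> Bt" for ks
      using that wj(1) by (simp add: traces_def o_def prod.distinct_set_conv_list[symmetric] subset_iff cong: map_cong)
    have un: "B - {n} = Ba \<union> Bt" "Ba \<inter> Bt = {}" by (auto simp: Ba_def Bt_def)
    have aT: "a * T (map w ks) = (\<Prod>i\<in>Ba \<union> set ks. us ! i)" if "distinct ks" "set ks \<subseteq> Bt" for ks
      unfolding T[OF that] a_def using fin un that by (subst prod.union_disjoint) (auto intro: finite_subset)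
    have "?m B = lam (a * tr z * T (map w js))"
    proof -
      have "a * tr z * T (map w js) = tr z * (a * T (map w js))" by (simp add: mult_ac)
      then show ?thesis unfolding prod_split_index[OF B] n(2) un(1) using aT[of js] js by simp
    qed
    also have "\<dots> = lam (tr z) * lam (a * T (map w js)) +
        (\<Sum>k<length (map w js). lam (spokes z (map w js ! k)) * lam (a * T (remove_nth k (map w js))))"
      by (rule lam_loop) (use n aR js wj(2) in \<open>auto simp: list_all_iff\<close>)
    also have "lam (a * T (map w js)) = ?m (B - {n})" unfolding un(1) using aT[of js] js by simp
    also have "lam (tr z) = ?m {n}" using n by simp
    also have "(\<Sum>k<length (map w js). lam (spokes z (map w js ! k)) * lam (a * T (remove_nth k (map w js)))) =
        (\<Sum>k<length js. c (js ! k) * ?m (B - {n, js ! k}))"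
    proof (rule sum.cong)
      fix k assume "k \<in> {..<length js}"
      then have k: "k < length js" by simp
      then have jk: "js ! k \<in> Bt" using js by auto
      have "js ! k \<notin> Ba" using jk un(2) by blast
      then have "Ba \<union> set (remove_nth k js) = (B - {n}) - {js ! k}"
        unfolding remove_nth_distinct(2)[OF js(1) k] un(1) js(2) by blast
      then have "Ba \<union> set (remove_nth k js) = B - {n, js ! k}" by blast
      then have "a * T (remove_nth k (map w js)) = (\<Prod>i\<in>B - {n, js ! k}. us ! i)"
        using aT[OF remove_nth_distinct(1)[OF js(1) k]] remove_nth_distinct(2)[OF js(1) k] js(2)
        by (simp add: remove_nth_map)
      then show "lam (spokes z (map w js ! k)) * lam (a * T (remove_nth k (map w js))) = c (js ! k) * ?m (B - {n, js ! k})"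
        using k jk by (simp add: c_def Bt_def)
    qed simp
    also have "\<dots> = (\<Sum>j\<in>Bt. c j * ?m (B - {n, j}))"
      by (rule sum.reindex_bij_betw[OF bij_betw_nth]) (use js in auto)
    also have "\<dots> = (\<Sum>j\<in>B - {n}. c j * ?m (B - {n, j}))"
      by (rule sum.mono_neutral_left) (use fin in \<open>auto simp: Bt_def c_def\<close>)
    finally show "?m B = ?m {n} * ?m (B - {n}) + (\<Sum>j\<in>B - {n}. c j * ?m (B - {n, j}))" .
  qed (use n len in \<open>auto simp: lam_1\<close>)
qed

text \<open>A constant or a negligible entry annihilates the cumulant. Otherwise either all entries
  are traces of given matrices, and \<open>Taus_cumulant\<close> applies, or one of them is the
  trace of a word and can be expanded.\<close>

lemma kappa_gens:
  assumes us: "set us \<subseteq> gens" and len: "length us \<ge> 3"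
  shows "kappa us = 0"
proof -
  have G: "set us \<subseteq> G" using us gens_G by auto
  have gi: "us ! i \<in> gens" if "i < length us" for i using us that by auto
  show ?thesis
  proof (cases "\<exists>n<length us. us ! n \<in> neg \<or> us ! n = 1")
    case True
    then show ?thesis using kappa_neg[OF G] kappa_one len by auto
  next
    case False
    have TW: "us ! i \<in> Taus \<union> {tr w | w. calt w}" if "i < length us" for i
      using gi[OF that] False that by (auto simp: gens_def)
    then have sub: "set us \<subseteq> Taus \<union> {tr w | w. calt w}" by (auto simp only: in_set_conv_nth subset_iff)
    show ?thesis
    proof (cases "set us \<subseteq> Taus")
      case True
      from Taus_cumulant[OF True len] kappa_lim[OF G] show ?thesis
        using tendsto_unique[OF F_neq_bot] by blast
    next
      case False
      then obtain n where n: "n < length us" "us ! n \<notin> Taus" by (metis in_set_conv_nth subsetI)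
      then obtain z where "us ! n = tr z" "calt z" using TW by blast
      then show ?thesis using kappa_wick[OF sub n(1) _ _ len] by blast
    qed
  qed
qed

text \<open>Multilinearity, one slot at a time: \<open>n\<close> counts the leading slots that may
  still hold arbitrary elements of \<open>lin\<close>, and the last of these is expanded into
  generators.\<close>

lemma kappa_lin:
  assumes "set us \<subseteq> lin" "length us \<ge> 3" shows "kappa us = 0"
proof -
  have "length us \<ge> 3 \<longrightarrow> n \<le> length us \<longrightarrow> (\<forall>i<n. us ! i \<in> lin) \<longrightarrow> (\<forall>i<length us. n \<le> i \<longrightarrow> us ! i \<in> gens) \<longrightarrow> kappa us = 0" for n us
  proof (induction n arbitrary: us)
    case 0
    then show ?case using kappa_gens by (auto simp: in_set_conv_nth subset_iff)
  next
    case (Suc n)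
    show ?case
    proof (intro impI)
      assume len: "length us \<ge> 3" "Suc n \<le> length us" and l: "\<forall>i<Suc n. us ! i \<in> lin"
        and g: "\<forall>i<length us. Suc n \<le> i \<longrightarrow> us ! i \<in> gens"
      have G: "set us \<subseteq> G"
      proof
        fix u assume "u \<in> set us"
        then obtain i where "i < length us" "u = us ! i" by (auto simp: in_set_conv_nth)
        then show "u \<in> G" using l g lin_G gens_G by (cases "i < Suc n") auto
      qed
      have base: "kappa (us[n := s]) = 0" if "s \<in> gens" for s
        using Suc.IH[of "us[n := s]"] len l g that by (auto simp: nth_list_update)
      have "kappa (us[n := f]) = 0" if "f \<in> lin" for f
        using that unfolding lin_def
      proof induction
        case zero
        have "0 \<in> gens" using neg_0 by (simp add: gens_def)
        then show ?case by (rule base)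
      next
        case (plus x y)
        then obtain c s where x: "x = cseq (\<lambda>_. c) * s" "s \<in> gens" by auto
        have "y \<in> lin" using plus(2) by (simp add: lin_def)
        then show ?case unfolding x(1)
          using kappa_linear[OF G _ gens_G[OF x(2)] lin_G, of n y c] len base[OF x(2)] plus(3) by simp
      qed
      from this[of "us ! n"] show "kappa us = 0" using l by simp
    qed
  qed
  from this[of us "length us"] show ?thesis using assms by auto
qed

lemma kappa_pair: "kappa [u, v] = lam (u * v) - lam u * lam v"
proof -
  have "{..<length [u, v]} = {0, 1::nat}" by auto
  then show ?thesis unfolding kappa_def by (simp only:) (subst cumulant_of_pair, auto simp: lam_1)
qed

text \<open>The sequences \<open>fs\<close> need not have limiting moments, since the deterministic
  parts \<open>D\<close> may diverge; cumulants of order at least two do not see them.\<close>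

lemma joint_cumulant_lim:
  assumes "list_all2 (\<lambda>f u. u \<in> G \<and> (\<exists>D. f = cseq D + u)) fs us" "length us \<ge> 2"
  shows "((\<lambda>N. joint_cumulant (M N) (map (\<lambda>f. f N) fs)) \<longlongrightarrow> kappa us) F"
proof (rule Lim_transform_eventually[OF kappa_lim])
  show "set us \<subseteq> G" using assms(1) by (auto simp: list_all2_conv_all_nth in_set_conv_nth)
  show "eventually (\<lambda>N. joint_cumulant (M N) (map (\<lambda>u. u N) us) = joint_cumulant (M N) (map (\<lambda>f. f N) fs)) F"
    using eventually_Ns
  proof eventually_elim
    case (elim N)
    interpret prob_space "M N" by (rule prob_M[OF elim])
    have "list_all2 (\<lambda>X Y. Y \<in> all_moments (M N) \<and> (\<exists>D. \<forall>\<omega>. X \<omega> = D + Y \<omega>)) (map (\<lambda>f. f N) fs) (map (\<lambda>u. u N) us)"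
      unfolding list.rel_map using assms(1)
    proof (rule list_all2_mono)
      fix f u assume "u \<in> G \<and> (\<exists>D. f = cseq D + u)"
      then obtain D where "u \<in> V" "f = cseq D + u" using G_V by auto
      then show "u N \<in> all_moments (M N) \<and> (\<exists>D. \<forall>\<omega>. f N \<omega> = D + u N \<omega>)"
        using elim by (auto simp: moment_seqs_def pointwise cseq_apply)
    qed
    from joint_cumulant_shift[OF this, of "[]"] assms(2) show ?case by simp
  qed
qed

subsection \<open>Traces of arbitrary words\<close>

text \<open>The form that \<open>tr_word\<close> gives to the trace of an arbitrary word: a
  normalized coefficient times \<open>N\<close>, and a remainder without a summand of order
  \<open>N\<close>.\<close>

definition Nn :: "'w scalar_seq set" where
  "Nn = {b * tr [] + v | b v. b \<in> R0 \<and> (\<exists>k. v \<in> V1 k)}"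

lemma Nn_add: "f \<in> Nn \<Longrightarrow> g \<in> Nn \<Longrightarrow> f + g \<in> Nn"
proof -
  assume "f \<in> Nn" "g \<in> Nn"
  then obtain b v k b' v' k' where *: "b \<in> R0" "v \<in> V1 k" "f = b * tr [] + v" "b' \<in> R0" "v' \<in> V1 k'" "g = b' * tr [] + v'"
    by (auto simp: Nn_def)
  have "f + g = (b + b') * tr [] + (v + v')" by (simp add: * algebra_simps)
  moreover have "v + v' \<in> V1 (max k k')" using * by (intro V1_add) (auto intro: V1_mono)
  ultimately show ?thesis using * R0_add unfolding Nn_def by blast
qed

lemma Nn_scale: "e \<in> R0 \<Longrightarrow> f \<in> Nn \<Longrightarrow> e * f \<in> Nn"
proof -
  assume e: "e \<in> R0" and "f \<in> Nn"
  then obtain b v k where *: "b \<in> R0" "v \<in> V1 k" "f = b * tr [] + v" by (auto simp: Nn_def)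
  have "e * f = (e * b) * tr [] + e * v" by (simp add: * algebra_simps)
  then show ?thesis using R0_mult[OF e *(1)] V1_scale[OF e *(2)] unfolding Nn_def by blast
qed

text \<open>In HOL the product is 0 at \<open>N = 0\<close>, so this is a sequence with limit 1 and
  not the constant 1.\<close>

lemma nn_lim: "((\<lambda>N. of_nat N * (1 / of_nat N) :: complex) \<longlongrightarrow> 1) F"
  by (rule Lim_transform_eventually[OF tendsto_const])
    (rule filter_leD[OF F_le], rule eventually_mono[OF eventually_gt_at_top[of 0]], simp)

text \<open>The fluctuation of the coefficient \<open>b\<close> is of order \<open>1/N\<close>;
  multiplied by \<open>N\<close> it survives as an element of \<open>lin\<close>. So an unnormalized
  trace is a deterministic sequence plus an element of \<open>lin\<close>, and its cumulants of
  order at least two are those of the latter.\<close>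

lemma Nn_affine:
  assumes "b \<in> R0" "v \<in> V1 k"
  shows "\<exists>d u. (d \<longlongrightarrow> lam b) F \<and> u \<in> lin \<and> b * tr [] + v = cseq (\<lambda>N. of_nat N * d N) + u"
proof -
  obtain d u where *: "(d \<longlongrightarrow> lam b) F" "u \<in> lin" "b = cseq d + cseq (\<lambda>N. 1 / of_nat N) * u"
    using R0_form'[OF assms(1)] by blast
  have "b * tr [] + v = cseq (\<lambda>N. of_nat N * d N) + (cseq (\<lambda>N. of_nat N * (1 / of_nat N)) * u + v)"
    unfolding *(3) tr_Nil by (simp add: fun_eq_iff pointwise cseq_apply algebra_simps)
  moreover have "cseq (\<lambda>N. of_nat N * (1 / of_nat N)) * u + v \<in> lin"
    by (intro lin_add lin_cseq[OF nn_lim] * V1_lin[OF assms(2)])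
  ultimately show ?thesis using * by blast
qed

lemma Nn_V: "f \<in> Nn \<Longrightarrow> f \<in> V"
  unfolding Nn_def tr_Nil using V_add[OF V_mult[OF G_V[OF R0_G] V_cseq] G_V[OF V1_G]] by auto

lemma Nn_mean:
  assumes "b \<in> R0" "v \<in> V1 k"
  shows "((\<lambda>N. E N (b * tr [] + v) / of_nat N) \<longlongrightarrow> lam b) F"
proof -
  have "((\<lambda>N. E N b + 1 / of_nat N * E N v) \<longlongrightarrow> lam b + 0 * lam v) F"
    by (intro tendsto_add tendsto_mult lam_lim nv_lim R0_G[OF assms(1)] V1_G[OF assms(2)])
  then have "((\<lambda>N. E N b + 1 / of_nat N * E N v) \<longlongrightarrow> lam b) F" by simp
  then show ?thesis
  proof (rule Lim_transform_eventually)
    show "eventually (\<lambda>N. E N b + 1 / of_nat N * E N v = E N (b * tr [] + v) / of_nat N) F"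
      using eventually_Ns filter_leD[OF F_le eventually_gt_at_top[of 0]]
    proof eventually_elim
      case (elim N)
      have "b * tr [] \<in> V" unfolding tr_Nil by (intro V_mult V_cseq G_V R0_G assms)
      then have "E N (b * tr [] + v) = of_nat N * E N b + E N v"
        using expect_add[OF _ G_V[OF V1_G[OF assms(2)]] elim(1), of "b * tr []"] expect_cseq[of M N of_nat b]
        by (simp add: tr_Nil mult.commute)
      then show ?case using elim(2) by (simp add: add_divide_distrib)
    qed
  qed
qed

theorem Nn_mean_conv: "f \<in> Nn \<Longrightarrow> \<exists>c. ((\<lambda>N. E N f / of_nat N) \<longlongrightarrow> c) F"
  using Nn_mean unfolding Nn_def by blast

lemma Nn_obtain:
  assumes "set fs \<subseteq> Nn"
  obtains us where "list_all2 (\<lambda>f u. u \<in> G \<and> (\<exists>D. f = cseq D + u)) fs us" "set us \<subseteq> lin"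
proof -
  have "\<exists>us. list_all2 (\<lambda>f u. u \<in> G \<and> (\<exists>D. f = cseq D + u)) fs us \<and> set us \<subseteq> lin" using assms
  proof (induction fs)
    case (Cons f fs)
    then obtain us where us: "list_all2 (\<lambda>f u. u \<in> G \<and> (\<exists>D. f = cseq D + u)) fs us" "set us \<subseteq> lin" by auto
    obtain b v k where "b \<in> R0" "v \<in> V1 k" "f = b * tr [] + v" using Cons by (auto simp: Nn_def)
    then obtain d u where "u \<in> lin" "f = cseq (\<lambda>N. of_nat N * d N) + u" using Nn_affine by metis
    then show ?case using us lin_G by (intro exI[of _ "u # us"]) auto
  qed auto
  then show thesis using that by blast
qed

theorem Nn_cumulant:
  assumes "set fs \<subseteq> Nn" "length fs \<ge> 3"
  shows "((\<lambda>N. joint_cumulant (M N) (map (\<lambda>f. f N) fs)) \<longlongrightarrow> 0) F"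
proof -
  obtain us where us: "list_all2 (\<lambda>f u. u \<in> G \<and> (\<exists>D. f = cseq D + u)) fs us" "set us \<subseteq> lin"
    using Nn_obtain[OF assms(1)] .
  have "length us = length fs" using us list_all2_lengthD by fastforce
  then show ?thesis using joint_cumulant_lim[OF us(1)] kappa_lin[OF us(2)] assms(2) by simp
qed

theorem Nn_pair_conv:
  assumes "f \<in> Nn" "g \<in> Nn"
  shows "\<exists>c. ((\<lambda>N. joint_cumulant (M N) [f N, g N]) \<longlongrightarrow> c) F"
proof -
  obtain us where us: "list_all2 (\<lambda>f u. u \<in> G \<and> (\<exists>D. f = cseq D + u)) [f, g] us" "set us \<subseteq> lin"
    using Nn_obtain[of "[f, g]"] assms by auto
  have "length us = 2" using us list_all2_lengthD by fastforce
  then show ?thesis using joint_cumulant_lim[OF us(1)] by auto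
qed

text \<open>The trace of a word each of whose letters is a traceless letter \<open>fst x\<close>
  plus a scalar \<open>snd x\<close>, multiplied out from left to right; \<open>pre\<close> holds
  the traceless letters chosen so far.\<close>

primrec utr :: "'l list \<Rightarrow> ('l \<times> 'w scalar_seq) list \<Rightarrow> 'w scalar_seq" where
  "utr pre [] = tr pre"
| "utr pre (x # xs) = utr (pre @ [fst x]) xs + snd x * utr pre xs"

definition valid :: "('l \<times> 'w scalar_seq) list \<Rightarrow> bool" where
  "valid xs \<longleftrightarrow> (\<forall>x\<in>set xs. fst x \<in> L \<and> snd x \<in> R0)"

lemma utr_Nn: "set pre \<subseteq> L \<Longrightarrow> valid xs \<Longrightarrow> utr pre xs \<in> Nn"
proof (induction xs arbitrary: pre)
  case Nil
  obtain b where "b \<in> R0" "tr pre - b * tr [] \<in> V1 (length pre)" using tr_word Nil by blast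
  then have "tr pre = b * tr [] + (tr pre - b * tr [])" "b \<in> R0" "\<exists>k. tr pre - b * tr [] \<in> V1 k" by auto
  then show ?case unfolding Nn_def utr.simps by blast
qed (auto simp: valid_def intro!: Nn_add Nn_scale)

text \<open>By cyclicity of the trace, the letters \<open>p\<close> at the front may be thought of as standing at the end.\<close>

lemma utr_centred:
  assumes "valid xs" "\<forall>x\<in>set xs. lam (snd x) = 0" "lalt (q @ map fst xs @ p)" "q @ map fst xs @ p \<noteq> []"
  shows "\<exists>b v k. b \<in> R0 \<and> lam b = 0 \<and> v \<in> V1 k \<and> utr (p @ q) xs = b * tr [] + v"
  using assms
proof (induction xs arbitrary: q)
  case Nil
  then have L: "set p \<subseteq> L" "set q \<subseteq> L" by (auto simp: lin_alt_def)
  have "tr (p @ q) = tr (q @ p)" using tr_rot L by blast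
  also have "\<dots> \<in> V1 (length (q @ p))" using Nil by (intro tr_lalt) auto
  finally have v: "tr (p @ q) \<in> V1 (length (q @ p))" .
  have "lam 0 = 0" using lam_add[OF zero_G zero_G] by simp
  then show ?case using R0_0 v by (intro exI[of _ 0] exI[of _ "tr (p @ q)"] exI[of _ "length (q @ p)"]) simp
next
  case (Cons x xs)
  have "\<exists>b v k. b \<in> R0 \<and> lam b = 0 \<and> v \<in> V1 k \<and> utr (p @ (q @ [fst x])) xs = b * tr [] + v"
    by (rule Cons.IH) (use Cons.prems in \<open>auto simp: valid_def\<close>)
  then obtain b v k where 1: "b \<in> R0" "lam b = 0" "v \<in> V1 k" "utr (p @ q @ [fst x]) xs = b * tr [] + v" by auto
  have L: "set (p @ q) \<subseteq> L" using Cons.prems(3) by (auto simp: lin_alt_def)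
  have "utr (p @ q) xs \<in> Nn" by (rule utr_Nn[OF L]) (use Cons.prems in \<open>auto simp: valid_def\<close>)
  then obtain b' v' k' where 2: "b' \<in> R0" "v' \<in> V1 k'" "utr (p @ q) xs = b' * tr [] + v'" by (auto simp: Nn_def)
  have x: "snd x \<in> R0" "lam (snd x) = 0" using Cons.prems by (auto simp: valid_def)
  have "utr (p @ q) (x # xs) = (b + snd x * b') * tr [] + (v + snd x * v')"
    using 1(4) 2(3) by (simp add: algebra_simps)
  moreover have "b + snd x * b' \<in> R0" using 1 2 x by (intro R0_add R0_mult)
  moreover have "lam (b + snd x * b') = 0"
    using 1 2 x lam_add[OF R0_G[OF 1(1)] R0_G[OF R0_mult[OF x(1) 2(1)]]] lam_R0_mult[OF x(1) R0_G[OF 2(1)]] by simp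
  moreover have "v + snd x * v' \<in> V1 (max k k')"
    using V1_scale[OF x(1) 2(2)] 1(3) by (intro V1_add) (auto intro: V1_mono)
  ultimately show ?case by blast
qed

text \<open>In \<open>utr_centred\<close> the coefficient of \<open>tr []\<close>, which is the
  limit of the normalized trace, has limit zero.\<close>

theorem utr_free:
  assumes "valid xs" "\<forall>x\<in>set xs. lam (snd x) = 0" "lalt (map fst xs)" "xs \<noteq> []"
  shows "((\<lambda>N. E N (utr [] xs) / of_nat N) \<longlongrightarrow> 0) F"
  using utr_centred[of xs "[]" "[]"] Nn_mean assms by fastforce

text \<open>Two null factors next to \<open>tr []\<close> need not be negligible. With
  \<open>e = d + u / N\<close> and \<open>b = d' + u' / N\<close>, the product
  \<open>N * d * d'\<close> may even diverge, but it is deterministic; each of the remaining terms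
  contains one of \<open>d\<close>, \<open>d'\<close>, \<open>1/N\<close> or \<open>e\<close> as a
  null factor and no further \<open>N\<close>.\<close>

lemma null_product:
  assumes e: "e \<in> R0" "lam e = 0" and b: "b \<in> R0" "lam b = 0" "v \<in> V1 k"
  shows "\<exists>D. e * (b * tr [] + v) - cseq D \<in> neg"
proof -
  obtain d u where 1: "(d \<longlongrightarrow> 0) F" "u \<in> lin" "e = cseq d + cseq (\<lambda>N. 1 / of_nat N) * u" using R0_form'[OF e(1)] e by auto
  obtain d' u' where 2: "(d' \<longlongrightarrow> 0) F" "u' \<in> lin" "b = cseq d' + cseq (\<lambda>N. 1 / of_nat N) * u'" using R0_form'[OF b(1)] b by auto
  let ?nn = "cseq (\<lambda>N. of_nat N * (1 / of_nat N)) :: 'w scalar_seq"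
  have "e * (b * tr [] + v) - cseq (\<lambda>N. of_nat N * d N * d' N) =
      cseq d * (?nn * u') + cseq d' * (?nn * u) + cseq (\<lambda>N. 1 / of_nat N) * (?nn * (u * u')) + e * v"
    unfolding 1(3) 2(3) tr_Nil by (simp add: fun_eq_iff pointwise cseq_apply algebra_simps)
  also have "\<dots> \<in> neg"
    by (intro neg_add neg_null[OF 1(1)] neg_null[OF 2(1)] nv_neg R0_null_neg[OF e] G_mult cseq_G[OF nn_lim] lin_G[OF 1(2)] lin_G[OF 2(2)] V1_G[OF b(3)])
  finally show ?thesis by blast
qed

text \<open>Up to a deterministic shift and a negligible error, only the term with all traceless
  letters counts. Where a letter is replaced by its scalar, both this scalar and the coefficient of
  \<open>tr []\<close> in what is left have limit zero, so \<open>null_product\<close>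
  applies.\<close>

lemma utr_cyc:
  assumes "valid xs" "\<forall>x\<in>set xs. lam (snd x) = 0" "calt (pre @ map fst xs)"
  shows "\<exists>D. utr pre xs - tr (pre @ map fst xs) - cseq D \<in> neg"
  using assms
proof (induction xs arbitrary: pre)
  case Nil
  show ?case by (rule exI[of _ "\<lambda>_. 0"]) (simp add: cseq_simps neg_0)
next
  case (Cons x xs)
  have "\<exists>D. utr (pre @ [fst x]) xs - tr ((pre @ [fst x]) @ map fst xs) - cseq D \<in> neg"
    by (rule Cons.IH) (use Cons.prems in \<open>auto simp: valid_def\<close>)
  then obtain D where D: "utr (pre @ [fst x]) xs - tr (pre @ fst x # map fst xs) - cseq D \<in> neg"
    unfolding append_assoc append_Cons append_Nil by blast
  have x: "snd x \<in> R0" "lam (snd x) = 0" using Cons.prems by (auto simp: valid_def)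
  \<comment> \<open>Without the letter of \<open>x\<close> the word need no longer alternate across
    the gap, but it does when it is read around the cycle starting behind the gap.\<close>
  have "lalt (map fst xs @ pre)" "map fst xs @ pre \<noteq> []"
    using Cons.prems(3) by (cases "pre = []"; cases "xs = []"; auto simp: calt_iff lalt_append lalt_Cons last_map hd_map)+
  then obtain b v k where b: "b \<in> R0" "lam b = 0" "v \<in> V1 k" "utr pre xs = b * tr [] + v"
    using utr_centred[of xs "[]" pre] Cons.prems by (auto simp: valid_def)
  obtain D' where D': "snd x * (b * tr [] + v) - cseq D' \<in> neg" using null_product[OF x b(1-3)] by blast
  have "utr pre (x # xs) - tr (pre @ map fst (x # xs)) - cseq (\<lambda>N. D N + D' N) =
      (utr (pre @ [fst x]) xs - tr (pre @ fst x # map fst xs) - cseq D) + (snd x * (b * tr [] + v) - cseq D')"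
    using b(4) by (simp add: cseq_simps(1)[symmetric])
  then show ?case using neg_add[OF D D'] by metis
qed

text \<open>After removal of the shifts and of the negligible parts, the covariance is that of two
  cyclically alternating words, and \<open>lam_loop\<close> with a single other trace gives it as
  \<open>spokes\<close>.\<close>

theorem utr_pair:
  assumes x: "valid xs" "\<forall>x\<in>set xs. lam (snd x) = 0" "calt (map fst xs)"
    and y: "valid ys" "\<forall>x\<in>set ys. lam (snd x) = 0" "calt (map fst ys)"
  shows "((\<lambda>N. joint_cumulant (M N) [utr [] xs N, utr [] ys N]) \<longlongrightarrow> lam (spokes (map fst xs) (map fst ys))) F"
proof -
  let ?z = "map fst xs" and ?w = "map fst ys"
  obtain D where D: "utr [] xs - tr ?z - cseq D \<in> neg" using utr_cyc[OF x(1,2), of "[]"] x(3) by auto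
  obtain D' where D': "utr [] ys - tr ?w - cseq D' \<in> neg" using utr_cyc[OF y(1,2), of "[]"] y(3) by auto
  define i j where "i = utr [] xs - tr ?z - cseq D" and "j = utr [] ys - tr ?w - cseq D'"
  have ij: "i \<in> neg" "j \<in> neg" using D D' by (simp_all add: i_def j_def)
  have e: "utr [] xs = cseq D + (tr ?z + i)" "utr [] ys = cseq D' + (tr ?w + j)" by (simp_all add: i_def j_def)
  have G: "tr ?z \<in> G" "tr ?w \<in> G" "i \<in> G" "j \<in> G" using x y ij by (auto intro: tr_G neg_G)
  have "list_all2 (\<lambda>f u. u \<in> G \<and> (\<exists>D. f = cseq D + u)) [utr [] xs, utr [] ys] [tr ?z + i, tr ?w + j]"
    using e G by (auto intro: G_add)
  from joint_cumulant_lim[OF this] have "((\<lambda>N. joint_cumulant (M N) [utr [] xs N, utr [] ys N]) \<longlongrightarrow> kappa [tr ?z + i, tr ?w + j]) F"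
    by simp
  moreover have "kappa [tr ?z + i, tr ?w + j] = lam (spokes ?z ?w)"
  proof -
    have n: "tr ?z * j + i * (tr ?w + j) \<in> neg"
      using neg_mult[OF ij(2) G(1)] neg_mult[OF ij(1) G_add[OF G(2,4)]] by (intro neg_add) (simp_all add: mult.commute)
    have "(tr ?z + i) * (tr ?w + j) = tr ?z * tr ?w + (tr ?z * j + i * (tr ?w + j))" by (simp add: algebra_simps)
    then have 1: "lam ((tr ?z + i) * (tr ?w + j)) = lam (tr ?z * tr ?w)"
      using lam_add[OF G_mult[OF G(1,2)] neg_G[OF n]] neg_lam[OF n] by simp
    have 2: "lam (tr ?z + i) = lam (tr ?z)" "lam (tr ?w + j) = lam (tr ?w)"
      using lam_add G neg_lam ij by simp_all
    have "lam (1 * tr ?z * T [?w]) = lam (tr ?z) * lam (1 * T [?w]) + (\<Sum>j<length [?w]. lam (spokes ?z ([?w] ! j)) * lam (1 * T (remove_nth j [?w])))"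
      by (rule lam_loop) (use x y R_1 in auto)
    then have "lam (tr ?z * tr ?w) = lam (tr ?z) * lam (tr ?w) + lam (spokes ?z ?w)"
      by (simp add: remove_nth_def lam_1)
    then show ?thesis unfolding kappa_pair 1 2 by simp
  qed
  ultimately show ?thesis by simp
qed

lemma lam_contr:
  "set u \<subseteq> L \<Longrightarrow> set v \<subseteq> L \<Longrightarrow> lam (contr u v) =
    (if length u = length v then \<Prod>i<length u. lam (prc (v ! i) (u ! i)) else 0)"
proof (induction u v rule: contr.induct)
  case (2 x u y v)
  have "lam (contr (x # u) (y # v)) = lam (prc y x) * lam (contr u v)"
    using 2 by (simp add: lam_R0_mult prc_R0 R0_G contr_R0)
  then show ?case using 2 by (simp add: prod.lessThan_Suc_shift del: prod.lessThan_Suc)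
next
  case 1
  then show ?case by (simp add: lam_1)
qed (use lam_add[OF zero_G zero_G] in auto)

end

section \<open>Random matrices conjugated by independent Haar-distributed orthogonal matrices\<close>

text \<open>Shown by the moment-cumulant recursion instead of transporting partitions: the moments
  of all subsets determine the cumulants.\<close>

lemma cumulant_of_image:
  assumes "finite S" "inj_on f S" "m {} = 1"
  shows "cumulant_of m (f ` S) = cumulant_of (\<lambda>B. m (f ` B)) S"
  using assms(1,2)
proof (induction S rule: finite_psubset_induct)
  case (psubset S)
  show ?case
  proof (cases "S = {}")
    case True
    then show ?thesis by (simp add: cumulant_of_def partition_on_empty)
  next
    case False
    then obtain i where i: "i \<in> S" by blast
    let ?K = "{V. V \<subset> S \<and> i \<in> V}" and ?m = "\<lambda>B. m (f ` B)"
    have split: "{V. V \<subseteq> S \<and> i \<in> V} = insert S ?K" using i by auto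
    have fK: "finite ?K" using psubset.hyps by (auto intro: finite_subset[of _ "Pow S"])
    have bij: "{W. W \<subseteq> f ` S \<and> f i \<in> W} = (`) f ` {V. V \<subseteq> S \<and> i \<in> V}"
    proof safe
      fix W assume W: "W \<subseteq> f ` S" "f i \<in> W"
      then have "W = f ` {x \<in> S. f x \<in> W}" by auto
      then show "W \<in> (`) f ` {V. V \<subseteq> S \<and> i \<in> V}" using W i by blast
    qed auto
    have inj: "inj_on ((`) f) {V. V \<subseteq> S \<and> i \<in> V}"
      using psubset.prems by (auto simp: inj_on_def) (metis inj_on_image_eq_iff psubset.prems subsetD)+
    have "?m S = (\<Sum>W | W \<subseteq> f ` S \<and> f i \<in> W. cumulant_of m W * m (f ` S - W))"
      using psubset.hyps i assms(3) by (intro moment_cumulant_rec) auto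
    also have "\<dots> = (\<Sum>V | V \<subseteq> S \<and> i \<in> V. cumulant_of m (f ` V) * m (f ` S - f ` V))"
      unfolding bij by (simp add: sum.reindex[OF inj])
    also have "\<dots> = (\<Sum>V | V \<subseteq> S \<and> i \<in> V. cumulant_of m (f ` V) * ?m (S - V))"
      using psubset.prems by (intro sum.cong refl) (auto simp: inj_on_image_set_diff)
    also have "\<dots> = cumulant_of m (f ` S) + (\<Sum>V\<in>?K. cumulant_of m (f ` V) * ?m (S - V))"
      unfolding split using fK assms(3) by (subst sum.insert) auto
    also have "(\<Sum>V\<in>?K. cumulant_of m (f ` V) * ?m (S - V)) = (\<Sum>V\<in>?K. cumulant_of ?m V * ?m (S - V))"
      using psubset by (intro sum.cong refl) (auto simp: inj_on_subset)
    finally have 1: "?m S = cumulant_of m (f ` S) + (\<Sum>V\<in>?K. cumulant_of ?m V * ?m (S - V))" .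
    have "?m S = (\<Sum>V | V \<subseteq> S \<and> i \<in> V. cumulant_of ?m V * ?m (S - V))"
      using psubset.hyps i assms(3) by (intro moment_cumulant_rec) auto
    also have "\<dots> = cumulant_of ?m S + (\<Sum>V\<in>?K. cumulant_of ?m V * ?m (S - V))"
      unfolding split using fK assms(3) by (subst sum.insert) auto
    finally show ?thesis using 1 by simp
  qed
qed

text \<open>Integrals refer to \<open>P\<close>; \<open>H\<close> records by which events the
  variable is determined.\<close>

definition sub_moments :: "'w measure \<Rightarrow> 'w measure \<Rightarrow> ('w \<Rightarrow> complex) set" where
  "sub_moments P H = {g \<in> all_moments P. g \<in> borel_measurable H}"

lemma sub_moments_add: "f \<in> sub_moments P H \<Longrightarrow> g \<in> sub_moments P H \<Longrightarrow> (\<lambda>\<omega>. f \<omega> + g \<omega>) \<in> sub_moments P H"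
  by (auto simp: sub_moments_def intro: all_moments_add)

lemma sub_moments_mult: "f \<in> sub_moments P H \<Longrightarrow> g \<in> sub_moments P H \<Longrightarrow> (\<lambda>\<omega>. f \<omega> * g \<omega>) \<in> sub_moments P H"
  by (auto simp: sub_moments_def intro: all_moments_mult)

lemma sub_moments_const: "finite_measure P \<Longrightarrow> (\<lambda>\<omega>. c) \<in> sub_moments P H"
  by (auto simp: sub_moments_def intro: all_moments_const)

lemma sub_moments_sum:
  "finite_measure P \<Longrightarrow> (\<And>i. i \<in> I \<Longrightarrow> f i \<in> sub_moments P H) \<Longrightarrow> (\<lambda>\<omega>. \<Sum>i\<in>I. f i \<omega>) \<in> sub_moments P H"
  by (induction I rule: infinite_finite_induct) (auto intro: sub_moments_add sub_moments_const)

section \<open>Random matrices with entries in a given class of random variables\<close>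

definition entries_in :: "nat \<Rightarrow> ('w \<Rightarrow> complex) set \<Rightarrow> ('w \<Rightarrow> complex mat) \<Rightarrow> bool" where
  "entries_in N S A \<longleftrightarrow> (\<forall>\<omega>. A \<omega> \<in> carrier_mat N N) \<and> (\<forall>i<N. \<forall>j<N. (\<lambda>\<omega>. A \<omega> $$ (i, j)) \<in> S)"

lemma entries_in_carrier: "entries_in N S A \<Longrightarrow> A \<omega> \<in> carrier_mat N N"
  by (simp add: entries_in_def)

lemma entries_in_mult:
  assumes "finite_measure P" "entries_in N (sub_moments P H) A" "entries_in N (sub_moments P H) B"
  shows "entries_in N (sub_moments P H) (\<lambda>\<omega>. A \<omega> * B \<omega>)"
  unfolding entries_in_def
proof (intro conjI allI impI)
  have c: "A \<omega> \<in> carrier_mat N N" "B \<omega> \<in> carrier_mat N N" for \<omega> using assms by (auto simp: entries_in_def)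
  show "A \<omega> * B \<omega> \<in> carrier_mat N N" for \<omega> by (intro mult_carrier_mat[of _ N N] c)
  fix i j assume ij: "i < N" "j < N"
  have "(\<lambda>\<omega>. \<Sum>k<N. A \<omega> $$ (i, k) * B \<omega> $$ (k, j)) \<in> sub_moments P H"
    using assms ij by (intro sub_moments_sum sub_moments_mult) (auto simp: entries_in_def)
  then show "(\<lambda>\<omega>. (A \<omega> * B \<omega>) $$ (i, j)) \<in> sub_moments P H"
    by (simp only: mat_mult_entry[OF c ij])
qed

lemma entries_in_transpose:
  assumes "entries_in N S A" shows "entries_in N S (\<lambda>\<omega>. transpose_mat (A \<omega>))"
proof -
  have c: "A \<omega> \<in> carrier_mat N N" for \<omega> using assms by (simp add: entries_in_def)
  have "(\<lambda>\<omega>. transpose_mat (A \<omega>) $$ (i, j)) = (\<lambda>\<omega>. A \<omega> $$ (j, i))" if "i < N" "j < N" for i j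
    using that carrier_matD[OF c] by (intro ext) simp
  then show ?thesis using assms by (auto simp: entries_in_def)
qed

lemma entries_in_add:
  assumes "entries_in N (sub_moments P H) A" "entries_in N (sub_moments P H) B"
  shows "entries_in N (sub_moments P H) (\<lambda>\<omega>. A \<omega> + B \<omega>)"
proof -
  have c: "A \<omega> \<in> carrier_mat N N" "B \<omega> \<in> carrier_mat N N" for \<omega> using assms by (auto simp: entries_in_def)
  have "(\<lambda>\<omega>. (A \<omega> + B \<omega>) $$ (i, j)) = (\<lambda>\<omega>. A \<omega> $$ (i, j) + B \<omega> $$ (i, j))" if "i < N" "j < N" for i j
    using that carrier_matD[OF c(2)] by (intro ext) simp
  then show ?thesis using assms by (auto simp: entries_in_def intro: sub_moments_add)
qed

lemma entries_in_smult:
  assumes "f \<in> sub_moments P H" "entries_in N (sub_moments P H) A"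
  shows "entries_in N (sub_moments P H) (\<lambda>\<omega>. f \<omega> \<cdot>\<^sub>m A \<omega>)"
proof -
  have c: "A \<omega> \<in> carrier_mat N N" for \<omega> using assms by (auto simp: entries_in_def)
  have "(\<lambda>\<omega>. (f \<omega> \<cdot>\<^sub>m A \<omega>) $$ (i, j)) = (\<lambda>\<omega>. f \<omega> * A \<omega> $$ (i, j))" if "i < N" "j < N" for i j
    using that carrier_matD[OF c] by (intro ext) simp
  then show ?thesis using assms by (auto simp: entries_in_def intro: sub_moments_mult)
qed

lemma entries_in_one: "finite_measure P \<Longrightarrow> entries_in N (sub_moments P H) (\<lambda>\<omega>. 1\<^sub>m N)"
  by (auto simp: entries_in_def sub_moments_const)

lemma entries_in_trace:
  assumes "finite_measure P" "entries_in N (sub_moments P H) A"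
  shows "(\<lambda>\<omega>. mat_trace (A \<omega>)) \<in> sub_moments P H"
proof -
  have c: "A \<omega> \<in> carrier_mat N N" for \<omega> using assms by (auto simp: entries_in_def)
  show ?thesis unfolding mat_trace_carrier[OF c]
    using assms by (intro sub_moments_sum) (auto simp: entries_in_def)
qed

lemma entries_in_mono: "entries_in N S A \<Longrightarrow> S \<subseteq> S' \<Longrightarrow> entries_in N S' A"
  by (auto simp: entries_in_def)

definition scale_seq :: "'w scalar_seq \<Rightarrow> 'w matrix_seq \<Rightarrow> 'w matrix_seq" where
  "scale_seq f X = (\<lambda>N \<omega>. f N \<omega> \<cdot>\<^sub>m X N \<omega>)"

definition trace_seq :: "'w matrix_seq \<Rightarrow> 'w scalar_seq" where
  "trace_seq X = (\<lambda>N \<omega>. mat_trace (X N \<omega>))"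

definition ntrace_seq :: "'w matrix_seq \<Rightarrow> 'w scalar_seq" where
  "ntrace_seq X = (\<lambda>N \<omega>. mat_trace (X N \<omega>) / of_nat N)"

definition ctrace_seq :: "(nat \<Rightarrow> 'w measure) \<Rightarrow> 'w matrix_seq \<Rightarrow> 'w scalar_seq" where
  "ctrace_seq M X = (\<lambda>N \<omega>. mat_trace (X N \<omega>) - (\<integral>\<omega>. mat_trace (X N \<omega>) \<partial>M N))"

lemma smult_smult_mat: "a \<cdot>\<^sub>m (b \<cdot>\<^sub>m X) = (a * b) \<cdot>\<^sub>m (X :: complex mat)"
  by (rule eq_matI) (simp_all add: mult.assoc)

lemma sigma_mono_measurable:
  assumes "f \<in> borel_measurable (sigma \<Omega> A)" "A \<subseteq> B" "B \<subseteq> Pow \<Omega>"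
  shows "f \<in> borel_measurable (sigma \<Omega> B)"
  using assms(1)
proof (rule measurable_mono[of borel borel, THEN subsetD, rotated -1])
  show "sets (sigma \<Omega> A) \<subseteq> sets (sigma \<Omega> B)"
    using assms by (simp add: sigma_sets_mono' order.trans)
  show "space (sigma \<Omega> A) = space (sigma \<Omega> B)"
    using assms by (simp add: space_measure_of_conv)
qed auto

lemma matrix_sigma_Pow: "matrix_sigma P N S \<subseteq> Pow (space P)"
  unfolding matrix_sigma_def by (rule order.trans[OF _ sigma_sets_into_sp[THEN PowI, THEN subsetI]])
    (auto intro: sigma_sets_into_sp)

lemma matrix_sigma_measurable:
  assumes "X \<in> S" "i < N" "j < N"
  shows "(\<lambda>\<omega>. X N \<omega> $$ (i, j)) \<in> borel_measurable (sigma (space P) (matrix_sigma P N S))"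
proof (rule measurableI)
  fix E :: "complex set" assume "E \<in> sets borel"
  then have "(\<lambda>\<omega>. X N \<omega> $$ (i, j)) -` E \<inter> space P \<in> matrix_sigma P N S"
    unfolding matrix_sigma_def using assms by (intro sigma_sets.Basic) blast
  then show "(\<lambda>\<omega>. X N \<omega> $$ (i, j)) -` E \<inter> space (sigma (space P) (matrix_sigma P N S)) \<in> sets (sigma (space P) (matrix_sigma P N S))"
    using matrix_sigma_Pow[of P N S] by (simp add: space_measure_of_conv sigma_sets.Basic)
qed auto

lemma matrix_sigma_Int_stable: "Int_stable (matrix_sigma P N S)"
proof -
  interpret sigma_algebra "space P" "matrix_sigma P N S"
    unfolding matrix_sigma_def by (rule sigma_algebra_sigma_sets) auto
  show ?thesis by (auto simp: Int_stable_def)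
qed

text \<open>The events with index in \<open>K\<close> and those with index in \<open>L\<close>
  generate two independent \<sigma>-algebras, for which expectations of products factor.\<close>

lemma (in prob_space) indep_sets_integral_mult:
  assumes ind: "indep_sets S (K \<union> L)" and KL: "K \<inter> L = {}"
    and st: "\<And>k. Int_stable (S k)" and Pow: "\<And>k. S k \<subseteq> Pow (space M)"
    and g: "g \<in> borel_measurable (sigma (space M) (\<Union>k\<in>K. S k))" "integrable M g"
    and h: "h \<in> borel_measurable (sigma (space M) (\<Union>k\<in>L. S k))" "integrable M h"
  shows "(\<integral>\<omega>. g \<omega> * h \<omega> \<partial>M) = (\<integral>\<omega>. g \<omega> \<partial>M) * (\<integral>\<omega>. h \<omega> \<partial>M :: complex)"
proof -
  define J where "J = case_bool K L"
  let ?sig = "\<lambda>b. sigma_sets (space M) (\<Union>k\<in>J b. S k)"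
  have "indep_sets ?sig UNIV"
  proof (rule indep_sets_collect_sigma)
    have "(\<Union>j\<in>UNIV. J j) = K \<union> L" by (auto simp: J_def UNIV_bool)
    then show "indep_sets S (\<Union>j\<in>UNIV. J j)" using ind by (simp only:)
    show "disjoint_family J" using KL by (auto simp: disjoint_family_on_def J_def split: bool.splits)
  qed (rule st)
  then have ind: "indep_set (?sig True) (?sig False)"
    unfolding indep_set_def
  proof (rule indep_sets_mono_sets)
    fix j show "(case j of True \<Rightarrow> ?sig True | False \<Rightarrow> ?sig False) \<subseteq> ?sig j"
      by (cases j) (simp_all only: bool.case order_refl)
  qed
  have sets: "sets (sigma (space M) (\<Union>k\<in>J b. S k)) = ?sig b" for b
    by (rule sets_measure_of) (intro UN_least Pow)
  have gen: "sigma_sets (space M) {f -` E \<inter> space M |E. E \<in> sets borel} \<subseteq> ?sig b"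
    if f: "f \<in> borel_measurable (sigma (space M) (\<Union>k\<in>J b. S k))" for f :: "'a \<Rightarrow> complex" and b
  proof -
    have sp: "space (sigma (space M) (\<Union>k\<in>J b. S k)) = space M" by (simp add: space_measure_of_conv)
    have "{f -` E \<inter> space M |E. E \<in> sets borel} \<subseteq> sets (sigma (space M) (\<Union>k\<in>J b. S k))"
      using measurable_sets[OF f] unfolding sp by blast
    from sets.sigma_sets_subset[OF this] show ?thesis unfolding sp sets .
  qed
  have g': "g \<in> borel_measurable (sigma (space M) (\<Union>k\<in>J True. S k))"
    and h': "h \<in> borel_measurable (sigma (space M) (\<Union>k\<in>J False. S k))"
    using g(1) h(1) by (simp_all only: J_def bool.case)
  have "indep_set (sigma_sets (space M) {g -` E \<inter> space M |E. E \<in> sets borel})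
      (sigma_sets (space M) {h -` E \<inter> space M |E. E \<in> sets borel})"
    using ind unfolding indep_set_def
  proof (rule indep_sets_mono_sets)
    fix j show "(case j of True \<Rightarrow> sigma_sets (space M) {g -` E \<inter> space M |E. E \<in> sets borel}
        | False \<Rightarrow> sigma_sets (space M) {h -` E \<inter> space M |E. E \<in> sets borel}) \<subseteq>
        (case j of True \<Rightarrow> ?sig True | False \<Rightarrow> ?sig False)"
      using gen[OF g'] gen[OF h'] by (cases j) (simp_all only: bool.case)
  qed
  then have "indep_var borel g borel h"
    unfolding indep_var_eq using g(2) h(2) by (auto dest: borel_measurable_integrable)
  from indep_var_lebesgue_integral[OF this g(2) h(2)] show ?thesis .
qed

text \<open>Both alternatives for the given algebras are reduced to limits of means and cumulants of
  traces of single matrices. As each \<open>A c\<close> is an algebra, these cover the polynomials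
  within one colour, which is the form in which the given matrices enter the coefficients.\<close>

locale orth_setting =
  fixes Ns :: "nat set" and M :: "nat \<Rightarrow> 'w measure" and C :: nat
    and A :: "nat \<Rightarrow> 'w matrix_seq set" and Q :: "nat \<Rightarrow> nat \<Rightarrow> 'w \<Rightarrow> real mat"
  assumes infinite_Ns: "infinite Ns"
    and prob_M: "\<And>N. N \<in> Ns \<Longrightarrow> prob_space (M N)"
    and alg: "\<And>c. c \<in> {1..C} \<Longrightarrow> random_matrix_algebra Ns M (A c)"
    and mean_lim: "\<And>X. X \<in> (\<Union>c\<in>{1..C}. A c) \<Longrightarrow>
      \<exists>v. ((\<lambda>N. \<integral>\<omega>. mat_trace (X N \<omega>) / of_nat N \<partial>M N) \<longlongrightarrow> v) (dims_to_infinity Ns)"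
    and cumulant_lim: "\<And>Xs. set Xs \<subseteq> (\<Union>c\<in>{1..C}. A c) \<Longrightarrow> length Xs \<ge> 2 \<Longrightarrow>
      \<exists>v. ((\<lambda>N. joint_cumulant (M N) (map (\<lambda>X \<omega>. mat_trace (X N \<omega>)) Xs)) \<longlongrightarrow> v) (dims_to_infinity Ns)"
    and cumulant_lim_0: "\<And>Xs. set Xs \<subseteq> (\<Union>c\<in>{1..C}. A c) \<Longrightarrow> length Xs \<ge> 3 \<Longrightarrow>
      ((\<lambda>N. joint_cumulant (M N) (map (\<lambda>X \<omega>. mat_trace (X N \<omega>)) Xs)) \<longlongrightarrow> 0) (dims_to_infinity Ns)"
    and Q_carrier: "\<And>c N \<omega>. c \<in> {1..C} \<Longrightarrow> Q c N \<omega> \<in> carrier_mat N N"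
    and Q_haar: "\<And>c N. c \<in> {1..C} \<Longrightarrow> N \<in> Ns \<Longrightarrow> haar_orthogonal (M N) N (Q c N)"
    and Q_indep: "\<And>N. N \<in> Ns \<Longrightarrow> prob_space.indep_sets (M N)
           (\<lambda>k. case k of
                  None \<Rightarrow> matrix_sigma (M N) N (\<Union>c\<in>{1..C}. A c)
                | Some c \<Rightarrow> matrix_sigma (M N) N {complexify (Q c)})
           (insert None (Some ` {1..C}))"
begin

abbreviation I :: "nat set" where "I \<equiv> {1..C}"
definition AA :: "'w matrix_seq set" where "AA = (\<Union>c\<in>I. A c)"
abbreviation F :: "nat filter" where "F \<equiv> dims_to_infinity Ns"

lemma F_eventually: "eventually P F \<longleftrightarrow> (\<exists>n0. \<forall>N\<ge>n0. N \<in> Ns \<longrightarrow> P N)"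
  by (simp add: dims_to_infinity_def eventually_inf_principal eventually_sequentially)

lemma F_le: "F \<le> sequentially" by (simp add: dims_to_infinity_def)

lemma eventually_Ns: "eventually (\<lambda>N. N \<in> Ns) F" by (simp add: F_eventually)

lemma fin_M: "N \<in> Ns \<Longrightarrow> finite_measure (M N)"
  using prob_M prob_space.finite_measure by blast

text \<open>\<open>U\<close> equals \<open>Q\<close> where it matters and is orthogonal everywhere, so that identities between
  conjugated matrices hold without exception.\<close>

definition U :: "nat \<Rightarrow> nat \<Rightarrow> 'w \<Rightarrow> real mat" where
  "U c N \<omega> = (if Q c N \<omega> \<in> orthogonal_group_mat N then Q c N \<omega> else 1\<^sub>m N)"

definition Uc :: "nat \<Rightarrow> nat \<Rightarrow> 'w \<Rightarrow> complex mat" where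
  "Uc c N \<omega> = map_mat complex_of_real (U c N \<omega>)"

lemma U_orth: "U c N \<omega> \<in> orthogonal_group_mat N"
  by (auto simp: U_def orthogonal_group_mat_def)

lemma U_carrier: "U c N \<omega> \<in> carrier_mat N N"
  using U_orth by (auto simp: orthogonal_group_mat_def)

lemma Uc_carrier: "Uc c N \<omega> \<in> carrier_mat N N" "transpose_mat (Uc c N \<omega>) \<in> carrier_mat N N"
  using U_carrier by (auto simp: Uc_def)

lemma Uc_orth: "transpose_mat (Uc c N \<omega>) * Uc c N \<omega> = 1\<^sub>m N" "Uc c N \<omega> * transpose_mat (Uc c N \<omega>) = 1\<^sub>m N"
proof -
  let ?U = "U c N \<omega>"
  have c: "?U \<in> carrier_mat N N" "transpose_mat ?U \<in> carrier_mat N N" using U_carrier by auto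
  have o: "transpose_mat ?U * ?U = 1\<^sub>m N" using U_orth by (auto simp: orthogonal_group_mat_def)
  have "transpose_mat (Uc c N \<omega>) * Uc c N \<omega> = map_mat complex_of_real (transpose_mat ?U * ?U)"
    unfolding Uc_def of_real_hom.mat_hom_mult[OF c(2,1)] by (simp add: map_mat_transpose)
  also have "\<dots> = 1\<^sub>m N" unfolding o by (auto intro!: eq_matI)
  finally show "transpose_mat (Uc c N \<omega>) * Uc c N \<omega> = 1\<^sub>m N" .
  then show "Uc c N \<omega> * transpose_mat (Uc c N \<omega>) = 1\<^sub>m N"
    by (rule mat_mult_left_right_inverse[OF Uc_carrier(2,1)])
qed

lemma U_Q: "c \<in> I \<Longrightarrow> N \<in> Ns \<Longrightarrow> \<omega> \<in> space (M N) \<Longrightarrow> U c N \<omega> = Q c N \<omega>"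
  using Q_haar by (auto simp: U_def haar_orthogonal_def)

definition GA :: "nat \<Rightarrow> 'w measure" where "GA N = sigma (space (M N)) (matrix_sigma (M N) N AA)"

definition sig :: "nat \<Rightarrow> nat option \<Rightarrow> 'w set set" where
  "sig N k = (case k of None \<Rightarrow> matrix_sigma (M N) N AA | Some c \<Rightarrow> matrix_sigma (M N) N {complexify (Q c)})"

text \<open>What is independent of the Haar matrix of colour \<open>c\<close>: the given matrices
  and the Haar matrices of the other colours. It plays the part of \<open>H\<close> in
  \<open>haar_step\<close>, and \<open>own_sigma\<close> that of \<open>GY\<close>.\<close>

definition rest_sigma :: "nat \<Rightarrow> nat \<Rightarrow> 'w measure" where
  "rest_sigma c N = sigma (space (M N)) (\<Union>k\<in>insert None (Some ` (I - {c})). sig N k)"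

definition own_sigma :: "nat \<Rightarrow> nat \<Rightarrow> 'w measure" where
  "own_sigma c N = sigma (space (M N)) (sig N (Some c))"

lemma sig_Pow: "sig N k \<subseteq> Pow (space (M N))"
  by (cases k) (simp_all add: sig_def matrix_sigma_Pow)

lemma sig_indep: "N \<in> Ns \<Longrightarrow> prob_space.indep_sets (M N) (sig N) (insert None (Some ` I))"
proof -
  assume N: "N \<in> Ns"
  have "sig N = (\<lambda>k. case k of None \<Rightarrow> matrix_sigma (M N) N (\<Union>c\<in>{1..C}. A c)
      | Some c \<Rightarrow> matrix_sigma (M N) N {complexify (Q c)})"
    by (rule ext) (simp only: sig_def AA_def)
  then show ?thesis using Q_indep[OF N] by (simp only:)
qed

lemma alg_AA: "X \<in> AA \<Longrightarrow> random_matrix Ns M X"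
  using alg by (auto simp: AA_def random_matrix_algebra_def)

lemma AA_carrier: "X \<in> AA \<Longrightarrow> X N \<omega> \<in> carrier_mat N N"
  using alg_AA by (auto simp: random_matrix_def)

lemma AA_entries: "X \<in> AA \<Longrightarrow> N \<in> Ns \<Longrightarrow> entries_in N (sub_moments (M N) (GA N)) (X N)"
  using alg_AA[of X] matrix_sigma_measurable[of X AA]
  by (auto simp: entries_in_def sub_moments_def all_moments_def random_matrix_def GA_def)

lemma sig_events: "N \<in> Ns \<Longrightarrow> k \<in> insert None (Some ` I) \<Longrightarrow> sig N k \<subseteq> sets (M N)"
proof -
  assume N: "N \<in> Ns" and k: "k \<in> insert None (Some ` I)"
  interpret prob_space "M N" by (rule prob_M[OF N])
  have "\<forall>k\<in>insert None (Some ` I). sig N k \<subseteq> events"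
    using sig_indep[OF N] unfolding indep_sets_def by (rule conjunct1)
  then show ?thesis using k by (rule bspec)
qed

lemma rest_sets: "N \<in> Ns \<Longrightarrow> sets (rest_sigma c N) \<subseteq> sets (M N)"
proof -
  assume N: "N \<in> Ns"
  have "(\<Union>k\<in>insert None (Some ` (I - {c})). sig N k) \<subseteq> sets (M N)"
    by (intro UN_least sig_events[OF N]) blast
  then show ?thesis unfolding rest_sigma_def
    by (subst sets_measure_of) (auto intro!: UN_least sig_Pow sets.sigma_sets_subset)
qed

lemma GA_sets: "N \<in> Ns \<Longrightarrow> sets (GA N) \<subseteq> sets (M N)"
  unfolding GA_def using sig_Pow[of N None] sig_events[of N None]
  by (subst sets_measure_of) (auto intro!: sets.sigma_sets_subset simp: sig_def)

lemma GA_rest: "f \<in> borel_measurable (GA N) \<Longrightarrow> f \<in> borel_measurable (rest_sigma c N)"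
  unfolding GA_def rest_sigma_def
proof (erule sigma_mono_measurable)
  show "matrix_sigma (M N) N AA \<subseteq> (\<Union>k\<in>insert None (Some ` (I - {c})). sig N k)"
    by (rule order.trans[OF _ UN_upper[of None]]) (simp_all add: sig_def)
qed (intro UN_least sig_Pow)

lemma U_measurable:
  assumes "c \<in> I" "N \<in> Ns" "i < N" "j < N"
  shows "(\<lambda>\<omega>. complex_of_real (U c N \<omega> $$ (i, j))) \<in> borel_measurable (own_sigma c N)"
proof -
  have "(\<lambda>\<omega>. complexify (Q c) N \<omega> $$ (i, j)) \<in> borel_measurable (own_sigma c N)"
    unfolding own_sigma_def sig_def by (simp add: matrix_sigma_measurable assms)
  moreover have "complexify (Q c) N \<omega> $$ (i, j) = complex_of_real (U c N \<omega> $$ (i, j))" if "\<omega> \<in> space (own_sigma c N)" for \<omega>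
    using that U_Q[OF assms(1,2)] Q_carrier[OF assms(1), of N \<omega>] assms
    by (simp add: own_sigma_def complexify_def space_measure_of_conv)
  ultimately show ?thesis by (simp cong: measurable_cong)
qed

lemma own_rest: "d \<in> I \<Longrightarrow> d \<noteq> c \<Longrightarrow> f \<in> borel_measurable (own_sigma d N) \<Longrightarrow> f \<in> borel_measurable (rest_sigma c N)"
  unfolding own_sigma_def rest_sigma_def
  by (erule sigma_mono_measurable) (use sig_Pow in auto)

lemma U_haar:
  assumes "c \<in> I" "N \<in> Ns" shows "haar_orthogonal (M N) N (U c N)"
proof -
  have h: "haar_orthogonal (M N) N (Q c N)" using Q_haar assms by blast
  have law: "matrix_law (M N) N (\<lambda>\<omega>. R * U c N \<omega>) = matrix_law (M N) N (\<lambda>\<omega>. R * Q c N \<omega>)"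
    "matrix_law (M N) N (U c N) = matrix_law (M N) N (Q c N)" for R
    unfolding matrix_law_def by (intro distr_cong refl; simp add: U_Q[OF assms])+
  have "(\<lambda>\<omega>. U c N \<omega> $$ (i, j)) \<in> borel_measurable (M N)" if "i < N" "j < N" for i j
    using h that U_Q[OF assms] by (simp add: haar_orthogonal_def cong: measurable_cong)
  then show ?thesis using h U_orth unfolding haar_orthogonal_def law by auto
qed

lemma rest_indep:
  assumes c: "c \<in> I" and N: "N \<in> Ns"
    and g: "g \<in> borel_measurable (rest_sigma c N)" "integrable (M N) g"
    and h: "h \<in> borel_measurable (own_sigma c N)" "integrable (M N) h"
  shows "(\<integral>\<omega>. g \<omega> * h \<omega> \<partial>M N) = (\<integral>\<omega>. g \<omega> \<partial>M N) * (\<integral>\<omega>. h \<omega> \<partial>M N :: complex)"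
proof (rule prob_space.indep_sets_integral_mult[OF prob_M[OF N], of "sig N" "insert None (Some ` (I - {c}))" "{Some c}"])
  have "insert None (Some ` (I - {c})) \<union> {Some c} = insert None (Some ` I)" using c by auto
  then show "prob_space.indep_sets (M N) (sig N) (insert None (Some ` (I - {c})) \<union> {Some c})"
    using sig_indep[OF N] by (simp only:)
  show "Int_stable (sig N k)" for k
    by (auto simp: sig_def matrix_sigma_Int_stable split: option.splits)
  show "g \<in> borel_measurable (sigma (space (M N)) (\<Union>k\<in>insert None (Some ` (I - {c})). sig N k))"
    using g(1) by (simp only: rest_sigma_def)
  show "h \<in> borel_measurable (sigma (space (M N)) (\<Union>k\<in>{Some c}. sig N k))"
    using h(1) by (simp add: own_sigma_def)
qed (use sig_Pow g h in auto)

subsection \<open>The coefficient algebras and the letters\<close>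

text \<open>Polynomials in the members of \<open>S\<close> with convergent deterministic sequences
  as coefficients. Constants would be too few: the mean of a normalized trace depends on
  \<open>N\<close>.\<close>

definition Rgen :: "'w scalar_seq set \<Rightarrow> 'w scalar_seq set" where
  "Rgen S = sumset {cseq d * prod_list ss | d ss. (\<exists>c. (d \<longlongrightarrow> c) F) \<and> set ss \<subseteq> S}"

lemma Rgen_add: "f \<in> Rgen S \<Longrightarrow> g \<in> Rgen S \<Longrightarrow> f + g \<in> Rgen S"
  unfolding Rgen_def by (rule sumset_add)

lemma Rgen_mult: "f \<in> Rgen S \<Longrightarrow> g \<in> Rgen S \<Longrightarrow> f * g \<in> Rgen S"
  unfolding Rgen_def
proof (erule sumset_mult, assumption, safe)
  fix d d' :: "nat \<Rightarrow> complex" and c c' ss ss' assume *: "(d \<longlongrightarrow> c) F" "(d' \<longlongrightarrow> c') F" "set ss \<subseteq> S" "set ss' \<subseteq> S"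
  have "cseq d * prod_list ss * (cseq d' * prod_list ss') = cseq (\<lambda>N. d N * d' N) * prod_list (ss @ ss')"
    by (simp add: cseq_simps(2)[symmetric] mult_ac)
  moreover have "((\<lambda>N. d N * d' N) \<longlongrightarrow> c * c') F" using * by (intro tendsto_mult)
  ultimately show "cseq d * prod_list ss * (cseq d' * prod_list ss') \<in>
      sumset {cseq d * prod_list ss | d ss. (\<exists>c. (d \<longlongrightarrow> c) F) \<and> set ss \<subseteq> S}"
    using * by (intro sumset_base CollectI exI[of _ "\<lambda>N. d N * d' N"] exI[of _ "ss @ ss'"]) auto
qed

lemma Rgen_cseq: "(d \<longlongrightarrow> c) F \<Longrightarrow> cseq d \<in> Rgen S"
  unfolding Rgen_def by (intro sumset_base CollectI exI[of _ d] exI[of _ "[]"]) auto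

lemma Rgen_const: "cseq (\<lambda>_. c) \<in> Rgen S" by (rule Rgen_cseq[OF tendsto_const])

lemma Rgen_base: "s \<in> S \<Longrightarrow> s \<in> Rgen S"
  unfolding Rgen_def by (intro sumset_base CollectI exI[of _ "\<lambda>_. 1"] exI[of _ "[s]"]) (auto simp: cseq_simps)

lemma Rgen_subset:
  assumes "\<And>s. s \<in> S \<Longrightarrow> s \<in> T" "\<And>d c. (d \<longlongrightarrow> c) F \<Longrightarrow> cseq d \<in> T"
    and "\<And>f g. f \<in> T \<Longrightarrow> g \<in> T \<Longrightarrow> f + g \<in> T" "\<And>f g. f \<in> T \<Longrightarrow> g \<in> T \<Longrightarrow> f * g \<in> T"
  shows "Rgen S \<subseteq> T"
proof
  fix f assume "f \<in> Rgen S"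
  then show "f \<in> T" unfolding Rgen_def
  proof (rule sumset_closed)
    have one: "1 \<in> T" using assms(2)[OF tendsto_const[of 1]] by (simp add: cseq_simps)
    have "prod_list ss \<in> T" if "set ss \<subseteq> S" for ss
      using that by (induction ss) (auto intro: assms one)
    then show "{cseq d * prod_list ss | d ss. (\<exists>c. (d \<longlongrightarrow> c) F) \<and> set ss \<subseteq> S} \<subseteq> T"
      using assms by auto
    show "0 \<in> T" using assms(2)[OF tendsto_const[of 0]] by (simp add: cseq_simps)
  qed (rule assms(3))
qed

definition Taus :: "'w scalar_seq set" where "Taus = ctrace_seq M ` AA"
definition Trs :: "'w scalar_seq set" where "Trs = ntrace_seq ` AA"
definition R :: "'w scalar_seq set" where "R = Rgen Taus"
definition R0 :: "'w scalar_seq set" where "R0 = Rgen Trs"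

definition AM :: "'w scalar_seq set" where "AM = {f. \<forall>N\<in>Ns. f N \<in> sub_moments (M N) (GA N)}"

lemma AM_add: "f \<in> AM \<Longrightarrow> g \<in> AM \<Longrightarrow> f + g \<in> AM"
  by (auto simp: AM_def plus_fun_def intro: sub_moments_add)
lemma AM_mult: "f \<in> AM \<Longrightarrow> g \<in> AM \<Longrightarrow> f * g \<in> AM"
  by (auto simp: AM_def times_fun_def intro: sub_moments_mult)
lemma AM_cseq: "cseq d \<in> AM"
  by (auto simp: AM_def cseq_def intro: sub_moments_const fin_M)
lemma AM_trace: "X \<in> AA \<Longrightarrow> trace_seq X \<in> AM"
  by (auto simp: AM_def trace_seq_def intro: entries_in_trace fin_M AA_entries)

lemma ctrace_eq: "ctrace_seq M X = trace_seq X + cseq (\<lambda>N. - (\<integral>\<omega>. mat_trace (X N \<omega>) \<partial>M N))"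
  by (auto simp: ctrace_seq_def trace_seq_def fun_eq_iff pointwise cseq_apply)
lemma ntrace_ctrace: "ntrace_seq X = cseq (\<lambda>N. \<integral>\<omega>. mat_trace (X N \<omega>) / of_nat N \<partial>M N) + cseq (\<lambda>N. 1 / of_nat N) * ctrace_seq M X"
  by (auto simp: ntrace_seq_def ctrace_seq_def fun_eq_iff pointwise cseq_apply add_divide_distrib[symmetric])

lemma nv_lim: "((\<lambda>N. 1 / of_nat N :: complex) \<longlongrightarrow> 0) F"
  by (rule tendsto_mono[OF F_le]) (rule lim_const_over_n)

lemma R_AM: "R \<subseteq> AM"
  unfolding R_def by (rule Rgen_subset) (auto simp: Taus_def ctrace_eq intro!: AM_add AM_mult AM_cseq AM_trace)

text \<open>A normalized trace is its mean, which converges, plus \<open>1/N\<close> times a centred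
  trace.\<close>

lemma R0_R: "R0 \<subseteq> R"
  unfolding R0_def R_def
proof (rule Rgen_subset)
  fix s assume "s \<in> Trs"
  then obtain X where X: "X \<in> AA" "s = ntrace_seq X" by (auto simp: Trs_def)
  obtain v where "((\<lambda>N. \<integral>\<omega>. mat_trace (X N \<omega>) / of_nat N \<partial>M N) \<longlongrightarrow> v) F"
    using mean_lim[of X] X by (auto simp: AA_def)
  from Rgen_cseq[OF this] show "s \<in> Rgen Taus" unfolding X(2) ntrace_ctrace
    by (rule Rgen_add[OF _ Rgen_mult[OF Rgen_cseq[OF nv_lim] Rgen_base]]) (use X(1) in \<open>auto simp: Taus_def\<close>)
qed (auto intro: Rgen_add Rgen_mult Rgen_cseq)

lemma AM_moments: "AM \<subseteq> moment_seqs Ns M"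
  by (auto simp: AM_def moment_seqs_def sub_moments_def)

text \<open>Joint moments of centred traces converge since their cumulants do.\<close>

lemma cumulant_ctrace:
  assumes "set Xs \<subseteq> AA" "length Xs \<ge> 2" "N \<in> Ns"
  shows "joint_cumulant (M N) (map (\<lambda>X. ctrace_seq M X N) Xs) = joint_cumulant (M N) (map (\<lambda>X \<omega>. mat_trace (X N \<omega>)) Xs)"
proof -
  interpret prob_space "M N" by (rule prob_M[OF assms(3)])
  have "list_all2 (\<lambda>X Y. Y \<in> all_moments (M N) \<and> (\<exists>D. \<forall>\<omega>. X \<omega> = D + Y \<omega>))
      (map (\<lambda>X. ctrace_seq M X N) Xs) (map (\<lambda>X \<omega>. mat_trace (X N \<omega>)) Xs)"
    unfolding list.rel_map
  proof (rule list.rel_refl_strong)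
    fix X assume "X \<in> set Xs"
    then have "trace_seq X \<in> AM" using assms AM_trace by auto
    then have "(\<lambda>\<omega>. mat_trace (X N \<omega>)) \<in> all_moments (M N)"
      using assms(3) by (auto simp: AM_def trace_seq_def sub_moments_def)
    moreover have "ctrace_seq M X N \<omega> = - (\<integral>\<omega>. mat_trace (X N \<omega>) \<partial>M N) + mat_trace (X N \<omega>)" for \<omega>
      by (simp add: ctrace_seq_def)
    ultimately show "(\<lambda>\<omega>. mat_trace (X N \<omega>)) \<in> all_moments (M N) \<and> (\<exists>D. \<forall>\<omega>. ctrace_seq M X N \<omega> = D + mat_trace (X N \<omega>))"
      by blast
  qed
  from joint_cumulant_shift[OF this, of "[]"] assms(2) show ?thesis by simp
qed

text \<open>The moment-cumulant recursion is read as a formula for moments. Its input: the cumulants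
  of single centred traces are zero, and those of several agree with the cumulants of the uncentred
  traces, which converge.\<close>

lemma ctrace_moment_lim:
  assumes "set Xs \<subseteq> AA"
  shows "\<exists>v. ((\<lambda>N. expect M N (prod_list (map (ctrace_seq M) Xs))) \<longlongrightarrow> v) F"
proof -
  define m where "m N B = (\<integral>\<omega>. (\<Prod>i\<in>B. ctrace_seq M (Xs ! i) N \<omega>) \<partial>M N)" for N B
  have m0: "m N {} = 1" if "N \<in> Ns" for N
  proof -
    interpret prob_space "M N" by (rule prob_M[OF that])
    show ?thesis by (simp add: m_def prob_space)
  qed
  have kc: "\<exists>v. ((\<lambda>N. cumulant_of (m N) V) \<longlongrightarrow> v) F" if V: "V \<subseteq> {..<length Xs}" "V \<noteq> {}" for V
  proof -
    have fV: "finite V" using V finite_subset by auto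
    define vs where "vs = sorted_list_of_set V"
    have vs: "distinct vs" "set vs = V" "length vs = card V" using fV by (auto simp: vs_def)
    \<comment> \<open>The hypotheses speak of lists of matrices, so the positions in
      \<open>V\<close> are listed and the cumulant is reindexed.\<close>
    define Ys where "Ys = map (\<lambda>i. Xs ! i) vs"
    have "Xs ! i \<in> AA" if "i \<in> V" for i using assms subsetD[OF V(1) that] nth_mem[of i Xs] by auto
    then have Ys: "set Ys \<subseteq> AA" using vs by (auto simp: Ys_def)
    have e: "joint_cumulant (M N) (map (\<lambda>X. ctrace_seq M X N) Ys) = cumulant_of (m N) V" if N: "N \<in> Ns" for N
    proof -
      have len: "length Ys = card V" using vs by (simp add: Ys_def)
      have inj: "inj_on ((!) vs) {..<card V}" using vs by (simp add: inj_on_nth)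
      have img: "(!) vs ` {..<card V} = V" using vs by (auto simp: set_conv_nth)
      have "joint_cumulant (M N) (map (\<lambda>X. ctrace_seq M X N) Ys) =
          cumulant_of (\<lambda>B. m N ((!) vs ` B)) {..<card V}"
        unfolding joint_cumulant_eq length_map len
      proof (rule cumulant_of_cong)
        fix B assume B: "B \<subseteq> {..<card V}"
        have "(\<Prod>i\<in>B. (map (\<lambda>X. ctrace_seq M X N) Ys ! i) \<omega>) = (\<Prod>i\<in>(!) vs ` B. ctrace_seq M (Xs ! i) N \<omega>)" for \<omega>
          using B vs(3) by (subst prod.reindex[OF inj_on_subset[OF inj B]]) (auto simp: Ys_def intro!: prod.cong)
        then show "(\<integral>\<omega>. (\<Prod>i\<in>B. (map (\<lambda>X. ctrace_seq M X N) Ys ! i) \<omega>) \<partial>M N) = m N ((!) vs ` B)"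
          by (simp add: m_def)
      qed
      also have "\<dots> = cumulant_of (m N) ((!) vs ` {..<card V})"
        using inj m0[OF N] by (intro cumulant_of_image[symmetric]) auto
      finally show ?thesis unfolding img .
    qed
    show ?thesis
    proof (cases "length Ys \<ge> 2")
      case True
      obtain v where "((\<lambda>N. joint_cumulant (M N) (map (\<lambda>X \<omega>. mat_trace (X N \<omega>)) Ys)) \<longlongrightarrow> v) F"
        using cumulant_lim Ys True by (auto simp: AA_def)
      then have "((\<lambda>N. cumulant_of (m N) V) \<longlongrightarrow> v) F"
        by (rule Lim_transform_eventually)
          (rule eventually_mono[OF eventually_Ns], use cumulant_ctrace[OF Ys True] e in simp)
      then show ?thesis by blast
    next
      case False
      moreover have "card V \<noteq> 0" "length Ys = card V" using vs V fV by (simp_all add: Ys_def)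
      ultimately have "card V = 1" by linarith
      then obtain i where i: "V = {i}" by (meson card_1_singletonE)
      then have "Xs ! i \<in> AA" using assms V by auto
      then have tr: "(\<lambda>\<omega>. mat_trace ((Xs ! i) N \<omega>)) \<in> all_moments (M N)" if "N \<in> Ns" for N
        using AM_trace that by (auto simp: AM_def trace_seq_def sub_moments_def)
      have "cumulant_of (m N) V = 0" if N: "N \<in> Ns" for N
      proof -
        interpret prob_space "M N" by (rule prob_M[OF N])
        show ?thesis using all_moments_integrable[OF tr[OF N]] by (simp add: i m_def ctrace_seq_def prob_space)
      qed
      then have "((\<lambda>N. cumulant_of (m N) V) \<longlongrightarrow> 0) F"
        by (intro Lim_transform_eventually[OF tendsto_const]) (rule eventually_mono[OF eventually_Ns], simp)
      then show ?thesis by blast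
    qed
  qed
  have "S \<subseteq> {..<length Xs} \<longrightarrow> (\<exists>v. ((\<lambda>N. m N S) \<longlongrightarrow> v) F)" if "finite S" for S
    using that
  proof (induction S rule: finite_psubset_induct)
    case (psubset S)
    show ?case
    proof (intro impI, cases "S = {}")
      case True
      have "((\<lambda>N. m N S) \<longlongrightarrow> 1) F"
        by (rule Lim_transform_eventually[OF tendsto_const]) (rule eventually_mono[OF eventually_Ns], simp add: m0 True)
      then show "\<exists>v. ((\<lambda>N. m N S) \<longlongrightarrow> v) F" by blast
    next
      case False
      assume S: "S \<subseteq> {..<length Xs}"
      obtain i where i: "i \<in> S" using False by blast
      let ?K = "{V. V \<subseteq> S \<and> i \<in> V}"
      have "\<forall>V\<in>?K. \<exists>v. ((\<lambda>N. cumulant_of (m N) V * m N (S - V)) \<longlongrightarrow> v) F"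
      proof
        fix V assume V: "V \<in> ?K"
        obtain v where v: "((\<lambda>N. cumulant_of (m N) V) \<longlongrightarrow> v) F" using kc[of V] V S by auto
        have "S - V \<subset> S" using V i by auto
        then obtain w where w: "((\<lambda>N. m N (S - V)) \<longlongrightarrow> w) F" using psubset.IH[of "S - V"] S by auto
        show "\<exists>v. ((\<lambda>N. cumulant_of (m N) V * m N (S - V)) \<longlongrightarrow> v) F" using tendsto_mult[OF v w] by blast
      qed
      from bchoice[OF this] obtain l where l: "\<forall>V\<in>?K. ((\<lambda>N. cumulant_of (m N) V * m N (S - V)) \<longlongrightarrow> l V) F" by blast
      have "((\<lambda>N. \<Sum>V\<in>?K. cumulant_of (m N) V * m N (S - V)) \<longlongrightarrow> (\<Sum>V\<in>?K. l V)) F"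
        using l by (intro tendsto_sum) auto
      then have "((\<lambda>N. m N S) \<longlongrightarrow> (\<Sum>V\<in>?K. l V)) F"
        by (rule Lim_transform_eventually)
          (rule eventually_mono[OF eventually_Ns], use moment_cumulant_rec[of S i] psubset.hyps i m0 in simp)
      then show "\<exists>v. ((\<lambda>N. m N S) \<longlongrightarrow> v) F" by blast
    qed
  qed
  from this[of "{..<length Xs}"] obtain v where v: "((\<lambda>N. m N {..<length Xs}) \<longlongrightarrow> v) F" by auto
  have "prod_list (map (ctrace_seq M) Xs) N \<omega> = (\<Prod>i<length Xs. ctrace_seq M (Xs ! i) N \<omega>)" for N \<omega>
    by (induction Xs rule: rev_induct) (simp_all add: pointwise nth_append)
  then show ?thesis using v by (auto simp: expect_def m_def)
qed

lemma R_conv: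
  assumes "f \<in> R" shows "\<exists>c. ((\<lambda>N. expect M N f) \<longlongrightarrow> c) F"
proof -
  let ?T = "{f \<in> AM. \<exists>c. ((\<lambda>N. expect M N f) \<longlongrightarrow> c) F}"
  have "f \<in> ?T" using assms unfolding R_def Rgen_def
  proof (rule sumset_closed)
    show "{cseq d * prod_list ss | d ss. (\<exists>c. (d \<longlongrightarrow> c) F) \<and> set ss \<subseteq> Taus} \<subseteq> ?T"
    proof safe
      fix d :: "nat \<Rightarrow> complex" and ss c assume d: "(d \<longlongrightarrow> c) F" and ss: "set ss \<subseteq> Taus"
      have "\<exists>Xs. ss = map (ctrace_seq M) Xs \<and> set Xs \<subseteq> AA" using ss
      proof (induction ss)
        case (Cons s ss)
        then obtain X Xs where "X \<in> AA" "s = ctrace_seq M X" "ss = map (ctrace_seq M) Xs" "set Xs \<subseteq> AA"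
          by (auto simp: Taus_def)
        then show ?case by (intro exI[of _ "X # Xs"]) auto
      qed auto
      then obtain Xs where Xs: "ss = map (ctrace_seq M) Xs" "set Xs \<subseteq> AA" by blast
      obtain v where "((\<lambda>N. expect M N (prod_list ss)) \<longlongrightarrow> v) F" using ctrace_moment_lim[OF Xs(2)] Xs(1) by auto
      then show "\<exists>c. ((\<lambda>N. expect M N (cseq d * prod_list ss)) \<longlongrightarrow> c) F"
        unfolding expect_cseq using tendsto_mult[OF d] by blast
      have "cseq d * prod_list ss \<in> R" unfolding R_def Rgen_def using d ss by (intro sumset_base) blast
      then show "cseq d * prod_list ss \<in> AM" using R_AM by blast
    qed
    show "0 \<in> ?T" using AM_cseq[of "\<lambda>_. 0"] by (auto simp: cseq_simps)
    fix f g assume f: "f \<in> ?T" and g: "g \<in> ?T"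
    then obtain c d where cd: "((\<lambda>N. expect M N f) \<longlongrightarrow> c) F" "((\<lambda>N. expect M N g) \<longlongrightarrow> d) F" by auto
    have fg: "f \<in> moment_seqs Ns M" "g \<in> moment_seqs Ns M" using f g AM_moments by auto
    have "((\<lambda>N. expect M N (f + g)) \<longlongrightarrow> c + d) F"
      by (rule Lim_transform_eventually[OF tendsto_add[OF cd]])
        (rule eventually_mono[OF eventually_Ns], simp add: expect_add[OF fg])
    then show "f + g \<in> ?T" using f g AM_add by auto
  qed
  then show ?thesis by simp
qed

lemma Trs_form: "s \<in> Trs \<Longrightarrow> \<exists>d c t. (d \<longlongrightarrow> c) F \<and> t \<in> Taus \<and> s = cseq d + cseq (\<lambda>N. 1 / of_nat N) * t"
proof -
  assume "s \<in> Trs"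
  then obtain X where X: "X \<in> AA" "s = ntrace_seq X" by (auto simp: Trs_def)
  obtain v where "((\<lambda>N. \<integral>\<omega>. mat_trace (X N \<omega>) / of_nat N \<partial>M N) \<longlongrightarrow> v) F"
    using mean_lim[of X] X by (auto simp: AA_def)
  then show ?thesis using X ntrace_ctrace[of X] by (auto simp: Taus_def)
qed

lemma Taus_cumulant:
  assumes "set ss \<subseteq> Taus" "length ss \<ge> 3"
  shows "((\<lambda>N. joint_cumulant (M N) (map (\<lambda>s. s N) ss)) \<longlongrightarrow> 0) F"
proof -
  have "\<exists>Xs. ss = map (ctrace_seq M) Xs \<and> set Xs \<subseteq> AA" using assms(1)
  proof (induction ss)
    case (Cons s ss)
    then obtain X Xs where "X \<in> AA" "s = ctrace_seq M X" "ss = map (ctrace_seq M) Xs" "set Xs \<subseteq> AA"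
      by (auto simp: Taus_def)
    then show ?case by (intro exI[of _ "X # Xs"]) auto
  qed auto
  then obtain Xs where Xs: "ss = map (ctrace_seq M) Xs" "set Xs \<subseteq> AA" by blast
  have "((\<lambda>N. joint_cumulant (M N) (map (\<lambda>X \<omega>. mat_trace (X N \<omega>)) Xs)) \<longlongrightarrow> 0) F"
    using cumulant_lim_0[of Xs] Xs assms(2) by (simp add: AA_def)
  then show ?thesis
    by (rule Lim_transform_eventually)
      (rule eventually_mono[OF eventually_Ns], use cumulant_ctrace[OF Xs(2)] Xs(1) assms(2) in \<open>simp add: o_def\<close>)
qed

text \<open>Subtracting a random normalized trace leads out of \<open>A c\<close>. The scalars are
  therefore extended to \<open>R0\<close>; sums of such multiples form the algebra
  \<open>ext c\<close>, in which centring and merging can be carried out.\<close>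

definition ext_gen :: "nat \<Rightarrow> 'w matrix_seq set" where
  "ext_gen c = {scale_seq f X | f X. f \<in> R0 \<and> X \<in> A c}"

inductive_set ext :: "nat \<Rightarrow> 'w matrix_seq set" for c where
  base: "X \<in> ext_gen c \<Longrightarrow> X \<in> ext c"
| add: "X \<in> ext c \<Longrightarrow> Y \<in> ext c \<Longrightarrow> seq_add X Y \<in> ext c"

lemma R0_AM: "f \<in> R0 \<Longrightarrow> f \<in> AM" using R0_R R_AM by auto

lemma A_AA: "c \<in> I \<Longrightarrow> X \<in> A c \<Longrightarrow> X \<in> AA" by (auto simp: AA_def)

lemma ext_carrier: "X \<in> ext c \<Longrightarrow> c \<in> I \<Longrightarrow> X N \<omega> \<in> carrier_mat N N"
proof (induction rule: ext.induct)
  case (base X)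
  then obtain f Y where "X = scale_seq f Y" "Y \<in> A c" by (auto simp: ext_gen_def)
  then show ?case using AA_carrier[OF A_AA[OF base(2)]] by (simp add: scale_seq_def)
qed (simp add: seq_add_def)

lemma ext_entries: "X \<in> ext c \<Longrightarrow> c \<in> I \<Longrightarrow> N \<in> Ns \<Longrightarrow> entries_in N (sub_moments (M N) (GA N)) (X N)"
proof (induction rule: ext.induct)
  case (base X)
  then obtain f Y where "X = scale_seq f Y" "f \<in> R0" "Y \<in> A c" by (auto simp: ext_gen_def)
  then show ?case using base R0_AM[of f] A_AA[of c Y] AA_entries[of Y N]
    by (auto simp: scale_seq_def AM_def intro!: entries_in_smult)
next
  case (add X Y)
  then show ?case by (auto simp: seq_add_def intro!: entries_in_add)
qed

lemma ext_scale:
  assumes "X \<in> ext c" "c \<in> I" "f \<in> R0" shows "scale_seq f X \<in> ext c"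
  using assms(1)
proof (induction rule: ext.induct)
  case (base X)
  then obtain g Y where X: "X = scale_seq g Y" "g \<in> R0" "Y \<in> A c" by (auto simp: ext_gen_def)
  have "scale_seq f X = scale_seq (f * g) Y" by (simp add: X scale_seq_def fun_eq_iff pointwise smult_smult_mat)
  moreover have "f * g \<in> R0" using assms(3) X(2) unfolding R0_def by (rule Rgen_mult)
  ultimately have "scale_seq f X \<in> ext_gen c" using X(3) unfolding ext_gen_def by blast
  then show ?case by (rule ext.base)
next
  case (add X Y)
  have "scale_seq f (seq_add X Y) = seq_add (scale_seq f X) (scale_seq f Y)"
    using ext_carrier[OF add(1) assms(2)] ext_carrier[OF add(2) assms(2)]
    by (simp add: scale_seq_def seq_add_def fun_eq_iff add_smult_distrib_left_mat[OF ext_carrier[OF add(1) assms(2)] ext_carrier[OF add(2) assms(2)]])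
  then show ?case using add ext.add by simp
qed

lemma A_ext: "X \<in> A c \<Longrightarrow> X \<in> ext c"
proof -
  assume X: "X \<in> A c"
  have "1 \<in> R0" unfolding R0_def using Rgen_const[of 1 Trs] by (simp add: cseq_simps)
  moreover have "X = scale_seq 1 X" by (auto simp: scale_seq_def fun_eq_iff pointwise intro!: eq_matI)
  ultimately have "X \<in> ext_gen c" using X unfolding ext_gen_def by blast
  then show ?thesis by (rule ext.base)
qed

lemma A_closed:
  assumes "c \<in> I"
  shows "seq_one \<in> A c" "X \<in> A c \<Longrightarrow> Y \<in> A c \<Longrightarrow> seq_mult X Y \<in> A c" "X \<in> A c \<Longrightarrow> Y \<in> A c \<Longrightarrow> seq_add X Y \<in> A c"
    "X \<in> A c \<Longrightarrow> seq_transpose X \<in> A c" "X \<in> A c \<Longrightarrow> seq_smult z X \<in> A c"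
  using alg[OF assms] by (auto simp: random_matrix_algebra_def)

lemma ext_mult:
  assumes "X \<in> ext c" "Y \<in> ext c" and c: "c \<in> I" shows "seq_mult X Y \<in> ext c"
  using assms(1)
proof (induction rule: ext.induct)
  case (base X)
  then obtain f X' where X: "X = scale_seq f X'" "f \<in> R0" "X' \<in> A c" by (auto simp: ext_gen_def)
  have Xc: "X' N \<omega> \<in> carrier_mat N N" for N \<omega> using X(3) A_AA[OF c] AA_carrier by blast
  show ?case using assms(2)
  proof (induction rule: ext.induct)
    case (base Y)
    then obtain g Y' where Y: "Y = scale_seq g Y'" "g \<in> R0" "Y' \<in> A c" by (auto simp: ext_gen_def)
    have Yc: "Y' N \<omega> \<in> carrier_mat N N" for N \<omega> using Y(3) A_AA[OF c] AA_carrier by blast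
    have "X N \<omega> * Y N \<omega> = (f * g) N \<omega> \<cdot>\<^sub>m (X' N \<omega> * Y' N \<omega>)" for N \<omega>
      using mult_smult_assoc_mat[OF Xc smult_carrier_mat[OF Yc], of "f N \<omega>" N \<omega> "g N \<omega>" \<omega>]
        mult_smult_distrib[OF Xc Yc, of N \<omega> "g N \<omega>" \<omega>]
      by (simp add: X(1) Y(1) scale_seq_def pointwise smult_smult_mat)
    then have "seq_mult X Y = scale_seq (f * g) (seq_mult X' Y')"
      by (simp add: seq_mult_def scale_seq_def)
    moreover have "f * g \<in> R0" using X(2) Y(2) unfolding R0_def by (rule Rgen_mult)
    ultimately have "seq_mult X Y \<in> ext_gen c" using A_closed(2)[OF c X(3) Y(3)] unfolding ext_gen_def by blast
    then show ?case by (rule ext.base)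
  next
    case (add Y Z)
    have "X N \<omega> * (Y N \<omega> + Z N \<omega>) = X N \<omega> * Y N \<omega> + X N \<omega> * Z N \<omega>" for N \<omega>
      using Xc[of N \<omega>] ext_carrier[OF add(1) c, of N \<omega>] ext_carrier[OF add(2) c, of N \<omega>]
      by (intro mult_add_distrib_mat[of _ N N]) (auto simp: X(1) scale_seq_def)
    then have "seq_mult X (seq_add Y Z) = seq_add (seq_mult X Y) (seq_mult X Z)"
      by (simp add: seq_mult_def seq_add_def)
    then show ?case using add(3,4) ext.add by simp
  qed
next
  case (add X Z)
  have "(X N \<omega> + Z N \<omega>) * Y N \<omega> = X N \<omega> * Y N \<omega> + Z N \<omega> * Y N \<omega>" for N \<omega>
    using ext_carrier[OF add(1) c, of N \<omega>] ext_carrier[OF add(2) c, of N \<omega>] ext_carrier[OF assms(2) c, of N \<omega>]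
    by (intro add_mult_distrib_mat[of _ N N]) auto
  then have "seq_mult (seq_add X Z) Y = seq_add (seq_mult X Y) (seq_mult Z Y)"
    by (simp add: seq_mult_def seq_add_def)
  then show ?case using add(3,4) ext.add by simp
qed

lemma ext_transpose:
  assumes "X \<in> ext c" "c \<in> I" shows "seq_transpose X \<in> ext c"
  using assms(1)
proof (induction rule: ext.induct)
  case (base X)
  then obtain f Y where X: "X = scale_seq f Y" "f \<in> R0" "Y \<in> A c" by (auto simp: ext_gen_def)
  have "seq_transpose X = scale_seq f (seq_transpose Y)"
    by (auto simp: X(1) seq_transpose_def scale_seq_def fun_eq_iff intro!: eq_matI)
  then have "seq_transpose X \<in> ext_gen c" using A_closed(4)[OF assms(2) X(3)] X(2) unfolding ext_gen_def by blast
  then show ?case by (rule ext.base)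
next
  case (add X Y)
  have "seq_transpose (seq_add X Y) = seq_add (seq_transpose X) (seq_transpose Y)"
    using ext_carrier[OF add(1) assms(2)] ext_carrier[OF add(2) assms(2)]
    by (simp add: seq_transpose_def seq_add_def fun_eq_iff transpose_add[OF ext_carrier[OF add(1) assms(2)] ext_carrier[OF add(2) assms(2)]])
  then show ?case using add ext.add by simp
qed

lemma ntrace_add: "(\<And>N \<omega>. X N \<omega> \<in> carrier_mat N N) \<Longrightarrow> (\<And>N \<omega>. Y N \<omega> \<in> carrier_mat N N) \<Longrightarrow>
    ntrace_seq (seq_add X Y) = ntrace_seq X + ntrace_seq Y"
proof -
  assume c: "\<And>N \<omega>. X N \<omega> \<in> carrier_mat N N" "\<And>N \<omega>. Y N \<omega> \<in> carrier_mat N N"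
  show ?thesis
    by (simp add: ntrace_seq_def seq_add_def fun_eq_iff pointwise mat_trace_add[OF c] add_divide_distrib)
qed

lemma ext_ntrace:
  assumes "X \<in> ext c" "c \<in> I" shows "ntrace_seq X \<in> R0"
  using assms(1)
proof (induction rule: ext.induct)
  case (base X)
  then obtain f Y where X: "X = scale_seq f Y" "f \<in> R0" "Y \<in> A c" by (auto simp: ext_gen_def)
  have "mat_trace (X N \<omega>) = f N \<omega> * mat_trace (Y N \<omega>)" for N \<omega>
    unfolding X(1) scale_seq_def by (rule mat_trace_smult[OF AA_carrier[OF A_AA[OF assms(2) X(3)]]])
  then have "ntrace_seq X = f * ntrace_seq Y" by (simp add: ntrace_seq_def fun_eq_iff pointwise)
  moreover have "ntrace_seq Y \<in> R0" unfolding R0_def using X(3) A_AA[OF assms(2)] by (intro Rgen_base) (auto simp: Trs_def)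
  ultimately show ?case using X(2) unfolding R0_def by (simp add: Rgen_mult)
next
  case (add X Y)
  then show ?case using ntrace_add[of X Y] ext_carrier[OF _ assms(2)] unfolding R0_def by (simp add: Rgen_add)
qed

text \<open>The random normalized trace is subtracted and not its mean or limit, so that the result
  is traceless at every point.\<close>

definition cen :: "'w matrix_seq \<Rightarrow> 'w matrix_seq" where
  "cen X = seq_add X (scale_seq (- ntrace_seq X) seq_one)"

lemma cen_ext: "X \<in> ext c \<Longrightarrow> c \<in> I \<Longrightarrow> cen X \<in> ext c"
proof -
  assume X: "X \<in> ext c" and c: "c \<in> I"
  have "cseq (\<lambda>_. - 1) * ntrace_seq X \<in> R0"
    using ext_ntrace[OF X c] Rgen_const unfolding R0_def by (intro Rgen_mult)
  moreover have "cseq (\<lambda>_. - 1) * ntrace_seq X = - ntrace_seq X" by (auto simp: fun_eq_iff pointwise cseq_apply)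
  ultimately show ?thesis unfolding cen_def using X c A_ext[OF A_closed(1)[OF c]] by (intro ext.add ext_scale) auto
qed

lemma cen_eq: "cen X N \<omega> = X N \<omega> + (- ntrace_seq X N \<omega>) \<cdot>\<^sub>m 1\<^sub>m N"
  by (simp add: cen_def seq_add_def scale_seq_def seq_one_def pointwise)

lemma cen_trace: "X N \<omega> \<in> carrier_mat N N \<Longrightarrow> mat_trace (cen X N \<omega>) = 0"
  unfolding cen_eq
  by (subst mat_trace_add[of _ N]) (auto simp: mat_trace_smult[of _ N] mat_trace_one ntrace_seq_def mat_trace_def)

end

section \<open>The loop equation for letters of several colours\<close>

context haar_step
begin

text \<open>The factor \<open>1 - of_nat N\<close> comes from the cut in front of \<open>l\<close>:
  it produces the empty word, with trace \<open>N\<close>, and the transposed whole word, whose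
  trace is that of the word itself. The cut behind \<open>l\<close> has a vanishing product of
  traces, since \<open>l\<close> is traceless.\<close>

lemma self_sum_Cons:
  assumes l: "fst l" and z: "list_all good (l # y)" and 0: "tr_word \<omega> [l] = 0"
  shows "self_sum \<omega> (l # y) = (1 - of_nat N) * tr_word \<omega> (l # y) + loop_self fst flip (tr_word \<omega>) l y"
proof -
  let ?t = "tr_word \<omega>" and ?K = "{i. i < length y \<and> fst (y ! i)}"
  have K: "{i. i < length (l # y) \<and> fst ((l # y) ! i)} = insert 0 (Suc ` ?K)"
  proof (rule equalityI)
    show "{i. i < length (l # y) \<and> fst ((l # y) ! i)} \<subseteq> insert 0 (Suc ` ?K)"
    proof
      fix i assume "i \<in> {i. i < length (l # y) \<and> fst ((l # y) ! i)}"
      then show "i \<in> insert 0 (Suc ` ?K)" by (cases i) auto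
    qed
  qed (use l in auto)
  have "finite ?K" by simp
  have rev: "?t (mrev flip (l # y)) = ?t (l # y)"
    unfolding tr_word_def using z by (subst word_mrev) (auto intro: mat_trace_transpose[OF word_carrier])
  have nil: "?t [] = of_nat N" by (simp add: tr_word_def word_simps mat_trace_one)
  have "self_sum \<omega> (l # y) = ?t [l] * ?t y - ?t (l # mrev flip y) - (?t [] * ?t (l # y) - ?t (mrev flip (l # y))) +
      (\<Sum>i\<in>?K. ?t (l # take (Suc i) y) * ?t (drop (Suc i) y) - ?t (l # take (Suc i) y @ mrev flip (drop (Suc i) y))
        - (?t (l # take i y) * ?t (drop i y) - ?t (l # take i y @ mrev flip (drop i y))))"
    unfolding self_sum_def K by (subst sum.insert) (auto simp: sum.reindex)
  also have "\<dots> = (1 - of_nat N) * ?t (l # y) - ?t (l # mrev flip y) +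
      (\<Sum>i\<in>?K. ?t (l # take (Suc i) y) * ?t (drop (Suc i) y) - ?t (l # take i y) * ?t (drop i y)
        - ?t (l # take (Suc i) y @ mrev flip (drop (Suc i) y)) + ?t (l # take i y @ mrev flip (drop i y)))"
    unfolding 0 rev nil by (simp add: algebra_simps cong: sum.cong)
  finally show ?thesis using l by (simp add: loop_self_def)
qed

lemma cross_sum_eq: "fst (hd z) \<Longrightarrow> cross_sum \<omega> z w = loop_cross fst flip (tr_word \<omega>) z w"
  unfolding cross_sum_def loop_cross_def by (intro sum.cong) auto

end

context orth_setting
begin

text \<open>Traceless in every dimension and at every point, so that the vanishing of one-letter
  traces is an identity of functions.\<close>

definition LL :: "(nat \<times> 'w matrix_seq) set" where
  "LL = {(c, X). c \<in> I \<and> X \<in> ext c \<and> (\<forall>N \<omega>. mat_trace (X N \<omega>) = 0)}"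

definition lfl :: "nat \<times> 'w matrix_seq \<Rightarrow> nat \<times> 'w matrix_seq" where
  "lfl l = (fst l, seq_transpose (snd l))"

definition lmrg :: "nat \<times> 'w matrix_seq \<Rightarrow> nat \<times> 'w matrix_seq \<Rightarrow> nat \<times> 'w matrix_seq" where
  "lmrg l l' = (fst l, cen (seq_mult (snd l) (snd l')))"

definition lpr :: "nat \<times> 'w matrix_seq \<Rightarrow> nat \<times> 'w matrix_seq \<Rightarrow> 'w scalar_seq" where
  "lpr l l' = ntrace_seq (seq_mult (snd l) (snd l'))"

definition val :: "nat \<times> 'w matrix_seq \<Rightarrow> nat \<Rightarrow> 'w \<Rightarrow> complex mat" where
  "val l N \<omega> = transpose_mat (Uc (fst l) N \<omega>) * snd l N \<omega> * Uc (fst l) N \<omega>"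

definition wval :: "(nat \<times> 'w matrix_seq) list \<Rightarrow> nat \<Rightarrow> 'w \<Rightarrow> complex mat" where
  "wval w N \<omega> = foldr (\<lambda>l B. val l N \<omega> * B) w (1\<^sub>m N)"

definition ltr :: "(nat \<times> 'w matrix_seq) list \<Rightarrow> 'w scalar_seq" where
  "ltr w = (\<lambda>N \<omega>. mat_trace (wval w N \<omega>))"

definition EL :: "(nat \<times> 'w matrix_seq) set" where "EL = {(c, X). c \<in> I \<and> X \<in> ext c}"

lemma LL_EL: "l \<in> LL \<Longrightarrow> l \<in> EL" by (auto simp: LL_def EL_def)

lemma EL_carrier: "l \<in> EL \<Longrightarrow> snd l N \<omega> \<in> carrier_mat N N"
  by (auto simp: EL_def ext_carrier)

lemma val_carrier: "l \<in> EL \<Longrightarrow> val l N \<omega> \<in> carrier_mat N N"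
  unfolding val_def by (intro mult_carrier_mat[of _ N N] Uc_carrier EL_carrier)

lemma wval_simps: "wval [] N \<omega> = 1\<^sub>m N" "wval (l # w) N \<omega> = val l N \<omega> * wval w N \<omega>"
  by (simp_all add: wval_def)

lemma wval_carrier: "set w \<subseteq> EL \<Longrightarrow> wval w N \<omega> \<in> carrier_mat N N"
  by (induction w) (auto simp: wval_simps intro!: mult_carrier_mat[of _ N N] val_carrier)

lemma wval_append: "set u \<subseteq> EL \<Longrightarrow> set v \<subseteq> EL \<Longrightarrow> wval (u @ v) N \<omega> = wval u N \<omega> * wval v N \<omega>"
proof (induction u)
  case Nil
  then show ?case using left_mult_one_mat[OF wval_carrier[OF Nil(2)]] by (simp add: wval_simps)
next
  case (Cons l u)
  then show ?case using val_carrier[of l N \<omega>] wval_carrier[of u N \<omega>] wval_carrier[of v N \<omega>]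
    by (simp add: wval_simps assoc_mult_mat[of _ N N _ N _ N])
qed

lemma wval_one: "l \<in> EL \<Longrightarrow> wval [l] N \<omega> = val l N \<omega>"
  using right_mult_one_mat[OF val_carrier] by (simp add: wval_simps)

lemma conj_mult:
  assumes "X \<in> carrier_mat N N" "Y \<in> carrier_mat N N"
  shows "transpose_mat (Uc c N \<omega>) * (X * Y) * Uc c N \<omega> =
    (transpose_mat (Uc c N \<omega>) * X * Uc c N \<omega>) * (transpose_mat (Uc c N \<omega>) * Y * Uc c N \<omega>)"
proof -
  define V where "V = Uc c N \<omega>"
  define W where "W = transpose_mat V"
  have c: "V \<in> carrier_mat N N" "W \<in> carrier_mat N N" using Uc_carrier by (auto simp: V_def W_def)
  have VW: "V * W = 1\<^sub>m N" using Uc_orth by (simp add: V_def W_def)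
  have "(W * X * V) * (W * Y * V) = W * X * (V * W * (Y * V))"
    using c assms by (simp add: assoc_mult_mat[of _ N N _ N _ N] mult_carrier_mat[of _ N N _ N])
  also have "\<dots> = W * X * (Y * V)" unfolding VW using c assms left_mult_one_mat[of "Y * V" N N] by simp
  also have "\<dots> = W * (X * Y) * V"
    using c assms by (simp add: assoc_mult_mat[of _ N N _ N _ N] mult_carrier_mat[of _ N N _ N])
  finally show ?thesis by (simp add: V_def W_def)
qed

lemma conj_add:
  assumes "X \<in> carrier_mat N N" "Y \<in> carrier_mat N N"
  shows "transpose_mat (Uc c N \<omega>) * (X + Y) * Uc c N \<omega> =
    (transpose_mat (Uc c N \<omega>) * X * Uc c N \<omega>) + (transpose_mat (Uc c N \<omega>) * Y * Uc c N \<omega>)"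
  using assms Uc_carrier[of c N \<omega>]
  by (simp add: mult_add_distrib_mat[of _ N N _ N] add_mult_distrib_mat[of _ N N _ _ N] mult_carrier_mat[of _ N N _ N])

lemma conj_smult_one: "transpose_mat (Uc c N \<omega>) * (z \<cdot>\<^sub>m 1\<^sub>m N) * Uc c N \<omega> = z \<cdot>\<^sub>m 1\<^sub>m N"
proof -
  have "transpose_mat (Uc c N \<omega>) * (z \<cdot>\<^sub>m 1\<^sub>m N) = z \<cdot>\<^sub>m transpose_mat (Uc c N \<omega>)"
    using Uc_carrier[of c N \<omega>] mult_smult_distrib[OF Uc_carrier(2) one_carrier_mat, of c N \<omega> z] right_mult_one_mat[OF Uc_carrier(2), of c N \<omega>] by simp
  then show ?thesis using mult_smult_assoc_mat[OF Uc_carrier(2,1), of z c N \<omega> c] Uc_orth by simp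
qed

lemma conj_trace:
  assumes "X \<in> carrier_mat N N"
  shows "mat_trace (transpose_mat (Uc c N \<omega>) * X * Uc c N \<omega>) = mat_trace X"
proof -
  have "mat_trace (transpose_mat (Uc c N \<omega>) * X * Uc c N \<omega>) = mat_trace (Uc c N \<omega> * (transpose_mat (Uc c N \<omega>) * X))"
    by (rule mat_trace_comm[of _ N]) (use assms Uc_carrier[of c N \<omega>] in \<open>auto intro!: mult_carrier_mat[of _ N N]\<close>)
  also have "Uc c N \<omega> * (transpose_mat (Uc c N \<omega>) * X) = Uc c N \<omega> * transpose_mat (Uc c N \<omega>) * X"
    using assms Uc_carrier[of c N \<omega>] by (simp add: assoc_mult_mat[of _ N N _ N _ N])
  finally show ?thesis using assms by (simp add: Uc_orth left_mult_one_mat[of _ N N])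
qed

lemma val_cen:
  assumes "l \<in> EL"
  shows "val l N \<omega> = val (fst l, cen (snd l)) N \<omega> + ntrace_seq (snd l) N \<omega> \<cdot>\<^sub>m 1\<^sub>m N"
proof -
  let ?X = "snd l N \<omega>" and ?e = "ntrace_seq (snd l) N \<omega>"
  have X: "?X \<in> carrier_mat N N" using EL_carrier[OF assms] .
  have "val (fst l, cen (snd l)) N \<omega> = val l N \<omega> + (- ?e) \<cdot>\<^sub>m 1\<^sub>m N"
    using conj_add[OF X smult_carrier_mat[OF one_carrier_mat], of "fst l" \<omega> "- ?e"]
    unfolding val_def fst_conv snd_conv cen_eq conj_smult_one .
  then show ?thesis using val_carrier[OF assms, of N \<omega>] by (intro eq_matI) auto
qed

text \<open>Letters of one colour are conjugated by the same orthogonal matrix, so their product is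
  the conjugate of the product, which is then centred.\<close>

lemma lmrg_val:
  assumes "l \<in> EL" "l' \<in> EL" "fst l = fst l'"
  shows "val l N \<omega> * val l' N \<omega> = val (lmrg l l') N \<omega> + lpr l l' N \<omega> \<cdot>\<^sub>m 1\<^sub>m N"
proof -
  have X: "snd l N \<omega> \<in> carrier_mat N N" "snd l' N \<omega> \<in> carrier_mat N N" using assms EL_carrier by auto
  have "(fst l, seq_mult (snd l) (snd l')) \<in> EL" using assms by (auto simp: EL_def ext_mult)
  note cn = val_cen[OF this, of N \<omega>]
  have v: "val (fst l, seq_mult (snd l) (snd l')) N \<omega> = val l N \<omega> * val l' N \<omega>"
    unfolding val_def fst_conv snd_conv seq_mult_def assms(3)[symmetric] by (rule conj_mult[OF X])
  show ?thesis using cn unfolding v lmrg_def lpr_def fst_conv snd_conv .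
qed

lemma lmrg_LL: "l \<in> LL \<Longrightarrow> l' \<in> LL \<Longrightarrow> fst l = fst l' \<Longrightarrow> lmrg l l' \<in> LL"
proof -
  assume l: "l \<in> LL" "l' \<in> LL" "fst l = fst l'"
  then have c: "fst l \<in> I" and "snd l \<in> ext (fst l)" "snd l' \<in> ext (fst l)" by (auto simp: LL_def)
  then have m: "seq_mult (snd l) (snd l') \<in> ext (fst l)" by (intro ext_mult)
  have "mat_trace (cen (seq_mult (snd l) (snd l')) N \<omega>) = 0" for N \<omega>
    by (rule cen_trace) (rule ext_carrier[OF m c])
  then show ?thesis using cen_ext[OF m c] c unfolding LL_def lmrg_def by simp
qed

lemma wval_entries:
  assumes "N \<in> Ns" "set w \<subseteq> EL" and H: "\<And>l. l \<in> set w \<Longrightarrow> entries_in N (sub_moments (M N) H) (val l N)"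
  shows "entries_in N (sub_moments (M N) H) (wval w N)"
  using assms(2,3)
proof (induction w)
  case Nil
  have "wval [] N = (\<lambda>\<omega>. 1\<^sub>m N)" by (simp add: fun_eq_iff wval_simps)
  then show ?case using entries_in_one[OF fin_M[OF assms(1)]] by simp
next
  case (Cons l w)
  have "wval (l # w) N = (\<lambda>\<omega>. val l N \<omega> * wval w N \<omega>)" by (simp add: fun_eq_iff wval_simps)
  then show ?case using Cons entries_in_mult[OF fin_M[OF assms(1)]] by simp
qed

text \<open>Used twice: with \<open>M N\<close> itself for \<open>H\<close>, to have moments, and
  with \<open>rest_sigma\<close>, for which the letters of other colours become
  coefficients.\<close>

lemma val_entries:
  assumes N: "N \<in> Ns" and l: "l \<in> EL" and sub: "\<And>f :: 'w \<Rightarrow> complex. f \<in> borel_measurable (GA N) \<Longrightarrow> f \<in> borel_measurable H"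
    and own: "\<And>f :: 'w \<Rightarrow> complex. f \<in> borel_measurable (own_sigma (fst l) N) \<Longrightarrow> f \<in> borel_measurable H"
  shows "entries_in N (sub_moments (M N) H) (val l N)"
proof -
  have c: "fst l \<in> I" and X: "snd l \<in> ext (fst l)" using l by (auto simp: EL_def)
  have eX: "entries_in N (sub_moments (M N) H) (snd l N)"
    by (rule entries_in_mono[OF ext_entries[OF X c N]]) (auto simp: sub_moments_def intro: sub)
  interpret prob_space "M N" by (rule prob_M[OF N])
  have "(\<lambda>\<omega>. Uc (fst l) N \<omega> $$ (i, j)) \<in> sub_moments (M N) H" if ij: "i < N" "j < N" for i j
  proof -
    have e: "Uc (fst l) N \<omega> $$ (i, j) = complex_of_real (U (fst l) N \<omega> $$ (i, j))" for \<omega>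
      using ij U_carrier[of "fst l" N \<omega>] by (simp add: Uc_def)
    have h: "haar_orthogonal (M N) N (U (fst l) N)" by (rule U_haar[OF c N])
    have b: "\<bar>U (fst l) N \<omega> $$ (i, j)\<bar> \<le> 1" for \<omega>
    proof -
      let ?U = "U (fst l) N \<omega>"
      have "(transpose_mat ?U * ?U) $$ (j, j) = (\<Sum>k<N. ?U $$ (k, j) * ?U $$ (k, j))"
        using ij carrier_matD[OF U_carrier[of "fst l" N \<omega>]] by (subst mat_mult_entry[of _ N]) auto
      then have "(\<Sum>k<N. (?U $$ (k, j))\<^sup>2) = 1" using ij U_orth[of "fst l" N \<omega>] by (simp add: orthogonal_group_mat_def power2_eq_square)
      moreover have "(?U $$ (i, j))\<^sup>2 \<le> (\<Sum>k<N. (?U $$ (k, j))\<^sup>2)" using ij by (intro member_le_sum) auto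
      ultimately show ?thesis by (simp add: abs_square_le_1)
    qed
    have "(\<lambda>\<omega>. complex_of_real (U (fst l) N \<omega> $$ (i, j))) \<in> all_moments (M N)"
    proof (rule all_moments_bounded[where B = 1, OF finite_measure_axioms])
      have "(\<lambda>\<omega>. U (fst l) N \<omega> $$ (i, j)) \<in> borel_measurable (M N)"
        using h ij unfolding haar_orthogonal_def by blast
      then show "(\<lambda>\<omega>. complex_of_real (U (fst l) N \<omega> $$ (i, j))) \<in> borel_measurable (M N)" by measurable
      show "norm (complex_of_real (U (fst l) N \<omega> $$ (i, j))) \<le> 1" for \<omega> using b[of \<omega>] by simp
    qed
    then show ?thesis unfolding e using own[OF U_measurable[OF c N ij]] unfolding sub_moments_def by blast
  qed
  then have eU: "entries_in N (sub_moments (M N) H) (Uc (fst l) N)" using Uc_carrier by (auto simp: entries_in_def)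
  have "entries_in N (sub_moments (M N) H) (\<lambda>\<omega>. transpose_mat (Uc (fst l) N \<omega>) * snd l N \<omega> * Uc (fst l) N \<omega>)"
    by (rule entries_in_mult[OF finite_measure_axioms entries_in_mult[OF finite_measure_axioms entries_in_transpose[OF eU] eX] eU])
  then show ?thesis by (simp only: val_def[abs_def])
qed

end

context orth_setting
begin

abbreviation MS :: "'w scalar_seq set" where "MS \<equiv> moment_seqs Ns M"

lemma MS_add: "f \<in> MS \<Longrightarrow> g \<in> MS \<Longrightarrow> f + g \<in> MS"
  by (auto simp: moment_seqs_def plus_fun_def intro: all_moments_add)

lemma MS_mult: "f \<in> MS \<Longrightarrow> g \<in> MS \<Longrightarrow> f * g \<in> MS"
  by (auto simp: moment_seqs_def times_fun_def intro: all_moments_mult)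

lemma MS_uminus: "f \<in> MS \<Longrightarrow> - f \<in> MS"
  by (auto simp: moment_seqs_def fun_Compl_def intro: all_moments_uminus)

lemma MS_diff: "f \<in> MS \<Longrightarrow> g \<in> MS \<Longrightarrow> f - g \<in> MS"
  using MS_add[OF _ MS_uminus] by fastforce

lemma MS_cseq: "cseq d \<in> MS" using AM_cseq AM_moments by blast

lemma MS_sum: "(\<And>i. i \<in> J \<Longrightarrow> f i \<in> MS) \<Longrightarrow> sum f J \<in> MS"
  by (induction J rule: infinite_finite_induct) (use MS_cseq[of "\<lambda>_. 0"] in \<open>auto simp: cseq_simps intro: MS_add\<close>)

lemma own_M:
  assumes "c \<in> I" "N \<in> Ns" "f \<in> borel_measurable (own_sigma c N)" shows "f \<in> borel_measurable (M N)"
proof (rule measurable_mono[of borel borel, THEN subsetD, OF _ _ _ _ assms(3)])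
  show "sets (own_sigma c N) \<subseteq> sets (M N)"
    unfolding own_sigma_def using sig_Pow[of N "Some c"] sig_events[OF assms(2), of "Some c"] assms(1)
    by (subst sets_measure_of) (auto intro!: sets.sigma_sets_subset)
  show "space (own_sigma c N) = space (M N)" by (simp add: own_sigma_def space_measure_of_conv)
qed auto

lemma GA_M: "N \<in> Ns \<Longrightarrow> f \<in> borel_measurable (GA N) \<Longrightarrow> f \<in> borel_measurable (M N)"
proof (rule measurable_mono[of borel borel, THEN subsetD, rotated 4])
  show "space (GA N) = space (M N)" by (simp add: GA_def space_measure_of_conv)
qed (auto simp: GA_sets)

lemma val_entries_M: "N \<in> Ns \<Longrightarrow> l \<in> EL \<Longrightarrow> entries_in N (sub_moments (M N) (M N)) (val l N)"
  by (rule val_entries) (auto simp: EL_def intro: GA_M own_M)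

lemma ltr_MS: "set w \<subseteq> EL \<Longrightarrow> ltr w \<in> MS"
  unfolding moment_seqs_def ltr_def
  using entries_in_trace[OF fin_M wval_entries[OF _ _ val_entries_M]] by (auto simp: sub_moments_def)

lemma traces_MS: "\<forall>w\<in>set ws. set w \<subseteq> EL \<Longrightarrow> traces ltr ws \<in> MS"
  unfolding traces_def
  by (induction ws) (use MS_cseq[of "\<lambda>_. 1"] in \<open>auto simp: cseq_simps intro: MS_mult ltr_MS\<close>)

lemma lfl_LL: "l \<in> LL \<Longrightarrow> lfl l \<in> LL"
  by (auto simp: LL_def lfl_def ext_transpose) (auto simp: seq_transpose_def mat_trace_transpose[OF ext_carrier])

lemma lfl_lfl: "lfl (lfl l) = l"
  by (cases l) (simp add: lfl_def seq_transpose_def)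

lemma val_lfl: "m \<in> EL \<Longrightarrow> val (lfl m) N \<omega> = transpose_mat (val m N \<omega>)"
proof -
  assume m: "m \<in> EL"
  let ?X = "snd m N \<omega>" and ?V = "Uc (fst m) N \<omega>"
  have cc: "?X \<in> carrier_mat N N" "?V \<in> carrier_mat N N" "transpose_mat ?V \<in> carrier_mat N N"
    using EL_carrier[OF m] Uc_carrier by auto
  have "transpose_mat (transpose_mat ?V * ?X * ?V) = transpose_mat ?V * (transpose_mat ?X * ?V)"
    using cc by (simp add: transpose_mult[of _ N N _ N] mult_carrier_mat[of _ N N])
  also have "\<dots> = transpose_mat ?V * transpose_mat ?X * ?V"
    using cc by (simp add: assoc_mult_mat[of _ N N _ N _ N])
  finally show ?thesis by (simp add: val_def lfl_def seq_transpose_def)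
qed

lemma mrev_EL: "set w \<subseteq> EL \<Longrightarrow> set (mrev lfl w) \<subseteq> EL"
  by (auto simp: mrev_def EL_def lfl_def ext_transpose)

lemma ltr_loop_MS:
  assumes "l \<in> EL" "set y \<subseteq> EL" shows "loop_self fst lfl ltr l y \<in> MS"
proof -
  have m: "ltr u \<in> MS" if "set u \<subseteq> insert l (set y \<union> set (mrev lfl y))" for u
    using that assms mrev_EL[OF assms(2)] by (intro ltr_MS) blast
  show ?thesis unfolding loop_self_def
    by (intro MS_add MS_uminus MS_sum MS_diff MS_mult m)
      (auto simp: mrev_def dest: in_set_takeD in_set_dropD)
qed

lemma ltr_cross_MS:
  assumes "set z \<subseteq> EL" "set w \<subseteq> EL" shows "loop_cross fst lfl ltr z w \<in> MS"
proof -
  have m: "ltr u \<in> MS" if "set u \<subseteq> set z \<union> set w \<union> set (mrev lfl w)" for u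
    using that assms mrev_EL[OF assms(2)] by (intro ltr_MS) blast
  show ?thesis unfolding loop_cross_def
    by (intro MS_add MS_sum MS_diff m) (auto simp: mrev_def dest: in_set_takeD in_set_dropD)
qed

lemma cyc_alt_EL: "cyc_alt LL fst w \<Longrightarrow> set w \<subseteq> EL"
  by (auto simp: cyc_alt_def LL_EL)

text \<open>From the point of view of the Haar matrix of colour \<open>c\<close>, the letters of other colours
  are coefficients.\<close>

definition loc :: "nat \<Rightarrow> nat \<Rightarrow> nat \<times> 'w matrix_seq \<Rightarrow> bool \<times> ('w \<Rightarrow> complex mat)" where
  "loc c N l = (fst l = c, if fst l = c then snd l N else val l N)"

text \<open>The loop equation of the Haar matrix of the colour of \<open>l\<close>, with words
  translated letter by letter through \<open>loc\<close>; the marked letters are exactly those of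
  this colour.\<close>

lemma ltr_loop:
  assumes N: "N \<in> Ns" and a: "a \<in> R" and z: "cyc_alt LL fst (l # y)" and ws: "list_all (cyc_alt LL fst) ws"
  shows "(of_nat N - 1) * expect M N (a * ltr (l # y) * traces ltr ws) =
          expect M N (a * traces ltr ws * loop_self fst lfl ltr l y) +
          expect M N (a * (\<Sum>j<length ws. traces ltr (remove_nth j ws) * loop_cross fst lfl ltr (l # y) (ws ! j)))"
proof -
  have EL: "l \<in> EL" "set y \<subseteq> EL" "\<forall>w\<in>set ws. set w \<subseteq> EL"
    using cyc_alt_EL[OF z] ws cyc_alt_EL by (simp_all add: list_all_iff)
  define c where "c = fst l"
  have c: "c \<in> I" using EL(1) by (auto simp: c_def EL_def)
  \<comment> \<open>The Haar matrix of colour \<open>c\<close> is rotated while those of all other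
    colours stay fixed as part of \<open>rest_sigma\<close>.\<close>
  interpret haar_step "M N" N "U c N" "rest_sigma c N" "own_sigma c N"
  proof (intro haar_step.intro haar_step_axioms.intro prob_M[OF N])
    show "haar_orthogonal (M N) N (U c N)" by (rule U_haar[OF c N])
    show "sets (rest_sigma c N) \<subseteq> sets (M N)" by (rule rest_sets[OF N])
    show "space (rest_sigma c N) = space (M N)" by (simp add: rest_sigma_def space_measure_of_conv)
  qed (use U_orth U_measurable[OF c N] rest_indep[OF c N] in auto)
  have Hm: "H_moments = sub_moments (M N) (rest_sigma c N)" by (simp add: H_moments_def sub_moments_def)
  have good: "good (loc c N m)" if m: "m \<in> EL" for m
  proof -
    have "entries_in N H_moments (snd m N)" unfolding Hm
      by (rule entries_in_mono[OF ext_entries[of _ "fst m"]]) (use m N in \<open>auto simp: EL_def sub_moments_def GA_rest\<close>)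
    moreover have "entries_in N H_moments (val m N)" if "fst m \<noteq> c" unfolding Hm
      by (rule val_entries[OF N m GA_rest own_rest]) (use m that in \<open>auto simp: EL_def\<close>)
    ultimately show ?thesis by (auto simp: good_def loc_def entries_in_def)
  qed
  have goods: "list_all good (map (loc c N) w)" if "set w \<subseteq> EL" for w
    using that good by (auto simp: list_all_iff)
  have "letter (U c N \<omega>) \<omega> (loc c N m) = val m N \<omega>" for m \<omega>
    by (simp add: letter_def loc_def val_def Uc_def)
  then have "word (U c N \<omega>) \<omega> (map (loc c N) w) = wval w N \<omega>" for w \<omega>
    by (induction w) (simp_all add: word_simps wval_simps)
  then have tw: "tr_word \<omega> (map (loc c N) w) = ltr w N \<omega>" for w \<omega> by (simp add: tr_word_def ltr_def)
  have lf: "flip (loc c N m) = loc c N (lfl m)" if "m \<in> EL" for m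
    using val_lfl[OF that] by (auto simp: flip_def loc_def fun_eq_iff) (auto simp: lfl_def seq_transpose_def)
  have lm: "mrev flip (map (loc c N) w) = map (loc c N) (mrev lfl w)" if "set w \<subseteq> EL" for w
    using that lf by (auto simp: mrev_def rev_map)
  have sub: "set (take i w) \<subseteq> EL" "set (drop i w) \<subseteq> EL" if "set w \<subseteq> EL" for i w
    using that by (auto dest: in_set_takeD in_set_dropD)
  have tc: "tr_word \<omega> (loc c N l # map (loc c N) w) = ltr (l # w) N \<omega>" for w \<omega> using tw[of \<omega> "l # w"] by simp
  have self: "loop_self fst flip (tr_word \<omega>) (loc c N l) (map (loc c N) y) = loop_self fst lfl ltr l y N \<omega>" for \<omega>
  proof -
    have K: "{i. i < length (map (loc c N) y) \<and> fst (map (loc c N) y ! i) = fst (loc c N l)} = {i. i < length y \<and> fst (y ! i) = fst l}"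
      by (auto simp: loc_def c_def)
    show ?thesis unfolding loop_self_def K
      by (simp add: take_map drop_map lm[OF EL(2)] lm[OF sub(2)[OF EL(2)]] tc tw pointwise sum_pointwise flip: map_append)
  qed
  have cross: "loop_cross fst flip (tr_word \<omega>) (map (loc c N) (l # y)) (map (loc c N) w) = loop_cross fst lfl ltr (l # y) w N \<omega>"
    if w: "set w \<subseteq> EL" for w \<omega>
  proof -
    have K: "{i. i < length (map (loc c N) w) \<and> fst (map (loc c N) w ! i) = fst (hd (map (loc c N) (l # y)))} = {i. i < length w \<and> fst (w ! i) = fst (hd (l # y))}"
      by (auto simp: loc_def c_def)
    have s: "set (drop i w @ take j w) \<subseteq> EL" for i j using sub[OF w] by simp
    show ?thesis unfolding loop_cross_def K
      by (simp add: take_map drop_map lm[OF s] tc tw pointwise sum_pointwise flip: map_append)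
  qed
  have T: "traces (tr_word \<omega>) (map (map (loc c N)) vs) = traces ltr vs N \<omega>" for vs \<omega>
    by (induction vs) (simp_all add: traces_def tw pointwise)
  have rm: "remove_nth j (map (map (loc c N)) ws) = map (map (loc c N)) (remove_nth j ws)" for j
    by (simp add: remove_nth_def take_map drop_map)
  have l0: "ltr [l] N \<omega> = 0" for \<omega>
    using z conj_trace[OF EL_carrier[OF EL(1), of N \<omega>]] EL(1) wval_one[OF EL(1), of N \<omega>]
    by (simp add: ltr_def val_def cyc_alt_def LL_def case_prod_beta)
  have "fst (loc c N l)" by (simp add: loc_def c_def)
  note ss = self_sum_Cons[OF this]
  have aH: "a N \<in> H_moments" unfolding Hm using a R_AM N by (auto simp: AM_def sub_moments_def GA_rest)
  have "(\<integral>\<omega>. a N \<omega> * (traces (tr_word \<omega>) (map (map (loc c N)) ws) * self_sum \<omega> (map (loc c N) (l # y)) +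
      (\<Sum>j<length (map (map (loc c N)) ws). traces (tr_word \<omega>) (remove_nth j (map (map (loc c N)) ws)) *
        cross_sum \<omega> (map (loc c N) (l # y)) (map (map (loc c N)) ws ! j))) \<partial>M N) = 0"
    by (rule loop_equation) (use EL goods[of "l # y"] goods aH in \<open>auto simp: list_all_iff\<close>)
  moreover have "self_sum \<omega> (map (loc c N) (l # y)) = (1 - of_nat N) * ltr (l # y) N \<omega> + loop_self fst lfl ltr l y N \<omega>" for \<omega>
    using ss[of "map (loc c N) y" \<omega>] goods[of "l # y"] EL tw[of \<omega> "[l]"] l0 tw[of \<omega> "l # y"] self[of \<omega>] by simp
  moreover have "cross_sum \<omega> (map (loc c N) (l # y)) (map (map (loc c N)) ws ! j) = loop_cross fst lfl ltr (l # y) (ws ! j) N \<omega>"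
    if "j < length ws" for j \<omega>
    using cross[of "ws ! j" \<omega>] EL(3) that by (subst cross_sum_eq) (auto simp: loc_def c_def)
  ultimately have 0: "(\<integral>\<omega>. a N \<omega> * (traces ltr ws N \<omega> * ((1 - of_nat N) * ltr (l # y) N \<omega> + loop_self fst lfl ltr l y N \<omega>) +
      (\<Sum>j<length ws. traces ltr (remove_nth j ws) N \<omega> * loop_cross fst lfl ltr (l # y) (ws ! j) N \<omega>)) \<partial>M N) = 0"
    unfolding rm T by simp
  let ?f = "a * ltr (l # y) * traces ltr ws" and ?g = "a * traces ltr ws * loop_self fst lfl ltr l y"
    and ?h = "a * (\<Sum>j<length ws. traces ltr (remove_nth j ws) * loop_cross fst lfl ltr (l # y) (ws ! j))"
  have aM: "a \<in> MS" using a R_AM AM_moments by blast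
  have zE: "set (l # y) \<subseteq> EL" using EL by simp
  have f: "?f \<in> MS" using EL(3) by (intro MS_mult aM ltr_MS[OF zE] traces_MS)
  have g: "?g \<in> MS" using EL by (intro MS_mult aM ltr_loop_MS traces_MS)
  have h: "?h \<in> MS" using EL(3)
    by (intro MS_mult aM MS_sum ltr_cross_MS[OF zE] traces_MS) (auto simp: remove_nth_def dest!: in_set_takeD in_set_dropD)
  have "expect M N (cseq (\<lambda>N. 1 - of_nat N) * ?f + ?g + ?h) = 0"
    unfolding expect_def
  proof (rule trans[OF _ 0], rule Bochner_Integration.integral_cong[OF refl])
    show "(cseq (\<lambda>N. 1 - of_nat N) * ?f + ?g + ?h) N \<omega> = a N \<omega> * (traces ltr ws N \<omega> * ((1 - of_nat N) * ltr (l # y) N \<omega> + loop_self fst lfl ltr l y N \<omega>) +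
      (\<Sum>j<length ws. traces ltr (remove_nth j ws) N \<omega> * loop_cross fst lfl ltr (l # y) (ws ! j) N \<omega>))" for \<omega>
      by (simp add: pointwise cseq_apply sum_pointwise algebra_simps)
  qed
  moreover have "expect M N (cseq (\<lambda>N. 1 - of_nat N) * ?f + ?g + ?h) = (1 - of_nat N) * expect M N ?f + expect M N ?g + expect M N ?h"
    using f g h N MS_cseq[of "\<lambda>N. 1 - of_nat N"] by (simp add: expect_add[of _ Ns] MS_add MS_mult expect_cseq)
  ultimately show ?thesis by (simp add: algebra_simps)
qed

sublocale gs: gauss_system Ns M R0 R LL fst lfl lmrg lpr ltr Taus Trs
proof (intro gauss_system.intro loop_system.intro gauss_system_axioms.intro)
  show "infinite Ns" by (rule infinite_Ns)
  show "R0 \<subseteq> R" by (rule R0_R)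
  show "R \<subseteq> moment_seqs Ns M" using R_AM AM_moments by blast
  show "Taus \<subseteq> R" unfolding R_def using Rgen_base by blast
next
  fix f g show "f \<in> R0 \<Longrightarrow> g \<in> R0 \<Longrightarrow> f + g \<in> R0" "f \<in> R0 \<Longrightarrow> g \<in> R0 \<Longrightarrow> f * g \<in> R0"
    "f \<in> R \<Longrightarrow> g \<in> R \<Longrightarrow> f + g \<in> R" "f \<in> R \<Longrightarrow> g \<in> R \<Longrightarrow> f * g \<in> R"
    unfolding R0_def R_def by (simp_all add: Rgen_add Rgen_mult)
next
  fix d :: "nat \<Rightarrow> complex" and c assume "(d \<longlongrightarrow> c) F"
  then show "cseq d \<in> R0" unfolding R0_def by (rule Rgen_cseq)
next
  fix l l' :: "nat \<times> 'w matrix_seq" assume l: "l \<in> LL" "l' \<in> LL" "fst l = fst l'"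
  have "seq_mult (snd l) (snd l') \<in> ext (fst l)" "fst l \<in> I" using l by (auto simp: LL_def intro: ext_mult)
  then show "lpr l l' \<in> R0" unfolding lpr_def by (rule ext_ntrace)
next
  fix w assume "set w \<subseteq> LL" then show "ltr w \<in> MS" using LL_EL by (intro ltr_MS) blast
next
  show "ltr [] = cseq of_nat" by (simp add: ltr_def wval_simps mat_trace_one cseq_def)
next
  fix l assume "l \<in> LL"
  then show "ltr [l] = 0"
    using conj_trace[OF EL_carrier[OF LL_EL]] wval_one[OF LL_EL]
    by (auto simp: ltr_def val_def LL_def fun_eq_iff pointwise)
next
  fix u v assume "set u \<subseteq> LL" "set v \<subseteq> LL"
  then have uv: "set u \<subseteq> EL" "set v \<subseteq> EL" using LL_EL by auto
  show "ltr (u @ v) = ltr (v @ u)"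
    by (intro ext) (simp add: ltr_def wval_append uv mat_trace_comm[OF wval_carrier[OF uv(1)] wval_carrier[OF uv(2)]])
next
  fix u v l l' assume u: "set u \<subseteq> LL" and l: "l \<in> LL" "l' \<in> LL" "fst l = fst l'" and v: "set v \<subseteq> LL"
  have uv: "set u \<subseteq> EL" "set v \<subseteq> EL" using LL_EL u v by auto
  have lE: "l \<in> EL" "l' \<in> EL" "lmrg l l' \<in> EL" using l lmrg_LL LL_EL by auto
  show "ltr (u @ [l, l'] @ v) = ltr (u @ [lmrg l l'] @ v) + lpr l l' * ltr (u @ v)"
  proof (intro ext)
    fix N \<omega>
    have c: "wval u N \<omega> \<in> carrier_mat N N" "wval v N \<omega> \<in> carrier_mat N N"
      "val l N \<omega> \<in> carrier_mat N N" "val l' N \<omega> \<in> carrier_mat N N" "val (lmrg l l') N \<omega> \<in> carrier_mat N N"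
      using uv lE by (auto intro: wval_carrier val_carrier)
    let ?e = "lpr l l' N \<omega>" and ?u = "wval u N \<omega>" and ?v = "wval v N \<omega>" and ?m = "val (lmrg l l') N \<omega>"
    have "wval (u @ [l, l'] @ v) N \<omega> = ?u * (val l N \<omega> * val l' N \<omega> * ?v)"
      using uv lE c by (subst wval_append) (auto simp: wval_simps assoc_mult_mat[of _ N N _ N _ N])
    also have "val l N \<omega> * val l' N \<omega> * ?v = ?m * ?v + ?e \<cdot>\<^sub>m ?v"
      unfolding lmrg_val[OF lE(1,2) l(3)]
      using c add_mult_distrib_mat[OF c(5) smult_carrier_mat[OF one_carrier_mat] c(2), of ?e]
        mult_smult_assoc_mat[OF one_carrier_mat c(2), of ?e] left_mult_one_mat[OF c(2)] by simp
    also have "?u * (?m * ?v + ?e \<cdot>\<^sub>m ?v) = ?u * (?m * ?v) + ?e \<cdot>\<^sub>m (?u * ?v)"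
      using mult_add_distrib_mat[OF c(1) mult_carrier_mat[OF c(5,2)] smult_carrier_mat[OF c(2)], of ?e]
        mult_smult_distrib[OF c(1,2), of ?e] by simp
    also have "?u * (?m * ?v) = wval (u @ [lmrg l l'] @ v) N \<omega>"
      using uv lE by (subst wval_append) (auto simp: wval_simps)
    finally have "wval (u @ [l, l'] @ v) N \<omega> = wval (u @ [lmrg l l'] @ v) N \<omega> + ?e \<cdot>\<^sub>m wval (u @ v) N \<omega>"
      using uv by (simp add: wval_append)
    moreover have "wval (u @ [lmrg l l'] @ v) N \<omega> \<in> carrier_mat N N" "wval (u @ v) N \<omega> \<in> carrier_mat N N"
      using uv lE by (intro wval_carrier; simp)+
    ultimately show "ltr (u @ [l, l'] @ v) N \<omega> = (ltr (u @ [lmrg l l'] @ v) + lpr l l' * ltr (u @ v)) N \<omega>"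
      unfolding ltr_def pointwise by (simp add: mat_trace_add[of _ N] mat_trace_smult[of _ N])
  qed
next
  fix N a l y ws assume "N \<in> Ns" "a \<in> R" "cyc_alt LL fst (l # y)" "list_all (cyc_alt LL fst) ws"
  then show "(of_nat N - 1) * expect M N (a * ltr (l # y) * traces ltr ws) =
          expect M N (a * traces ltr ws * loop_self fst lfl ltr l y) +
          expect M N (a * (\<Sum>j<length ws. traces ltr (remove_nth j ws) * loop_cross fst lfl ltr (l # y) (ws ! j)))"
    by (rule ltr_loop)
qed (use prob_M R_conv lfl_LL lfl_lfl lmrg_LL Trs_form Taus_cumulant in \<open>auto simp: lfl_def lmrg_def R0_def Rgen_def\<close>)

end

subsection \<open>Limits of traces\<close>

lemma joint_cumulant_cong:
  assumes "list_all2 (\<lambda>f g. \<forall>\<omega>\<in>space P. f \<omega> = g \<omega>) Xs Ys"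
  shows "joint_cumulant P Xs = joint_cumulant P Ys"
proof -
  have len: "length Xs = length Ys" using assms by (rule list_all2_lengthD)
  have e: "(Xs ! i) \<omega> = (Ys ! i) \<omega>" if "i < length Ys" "\<omega> \<in> space P" for i \<omega>
    using assms that len by (auto simp: list_all2_conv_all_nth)
  show ?thesis unfolding joint_cumulant_eq len
  proof (rule cumulant_of_cong)
    fix B assume "B \<subseteq> {..<length Ys}"
    then show "(\<integral>\<omega>. (\<Prod>i\<in>B. (Xs ! i) \<omega>) \<partial>P) = (\<integral>\<omega>. (\<Prod>i\<in>B. (Ys ! i) \<omega>) \<partial>P)"
      using e by (intro Bochner_Integration.integral_cong prod.cong) auto
  qed
qed

lemma joint_cumulant_scale:
  "joint_cumulant P (map (\<lambda>f \<omega>. c * f \<omega>) Xs) = c ^ length Xs * joint_cumulant P Xs"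
proof -
  let ?Y = "map (\<lambda>f \<omega>. c * f \<omega>) Xs"
  have "(\<Prod>V\<in>\<pi>. \<integral>\<omega>. (\<Prod>i\<in>V. (?Y ! i) \<omega>) \<partial>P) = c ^ length Xs * (\<Prod>V\<in>\<pi>. \<integral>\<omega>. (\<Prod>i\<in>V. (Xs ! i) \<omega>) \<partial>P)"
    if p: "partition_on {..<length Xs} \<pi>" for \<pi>
  proof -
    have V: "V \<subseteq> {..<length Xs}" if "V \<in> \<pi>" for V using p that by (auto simp: partition_on_def)
    have "(\<Prod>i\<in>V. (?Y ! i) \<omega>) = c ^ card V * (\<Prod>i\<in>V. (Xs ! i) \<omega>)" if "V \<in> \<pi>" for V \<omega>
    proof -
      have "(\<Prod>i\<in>V. (?Y ! i) \<omega>) = (\<Prod>i\<in>V. c * (Xs ! i) \<omega>)" using V[OF that] by (intro prod.cong) auto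
      then show ?thesis by (simp add: prod.distrib)
    qed
    then have "(\<Prod>V\<in>\<pi>. \<integral>\<omega>. (\<Prod>i\<in>V. (?Y ! i) \<omega>) \<partial>P) = (\<Prod>V\<in>\<pi>. c ^ card V * (\<integral>\<omega>. (\<Prod>i\<in>V. (Xs ! i) \<omega>) \<partial>P))"
      by (intro prod.cong) auto
    also have "\<dots> = c ^ (\<Sum>V\<in>\<pi>. card V) * (\<Prod>V\<in>\<pi>. \<integral>\<omega>. (\<Prod>i\<in>V. (Xs ! i) \<omega>) \<partial>P)"
      by (simp add: prod.distrib power_sum)
    also have "(\<Sum>V\<in>\<pi>. card V) = card (\<Union>\<pi>)"
    proof (rule card_Union_disjoint[symmetric])
      show "pairwise disjnt \<pi>" using p by (auto simp: partition_on_def disjoint_def pairwise_def disjnt_def)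
      show "finite B" if "B \<in> \<pi>" for B using V[OF that] finite_subset by blast
    qed
    also have "\<Union>\<pi> = {..<length Xs}" using p by (simp add: partition_on_def)
    finally show ?thesis by simp
  qed
  then show ?thesis unfolding joint_cumulant_def sum_distrib_left
    by (intro sum.cong) (auto simp: mult_ac)
qed

context orth_setting
begin

text \<open>Conjugation by \<open>Q\<close> and by its everywhere orthogonal modification
  \<open>U\<close> can differ in dimensions outside \<open>Ns\<close> and outside the sample spaces;
  expectations and their limits do not see this.\<close>

definition agree :: "'w matrix_seq \<Rightarrow> 'w matrix_seq \<Rightarrow> bool" where
  "agree X Y \<longleftrightarrow> (\<forall>N\<in>Ns. \<forall>\<omega>\<in>space (M N). X N \<omega> = Y N \<omega>)"

lemma agree_refl: "agree X X" by (simp add: agree_def)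
lemma agree_add: "agree X X' \<Longrightarrow> agree Y Y' \<Longrightarrow> agree (seq_add X Y) (seq_add X' Y')" by (simp add: agree_def seq_add_def)
lemma agree_mult: "agree X X' \<Longrightarrow> agree Y Y' \<Longrightarrow> agree (seq_mult X Y) (seq_mult X' Y')" by (simp add: agree_def seq_mult_def)
lemma agree_smult: "agree X X' \<Longrightarrow> agree (seq_smult z X) (seq_smult z X')" by (simp add: agree_def seq_smult_def)
lemma agree_transpose: "agree X X' \<Longrightarrow> agree (seq_transpose X) (seq_transpose X')" by (simp add: agree_def seq_transpose_def)

text \<open>A normal form for the generated algebra: complex combinations of words in conjugated
  letters. Random scalars are hidden inside the letters, which come from \<open>ext\<close>.\<close>

inductive_set wspan :: "'w matrix_seq set" where
  base: "set w \<subseteq> EL \<Longrightarrow> wval w \<in> wspan"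
| add: "X \<in> wspan \<Longrightarrow> Y \<in> wspan \<Longrightarrow> seq_add X Y \<in> wspan"
| smult: "X \<in> wspan \<Longrightarrow> seq_smult z X \<in> wspan"

lemma wspan_carrier: "X \<in> wspan \<Longrightarrow> X N \<omega> \<in> carrier_mat N N"
  by (induction rule: wspan.induct) (auto simp: seq_add_def seq_smult_def wval_carrier)

lemma wspan_mult: "X \<in> wspan \<Longrightarrow> Y \<in> wspan \<Longrightarrow> seq_mult X Y \<in> wspan"
proof (induction rule: wspan.induct)
  case (base u)
  note u = base(1)
  show ?case using base(2)
  proof (induction rule: wspan.induct)
    case (base v)
    have "seq_mult (wval u) (wval v) = wval (u @ v)" by (simp add: seq_mult_def wval_append[OF u base] fun_eq_iff)
    then show ?case using wspan.base[of "u @ v"] u base by simp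
  next
    case (add Y Z)
    have "seq_mult (wval u) (seq_add Y Z) = seq_add (seq_mult (wval u) Y) (seq_mult (wval u) Z)"
      using mult_add_distrib_mat[OF wval_carrier[OF u] wspan_carrier[OF add(1)] wspan_carrier[OF add(2)]]
      by (simp add: seq_mult_def seq_add_def fun_eq_iff)
    then show ?case using wspan.add[OF add(3,4)] by simp
  next
    case (smult Y z)
    have "seq_mult (wval u) (seq_smult z Y) = seq_smult z (seq_mult (wval u) Y)"
      using mult_smult_distrib[OF wval_carrier[OF u] wspan_carrier[OF smult(1)]]
      by (simp add: seq_mult_def seq_smult_def fun_eq_iff)
    then show ?case using wspan.smult[OF smult(2)] by simp
  qed
next
  case (add X Z)
  have "seq_mult (seq_add X Z) Y = seq_add (seq_mult X Y) (seq_mult Z Y)"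
    using add_mult_distrib_mat[OF wspan_carrier[OF add(1)] wspan_carrier[OF add(2)] wspan_carrier[OF add(5)]]
    by (simp add: seq_mult_def seq_add_def fun_eq_iff)
  then show ?case using wspan.add[OF add(3)[OF add(5)] add(4)[OF add(5)]] by simp
next
  case (smult X z)
  have "seq_mult (seq_smult z X) Y = seq_smult z (seq_mult X Y)"
    using mult_smult_assoc_mat[OF wspan_carrier[OF smult(1)] wspan_carrier[OF smult(3)]]
    by (simp add: seq_mult_def seq_smult_def fun_eq_iff)
  then show ?case using wspan.smult[OF smult(2)[OF smult(3)]] by simp
qed

lemma wval_mrev: "set w \<subseteq> EL \<Longrightarrow> wval (mrev lfl w) N \<omega> = transpose_mat (wval w N \<omega>)"
proof (induction w)
  case (Cons l w)
  have l: "l \<in> EL" and w: "set w \<subseteq> EL" using Cons by auto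
  have "wval (mrev lfl (l # w)) N \<omega> = wval (mrev lfl w @ [lfl l]) N \<omega>" by (simp add: mrev_def)
  also have "\<dots> = transpose_mat (wval w N \<omega>) * transpose_mat (val l N \<omega>)"
    using mrev_EL[OF w] mrev_EL[of "[l]"] l w Cons.IH
    by (subst wval_append) (auto simp: mrev_def wval_one val_lfl)
  also have "\<dots> = transpose_mat (wval (l # w) N \<omega>)"
    using transpose_mult[OF val_carrier[OF l] wval_carrier[OF w]] by (simp add: wval_simps)
  finally show ?case .
qed (simp add: mrev_def wval_simps)

lemma wspan_transpose: "X \<in> wspan \<Longrightarrow> seq_transpose X \<in> wspan"
proof (induction rule: wspan.induct)
  case (base w)
  have "seq_transpose (wval w) = wval (mrev lfl w)" by (simp add: seq_transpose_def wval_mrev[OF base] fun_eq_iff)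
  then show ?case using wspan.base[OF mrev_EL[OF base]] by simp
next
  case (add X Y)
  have "seq_transpose (seq_add X Y) = seq_add (seq_transpose X) (seq_transpose Y)"
    using transpose_add[OF wspan_carrier[OF add(1)] wspan_carrier[OF add(2)]]
    by (simp add: seq_transpose_def seq_add_def fun_eq_iff)
  then show ?case using wspan.add add by simp
next
  case (smult X z)
  have "seq_transpose (seq_smult z X) = seq_smult z (seq_transpose X)"
    by (auto simp: seq_transpose_def seq_smult_def fun_eq_iff intro!: eq_matI)
  then show ?case using wspan.smult smult by simp
qed

text \<open>The algebra generated by the conjugated matrices; it becomes the carrier of the limit
  space.\<close>

definition BB :: "'w matrix_seq set" where
  "BB = generated_matrix_algebra (\<Union>c\<in>I. conjugate_by (Q c) ` A c)"

lemma conj_agree: "c \<in> I \<Longrightarrow> agree (conjugate_by (Q c) X) (val (c, X))"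
  by (simp add: agree_def conjugate_by_def seq_mult_def seq_transpose_def complexify_def val_def Uc_def U_Q)

lemma conj_carrier: "c \<in> I \<Longrightarrow> X \<in> A c \<Longrightarrow> conjugate_by (Q c) X N \<omega> \<in> carrier_mat N N"
proof -
  assume c: "c \<in> I" and X: "X \<in> A c"
  have "complexify (Q c) N \<omega> \<in> carrier_mat N N" using Q_carrier[OF c] by (simp add: complexify_def)
  then show ?thesis using AA_carrier[OF A_AA[OF c X], of N \<omega>]
    by (auto simp: conjugate_by_def seq_mult_def seq_transpose_def intro!: mult_carrier_mat[of _ N N])
qed

lemma A_EL: "c \<in> I \<Longrightarrow> X \<in> A c \<Longrightarrow> (c, X) \<in> EL"
  by (auto simp: EL_def intro: A_ext)

lemma BB_carrier: "X \<in> BB \<Longrightarrow> X N \<omega> \<in> carrier_mat N N"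
  unfolding BB_def
proof (induction rule: generated_matrix_algebra.induct)
  case (base X)
  then show ?case using conj_carrier by auto
qed (auto simp: seq_one_def seq_add_def seq_smult_def seq_mult_def seq_transpose_def intro: mult_carrier_mat[of _ N N])

lemma BB_closed:
  "seq_one \<in> BB" "X \<in> BB \<Longrightarrow> Y \<in> BB \<Longrightarrow> seq_add X Y \<in> BB" "X \<in> BB \<Longrightarrow> Y \<in> BB \<Longrightarrow> seq_mult X Y \<in> BB"
  "X \<in> BB \<Longrightarrow> seq_smult z X \<in> BB" "X \<in> BB \<Longrightarrow> seq_transpose X \<in> BB"
  unfolding BB_def by (auto intro: generated_matrix_algebra.intros)

lemma BB_base: "c \<in> I \<Longrightarrow> X \<in> A c \<Longrightarrow> conjugate_by (Q c) X \<in> BB"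
  unfolding BB_def by (intro generated_matrix_algebra.base) blast

lemma BB_wspan: "X \<in> BB \<Longrightarrow> \<exists>Y\<in>wspan. agree X Y"
  unfolding BB_def
proof (induction rule: generated_matrix_algebra.induct)
  case (base X)
  then obtain c Y where cY: "c \<in> I" "Y \<in> A c" "X = conjugate_by (Q c) Y" by auto
  have "wval [(c, Y)] = val (c, Y)" using wval_one[OF A_EL[OF cY(1,2)]] by (intro ext) simp
  then show ?case using conj_agree[OF cY(1), of Y] wspan.base[of "[(c, Y)]"] A_EL[OF cY(1,2)] cY(3) by auto
next
  case one
  have "wval [] = seq_one" by (intro ext) (simp add: wval_simps seq_one_def)
  then show ?case using wspan.base[of "[]"] agree_refl by auto
next
  case (add X Y)
  then show ?case using agree_add wspan.add by blast
next
  case (smult X z)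
  then show ?case using agree_smult wspan.smult by blast
next
  case (mult X Y)
  then show ?case using agree_mult wspan_mult by blast
next
  case (transpose X)
  then show ?case using agree_transpose wspan_transpose by blast
qed

text \<open>A letter as a traceless letter plus a scalar, in the form that \<open>utr\<close>
  expands.\<close>

definition dec :: "nat \<times> 'w matrix_seq \<Rightarrow> (nat \<times> 'w matrix_seq) \<times> 'w scalar_seq" where
  "dec l = ((fst l, cen (snd l)), ntrace_seq (snd l))"

lemma dec_EL: "l \<in> EL \<Longrightarrow> fst (dec l) \<in> EL" by (auto simp: EL_def dec_def cen_ext)

lemma dec_valid: "set w \<subseteq> EL \<Longrightarrow> gs.valid (map dec w)"
proof -
  assume w: "set w \<subseteq> EL"
  have "fst (dec l) \<in> LL" "snd (dec l) \<in> R0" if "l \<in> EL" for l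
  proof -
    have c: "fst l \<in> I" "snd l \<in> ext (fst l)" using that by (auto simp: EL_def)
    have "mat_trace (cen (snd l) N \<omega>) = 0" for N \<omega> by (rule cen_trace) (rule ext_carrier[OF c(2,1)])
    then show "fst (dec l) \<in> LL" using c cen_ext[OF c(2,1)] unfolding dec_def LL_def by simp
    show "snd (dec l) \<in> R0" using ext_ntrace[OF c(2,1)] by (simp add: dec_def)
  qed
  then show ?thesis using w unfolding gs.valid_def by auto
qed

lemma ltr_utr: "set u \<subseteq> EL \<Longrightarrow> set w \<subseteq> EL \<Longrightarrow> ltr (u @ w) = gs.utr u (map dec w)"
proof (induction w arbitrary: u)
  case (Cons l w)
  let ?c = "fst (dec l)" and ?e = "ntrace_seq (snd l)"
  have l: "l \<in> EL" "?c \<in> EL" and w: "set w \<subseteq> EL" and u: "set u \<subseteq> EL" using Cons dec_EL by auto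
  have "ltr (u @ l # w) = ltr (u @ ?c # w) + ?e * ltr (u @ w)"
  proof (intro ext)
    fix N \<omega>
    have c: "wval u N \<omega> \<in> carrier_mat N N" "wval w N \<omega> \<in> carrier_mat N N" "val ?c N \<omega> \<in> carrier_mat N N"
      using u w l by (auto intro: wval_carrier val_carrier)
    let ?f = "?e N \<omega>" and ?u = "wval u N \<omega>" and ?w = "wval w N \<omega>" and ?m = "val ?c N \<omega>"
    have "wval (u @ l # w) N \<omega> = ?u * (val l N \<omega> * ?w)"
      using u w l by (subst wval_append) (auto simp: wval_simps)
    also have "val l N \<omega> = ?m + ?f \<cdot>\<^sub>m 1\<^sub>m N" using val_cen[OF l(1), of N \<omega>] by (simp add: dec_def)
    also have "(?m + ?f \<cdot>\<^sub>m 1\<^sub>m N) * ?w = ?m * ?w + ?f \<cdot>\<^sub>m ?w"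
      using add_mult_distrib_mat[OF c(3) smult_carrier_mat[OF one_carrier_mat] c(2), of ?f]
        mult_smult_assoc_mat[OF one_carrier_mat c(2), of ?f] left_mult_one_mat[OF c(2)] by simp
    also have "?u * (?m * ?w + ?f \<cdot>\<^sub>m ?w) = ?u * (?m * ?w) + ?f \<cdot>\<^sub>m (?u * ?w)"
      using mult_add_distrib_mat[OF c(1) mult_carrier_mat[OF c(3,2)] smult_carrier_mat[OF c(2)], of ?f]
        mult_smult_distrib[OF c(1,2), of ?f] by simp
    also have "?u * (?m * ?w) = wval (u @ ?c # w) N \<omega>"
      using u w l by (subst wval_append) (auto simp: wval_simps)
    also have "?u * ?w = wval (u @ w) N \<omega>" using u w by (simp add: wval_append)
    finally have "wval (u @ l # w) N \<omega> = wval (u @ ?c # w) N \<omega> + ?f \<cdot>\<^sub>m wval (u @ w) N \<omega>" .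
    moreover have "wval (u @ ?c # w) N \<omega> \<in> carrier_mat N N" "wval (u @ w) N \<omega> \<in> carrier_mat N N"
      using u w l by (intro wval_carrier; simp)+
    ultimately show "ltr (u @ l # w) N \<omega> = (ltr (u @ ?c # w) + ?e * ltr (u @ w)) N \<omega>"
      unfolding ltr_def pointwise by (simp add: mat_trace_add[of _ N] mat_trace_smult[of _ N])
  qed
  moreover have "ltr (u @ ?c # w) = gs.utr (u @ [?c]) (map dec w)" using Cons.IH[of "u @ [?c]"] u w l by simp
  moreover have "ltr (u @ w) = gs.utr u (map dec w)" using Cons.IH u w by simp
  moreover have "snd (dec l) = ?e" by (simp add: dec_def)
  ultimately show ?case by (simp only: gs.utr.simps list.map)
qed simp

lemma wspan_Nn: "X \<in> wspan \<Longrightarrow> trace_seq X \<in> gs.Nn"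
proof (induction rule: wspan.induct)
  case (base w)
  have "trace_seq (wval w) = gs.utr [] (map dec w)"
    using ltr_utr[of "[]" w] base by (simp add: trace_seq_def ltr_def)
  then show ?case using gs.utr_Nn[OF _ dec_valid[OF base], of "[]"] by simp
next
  case (add X Y)
  have "trace_seq (seq_add X Y) = trace_seq X + trace_seq Y"
    using mat_trace_add[OF wspan_carrier[OF add(1)] wspan_carrier[OF add(2)]]
    by (simp add: trace_seq_def seq_add_def fun_eq_iff pointwise)
  then show ?case using gs.Nn_add add by simp
next
  case (smult X z)
  have "trace_seq (seq_smult z X) = cseq (\<lambda>_. z) * trace_seq X"
    using mat_trace_smult[OF wspan_carrier[OF smult(1)]]
    by (simp add: trace_seq_def seq_smult_def fun_eq_iff pointwise cseq_apply)
  then show ?case using gs.Nn_scale[OF gs.R0_cseq[OF tendsto_const]] smult by simp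
qed

section \<open>Limits of means and covariances of traces on the generated algebra\<close>

definition tmean :: "'w matrix_seq \<Rightarrow> nat \<Rightarrow> complex" where
  "tmean X N = (\<integral>\<omega>. mat_trace (X N \<omega>) / of_nat N \<partial>M N)"

definition tcov :: "'w matrix_seq \<Rightarrow> 'w matrix_seq \<Rightarrow> nat \<Rightarrow> complex" where
  "tcov X Y N = joint_cumulant (M N) [trace_seq X N, trace_seq Y N]"

text \<open>With \<open>clim\<close>, these limits become the functionals of the limit space; that
  they exist on \<open>BB\<close> is shown in \<open>tmean_lim\<close> and
  \<open>tcov_lim\<close>.\<close>

definition tlim :: "'w matrix_seq \<Rightarrow> complex" where "tlim X = Lim F (tmean X)"

definition clim :: "'w matrix_seq \<Rightarrow> 'w matrix_seq \<Rightarrow> complex" where "clim X Y = Lim F (tcov X Y)"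

lemma tmean_agree: "agree X Y \<Longrightarrow> N \<in> Ns \<Longrightarrow> tmean X N = tmean Y N"
  unfolding tmean_def by (rule Bochner_Integration.integral_cong) (simp_all add: agree_def)

lemma cumulant_agree:
  assumes "list_all2 agree Xs Ys" "N \<in> Ns"
  shows "joint_cumulant (M N) (map (\<lambda>X. trace_seq X N) Xs) = joint_cumulant (M N) (map (\<lambda>X. trace_seq X N) Ys)"
  by (rule joint_cumulant_cong) (use assms in \<open>auto simp: list_all2_conv_all_nth agree_def trace_seq_def\<close>)

lemma F_cong: "(\<And>N. N \<in> Ns \<Longrightarrow> f N = g N) \<Longrightarrow> (f \<longlongrightarrow> c) F \<longleftrightarrow> (g \<longlongrightarrow> c) F"
  by (rule tendsto_cong) (rule eventually_mono[OF eventually_Ns], simp)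

lemma Lim_eqI: "(f \<longlongrightarrow> c) F \<Longrightarrow> Lim F f = c"
  by (rule tendsto_Lim[OF gs.F_neq_bot])

lemma tmean_expect: "tmean X N = expect M N (trace_seq X) / of_nat N"
  unfolding tmean_def expect_def trace_seq_def by (cases "N = 0") auto

lemma BB_lift:
  assumes "set Xs \<subseteq> BB"
  obtains Ys where "list_all2 agree Xs Ys" "set Ys \<subseteq> wspan"
proof -
  have "\<exists>Ys. list_all2 agree Xs Ys \<and> set Ys \<subseteq> wspan" using assms
  proof (induction Xs)
    case (Cons X Xs)
    then obtain Ys Y where "list_all2 agree Xs Ys \<and> set Ys \<subseteq> wspan" "Y \<in> wspan" "agree X Y"
      using BB_wspan[of X] by auto
    then show ?case by (intro exI[of _ "Y # Ys"]) auto
  qed auto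
  then show thesis using that by blast
qed

lemma tmean_lim: "X \<in> BB \<Longrightarrow> (tmean X \<longlongrightarrow> tlim X) F"
proof -
  assume "X \<in> BB"
  then obtain Y where Y: "Y \<in> wspan" "agree X Y" using BB_wspan by blast
  obtain c where "((\<lambda>N. expect M N (trace_seq Y) / of_nat N) \<longlongrightarrow> c) F" using gs.Nn_mean_conv[OF wspan_Nn[OF Y(1)]] by blast
  then have "(tmean X \<longlongrightarrow> c) F"
    by (subst F_cong[of _ "\<lambda>N. expect M N (trace_seq Y) / of_nat N"])
      (use tmean_agree[OF Y(2)] in \<open>simp_all add: tmean_expect[of Y]\<close>)
  then show ?thesis unfolding tlim_def using Lim_eqI by metis
qed

lemma tcov_lim: "X \<in> BB \<Longrightarrow> Y \<in> BB \<Longrightarrow> (tcov X Y \<longlongrightarrow> clim X Y) F"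
proof -
  assume "X \<in> BB" "Y \<in> BB"
  then obtain X' Y' where *: "X' \<in> wspan" "agree X X'" "Y' \<in> wspan" "agree Y Y'" using BB_wspan by meson
  obtain c where c: "(tcov X' Y' \<longlongrightarrow> c) F"
    using gs.Nn_pair_conv[OF wspan_Nn[OF *(1)] wspan_Nn[OF *(3)]] unfolding tcov_def by blast
  have "tcov X Y N = tcov X' Y' N" if "N \<in> Ns" for N
    using cumulant_agree[of "[X, Y]" "[X', Y']" N] * that by (simp add: tcov_def)
  then have "(tcov X Y \<longlongrightarrow> c) F" using c by (subst F_cong)
  then show ?thesis unfolding clim_def using Lim_eqI by metis
qed

lemma BB_cumulant:
  assumes "set Xs \<subseteq> BB" "length Xs \<ge> 3"
  shows "((\<lambda>N. joint_cumulant (M N) (map (\<lambda>X. trace_seq X N) Xs)) \<longlongrightarrow> 0) F"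
proof -
  obtain Ys where Ys: "list_all2 agree Xs Ys" "set Ys \<subseteq> wspan" using BB_lift[OF assms(1)] .
  have "set (map trace_seq Ys) \<subseteq> gs.Nn" using Ys(2) wspan_Nn by auto
  moreover have "length Ys = length Xs" using list_all2_lengthD[OF Ys(1)] by simp
  ultimately have "((\<lambda>N. joint_cumulant (M N) (map (\<lambda>f. f N) (map trace_seq Ys))) \<longlongrightarrow> 0) F"
    using assms(2) by (intro gs.Nn_cumulant) auto
  then show ?thesis using cumulant_agree[OF Ys(1)] by (subst F_cong) (auto simp: o_def)
qed

lemma trace_moments: "X \<in> BB \<Longrightarrow> N \<in> Ns \<Longrightarrow> trace_seq X N \<in> all_moments (M N)"
proof -
  assume "X \<in> BB" and N: "N \<in> Ns"
  then obtain Y where Y: "Y \<in> wspan" "agree X Y" using BB_wspan by blast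
  have m: "trace_seq Y N \<in> all_moments (M N)" using gs.Nn_V[OF wspan_Nn[OF Y(1)]] N by (auto simp: moment_seqs_def)
  have e: "\<And>\<omega>. \<omega> \<in> space (M N) \<Longrightarrow> trace_seq X N \<omega> = trace_seq Y N \<omega>" using Y(2) N by (simp add: trace_seq_def agree_def)
  show ?thesis using m e unfolding all_moments_def
    by (simp cong: measurable_cong Bochner_Integration.integrable_cong)
qed

lemma trace_add: "X \<in> BB \<Longrightarrow> Y \<in> BB \<Longrightarrow> trace_seq (seq_add X Y) = trace_seq X + trace_seq Y"
  using mat_trace_add[OF BB_carrier BB_carrier] by (simp add: trace_seq_def seq_add_def fun_eq_iff pointwise)

lemma trace_smult: "X \<in> BB \<Longrightarrow> trace_seq (seq_smult z X) = cseq (\<lambda>_. z) * trace_seq X"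
  using mat_trace_smult[OF BB_carrier] by (simp add: trace_seq_def seq_smult_def fun_eq_iff pointwise cseq_apply)

lemma trace_one: "trace_seq seq_one = cseq of_nat"
  by (simp add: trace_seq_def seq_one_def fun_eq_iff cseq_apply mat_trace_one)

lemma trace_comm: "X \<in> BB \<Longrightarrow> Y \<in> BB \<Longrightarrow> trace_seq (seq_mult X Y) = trace_seq (seq_mult Y X)"
  using mat_trace_comm[OF BB_carrier BB_carrier] by (simp add: trace_seq_def seq_mult_def fun_eq_iff)

lemma trace_MS: "X \<in> BB \<Longrightarrow> trace_seq X \<in> MS"
  by (simp add: moment_seqs_def trace_moments)

lemma tlim_add: "X \<in> BB \<Longrightarrow> Y \<in> BB \<Longrightarrow> tlim (seq_add X Y) = tlim X + tlim Y"
proof -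
  assume X: "X \<in> BB" and Y: "Y \<in> BB"
  have "tmean (seq_add X Y) N = tmean X N + tmean Y N" if "N \<in> Ns" for N
    unfolding tmean_expect trace_add[OF X Y] expect_add[OF trace_MS[OF X] trace_MS[OF Y] that] by (rule add_divide_distrib)
  then have "(tmean (seq_add X Y) \<longlongrightarrow> tlim X + tlim Y) F"
    using tendsto_add[OF tmean_lim[OF X] tmean_lim[OF Y]] by (subst F_cong)
  then show ?thesis unfolding tlim_def[of "seq_add X Y"] by (rule Lim_eqI)
qed

lemma tlim_smult: "X \<in> BB \<Longrightarrow> tlim (seq_smult z X) = z * tlim X"
proof -
  assume X: "X \<in> BB"
  have "tmean (seq_smult z X) = (\<lambda>N. z * tmean X N)"
    unfolding tmean_expect[abs_def] trace_smult[OF X] expect_cseq by simp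
  then show ?thesis unfolding tlim_def[of "seq_smult z X"]
    using Lim_eqI[OF tendsto_mult[OF tendsto_const tmean_lim[OF X]]] by simp
qed

lemma eventually_pos: "eventually (\<lambda>N. N \<in> Ns \<and> N > 0) F"
  by (rule eventually_conj[OF eventually_Ns filter_leD[OF F_le eventually_gt_at_top]])

lemma tlim_one: "tlim seq_one = 1"
proof -
  have "(tmean seq_one \<longlongrightarrow> 1) F"
  proof (rule Lim_transform_eventually[OF tendsto_const], rule eventually_mono[OF eventually_pos])
    fix N assume N: "N \<in> Ns \<and> N > 0"
    then interpret prob_space "M N" using prob_M by simp
    show "1 = tmean seq_one N" using N by (simp add: tmean_def seq_one_def mat_trace_one prob_space)
  qed
  then show ?thesis unfolding tlim_def by (rule Lim_eqI)
qed

lemma tlim_agree: "agree X Y \<Longrightarrow> tlim X = tlim Y"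
proof -
  assume "agree X Y"
  then have "(tmean X \<longlongrightarrow> c) F \<longleftrightarrow> (tmean Y \<longlongrightarrow> c) F" for c by (intro F_cong tmean_agree)
  then show ?thesis unfolding tlim_def Topological_Spaces.Lim_def by simp
qed

lemma tlim_transpose: "X \<in> BB \<Longrightarrow> tlim (seq_transpose X) = tlim X"
  unfolding tlim_def tmean_def[abs_def] seq_transpose_def using mat_trace_transpose[OF BB_carrier] by simp

lemma tcov_eq: "N \<in> Ns \<Longrightarrow> tcov X Y N = expect M N (trace_seq X * trace_seq Y) - expect M N (trace_seq X) * expect M N (trace_seq Y)"
proof -
  assume "N \<in> Ns"
  then interpret prob_space "M N" by (rule prob_M)
  show ?thesis unfolding tcov_def joint_cumulant_pair expect_def by (simp add: times_fun_def)
qed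

lemma clim_sym: "clim X Y = clim Y X"
proof -
  have "(tcov X Y \<longlongrightarrow> c) F \<longleftrightarrow> (tcov Y X \<longlongrightarrow> c) F" for c by (rule F_cong) (simp add: tcov_eq mult.commute)
  then show ?thesis unfolding clim_def Topological_Spaces.Lim_def by simp
qed

lemma clim_add: "X \<in> BB \<Longrightarrow> Y \<in> BB \<Longrightarrow> Z \<in> BB \<Longrightarrow> clim (seq_add X Y) Z = clim X Z + clim Y Z"
proof -
  assume X: "X \<in> BB" and Y: "Y \<in> BB" and Z: "Z \<in> BB"
  note ms = trace_MS[OF X] trace_MS[OF Y] trace_MS[OF Z]
  have "tcov (seq_add X Y) Z N = tcov X Z N + tcov Y Z N" if N: "N \<in> Ns" for N
    unfolding tcov_eq[OF N] trace_add[OF X Y] distrib_right expect_add[OF ms(1,2) N]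
      expect_add[OF MS_mult[OF ms(1,3)] MS_mult[OF ms(2,3)] N] by simp
  then have "(tcov (seq_add X Y) Z \<longlongrightarrow> clim X Z + clim Y Z) F"
    using tendsto_add[OF tcov_lim[OF X Z] tcov_lim[OF Y Z]] by (subst F_cong)
  then show ?thesis unfolding clim_def[of "seq_add X Y"] by (rule Lim_eqI)
qed

lemma clim_smult: "X \<in> BB \<Longrightarrow> Z \<in> BB \<Longrightarrow> clim (seq_smult z X) Z = z * clim X Z"
proof -
  assume X: "X \<in> BB" and Z: "Z \<in> BB"
  have "tcov (seq_smult z X) Z N = z * tcov X Z N" if N: "N \<in> Ns" for N
    unfolding tcov_eq[OF N] trace_smult[OF X] mult.assoc expect_cseq by (simp add: algebra_simps)
  then have "(tcov (seq_smult z X) Z \<longlongrightarrow> z * clim X Z) F"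
    using tendsto_mult[OF tendsto_const tcov_lim[OF X Z]] by (subst F_cong)
  then show ?thesis unfolding clim_def[of "seq_smult z X"] by (rule Lim_eqI)
qed

lemma clim_one: "clim seq_one Z = 0"
proof -
  have "tcov seq_one Z N = 0" if N: "N \<in> Ns" for N
  proof -
    interpret prob_space "M N" by (rule prob_M[OF N])
    have "expect M N (cseq of_nat) = of_nat N" by (simp add: expect_def cseq_apply prob_space)
    then show ?thesis unfolding tcov_eq[OF N] trace_one expect_cseq by simp
  qed
  then have "(tcov seq_one Z \<longlongrightarrow> 0) F" using tendsto_const[of 0] by (subst F_cong)
  then show ?thesis unfolding clim_def by (rule Lim_eqI)
qed

lemma clim_comm: "X \<in> BB \<Longrightarrow> Y \<in> BB \<Longrightarrow> clim (seq_mult X Y) Z = clim (seq_mult Y X) Z"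
  unfolding clim_def tcov_def[abs_def] by (simp only: trace_comm)

text \<open>By homogeneity a cumulant of normalized traces is a power of \<open>1/N\<close> times a
  convergent cumulant of unnormalized ones.\<close>

lemma BB_ncumulant:
  assumes "set Xs \<subseteq> BB" "length Xs \<ge> 2"
  shows "((\<lambda>N. joint_cumulant (M N) (map (\<lambda>X \<omega>. mat_trace (X N \<omega>) / of_nat N) Xs)) \<longlongrightarrow> 0) F"
proof -
  let ?k = "\<lambda>N. joint_cumulant (M N) (map (\<lambda>X. trace_seq X N) Xs)"
  have "\<exists>c. (?k \<longlongrightarrow> c) F"
  proof (cases "length Xs = 2")
    case True
    then obtain X Y where "Xs = [X, Y]" by (auto simp: length_Suc_conv numeral_2_eq_2)
    then show ?thesis using assms tcov_lim[of X Y] by (auto simp: tcov_def[abs_def])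
  next
    case False
    then show ?thesis using BB_cumulant[OF assms(1)] assms(2) by auto
  qed
  then obtain c where c: "(?k \<longlongrightarrow> c) F" by blast
  have "map (\<lambda>X \<omega>. mat_trace (X N \<omega>) / of_nat N) Xs = map (\<lambda>f \<omega>. (1 / of_nat N) * f \<omega>) (map (\<lambda>X. trace_seq X N) Xs)" for N
    by (simp add: trace_seq_def)
  then have "joint_cumulant (M N) (map (\<lambda>X \<omega>. mat_trace (X N \<omega>) / of_nat N) Xs) = (1 / of_nat N) ^ length Xs * ?k N" for N
    by (simp only: joint_cumulant_scale length_map)
  moreover have "((\<lambda>N. (1 / of_nat N) ^ length Xs * ?k N) \<longlongrightarrow> 0 ^ length Xs * c) F"
    by (intro tendsto_mult tendsto_power nv_lim c)
  moreover have "Xs \<noteq> []" using assms(2) by auto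
  ultimately show ?thesis by (simp add: power_0_left)
qed

subsection \<open>Freeness of the conjugated algebras\<close>

text \<open>\<open>Y\<close> is a member of \<open>BB\<close> that is the conjugate of a single
  letter, whose matrix lies in the given algebra and not just in its extension.\<close>

definition rep :: "'w matrix_seq \<Rightarrow> nat \<times> 'w matrix_seq \<Rightarrow> bool" where
  "rep Y l \<longleftrightarrow> fst l \<in> I \<and> snd l \<in> A (fst l) \<and> Y \<in> BB \<and> agree Y (val l)"

definition sprod :: "'w matrix_seq list \<Rightarrow> 'w matrix_seq" where
  "sprod Ys = foldr seq_mult Ys seq_one"

definition cl :: "nat \<times> 'w matrix_seq \<Rightarrow> nat \<times> 'w matrix_seq" where "cl l = fst (dec l)"

lemma rep_EL: "rep Y l \<Longrightarrow> l \<in> EL" using A_EL[of "fst l" "snd l"] by (simp add: rep_def)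

lemma reps_EL: "list_all2 rep Ys w \<Longrightarrow> set w \<subseteq> EL"
  by (induction rule: list_all2_induct) (auto simp: rep_EL)

lemma sprod_BB: "set Ys \<subseteq> BB \<Longrightarrow> sprod Ys \<in> BB"
  by (induction Ys) (auto simp: sprod_def BB_closed)

lemma sprod_agree: "list_all2 rep Ys w \<Longrightarrow> agree (sprod Ys) (wval w)"
  by (induction rule: list_all2_induct) (auto simp: sprod_def seq_one_def wval_simps agree_def seq_mult_def rep_def)

lemma tmean_wval: "tmean (wval w) N = expect M N (ltr w) / of_nat N"
  unfolding tmean_expect by (simp add: trace_seq_def ltr_def)

lemma lam_rep: "rep Y l \<Longrightarrow> gs.lam (snd (dec l)) = tlim Y"
proof -
  assume r: "rep Y l"
  have "mat_trace (val l N \<omega>) = mat_trace (snd l N \<omega>)" for N \<omega>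
    unfolding val_def by (rule conj_trace[OF EL_carrier[OF rep_EL[OF r]]])
  then have "tmean (val l) = (\<lambda>N. expect M N (ntrace_seq (snd l)))"
    by (simp add: tmean_def[abs_def] expect_def ntrace_seq_def)
  then have "tlim (val l) = gs.lam (ntrace_seq (snd l))" by (simp add: tlim_def gs.lam_def)
  moreover have "tlim Y = tlim (val l)" using r by (intro tlim_agree) (simp add: rep_def)
  ultimately show ?thesis by (simp add: dec_def)
qed

lemma reps_centred:
  "list_all2 rep Ys w \<Longrightarrow> \<forall>Y\<in>set Ys. tlim Y = 0 \<Longrightarrow> \<forall>x\<in>set (map dec w). gs.lam (snd x) = 0"
  by (induction rule: list_all2_induct) (auto simp: lam_rep)

lemma cl_map: "map fst (map dec w) = map cl w" "map fst (map cl w) = map fst w"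
  by (simp_all add: cl_def dec_def)

lemma cl_LL: "set w \<subseteq> EL \<Longrightarrow> set (map cl w) \<subseteq> LL"
  using dec_valid[of w] by (auto simp: gs.valid_def cl_def)

text \<open>The hypothesis says that the letters are centred in the limit; at finite
  \<open>N\<close> a random scalar with limit zero remains in each of them, and
  \<open>utr_free\<close> deals with these.\<close>

lemma free_mat:
  assumes r: "list_all2 rep Ys w" and 0: "\<forall>Y\<in>set Ys. tlim Y = 0" and w: "distinct_adj (map fst w)" "w \<noteq> []"
  shows "tlim (sprod Ys) = 0"
proof -
  have EL: "set w \<subseteq> EL" using reps_EL[OF r] .
  have "lin_alt LL fst (map fst (map dec w))" unfolding lin_alt_def cl_map using cl_LL[OF EL] w by simp
  then have "((\<lambda>N. expect M N (gs.utr [] (map dec w)) / of_nat N) \<longlongrightarrow> 0) F"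
    using reps_centred[OF r 0] w by (intro gs.utr_free dec_valid EL) auto
  then have "(tmean (wval w) \<longlongrightarrow> 0) F"
    using ltr_utr[of "[]" w] EL by (simp add: tmean_wval[abs_def])
  then show ?thesis using tlim_agree[OF sprod_agree[OF r]] Lim_eqI by (simp add: tlim_def)
qed

lemma second_mat:
  assumes r: "list_all2 rep Ys u" "\<forall>Y\<in>set Ys. tlim Y = 0" "cyc_alt LL fst (map cl u)"
    and s: "list_all2 rep Zs v" "\<forall>Y\<in>set Zs. tlim Y = 0" "cyc_alt LL fst (map cl v)"
  shows "clim (sprod Ys) (sprod Zs) = gs.lam (gs.spokes (map cl u) (map cl v))"
proof -
  have EL: "set u \<subseteq> EL" "set v \<subseteq> EL" using reps_EL r s by auto
  have t: "trace_seq (wval u) = gs.utr [] (map dec u)" "trace_seq (wval v) = gs.utr [] (map dec v)"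
    using ltr_utr[of "[]" u] ltr_utr[of "[]" v] EL by (simp_all add: trace_seq_def ltr_def)
  have "((\<lambda>N. joint_cumulant (M N) [gs.utr [] (map dec u) N, gs.utr [] (map dec v) N]) \<longlongrightarrow>
      gs.lam (gs.spokes (map fst (map dec u)) (map fst (map dec v)))) F"
    by (rule gs.utr_pair[OF dec_valid[OF EL(1)] reps_centred[OF r(1,2)] _ dec_valid[OF EL(2)] reps_centred[OF s(1,2)]])
      (simp_all only: cl_map r s)
  then have "(tcov (wval u) (wval v) \<longlongrightarrow> gs.lam (gs.spokes (map cl u) (map cl v))) F"
    unfolding tcov_def[abs_def] t cl_map .
  moreover have "tcov (sprod Ys) (sprod Zs) N = tcov (wval u) (wval v) N" if "N \<in> Ns" for N
    using cumulant_agree[of "[sprod Ys, sprod Zs]" "[wval u, wval v]", OF _ that] sprod_agree[OF r(1)] sprod_agree[OF s(1)]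
    by (simp add: tcov_def)
  ultimately have "(tcov (sprod Ys) (sprod Zs) \<longlongrightarrow> gs.lam (gs.spokes (map cl u) (map cl v))) F" by (subst F_cong)
  then show ?thesis unfolding clim_def by (rule Lim_eqI)
qed

lemma lam_0: "gs.lam 0 = 0" using gs.lam_add[OF gs.zero_G gs.zero_G] by simp

lemma lpr_comm: "l \<in> EL \<Longrightarrow> l' \<in> EL \<Longrightarrow> lpr l l' = lpr l' l"
  using mat_trace_comm[OF EL_carrier EL_carrier] by (simp add: lpr_def ntrace_seq_def seq_mult_def fun_eq_iff)

text \<open>Identifies contraction coefficients with limits of normalized traces of products. For
  different colours both sides are zero, the left one by freeness of two letters. For equal colours
  the letters differ from their centred versions by scalars with limit zero, whose product drops
  out.\<close>

lemma pair_mat: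
  assumes r: "rep Y l" "rep Z l'" "tlim Y = 0" "tlim Z = 0"
  shows "tlim (seq_mult Y Z) = gs.lam (gs.prc (cl l') (cl l))"
proof -
  have EL: "l \<in> EL" "l' \<in> EL" using rep_EL r by auto
  have ag: "agree (seq_mult Y Z) (wval [l, l'])"
    using r EL by (auto simp: agree_def rep_def seq_mult_def wval_simps right_mult_one_mat[OF val_carrier])
  have f: "fst (cl l) = fst l" for l by (simp add: cl_def dec_def)
  show ?thesis
  proof (cases "fst l = fst l'")
    case False
    have "tlim (sprod [Y, Z]) = 0" by (rule free_mat[of _ "[l, l']"]) (use r False in auto)
    moreover have "tlim (sprod [Y, Z]) = tlim (wval [l, l'])" by (intro tlim_agree sprod_agree) (use r in auto)
    moreover have "gs.prc (cl l') (cl l) = 0" using False by (simp add: gs.prc_def f)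
    ultimately show ?thesis using tlim_agree[OF ag] lam_0 by simp
  next
    case True
    let ?e = "snd (dec l)" and ?e' = "snd (dec l')"
    have LL: "cl l \<in> LL" "cl l' \<in> LL" using cl_LL[of "[l, l']"] EL by auto
    have R0: "?e \<in> R0" "?e' \<in> R0" using dec_valid[of "[l, l']"] EL by (auto simp: gs.valid_def)
    have eq: "fst (cl l) = fst (cl l')" using True f by simp
    have pR: "lpr (cl l) (cl l') \<in> R0" by (rule gs.pr_R0[OF LL eq])
    have m: "ltr ([] @ [cl l, cl l'] @ []) = ltr ([] @ [lmrg (cl l) (cl l')] @ []) + lpr (cl l) (cl l') * ltr ([] @ [])"
      by (rule gs.tr_mrg) (use LL eq in auto)
    have "ltr [l, l'] = ltr [cl l, cl l'] + ?e' * ltr [cl l] + ?e * (ltr [cl l'] + ?e' * ltr [])"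
      using ltr_utr[of "[]" "[l, l']"] EL by (simp add: cl_def)
    also have "\<dots> = cseq of_nat * (lpr (cl l) (cl l') + ?e * ?e')"
      using m gs.tr_single[OF LL(1)] gs.tr_single[OF LL(2)] gs.tr_single[OF lmrg_LL[OF LL eq]]
      by (simp add: gs.tr_Nil algebra_simps)
    finally have "tmean (wval [l, l']) N = expect M N (lpr (cl l) (cl l') + ?e * ?e')" if "N > 0" for N
      using that by (simp add: tmean_wval expect_cseq)
    then have "(tmean (wval [l, l']) \<longlongrightarrow> gs.lam (lpr (cl l) (cl l') + ?e * ?e')) F"
      by (intro Lim_transform_eventually[OF gs.lam_lim[OF gs.R0_G]] gs.R0_add gs.R0_mult pR R0)
        (rule eventually_mono[OF eventually_pos], simp)
    then have "tlim (wval [l, l']) = gs.lam (lpr (cl l) (cl l') + ?e * ?e')" unfolding tlim_def by (rule Lim_eqI)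
    also have "\<dots> = gs.lam (lpr (cl l) (cl l'))"
      using gs.lam_add[OF gs.R0_G[OF pR] gs.R0_G[OF gs.R0_mult[OF R0]]] gs.lam_R0_mult[OF R0(1) gs.R0_G[OF R0(2)]] lam_rep[OF r(1)] r(3) by simp
    also have "lpr (cl l) (cl l') = gs.prc (cl l') (cl l)"
      using eq lpr_comm[OF LL_EL[OF LL(1)] LL_EL[OF LL(2)]] by (simp add: gs.prc_def)
    finally show ?thesis using tlim_agree[OF ag] by simp
  qed
qed

lemma rep_transpose: "rep Y l \<Longrightarrow> rep (seq_transpose Y) (lfl l)"
proof -
  assume r: "rep Y l"
  have "snd l \<in> A (fst l)" "fst l \<in> I" using r by (auto simp: rep_def)
  then have "seq_transpose (snd l) \<in> A (fst l)" using A_closed(4) by blast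
  then show ?thesis using r val_lfl[OF rep_EL[OF r]] BB_closed(5)
    by (auto simp: rep_def agree_def seq_transpose_def) (auto simp: lfl_def seq_transpose_def)
qed

lemma cl_lfl: "l \<in> EL \<Longrightarrow> cl (lfl l) = lfl (cl l)"
proof -
  assume l: "l \<in> EL"
  have n: "ntrace_seq (seq_transpose (snd l)) = ntrace_seq (snd l)"
    using mat_trace_transpose[OF EL_carrier[OF l]] by (simp add: ntrace_seq_def seq_transpose_def)
  have "cen (seq_transpose (snd l)) N \<omega> = transpose_mat (cen (snd l) N \<omega>)" for N \<omega>
    unfolding cen_eq n using EL_carrier[OF l, of N \<omega>] by (auto simp: seq_transpose_def intro!: eq_matI)
  then have "cen (seq_transpose (snd l)) = seq_transpose (cen (snd l))" by (simp add: seq_transpose_def fun_eq_iff)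
  then show ?thesis by (simp add: cl_def dec_def lfl_def)
qed

lemma cyc_Suc: "j < length xs \<Longrightarrow> cyc xs (int j + 1) = xs ! j"
  by (simp add: cyc_def)

text \<open>By \<open>lam_contr\<close> the contractions in \<open>spokes\<close> become products
  over all letters, or zero if the lengths differ, and \<open>pair_mat\<close> turns the factors
  into limits of traces. The rest translates list positions into cyclic subscripts.\<close>

lemma second_formula:
  assumes r: "list_all2 rep Ys u" "\<forall>Y\<in>set Ys. tlim Y = 0" "cyc_alt LL fst (map cl u)"
    and s: "list_all2 rep Zs v" "\<forall>Y\<in>set Zs. tlim Y = 0" "cyc_alt LL fst (map cl v)"
  defines "P \<equiv> int (length Ys)"
  shows "clim (sprod Ys) (sprod Zs) = (if length Ys = length Zs then
      (\<Sum>k\<in>{0..P-1}. \<Prod>i\<in>{1..P}. tlim (seq_mult (cyc Ys i) (cyc Zs (k - i)))) +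
      (\<Sum>k\<in>{0..P-1}. \<Prod>i\<in>{1..P}. tlim (seq_mult (cyc Ys i) (seq_transpose (cyc Zs (k + i))))) else 0)"
proof -
  let ?z = "map cl u" and ?w = "map cl v"
  let ?r = "\<lambda>i. rev (drop (Suc i) ?w @ take (Suc i) ?w)" and ?d = "\<lambda>i. map lfl (drop i ?w @ take i ?w)"
  have len: "length u = length Ys" "length v = length Zs" using r s by (auto dest: list_all2_lengthD)
  have z: "set ?z \<subseteq> LL" and w: "set ?w \<subseteq> LL" using r s by (auto simp: cyc_alt_def)
  have parts: "set (?r i) \<subseteq> LL" "set (?d i) \<subseteq> LL" for i
  proof -
    have "set (drop i' ?w @ take i' ?w) \<subseteq> LL" for i'
      using order.trans[OF set_drop_subset w] order.trans[OF set_take_subset w] unfolding set_append by (intro Un_least)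
    then show "set (?r i) \<subseteq> LL" "set (?d i) \<subseteq> LL" using lfl_LL unfolding set_rev set_map by blast+
  qed
  have G: "gs.contr ?z y \<in> gs.G" if "set y \<subseteq> LL" for y using gs.contr_R0[OF z that] gs.R0_G by blast
  have "clim (sprod Ys) (sprod Zs) = gs.lam (gs.spokes ?z ?w)" by (rule second_mat[OF r s])
  also have "\<dots> = (\<Sum>i<length Zs. gs.lam (gs.contr ?z (?r i)) + gs.lam (gs.contr ?z (?d i)))"
  proof -
    have G': "gs.contr ?z (?r i) \<in> gs.G" "gs.contr ?z (?d i) \<in> gs.G" for i
      by (rule G[OF parts(1)]) (rule G[OF parts(2)])
    have "gs.lam (\<Sum>i<length Zs. gs.contr ?z (?r i) + gs.contr ?z (?d i)) =
        (\<Sum>i<length Zs. gs.lam (gs.contr ?z (?r i) + gs.contr ?z (?d i)))"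
      by (rule gs.lam_sum) (intro gs.G_add G')
    then show ?thesis unfolding gs.spokes_def length_map len by (simp only: gs.lam_add[OF G'])
  qed
  also have "\<dots> = (if length Ys = length Zs then
      (\<Sum>i<length Zs. (\<Prod>j<length Ys. gs.lam (gs.prc (?r i ! j) (?z ! j))) + (\<Prod>j<length Ys. gs.lam (gs.prc (?d i ! j) (?z ! j)))) else 0)"
  proof -
    have "length (?r i) = length Zs" "length (?d i) = length Zs" "length ?z = length Ys" for i using len by auto
    then show ?thesis by (simp only: gs.lam_contr[OF z parts(1)] gs.lam_contr[OF z parts(2)]) simp
  qed
  finally have main: "clim (sprod Ys) (sprod Zs) = \<dots>" .
  show ?thesis
  proof (cases "length Ys = length Zs")
    case False
    then show ?thesis using main by simp
  next
    case eq: True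
    define p where "p = length Zs"
    have lp: "length Ys = p" "length Zs = p" "length u = p" "length v = p" "P = int p"
      using eq len by (auto simp: p_def P_def)
    have p0: "p > 0" using r(3) lp by (auto simp: cyc_alt_def)
    define g where "g k = (\<Prod>i\<in>{1..P}. tlim (seq_mult (cyc Ys i) (cyc Zs (k - i))))" for k
    define h where "h k = (\<Prod>i\<in>{1..P}. tlim (seq_mult (cyc Ys i) (seq_transpose (cyc Zs (k + i)))))" for k
    have re: "(\<Prod>i\<in>{1..P}. f i) = (\<Prod>j<p. f (int j + 1))" for f :: "int \<Rightarrow> complex"
      by (rule prod.reindex_bij_witness[of _ "\<lambda>j. int j + 1" "\<lambda>i. nat (i - 1)"]) (auto simp: lp)
    have ry: "rep (Ys ! j) (u ! j)" "tlim (Ys ! j) = 0" "rep (Zs ! j) (v ! j)" "tlim (Zs ! j) = 0" if "j < p" for j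
      using r(1,2) s(1,2) that lp by (auto simp: list_all2_conv_all_nth)
    \<comment> \<open>Counting from 0, position \<open>j\<close> of the reversed rotation holds
      entry \<open>i - j\<close> of \<open>w\<close>, which has subscript
      \<open>i - j + 1 = (i + 2) - (j + 1)\<close>. As position \<open>j\<close> of \<open>z\<close>
      has subscript \<open>j + 1\<close>, the summation index is \<open>k = i + 2\<close>.\<close>
    have 1: "(\<Prod>j<p. gs.lam (gs.prc (?r i ! j) (?z ! j))) = g (int i + 2)" if i: "i < p" for i
    proof -
      have "gs.lam (gs.prc (?r i ! j) (?z ! j)) = tlim (seq_mult (cyc Ys (int j + 1)) (cyc Zs (int i + 2 - (int j + 1))))" if j: "j < p" for j
      proof -
        define n where "n = (Suc i + (p - Suc j)) mod p"
        have n: "n < p" using p0 by (simp add: n_def)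
        have "drop (Suc i) ?w @ take (Suc i) ?w = rotate (Suc i) ?w"
          using i lp by (cases "Suc i = p") (auto simp: rotate_drop_take)
        then have "?r i ! j = rotate (Suc i) ?w ! (p - Suc j)" using j lp by (simp add: rev_nth)
        also have "\<dots> = ?w ! n" using j lp by (subst nth_rotate) (auto simp: n_def)
        finally have "?r i ! j = cl (v ! n)" using n lp by simp
        moreover have "cyc Zs (int i + 2 - (int j + 1)) = Zs ! n"
        proof -
          have "int n = (int i - int j + int p) mod int p"
            using j by (simp add: n_def zmod_int of_nat_diff algebra_simps)
          also have "\<dots> = (int i - int j) mod int p" by simp
          finally have "nat ((int i - int j) mod int p) = n" by linarith
          then show ?thesis by (simp add: cyc_def lp)
        qed
        moreover have "cyc Ys (int j + 1) = Ys ! j" using j lp by (intro cyc_Suc) simp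
        ultimately show ?thesis using pair_mat[OF ry(1)[OF j] ry(3)[OF n] ry(2)[OF j] ry(4)[OF n]] j lp by simp
      qed
      then show ?thesis unfolding g_def re by (intro prod.cong) auto
    qed
    \<comment> \<open>Here position \<open>j\<close> holds entry \<open>i + j\<close>, with
      subscript \<open>i + (j + 1)\<close>, so that \<open>k = i\<close> without a shift.\<close>
    have 2: "(\<Prod>j<p. gs.lam (gs.prc (?d i ! j) (?z ! j))) = h (int i)" if i: "i < p" for i
    proof -
      have "gs.lam (gs.prc (?d i ! j) (?z ! j)) = tlim (seq_mult (cyc Ys (int j + 1)) (seq_transpose (cyc Zs (int i + (int j + 1)))))" if j: "j < p" for j
      proof -
        define n where "n = (i + j) mod p"
        have n: "n < p" using p0 by (simp add: n_def)
        have "drop i ?w @ take i ?w = rotate i ?w" using i lp by (simp add: rotate_drop_take)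
        then have "?d i ! j = lfl (rotate i ?w ! j)" using j lp by (simp del: map_append add: nth_map)
        also have "rotate i ?w ! j = ?w ! n" using j lp by (subst nth_rotate) (auto simp: n_def)
        finally have "?d i ! j = cl (lfl (v ! n))" using n lp cl_lfl[OF rep_EL[OF ry(3)[OF n]]] by simp
        moreover have "cyc Zs (int i + (int j + 1)) = Zs ! n"
        proof -
          have "int n = (int i + int j) mod int p" by (simp add: n_def zmod_int)
          then have "nat ((int i + int j) mod int p) = n" by linarith
          then show ?thesis by (simp add: cyc_def lp)
        qed
        moreover have "cyc Ys (int j + 1) = Ys ! j" using j lp by (intro cyc_Suc) simp
        moreover have "tlim (seq_transpose (Zs ! n)) = 0"
          using tlim_transpose[of "Zs ! n"] ry(3,4)[OF n] by (simp add: rep_def)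
        ultimately show ?thesis using pair_mat[OF ry(1)[OF j] rep_transpose[OF ry(3)[OF n]] ry(2)[OF j]] j lp by simp
      qed
      then show ?thesis unfolding h_def re by (intro prod.cong) auto
    qed
    \<comment> \<open>The shifted index runs through a full period of \<open>g\<close>.\<close>
    have "(\<Sum>i<p. g (int i + 2)) = (\<Sum>k\<in>{0..P-1}. g k)"
    proof (rule sum.reindex_bij_witness[of _ "\<lambda>k. nat ((k - 2) mod P)" "\<lambda>i. (int i + 2) mod P"])
      fix i assume i: "i \<in> {..<p}"
      have "((int i + 2) mod P - 2) mod P = int i" using i lp by (simp add: mod_diff_left_eq)
      then show "nat (((int i + 2) mod P - 2) mod P) = i" by simp
      show "(int i + 2) mod P \<in> {0..P-1}" using lp p0 pos_mod_bound[of P "int i + 2"] by simp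
      have "((int i + 2) mod P - x - 1) mod P = (int i + 2 - x - 1) mod P" for x by (metis mod_diff_left_eq)
      then show "g ((int i + 2) mod P) = g (int i + 2)" by (simp add: g_def cyc_def lp)
    next
      fix k assume k: "k \<in> {0..P-1}"
      have pos: "0 \<le> (k - 2) mod P" "(k - 2) mod P < P" using p0 lp by auto
      then show "nat ((k - 2) mod P) \<in> {..<p}" using lp by auto
      have "((k - 2) mod P + 2) mod P = k" using k by (simp add: mod_add_left_eq)
      then show "(int (nat ((k - 2) mod P)) + 2) mod P = k" using pos by simp
    qed
    moreover have "(\<Sum>i<p. h (int i)) = (\<Sum>k\<in>{0..P-1}. h k)"
      by (rule sum.reindex_bij_witness[of _ nat int]) (auto simp: lp)
    ultimately have "clim (sprod Ys) (sprod Zs) = (\<Sum>k\<in>{0..P-1}. g k) + (\<Sum>k\<in>{0..P-1}. h k)"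
      using main eq 1 2 lp by (simp add: sum.distrib)
    then show ?thesis unfolding g_def h_def if_P[OF eq] .
  qed
qed

end

section \<open>The hypotheses on the given algebras\<close>

text \<open>The positions are split according to whether their colour is that of \<open>i\<close>.
  Independence makes the moments factor along this splitting, and \<open>j\<close> lies on the other
  side of it.\<close>

lemma mixed_trace_cumulant:
  fixes P :: "'w measure"
  assumes P: "prob_space P" and ind: "prob_space.indep_sets P (\<lambda>c. matrix_sigma P N (S c)) J"
    and Xs: "\<And>l. l < length Xs \<Longrightarrow> cf l \<in> J \<and> Xs ! l \<in> S (cf l)"
    and ent: "\<And>X. X \<in> set Xs \<Longrightarrow> entries_in N (all_moments P) (X N)"
    and ij: "i < length Xs" "j < length Xs" "cf i \<noteq> cf j"
  shows "joint_cumulant P (map (\<lambda>X \<omega>. mat_trace (X N \<omega>)) Xs) = 0"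
proof -
  interpret prob_space P by (rule P)
  let ?n = "length Xs"
  define f where "f l \<omega> = mat_trace ((Xs ! l) N \<omega>)" for l \<omega>
  define K where "K = {l. l < ?n \<and> cf l = cf i}"
  let ?sig = "\<lambda>c. matrix_sigma P N (S c)"
  have f: "f l \<in> all_moments P" if "l < ?n" for l
  proof -
    have e: "entries_in N (all_moments P) ((Xs ! l) N)" using ent that by simp
    show ?thesis unfolding f_def[abs_def] mat_trace_carrier[OF entries_in_carrier[OF e]]
      using e by (intro all_moments_sum finite_measure_axioms) (auto simp: entries_in_def)
  qed
  have fm: "f l \<in> borel_measurable (sigma (space P) (\<Union>c\<in>T. ?sig c))" if l: "l < ?n" "cf l \<in> T" for l T
  proof -
    have e: "entries_in N (all_moments P) ((Xs ! l) N)" using ent l by simp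
    have "(\<lambda>\<omega>. (Xs ! l) N \<omega> $$ (a, a)) \<in> borel_measurable (sigma (space P) (\<Union>c\<in>T. ?sig c))" if "a < N" for a
    proof (rule sigma_mono_measurable[OF matrix_sigma_measurable])
      show "Xs ! l \<in> S (cf l)" using Xs[OF l(1)] by simp
      show "?sig (cf l) \<subseteq> (\<Union>c\<in>T. ?sig c)" using l by blast
      show "(\<Union>c\<in>T. ?sig c) \<subseteq> Pow (space P)" by (intro UN_least matrix_sigma_Pow)
    qed (use that in auto)
    then show ?thesis unfolding f_def[abs_def] mat_trace_carrier[OF entries_in_carrier[OF e]]
      by (intro borel_measurable_sum) auto
  qed
  define m where "m B = (\<integral>\<omega>. (\<Prod>l\<in>B. f l \<omega>) \<partial>P)" for B
  have "cumulant_of m {..<?n} = 0"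
  proof (rule cumulant_of_indep[of _ i K j])
    fix B assume B: "B \<subseteq> {..<?n}"
    have fB: "finite B" using B finite_subset by blast
    have int: "integrable P (\<lambda>\<omega>. \<Prod>l\<in>B'. f l \<omega>)" if "B' \<subseteq> B" for B'
      using that B f by (intro all_moments_integrable prod_all_moments) auto
    have "(\<Prod>l\<in>B. f l \<omega>) = (\<Prod>l\<in>B \<inter> K. f l \<omega>) * (\<Prod>l\<in>B - K. f l \<omega>)" for \<omega>
      using prod.Int_Diff[OF fB] .
    moreover have "(\<integral>\<omega>. (\<Prod>l\<in>B \<inter> K. f l \<omega>) * (\<Prod>l\<in>B - K. f l \<omega>) \<partial>P) = m (B \<inter> K) * m (B - K)"
      unfolding m_def
    proof (rule indep_sets_integral_mult[of ?sig "{cf i}" "J - {cf i}"])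
      have "{cf i} \<union> (J - {cf i}) = J" using Xs ij by auto
      then show "indep_sets ?sig ({cf i} \<union> (J - {cf i}))" using ind by (simp only:)
      show "Int_stable (?sig c)" "?sig c \<subseteq> Pow (space P)" for c by (rule matrix_sigma_Int_stable matrix_sigma_Pow)+
      show "(\<lambda>\<omega>. \<Prod>l\<in>B \<inter> K. f l \<omega>) \<in> borel_measurable (sigma (space P) (\<Union>c\<in>{cf i}. ?sig c))"
        by (intro borel_measurable_prod fm) (auto simp: K_def)
      show "(\<lambda>\<omega>. \<Prod>l\<in>B - K. f l \<omega>) \<in> borel_measurable (sigma (space P) (\<Union>c\<in>J - {cf i}. ?sig c))"
        using B Xs by (intro borel_measurable_prod fm) (auto simp: K_def)
    qed (auto intro: int)
    ultimately show "m B = m (B \<inter> K) * m (B - K)" by (simp add: m_def)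
  qed (use ij in \<open>auto simp: K_def m_def prob_space\<close>)
  moreover have "joint_cumulant P (map (\<lambda>X \<omega>. mat_trace (X N \<omega>)) Xs) = cumulant_of m {..<?n}"
    unfolding joint_cumulant_eq length_map
    by (rule cumulant_of_cong) (auto simp: m_def f_def intro!: Bochner_Integration.integral_cong prod.cong)
  ultimately show ?thesis by simp
qed

lemma random_matrix_entries:
  "random_matrix Ns M X \<Longrightarrow> N \<in> Ns \<Longrightarrow> entries_in N (all_moments (M N)) (X N)"
  by (auto simp: random_matrix_def entries_in_def all_moments_def)

lemma poly_Tr_single:
  assumes "X N \<omega> \<in> carrier_mat N N"
  shows "poly_Tr (\<lambda>X. X) N (Poly_Mapping.single [X] 1) \<omega> = mat_trace (X N \<omega>)"
proof -
  interpret A: abelian_group "module_mat TYPE(complex) N N" by (rule abelian_group_mat)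
  have "(\<lambda>w. Poly_Mapping.lookup (Poly_Mapping.single [X] 1) w \<odot>\<^bsub>module_mat TYPE(complex) N N\<^esub>
      list_prod (module_mat TYPE(complex) N N) (map (\<lambda>l. l N \<omega>) w)) \<in> {[X]} \<rightarrow> carrier (module_mat TYPE(complex) N N)"
    using assms by (auto simp: list_prod_def module_mat_simps intro: mult_carrier_mat[of _ N N])
  then have "nc_eval (module_mat TYPE(complex) N N) (\<lambda>l. l N \<omega>) (Poly_Mapping.single [X] 1) = 1 \<cdot>\<^sub>m (X N \<omega> * 1\<^sub>m N)"
    unfolding nc_eval_def using assms
    by (simp add: A.finsum_insert[of "{}"] A.finsum_empty list_prod_def module_mat_simps)
  also have "\<dots> = X N \<omega>" using assms by (auto simp: right_mult_one_mat[of _ N N] intro!: eq_matI)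
  finally show ?thesis by (simp add: poly_Tr_def)
qed

lemma single_nc_polys: "X \<in> S \<Longrightarrow> Poly_Mapping.single [X] 1 \<in> nc_polys S"
  by (simp add: nc_polys_def)

lemma trace_limits:
  assumes "has_second_order_limit_distribution TYPE('a) Ns M S"
  shows "X \<in> S \<Longrightarrow> \<exists>v. ((\<lambda>N. \<integral>\<omega>. mat_trace (X N \<omega>) / of_nat N \<partial>M N) \<longlongrightarrow> v) (dims_to_infinity Ns)"
    and "set Xs \<subseteq> S \<Longrightarrow> length Xs \<ge> 2 \<Longrightarrow>
      \<exists>v. ((\<lambda>N. joint_cumulant (M N) (map (\<lambda>X \<omega>. mat_trace (X N \<omega>)) Xs)) \<longlongrightarrow> v) (dims_to_infinity Ns)"
    and "set Xs \<subseteq> S \<Longrightarrow> length Xs \<ge> 3 \<Longrightarrow>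
      ((\<lambda>N. joint_cumulant (M N) (map (\<lambda>X \<omega>. mat_trace (X N \<omega>)) Xs)) \<longlongrightarrow> 0) (dims_to_infinity Ns)"
proof -
  obtain A :: "(complex, 'a) module" and \<phi>1 \<phi>2 x where lim: "second_order_limit_distribution Ns M S (\<lambda>X. X) A \<phi>1 \<phi>2 x"
    using assms unfolding has_second_order_limit_distribution_def by blast
  let ?p = "\<lambda>X. Poly_Mapping.single [X] 1 :: 'w matrix_seq nc_poly"
  have l1: "limit_distribution Ns M S (\<lambda>X. X) A \<phi>1 x" using lim by (simp add: second_order_limit_distribution_def)
  have c: "X N \<omega> \<in> carrier_mat N N" if "X \<in> S" for X N \<omega>
    using l1 that by (auto simp: limit_distribution_def random_matrix_def)
  have Tr: "poly_Tr (\<lambda>X. X) N (?p X) = (\<lambda>\<omega>. mat_trace (X N \<omega>))" if "X \<in> S" for X N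
    using poly_Tr_single[of X N] c[OF that] by blast
  have map: "map (poly_Tr (\<lambda>X. X) N) (map ?p Xs) = map (\<lambda>X \<omega>. mat_trace (X N \<omega>)) Xs" if "set Xs \<subseteq> S" for Xs N
    using that Tr by (auto simp del: One_nat_def)
  have polys: "set (map ?p Xs) \<subseteq> nc_polys S" if "set Xs \<subseteq> S" for Xs
    using that by (auto intro: single_nc_polys)
  show "\<exists>v. ((\<lambda>N. \<integral>\<omega>. mat_trace (X N \<omega>) / of_nat N \<partial>M N) \<longlongrightarrow> v) (dims_to_infinity Ns)" if X: "X \<in> S"
  proof -
    have "((\<lambda>N. \<integral>\<omega>. poly_tr (\<lambda>X. X) N (?p X) \<omega> \<partial>M N) \<longlongrightarrow> \<phi>1 (nc_eval A x (?p X))) (dims_to_infinity Ns)"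
      using l1 single_nc_polys[OF X] unfolding limit_distribution_def by blast
    then show ?thesis unfolding poly_tr_def Tr[OF X] by blast
  qed
  show 3: "((\<lambda>N. joint_cumulant (M N) (map (\<lambda>X \<omega>. mat_trace (X N \<omega>)) Xs)) \<longlongrightarrow> 0) (dims_to_infinity Ns)"
    if Xs: "set Xs \<subseteq> S" "length Xs \<ge> 3" for Xs
  proof -
    have "length (map ?p Xs) > 2" using Xs by simp
    then have "((\<lambda>N. joint_cumulant (M N) (map (poly_Tr (\<lambda>X. X) N) (map ?p Xs))) \<longlongrightarrow> 0) (dims_to_infinity Ns)"
      using lim polys[OF Xs(1)] unfolding second_order_limit_distribution_def by blast
    then show ?thesis unfolding map[OF Xs(1)] .
  qed
  show "\<exists>v. ((\<lambda>N. joint_cumulant (M N) (map (\<lambda>X \<omega>. mat_trace (X N \<omega>)) Xs)) \<longlongrightarrow> v) (dims_to_infinity Ns)"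
    if Xs: "set Xs \<subseteq> S" "length Xs \<ge> 2"
  proof (cases "length Xs = 2")
    case True
    then obtain X Y where XY: "Xs = [X, Y]" by (auto simp: length_Suc_conv numeral_2_eq_2)
    then have "X \<in> S" "Y \<in> S" using Xs by auto
    have pq: "((\<lambda>N. joint_cumulant (M N) [poly_Tr (\<lambda>X. X) N p, poly_Tr (\<lambda>X. X) N q]) \<longlongrightarrow>
        \<phi>2 (nc_eval A x p) (nc_eval A x q)) (dims_to_infinity Ns)" if "p \<in> nc_polys S" "q \<in> nc_polys S" for p q
      using lim that unfolding second_order_limit_distribution_def by simp
    have "((\<lambda>N. joint_cumulant (M N) [poly_Tr (\<lambda>X. X) N (?p X), poly_Tr (\<lambda>X. X) N (?p Y)]) \<longlongrightarrow>
        \<phi>2 (nc_eval A x (?p X)) (nc_eval A x (?p Y))) (dims_to_infinity Ns)"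
      by (rule pq[OF single_nc_polys[OF \<open>X \<in> S\<close>] single_nc_polys[OF \<open>Y \<in> S\<close>]])
    then show ?thesis unfolding Tr[OF \<open>X \<in> S\<close>] Tr[OF \<open>Y \<in> S\<close>] XY by auto
  next
    case False
    then show ?thesis using 3[of Xs] Xs by auto
  qed
qed

text \<open>A joint limit distribution contains the claim. For independent algebras, a cumulant that
  involves two different algebras is exactly zero, and otherwise all matrices lie in a single
  one.\<close>

lemma family_trace_limits:
  assumes M: "\<And>N. N \<in> Ns \<Longrightarrow> prob_space (M N)"
    and alg: "\<And>c. c \<in> J \<Longrightarrow> random_matrix_algebra Ns M (A c)"
    and lim: "\<And>c. c \<in> J \<Longrightarrow> has_second_order_limit_distribution TYPE('a) Ns M (A c)"
    and joint: "(\<forall>N\<in>Ns. prob_space.indep_sets (M N) (\<lambda>c. matrix_sigma (M N) N (A c)) J) \<or>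
         has_second_order_limit_distribution TYPE('b) Ns M (generated_matrix_algebra (\<Union>c\<in>J. A c))"
    and Xs: "set Xs \<subseteq> (\<Union>c\<in>J. A c)"
  shows "length Xs \<ge> 2 \<Longrightarrow>
      \<exists>v. ((\<lambda>N. joint_cumulant (M N) (map (\<lambda>X \<omega>. mat_trace (X N \<omega>)) Xs)) \<longlongrightarrow> v) (dims_to_infinity Ns)"
    and "length Xs \<ge> 3 \<Longrightarrow>
      ((\<lambda>N. joint_cumulant (M N) (map (\<lambda>X \<omega>. mat_trace (X N \<omega>)) Xs)) \<longlongrightarrow> 0) (dims_to_infinity Ns)"
proof -
  let ?k = "\<lambda>N. joint_cumulant (M N) (map (\<lambda>X \<omega>. mat_trace (X N \<omega>)) Xs)"
  have "(length Xs \<ge> 2 \<longrightarrow> (\<exists>v. (?k \<longlongrightarrow> v) (dims_to_infinity Ns))) \<and> (length Xs \<ge> 3 \<longrightarrow> (?k \<longlongrightarrow> 0) (dims_to_infinity Ns))"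
    using joint
  proof
    assume gen: "has_second_order_limit_distribution TYPE('b) Ns M (generated_matrix_algebra (\<Union>c\<in>J. A c))"
    have "set Xs \<subseteq> generated_matrix_algebra (\<Union>c\<in>J. A c)"
      using Xs generated_matrix_algebra.base by blast
    then show ?thesis using trace_limits(2,3)[OF gen] by blast
  next
    assume ind: "\<forall>N\<in>Ns. prob_space.indep_sets (M N) (\<lambda>c. matrix_sigma (M N) N (A c)) J"
    have "\<forall>l<length Xs. \<exists>c. c \<in> J \<and> Xs ! l \<in> A c" using Xs nth_mem by blast
    \<comment> \<open>A matrix such as the identity lies in several of the algebras; any choice will
      do, since independence is stated in terms of the indices.\<close>
    then obtain cf where cf: "\<And>l. l < length Xs \<Longrightarrow> cf l \<in> J \<and> Xs ! l \<in> A (cf l)" by metis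
    show ?thesis
    proof (cases "\<exists>i<length Xs. \<exists>j<length Xs. cf i \<noteq> cf j")
      case True
      then obtain i j where ij: "i < length Xs" "j < length Xs" "cf i \<noteq> cf j" by blast
      have "?k N = 0" if N: "N \<in> Ns" for N
      proof (rule mixed_trace_cumulant[OF M[OF N] _ cf _ ij])
        show "prob_space.indep_sets (M N) (\<lambda>c. matrix_sigma (M N) N (A c)) J" using ind N by blast
        fix X assume "X \<in> set Xs"
        then obtain c where "c \<in> J" "X \<in> A c" using Xs by auto
        then show "entries_in N (all_moments (M N)) (X N)"
          using alg random_matrix_entries[OF _ N] unfolding random_matrix_algebra_def by blast
      qed
      then have "eventually (\<lambda>N. 0 = ?k N) (dims_to_infinity Ns)"
        by (simp add: dims_to_infinity_def eventually_inf_principal)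
      then have "(?k \<longlongrightarrow> 0) (dims_to_infinity Ns)" by (rule Lim_transform_eventually[OF tendsto_const])
      then show ?thesis by blast
    next
      case False
      show ?thesis
      proof (cases "Xs = []")
        case ne: False
        then have J: "cf 0 \<in> J" using cf by simp
        have sub: "set Xs \<subseteq> A (cf 0)"
        proof
          fix X assume "X \<in> set Xs"
          then obtain l where l: "l < length Xs" "X = Xs ! l" by (auto simp: in_set_conv_nth)
          have "cf l = cf 0" using False ne l(1) by blast
          then show "X \<in> A (cf 0)" using cf[OF l(1)] l(2) by simp
        qed
        note tl = trace_limits[OF lim[OF J]]
        show ?thesis by (rule conjI; rule impI) (rule tl(2)[OF sub], assumption, rule tl(3)[OF sub], assumption)
      qed auto
    qed
  qed
  note res = this
  show "length Xs \<ge> 2 \<Longrightarrow> \<exists>v. (?k \<longlongrightarrow> v) (dims_to_infinity Ns)" by (rule mp[OF conjunct1[OF res]])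
  show "length Xs \<ge> 3 \<Longrightarrow> (?k \<longlongrightarrow> 0) (dims_to_infinity Ns)" by (rule mp[OF conjunct2[OF res]])
qed

section \<open>The limit algebra\<close>

text \<open>The limit space is to live on the type of polynomials. A matrix sequence enters it as
  the polynomial with this sequence as its only letter, and the operations of the limit space are
  those of the sequences, transported along this injection.\<close>

definition emb :: "'w matrix_seq \<Rightarrow> 'w matrix_seq nc_poly" where
  "emb X = Poly_Mapping.single [X] 1"

definition un :: "'w matrix_seq nc_poly \<Rightarrow> 'w matrix_seq" where
  "un = inv_into UNIV emb"

lemma inj_emb: "inj emb"
proof (rule injI)
  fix X Y :: "'w matrix_seq" assume "emb X = emb Y"
  then have "Poly_Mapping.lookup (emb X) [X] = Poly_Mapping.lookup (emb Y) [X]" by simp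
  then show "X = Y" by (auto simp: emb_def lookup_single when_def split: if_splits)
qed

lemma un_emb [simp]: "un (emb X) = X"
  by (simp add: un_def inv_f_f inj_emb)

text \<open>The zero is written as a multiple of the identity so that it lies in \<open>S\<close> as
  soon as \<open>S\<close> is closed under the operations.\<close>

definition seq_algebra :: "'w matrix_seq set \<Rightarrow> (complex, 'w matrix_seq nc_poly) module" where
  "seq_algebra S = \<lparr>carrier = emb ` S, mult = (\<lambda>a b. emb (seq_mult (un a) (un b))), one = emb seq_one,
     zero = emb (seq_smult 0 seq_one), add = (\<lambda>a b. emb (seq_add (un a) (un b))),
     smult = (\<lambda>z a. emb (seq_smult z (un a)))\<rparr>"

lemma seq_algebra_simps [simp]:
  "carrier (seq_algebra S) = emb ` S" "a \<otimes>\<^bsub>seq_algebra S\<^esub> b = emb (seq_mult (un a) (un b))"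
  "\<one>\<^bsub>seq_algebra S\<^esub> = emb seq_one" "\<zero>\<^bsub>seq_algebra S\<^esub> = emb (seq_smult 0 seq_one)"
  "a \<oplus>\<^bsub>seq_algebra S\<^esub> b = emb (seq_add (un a) (un b))" "z \<odot>\<^bsub>seq_algebra S\<^esub> a = emb (seq_smult z (un a))"
  by (simp_all add: seq_algebra_def)

lemma seq_algebra_complex_algebra:
  assumes c: "\<And>X N \<omega>. X \<in> S \<Longrightarrow> X N \<omega> \<in> carrier_mat N N"
    and closed: "seq_one \<in> S" "\<And>X Y. X \<in> S \<Longrightarrow> Y \<in> S \<Longrightarrow> seq_add X Y \<in> S"
      "\<And>X Y. X \<in> S \<Longrightarrow> Y \<in> S \<Longrightarrow> seq_mult X Y \<in> S" "\<And>z X. X \<in> S \<Longrightarrow> seq_smult z X \<in> S"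
  shows "complex_algebra (seq_algebra S)"
proof -
  have add_zero: "seq_add (seq_smult 0 seq_one) X = X" "seq_add (seq_smult (- 1) X) X = seq_smult 0 seq_one" if "X \<in> S" for X
    using carrier_matD[OF c[OF that]] by (auto simp: seq_add_def seq_smult_def seq_one_def fun_eq_iff intro!: eq_matI)
  have abel: "abelian_group (seq_algebra S)"
  proof (rule abelian_groupI)
    fix a b d assume "a \<in> carrier (seq_algebra S)" "b \<in> carrier (seq_algebra S)" "d \<in> carrier (seq_algebra S)"
    then obtain X Y Z where X: "X \<in> S" "Y \<in> S" "Z \<in> S" "a = emb X" "b = emb Y" "d = emb Z" by auto
    then show "a \<oplus>\<^bsub>seq_algebra S\<^esub> b \<oplus>\<^bsub>seq_algebra S\<^esub> d = a \<oplus>\<^bsub>seq_algebra S\<^esub> (b \<oplus>\<^bsub>seq_algebra S\<^esub> d)"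
      using assoc_add_mat[OF c[OF X(1)] c[OF X(2)] c[OF X(3)]] by (simp add: seq_add_def)
  next
    fix a b assume "a \<in> carrier (seq_algebra S)" "b \<in> carrier (seq_algebra S)"
    then obtain X Y where X: "X \<in> S" "Y \<in> S" "a = emb X" "b = emb Y" by auto
    then show "a \<oplus>\<^bsub>seq_algebra S\<^esub> b = b \<oplus>\<^bsub>seq_algebra S\<^esub> a"
      using comm_add_mat[OF c[OF X(1)] c[OF X(2)]] by (simp add: seq_add_def)
    show "a \<oplus>\<^bsub>seq_algebra S\<^esub> b \<in> carrier (seq_algebra S)" using X closed by simp
  next
    fix a assume "a \<in> carrier (seq_algebra S)"
    then obtain X where X: "X \<in> S" "a = emb X" by auto
    then show "\<zero>\<^bsub>seq_algebra S\<^esub> \<oplus>\<^bsub>seq_algebra S\<^esub> a = a" by (simp add: add_zero)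
    show "\<exists>y\<in>carrier (seq_algebra S). y \<oplus>\<^bsub>seq_algebra S\<^esub> a = \<zero>\<^bsub>seq_algebra S\<^esub>"
      using X closed(4)[of X "- 1"] by (intro bexI[of _ "emb (seq_smult (- 1) X)"]) (simp_all add: add_zero)
  qed (use closed in simp)
  have ring: "ring (seq_algebra S)"
  proof (rule ringI)
    show "abelian_group (seq_algebra S)" by (rule abel)
    show "monoid (seq_algebra S)"
    proof (rule monoidI)
      fix a b d assume "a \<in> carrier (seq_algebra S)" "b \<in> carrier (seq_algebra S)" "d \<in> carrier (seq_algebra S)"
      then obtain X Y Z where X: "X \<in> S" "Y \<in> S" "Z \<in> S" "a = emb X" "b = emb Y" "d = emb Z" by auto
      then show "a \<otimes>\<^bsub>seq_algebra S\<^esub> b \<otimes>\<^bsub>seq_algebra S\<^esub> d = a \<otimes>\<^bsub>seq_algebra S\<^esub> (b \<otimes>\<^bsub>seq_algebra S\<^esub> d)"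
        using assoc_mult_mat[OF c[OF X(1)] c[OF X(2)] c[OF X(3)]] by (simp add: seq_mult_def)
    next
      fix a assume "a \<in> carrier (seq_algebra S)"
      then obtain X where X: "X \<in> S" "a = emb X" by auto
      then show "\<one>\<^bsub>seq_algebra S\<^esub> \<otimes>\<^bsub>seq_algebra S\<^esub> a = a" "a \<otimes>\<^bsub>seq_algebra S\<^esub> \<one>\<^bsub>seq_algebra S\<^esub> = a"
        using left_mult_one_mat[OF c[OF X(1)]] right_mult_one_mat[OF c[OF X(1)]] by (simp_all add: seq_mult_def seq_one_def)
    qed (use closed in auto)
  next
    fix a b d assume "a \<in> carrier (seq_algebra S)" "b \<in> carrier (seq_algebra S)" "d \<in> carrier (seq_algebra S)"
    then obtain X Y Z where X: "X \<in> S" "Y \<in> S" "Z \<in> S" "a = emb X" "b = emb Y" "d = emb Z" by auto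
    then show "(a \<oplus>\<^bsub>seq_algebra S\<^esub> b) \<otimes>\<^bsub>seq_algebra S\<^esub> d = a \<otimes>\<^bsub>seq_algebra S\<^esub> d \<oplus>\<^bsub>seq_algebra S\<^esub> b \<otimes>\<^bsub>seq_algebra S\<^esub> d"
      "d \<otimes>\<^bsub>seq_algebra S\<^esub> (a \<oplus>\<^bsub>seq_algebra S\<^esub> b) = d \<otimes>\<^bsub>seq_algebra S\<^esub> a \<oplus>\<^bsub>seq_algebra S\<^esub> d \<otimes>\<^bsub>seq_algebra S\<^esub> b"
      using add_mult_distrib_mat[OF c[OF X(1)] c[OF X(2)] c[OF X(3)]] mult_add_distrib_mat[OF c[OF X(3)] c[OF X(1)] c[OF X(2)]]
      by (simp_all add: seq_mult_def seq_add_def)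
  qed
  have "cring (class_ring :: complex ring)" using class_field unfolding field_def domain_def by blast
  then have "Module.module (class_ring :: complex ring) (seq_algebra S)"
  proof (rule Module.moduleI)
    show "abelian_group (seq_algebra S)" by (rule abel)
  next
    fix y z :: complex and a b assume "a \<in> carrier (seq_algebra S)" "b \<in> carrier (seq_algebra S)"
    then obtain X Y where X: "X \<in> S" "Y \<in> S" "a = emb X" "b = emb Y" by auto
    then show "y \<odot>\<^bsub>seq_algebra S\<^esub> (a \<oplus>\<^bsub>seq_algebra S\<^esub> b) = y \<odot>\<^bsub>seq_algebra S\<^esub> a \<oplus>\<^bsub>seq_algebra S\<^esub> y \<odot>\<^bsub>seq_algebra S\<^esub> b"
      using add_smult_distrib_left_mat[OF c[OF X(1)] c[OF X(2)]] by (simp add: seq_smult_def seq_add_def)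
  next
    fix y z :: complex and a assume "a \<in> carrier (seq_algebra S)"
    then obtain X where X: "X \<in> S" "a = emb X" by auto
    then show "(y \<oplus>\<^bsub>class_ring\<^esub> z) \<odot>\<^bsub>seq_algebra S\<^esub> a = y \<odot>\<^bsub>seq_algebra S\<^esub> a \<oplus>\<^bsub>seq_algebra S\<^esub> z \<odot>\<^bsub>seq_algebra S\<^esub> a"
      using add_smult_distrib_right_mat[OF c[OF X(1)]] by (simp add: seq_smult_def seq_add_def)
    show "(y \<otimes>\<^bsub>class_ring\<^esub> z) \<odot>\<^bsub>seq_algebra S\<^esub> a = y \<odot>\<^bsub>seq_algebra S\<^esub> (z \<odot>\<^bsub>seq_algebra S\<^esub> a)"
      using X by (simp add: seq_smult_def smult_smult_mat)
    show "y \<odot>\<^bsub>seq_algebra S\<^esub> a \<in> carrier (seq_algebra S)" using X closed by simp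
    have "seq_smult 1 X = X" by (auto simp: seq_smult_def fun_eq_iff intro!: eq_matI)
    then show "\<one>\<^bsub>class_ring\<^esub> \<odot>\<^bsub>seq_algebra S\<^esub> a = a" using X by simp
  qed
  moreover have "complex_algebra_axioms (seq_algebra S)"
  proof (rule complex_algebra_axioms.intro)
    fix a b and z :: complex assume "a \<in> carrier (seq_algebra S)" "b \<in> carrier (seq_algebra S)"
    then obtain X Y where X: "X \<in> S" "Y \<in> S" "a = emb X" "b = emb Y" by auto
    then show "(z \<odot>\<^bsub>seq_algebra S\<^esub> a) \<otimes>\<^bsub>seq_algebra S\<^esub> b = z \<odot>\<^bsub>seq_algebra S\<^esub> (a \<otimes>\<^bsub>seq_algebra S\<^esub> b)"
      "a \<otimes>\<^bsub>seq_algebra S\<^esub> (z \<odot>\<^bsub>seq_algebra S\<^esub> b) = z \<odot>\<^bsub>seq_algebra S\<^esub> (a \<otimes>\<^bsub>seq_algebra S\<^esub> b)"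
      using mult_smult_assoc_mat[OF c[OF X(1)] c[OF X(2)]] mult_smult_distrib[OF c[OF X(1)] c[OF X(2)]]
      by (simp_all add: seq_smult_def seq_mult_def)
  qed
  ultimately show ?thesis using ring by (intro complex_algebra.intro)
qed

section \<open>The limit space and real second-order freeness in it\<close>

context orth_setting
begin

abbreviation LA :: "(complex, 'w matrix_seq nc_poly) module" where "LA \<equiv> seq_algebra BB"
definition phi1 :: "'w matrix_seq nc_poly \<Rightarrow> complex" where "phi1 a = tlim (un a)"
definition phi2 :: "'w matrix_seq nc_poly \<Rightarrow> 'w matrix_seq nc_poly \<Rightarrow> complex" where "phi2 a b = clim (un a) (un b)"
definition tr :: "'w matrix_seq nc_poly \<Rightarrow> 'w matrix_seq nc_poly" where "tr a = emb (seq_transpose (un a))"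

lemma LA_algebra: "complex_algebra LA"
  by (rule seq_algebra_complex_algebra) (simp_all add: BB_carrier BB_closed)

lemma LA_prob: "nc_prob_space LA phi1"
proof (intro nc_prob_space.intro nc_prob_space_axioms.intro LA_algebra)
  show "linear_functional LA phi1"
    by (auto simp: linear_functional_def phi1_def tlim_add tlim_smult)
  show "phi1 \<one>\<^bsub>LA\<^esub> = 1" by (simp add: phi1_def tlim_one)
qed

lemma LA_second: "second_order_prob_space LA phi1 phi2"
proof (intro second_order_prob_space.intro second_order_prob_space_axioms.intro LA_prob)
  fix a assume "a \<in> carrier LA"
  then obtain X where X: "X \<in> BB" "a = emb X" by auto
  show "linear_functional LA (phi2 a)" "linear_functional LA (\<lambda>b. phi2 b a)"
    using X by (auto simp: linear_functional_def phi2_def clim_sym[of X] clim_add clim_smult)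
  show "tracial LA (phi2 a)" "tracial LA (\<lambda>b. phi2 b a)"
    using X by (auto simp: tracial_def phi2_def clim_sym[of X] intro: clim_comm)
  show "phi2 \<one>\<^bsub>LA\<^esub> a = 0" "phi2 a \<one>\<^bsub>LA\<^esub> = 0"
    using X by (simp_all add: phi2_def clim_one clim_sym[of X])
qed

lemma LA_real: "real_second_order_prob_space LA phi1 phi2 tr"
proof (intro real_second_order_prob_space.intro real_second_order_prob_space_axioms.intro LA_second)
  fix a b assume "a \<in> carrier LA" "b \<in> carrier LA"
  then obtain X Y where X: "X \<in> BB" "a = emb X" "Y \<in> BB" "b = emb Y" by auto
  show "tr (a \<oplus>\<^bsub>LA\<^esub> b) = tr a \<oplus>\<^bsub>LA\<^esub> tr b"
    using X transpose_add[OF BB_carrier[OF X(1)] BB_carrier[OF X(3)]] by (simp add: tr_def seq_add_def seq_transpose_def)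
  show "tr (a \<otimes>\<^bsub>LA\<^esub> b) = tr b \<otimes>\<^bsub>LA\<^esub> tr a"
    using X transpose_mult[OF BB_carrier[OF X(1)] BB_carrier[OF X(3)]] by (simp add: tr_def seq_mult_def seq_transpose_def)
next
  fix a and z :: complex assume "a \<in> carrier LA"
  then obtain X where X: "X \<in> BB" "a = emb X" by auto
  show "tr a \<in> carrier LA" using X BB_closed(5) by (simp add: tr_def)
  have "seq_transpose (seq_smult z X) = seq_smult z (seq_transpose X)"
    by (auto simp: seq_transpose_def seq_smult_def fun_eq_iff intro!: eq_matI)
  then show "tr (z \<odot>\<^bsub>LA\<^esub> a) = z \<odot>\<^bsub>LA\<^esub> tr a" using X by (simp add: tr_def)
  show "tr (tr a) = a" using X by (simp add: tr_def seq_transpose_def)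
qed

lemma list_prod_emb: "list_prod (seq_algebra S) (map emb w) = emb (sprod w)"
  by (induction w) (simp_all add: list_prod_def sprod_def)

lemma list_prod_mat: "list_prod (module_mat TYPE(complex) N N) (map (\<lambda>X. X N \<omega>) w) = sprod w N \<omega>"
  by (induction w) (simp_all add: list_prod_def sprod_def module_mat_simps seq_one_def seq_mult_def)

text \<open>Addition in the limit space is pointwise, so a finite sum there is, in each dimension,
  the sum of matrices; this makes evaluation of polynomials commute with the embedding.\<close>

lemma finsum_emb:
  assumes "finite K" "\<And>k. k \<in> K \<Longrightarrow> f k \<in> BB"
  shows "\<exists>Y\<in>BB. finsum LA (\<lambda>k. emb (f k)) K = emb Y \<and>
    (\<forall>N \<omega>. Y N \<omega> = finsum (module_mat TYPE(complex) N N) (\<lambda>k. f k N \<omega>) K)"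
  using assms
proof (induction K rule: finite_induct)
  case empty
  interpret L: complex_algebra LA by (rule LA_algebra)
  have 1: "finsum (module_mat TYPE(complex) N N) (\<lambda>k. f k N \<omega>) {} = 0\<^sub>m N N" for N \<omega>
    using abelian_monoid.finsum_empty[OF abelian_group.axioms(1)[OF abelian_group_mat]] by (metis module_mat_simps(4))
  have 2: "seq_smult 0 seq_one N \<omega> = 0\<^sub>m N N" for N and \<omega> :: 'w by (auto simp: seq_smult_def seq_one_def)
  show ?case
  proof (intro bexI[of _ "seq_smult 0 seq_one"] conjI allI)
    show "seq_smult 0 seq_one N \<omega> = finsum (module_mat TYPE(complex) N N) (\<lambda>k. f k N \<omega>) {}" for N \<omega>
      by (simp only: 1 2)
  qed (simp_all add: L.finsum_empty BB_closed)
next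
  case (insert k K)
  interpret L: complex_algebra LA by (rule LA_algebra)
  obtain Y where Y: "Y \<in> BB" "finsum LA (\<lambda>k. emb (f k)) K = emb Y"
    "\<And>N \<omega>. Y N \<omega> = finsum (module_mat TYPE(complex) N N) (\<lambda>k. f k N \<omega>) K" using insert by auto
  have "finsum LA (\<lambda>k. emb (f k)) (insert k K) = emb (seq_add (f k) Y)"
    using insert Y(2) by (subst L.finsum_insert) auto
  moreover have "finsum (module_mat TYPE(complex) N N) (\<lambda>k. f k N \<omega>) (insert k K) = f k N \<omega> + Y N \<omega>" for N \<omega>
  proof -
    interpret A: abelian_group "module_mat TYPE(complex) N N" by (rule abelian_group_mat)
    show ?thesis using insert BB_carrier Y(3) by (subst A.finsum_insert) (auto simp: module_mat_simps)
  qed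
  ultimately show ?case using insert.prems[of k] Y(1) BB_closed(2)
    by (intro bexI[of _ "seq_add (f k) Y"]) (simp_all add: seq_add_def)
qed

text \<open>Evaluating a polynomial at the embedded matrices gives the embedding of its value at the
  matrices themselves. The limits that a limit distribution demands are then those by which
  \<open>phi1\<close> and \<open>phi2\<close> are defined.\<close>

lemma nc_eval_LA:
  assumes "p \<in> nc_polys S" "S \<subseteq> BB"
  shows "\<exists>Y\<in>BB. nc_eval LA emb p = emb Y \<and> (\<forall>N. poly_Tr (\<lambda>X. X) N p = (\<lambda>\<omega>. mat_trace (Y N \<omega>)))"
proof -
  let ?f = "\<lambda>w. seq_smult (Poly_Mapping.lookup p w) (sprod w)"
  have f: "?f w \<in> BB" if "w \<in> Poly_Mapping.keys p" for w
  proof -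
    have "set w \<subseteq> S" using assms(1) that by (auto simp: nc_polys_def)
    then show ?thesis using assms(2) by (intro BB_closed(4) sprod_BB) (rule order.trans)
  qed
  from finsum_emb[of "Poly_Mapping.keys p" ?f, OF finite_keys f] obtain Y where Y: "Y \<in> BB" "finsum LA (\<lambda>w. emb (?f w)) (Poly_Mapping.keys p) = emb Y"
    "\<And>N \<omega>. Y N \<omega> = finsum (module_mat TYPE(complex) N N) (\<lambda>w. ?f w N \<omega>) (Poly_Mapping.keys p)" by auto
  have 1: "nc_eval LA emb p = emb Y" using Y(2) by (simp add: nc_eval_def list_prod_emb)
  have 2: "poly_Tr (\<lambda>X. X) N p = (\<lambda>\<omega>. mat_trace (Y N \<omega>))" for N
    by (rule ext) (simp only: poly_Tr_def nc_eval_def list_prod_mat module_mat_simps(6) Y(3) seq_smult_def)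
  show ?thesis by (intro bexI[OF _ Y(1)] conjI allI 1 2)
qed

lemma nc_evals_LA:
  assumes "set ps \<subseteq> nc_polys S" "S \<subseteq> BB"
  shows "\<exists>Ys. set Ys \<subseteq> BB \<and> length Ys = length ps \<and> (\<forall>N. map (poly_Tr (\<lambda>X. X) N) ps = map (\<lambda>X \<omega>. mat_trace (X N \<omega>)) Ys)"
  using assms(1)
proof (induction ps)
  case (Cons p ps)
  then obtain Ys where Ys: "set Ys \<subseteq> BB" "length Ys = length ps" "\<And>N. map (poly_Tr (\<lambda>X. X) N) ps = map (\<lambda>X \<omega>. mat_trace (X N \<omega>)) Ys"
    by auto
  obtain Y where "Y \<in> BB" "\<And>N. poly_Tr (\<lambda>X. X) N p = (\<lambda>\<omega>. mat_trace (Y N \<omega>))" using nc_eval_LA[OF _ assms(2), of p] Cons.prems by auto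
  then show ?case using Ys by (intro exI[of _ "Y # Ys"]) simp
qed simp

definition SS :: "'w matrix_seq set" where "SS = (\<Union>c\<in>I. conjugate_by (Q c) ` A c)"

lemma SS_BB: "SS \<subseteq> BB" using BB_base by (auto simp: SS_def)

lemma SS_random: "X \<in> SS \<Longrightarrow> random_matrix Ns M X"
proof -
  assume "X \<in> SS"
  then obtain c Y where cY: "c \<in> I" "Y \<in> A c" "X = conjugate_by (Q c) Y" by (auto simp: SS_def)
  have "(\<lambda>\<omega>. X N \<omega> $$ (i, j)) \<in> all_moments (M N)" if N: "N \<in> Ns" and ij: "i < N" "j < N" for N i j
  proof -
    have "(\<lambda>\<omega>. val (c, Y) N \<omega> $$ (i, j)) \<in> all_moments (M N)"
      using val_entries_M[OF N A_EL[OF cY(1,2)]] ij by (auto simp: entries_in_def sub_moments_def)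
    moreover have "X N \<omega> $$ (i, j) = val (c, Y) N \<omega> $$ (i, j)" if "\<omega> \<in> space (M N)" for \<omega>
      using conj_agree[OF cY(1), of Y] N that cY(3) by (simp add: agree_def)
    ultimately show ?thesis unfolding all_moments_def
      by (simp cong: measurable_cong Bochner_Integration.integrable_cong)
  qed
  then show ?thesis using conj_carrier[OF cY(1,2)] cY(3) by (auto simp: random_matrix_def all_moments_def)
qed

lemma SS_transpose: "X \<in> SS \<Longrightarrow> seq_transpose X \<in> SS"
proof -
  assume "X \<in> SS"
  then obtain c Y where cY: "c \<in> I" "Y \<in> A c" "X = conjugate_by (Q c) Y" by (auto simp: SS_def)
  have "seq_transpose (conjugate_by (Q c) Y) = conjugate_by (Q c) (seq_transpose Y)"
  proof (intro ext)
    fix N \<omega>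
    let ?V = "complexify (Q c) N \<omega>"
    have V: "?V \<in> carrier_mat N N" "transpose_mat ?V \<in> carrier_mat N N" "Y N \<omega> \<in> carrier_mat N N" "transpose_mat (Y N \<omega>) \<in> carrier_mat N N"
      using Q_carrier[OF cY(1), of N \<omega>] AA_carrier[OF A_AA[OF cY(1,2)], of N \<omega>] by (auto simp: complexify_def)
    have "transpose_mat (transpose_mat ?V * Y N \<omega> * ?V) = transpose_mat ?V * transpose_mat (transpose_mat ?V * Y N \<omega>)"
      by (rule transpose_mult[OF mult_carrier_mat[OF V(2,3)] V(1)])
    also have "\<dots> = transpose_mat ?V * (transpose_mat (Y N \<omega>) * ?V)" using transpose_mult[OF V(2,3)] by simp
    also have "\<dots> = transpose_mat ?V * transpose_mat (Y N \<omega>) * ?V" by (rule assoc_mult_mat[OF V(2,4,1), symmetric])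
    finally show "seq_transpose (conjugate_by (Q c) Y) N \<omega> = conjugate_by (Q c) (seq_transpose Y) N \<omega>"
      by (simp add: conjugate_by_def seq_mult_def seq_transpose_def)
  qed
  then show ?thesis using cY A_closed(4)[OF cY(1,2)] unfolding SS_def by auto
qed

lemma limit: "real_second_order_limit_distribution Ns M SS (\<lambda>X. X) LA phi1 phi2 tr emb"
  unfolding real_second_order_limit_distribution_def second_order_limit_distribution_def limit_distribution_def
proof (intro conjI ballI allI impI LA_prob LA_second LA_real SS_random)
  fix l assume l: "l \<in> SS"
  then show "emb l \<in> carrier LA" using SS_BB by auto
  show "\<exists>l'\<in>SS. l' = seq_transpose l \<and> emb l' = tr (emb l)" using SS_transpose[OF l] by (simp add: tr_def)
next
  fix p assume "p \<in> nc_polys SS"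
  from nc_eval_LA[OF this SS_BB] obtain Y where Y: "Y \<in> BB" "nc_eval LA emb p = emb Y" "\<And>N. poly_Tr (\<lambda>X. X) N p = (\<lambda>\<omega>. mat_trace (Y N \<omega>))" by blast
  show "((\<lambda>N. \<integral>\<omega>. poly_tr (\<lambda>X. X) N p \<omega> \<partial>M N) \<longlongrightarrow> phi1 (nc_eval LA emb p)) F"
    using tmean_lim[OF Y(1)] by (simp add: poly_tr_def Y phi1_def tmean_def[abs_def])
next
  fix p q assume p: "p \<in> nc_polys SS" and q: "q \<in> nc_polys SS"
  from nc_eval_LA[OF p SS_BB] obtain Y where Y: "Y \<in> BB" "nc_eval LA emb p = emb Y" "\<And>N. poly_Tr (\<lambda>X. X) N p = (\<lambda>\<omega>. mat_trace (Y N \<omega>))" by blast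
  from nc_eval_LA[OF q SS_BB] obtain Z where Z: "Z \<in> BB" "nc_eval LA emb q = emb Z" "\<And>N. poly_Tr (\<lambda>X. X) N q = (\<lambda>\<omega>. mat_trace (Z N \<omega>))" by blast
  show "((\<lambda>N. joint_cumulant (M N) [poly_Tr (\<lambda>X. X) N p, poly_Tr (\<lambda>X. X) N q]) \<longlongrightarrow> phi2 (nc_eval LA emb p) (nc_eval LA emb q)) F"
    using tcov_lim[OF Y(1) Z(1)] by (simp add: Y Z phi2_def tcov_def[abs_def] trace_seq_def)
next
  fix ps :: "'w matrix_seq nc_poly list" assume ps: "set ps \<subseteq> nc_polys SS" and len: "2 \<le> length ps"
  obtain Ys where Ys: "set Ys \<subseteq> BB" "length Ys = length ps" "\<And>N. map (poly_Tr (\<lambda>X. X) N) ps = map (\<lambda>X \<omega>. mat_trace (X N \<omega>)) Ys"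
    using nc_evals_LA[OF ps SS_BB] by blast
  have "map (poly_tr (\<lambda>X. X) N) ps = map (\<lambda>f \<omega>. f \<omega> / of_nat N) (map (poly_Tr (\<lambda>X. X) N) ps)" for N
    by (simp add: poly_tr_def[abs_def])
  then have "map (poly_tr (\<lambda>X. X) N) ps = map (\<lambda>X \<omega>. mat_trace (X N \<omega>) / of_nat N) Ys" for N
    by (simp add: Ys(3) o_def)
  then show "((\<lambda>N. joint_cumulant (M N) (map (poly_tr (\<lambda>X. X) N) ps)) \<longlongrightarrow> 0) F"
    using BB_ncumulant[OF Ys(1)] Ys(2) len by simp
next
  fix ps :: "'w matrix_seq nc_poly list" assume ps: "set ps \<subseteq> nc_polys SS" and len: "2 < length ps"
  obtain Ys where Ys: "set Ys \<subseteq> BB" "length Ys = length ps" "\<And>N. map (poly_Tr (\<lambda>X. X) N) ps = map (\<lambda>X \<omega>. mat_trace (X N \<omega>)) Ys"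
    using nc_evals_LA[OF ps SS_BB] by blast
  show "((\<lambda>N. joint_cumulant (M N) (map (poly_Tr (\<lambda>X. X) N) ps)) \<longlongrightarrow> 0) F"
    using BB_cumulant[OF Ys(1)] Ys(2) len by (simp add: Ys(3) trace_seq_def)
qed

abbreviation sub :: "nat \<Rightarrow> 'w matrix_seq nc_poly set" where
  "sub k \<equiv> generated_t_algebra LA tr (emb ` conjugate_by (Q k) ` A k)"

text \<open>Conjugation is compatible with all operations and \<open>A k\<close> is closed under
  them, so each generated element is again the conjugate of a single matrix of \<open>A k\<close>. A
  factor in the definition of freeness is thus a single letter.\<close>

lemma generated_rep: "a \<in> sub k \<Longrightarrow> k \<in> I \<Longrightarrow> \<exists>Y X. a = emb Y \<and> rep Y (k, X)"
proof (induction rule: generated_t_algebra.induct)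
  case (base a)
  then obtain X where "X \<in> A k" "a = emb (conjugate_by (Q k) X)" by auto
  then have "rep (conjugate_by (Q k) X) (k, X)" using base by (simp add: rep_def BB_base conj_agree)
  then show ?case using \<open>a = _\<close> by blast
next
  case one
  have "val (k, seq_one) N \<omega> = 1\<^sub>m N" for N \<omega>
    using right_mult_one_mat[OF Uc_carrier(2), of k N \<omega>] Uc_orth(1)[of k N \<omega>] by (simp add: val_def seq_one_def)
  then have "rep seq_one (k, seq_one)" using one A_closed(1)[of k] BB_closed(1) by (simp add: rep_def agree_def seq_one_def)
  then show ?case by (intro exI) (rule conjI[rotated], simp_all)
next
  case (add a b)
  then obtain Y X Y' X' where *: "a = emb Y" "rep Y (k, X)" "b = emb Y'" "rep Y' (k, X')" by blast
  have "val (k, seq_add X X') N \<omega> = val (k, X) N \<omega> + val (k, X') N \<omega>" for N \<omega>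
    using conj_add[OF EL_carrier[OF rep_EL[OF *(2)], of N \<omega>] EL_carrier[OF rep_EL[OF *(4)], of N \<omega>], of k \<omega>] by (simp add: val_def seq_add_def)
  then have "rep (seq_add Y Y') (k, seq_add X X')"
    using * A_closed(3) BB_closed(2) by (simp add: rep_def agree_def) (simp add: seq_add_def)
  then show ?case using * by auto
next
  case (smult a z)
  then obtain Y X where *: "a = emb Y" "rep Y (k, X)" by blast
  have c: "X N \<omega> \<in> carrier_mat N N" for N \<omega> using EL_carrier[OF rep_EL[OF *(2)]] by simp
  have "val (k, seq_smult z X) N \<omega> = z \<cdot>\<^sub>m val (k, X) N \<omega>" for N \<omega>
    using mult_smult_distrib[OF Uc_carrier(2)[of k N \<omega>] c[of N \<omega>], of z] mult_smult_assoc_mat[OF mult_carrier_mat[OF Uc_carrier(2)[of k N \<omega>] c[of N \<omega>]] Uc_carrier(1)[of k N \<omega>], of z]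
    by (simp add: val_def seq_smult_def)
  then have "rep (seq_smult z Y) (k, seq_smult z X)"
    using * A_closed(5) BB_closed(4) by (simp add: rep_def agree_def) (simp add: seq_smult_def)
  then show ?case using * by auto
next
  case (mult a b)
  then obtain Y X Y' X' where *: "a = emb Y" "rep Y (k, X)" "b = emb Y'" "rep Y' (k, X')" by blast
  have "val (k, seq_mult X X') N \<omega> = val (k, X) N \<omega> * val (k, X') N \<omega>" for N \<omega>
    using conj_mult[OF EL_carrier[OF rep_EL[OF *(2)], of N \<omega>] EL_carrier[OF rep_EL[OF *(4)], of N \<omega>], of k \<omega>] by (simp add: val_def seq_mult_def)
  then have "rep (seq_mult Y Y') (k, seq_mult X X')"
    using * A_closed(2) BB_closed(3) by (simp add: rep_def agree_def) (simp add: seq_mult_def)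
  then show ?case using * by auto
next
  case (t a)
  then obtain Y X where *: "a = emb Y" "rep Y (k, X)" by blast
  then show ?case using rep_transpose[OF *(2)] by (auto simp: tr_def lfl_def)
qed

lemma centred_reps:
  assumes "centred_in phi1 I sub ks as"
  obtains Ys w where "as = map emb Ys" "list_all2 rep Ys w" "map fst w = ks" "\<forall>Y\<in>set Ys. tlim Y = 0"
proof -
  have ks: "set ks \<subseteq> I" and l: "list_all2 (\<lambda>k a. a \<in> sub k \<and> phi1 a = 0) ks as"
    using assms unfolding centred_in_def by blast+
  have "list_all2 (\<lambda>k a. k \<in> I \<and> a \<in> sub k \<and> phi1 a = 0) ks as"
    by (rule list.rel_mono_strong[OF l]) (use ks in blast)
  then have "\<exists>Ys w. as = map emb Ys \<and> list_all2 rep Ys w \<and> map fst w = ks \<and> (\<forall>Y\<in>set Ys. tlim Y = 0)"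
  proof (induction rule: list_all2_induct)
    case (Cons k ks a as)
    then obtain Ys w where "as = map emb Ys" "list_all2 rep Ys w" "map fst w = ks" "\<forall>Y\<in>set Ys. tlim Y = 0" by blast
    moreover obtain Y X where "a = emb Y" "rep Y (k, X)" using Cons generated_rep by blast
    moreover have "tlim Y = 0" using Cons(1) \<open>a = emb Y\<close> by (simp add: phi1_def)
    ultimately show ?case by (intro exI[of _ "Y # Ys"] exI[of _ "(k, X) # w"]) auto
  qed auto
  then show thesis using that by blast
qed

text \<open>Centring keeps the colours, so the alternation of the indices of the subalgebras carries
  over to the words of centred letters.\<close>

lemma cyc_alt_cl:
  assumes "set w \<subseteq> EL" "cyclically_alternating (map fst w)"
  shows "cyc_alt LL fst (map cl w)"
proof -
  have "w \<noteq> []" using assms by (auto simp: cyclically_alternating_def alternating_def)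
  then have "fst (hd (map cl w)) = hd (map fst w)" "fst (last (map cl w)) = last (map fst w)"
    by (simp_all add: hd_map last_map cl_def dec_def)
  then show ?thesis using assms cl_LL[OF assms(1)] \<open>w \<noteq> []\<close> unfolding cyc_alt_def cl_map
    by (auto simp: cyclically_alternating_def alternating_def)
qed

lemma cyc_map: "xs \<noteq> [] \<Longrightarrow> cyc (map f xs) i = f (cyc xs i)"
  by (simp add: cyc_def nat_less_iff)

lemma free: "real_second_order_free LA phi1 phi2 tr I (\<lambda>k. emb ` conjugate_by (Q k) ` A k)"
  unfolding real_second_order_free_def real_second_order_free_subalgebras_def
proof (intro conjI allI impI)
  show "free_subalgebras LA phi1 I sub"
    unfolding free_subalgebras_def
  proof (intro allI impI)
    fix ks as assume alt: "alternating ks" and "centred_in phi1 I sub ks as"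
    from centred_reps[OF this(2)] obtain Ys w where *: "as = map emb Ys" "list_all2 rep Ys w" "map fst w = ks" "\<forall>Y\<in>set Ys. tlim Y = 0" .
    then have "tlim (sprod Ys) = 0" using alt by (intro free_mat[of Ys w]) (auto simp: alternating_def)
    then show "phi1 (list_prod LA as) = 0" by (simp add: * list_prod_emb phi1_def)
  qed
next
  fix ks as ls bs
  assume "cyclically_alternating ks" "centred_in phi1 I sub ks as" "cyclically_alternating ls" "centred_in phi1 I sub ls bs"
  note alt = this(1,3) and cen = this(2,4)
  from centred_reps[OF cen(1)] obtain Ys u where u: "as = map emb Ys" "list_all2 rep Ys u" "map fst u = ks" "\<forall>Y\<in>set Ys. tlim Y = 0" .
  from centred_reps[OF cen(2)] obtain Zs v where v: "bs = map emb Zs" "list_all2 rep Zs v" "map fst v = ls" "\<forall>Y\<in>set Zs. tlim Y = 0" .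
  have "cyc_alt LL fst (map cl u)" "cyc_alt LL fst (map cl v)"
    using cyc_alt_cl[OF reps_EL[OF u(2)]] cyc_alt_cl[OF reps_EL[OF v(2)]] u(3) v(3) alt by auto
  note sf = second_formula[OF u(2,4) this(1) v(2,4) this(2)]
  have phi: "phi2 (list_prod LA as) (list_prod LA bs) = clim (sprod Ys) (sprod Zs)"
    by (simp add: u v list_prod_emb phi2_def)
  show "length as \<noteq> length bs \<Longrightarrow> phi2 (list_prod LA as) (list_prod LA bs) = 0"
    unfolding phi using sf u(1) v(1) by simp
  have "Ys \<noteq> []" "Zs \<noteq> []" using alt u v by (auto simp: cyclically_alternating_def alternating_def)
  then show "length as = length bs \<Longrightarrow> (let p = int (length as) in
      phi2 (list_prod LA as) (list_prod LA bs) =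
        (\<Sum>k\<in>{0..p-1}. \<Prod>i\<in>{1..p}. phi1 (cyc as i \<otimes>\<^bsub>LA\<^esub> cyc bs (k - i))) +
        (\<Sum>k\<in>{0..p-1}. \<Prod>i\<in>{1..p}. phi1 (cyc as i \<otimes>\<^bsub>LA\<^esub> tr (cyc bs (k + i)))))"
    unfolding Let_def phi using sf by (simp add: u(1) v(1) cyc_map phi1_def tr_def)
qed

end

theorem theorem5p6:
  fixes Ns :: "nat set" and M :: "nat \<Rightarrow> 'w measure" and C :: nat
    and A :: "nat \<Rightarrow> 'w matrix_seq set"
    and Q :: "nat \<Rightarrow> nat \<Rightarrow> 'w \<Rightarrow> real mat"
  assumes "infinite Ns"
    and "\<And>N. N \<in> Ns \<Longrightarrow> prob_space (M N)"
    and "\<And>c. c \<in> {1..C} \<Longrightarrow> random_matrix_algebra Ns M (A c)"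
    and "\<And>c. c \<in> {1..C} \<Longrightarrow> has_second_order_limit_distribution TYPE('a) Ns M (A c)"
    and "(\<forall>N\<in>Ns. prob_space.indep_sets (M N) (\<lambda>c. matrix_sigma (M N) N (A c)) {1..C}) \<or>
         has_second_order_limit_distribution TYPE('b) Ns M
           (generated_matrix_algebra (\<Union>c\<in>{1..C}. A c))"
    and "\<And>c N \<omega>. c \<in> {1..C} \<Longrightarrow> Q c N \<omega> \<in> carrier_mat N N"
    and "\<And>c N. c \<in> {1..C} \<Longrightarrow> N \<in> Ns \<Longrightarrow> haar_orthogonal (M N) N (Q c N)"
    and "\<And>N. N \<in> Ns \<Longrightarrow> prob_space.indep_sets (M N)
           (\<lambda>k. case k of
                  None \<Rightarrow> matrix_sigma (M N) N (\<Union>c\<in>{1..C}. A c)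
                | Some c \<Rightarrow> matrix_sigma (M N) N {complexify (Q c)})
           (insert None (Some ` {1..C}))"
  shows "asymptotically_real_second_order_free TYPE('w matrix_seq nc_poly) Ns M {1..C}
           (\<lambda>c. conjugate_by (Q c) ` A c)"
  proof -
  \<comment> \<open>From here on the given limit spaces are present only through the limits of
    traces that they provide.\<close>
  interpret orth_setting Ns M C A Q
  proof (rule orth_setting.intro)
    fix X assume "X \<in> (\<Union>c\<in>{1..C}. A c)"
    then obtain c where "c \<in> {1..C}" "X \<in> A c" by blast
    then show "\<exists>v. ((\<lambda>N. \<integral>\<omega>. mat_trace (X N \<omega>) / of_nat N \<partial>M N) \<longlongrightarrow> v) (dims_to_infinity Ns)"
      using trace_limits(1)[OF assms(4)] by blast
  next
    fix Xs assume Xs: "set Xs \<subseteq> (\<Union>c\<in>{1..C}. A c)"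
    note lim = family_trace_limits[OF assms(2,3,4,5) Xs]
    show "2 \<le> length Xs \<Longrightarrow>
      \<exists>v. ((\<lambda>N. joint_cumulant (M N) (map (\<lambda>X \<omega>. mat_trace (X N \<omega>)) Xs)) \<longlongrightarrow> v) (dims_to_infinity Ns)"
      by (rule lim(1))
    show "3 \<le> length Xs \<Longrightarrow>
      ((\<lambda>N. joint_cumulant (M N) (map (\<lambda>X \<omega>. mat_trace (X N \<omega>)) Xs)) \<longlongrightarrow> 0) (dims_to_infinity Ns)"
      by (rule lim(2))
  qed (rule assms; assumption)+
  show ?thesis unfolding asymptotically_real_second_order_free_def
    using limit[unfolded SS_def] free by (intro exI conjI)
qed

end
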